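(* Let $\Gamma_{\circlearrowright}$ denote either of the two versions $\mathcal A$, $\mathcal B$ of the wheeled graphical category. Then $\Gamma_{\circlearrowright}$ is a dualizable generalized Reedy category; precisely, the degree function $\deg$ and the wide subcategories $\Gamma_{\circlearrowright}^+$ and $\Gamma_{\circlearrowright}^-$ constitute a dualizable generalized Reedy structure on $\Gamma_{\circlearrowright}$.
   Context: **Graphs.** A graph here is a connected directed graph $G$, possibly with directed cycles, of one of three kinds: the exceptional edge $\uparrow$ (no vertices, one edge $e$, with $\mathrm{in}(\uparrow)=\mathrm{out}(\uparrow)=\{e\}$ and no inner edges); the exceptional loop $\circlearrowright$ (no vertices, one edge, which is an inner edge; no inputs or outputs); or an ordinary graph, consisting of a finite nonempty set $\mathrm{Vt}(G)$, a finite set $\mathrm{Edge}(G)$ and partial functions $\mathrm{src},\mathrm{tgt}\colon\mathrm{Edge}(G)\to\mathrm{Vt}(G)$, at least one of them defined on each edge, with connected result. Put $\mathrm{in}(v)=\mathrm{tgt}^{-1}(v)$, $\mathrm{out}(v)=\mathrm{src}^{-1}(v)$. For an ordinary graph, $\mathrm{in}(G)$ (resp. $\mathrm{out}(G)$) is the set of edges with $\mathrm{src}$ (resp. $\mathrm{tgt}$) undefined, and inner edges are those with both defined. $\mathrm{Edge_i}(G)$ is the set of inner edges. A corolla is an ordinary graph with one vertex and no inner edge; $\bullet$ is the corolla with no edges. Graphs are drawn from a fixed set containing every isomorphism type, so categories below are small; orderings of legs are suppressed. **Substitution.** Given graphs $P_v$ with bijections $\mathrm{in}(v)\cong\mathrm{in}(P_v)$,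 $\mathrm{out}(v)\cong\mathrm{out}(P_v)$ for $v\in\mathrm{Vt}(G)$, the graph $G(\{P_v\})$ is obtained by replacing each $v$ by $P_v$ and identifying legs accordingly. (Substituting $\uparrow$ for $v$ deletes $v$ and merges its input and output edge; if the result has no vertices it is $\uparrow$ or $\circlearrowright$, according to whether it has legs or not.) Vertices not mentioned get a corolla substituted, which changes nothing. **Subgraphs.** The subgraphs of $K$ are: (a) for each $e\in\mathrm{Edge}(K)$, the edge $\uparrow_e$; (b) if $K=\circlearrowright$, $K$ itself; (c) for each nonempty $S\subseteq\mathrm{Vt}(K)$ and each set $I$ of inner edges of $K$ with both ends in $S$ such that the graph $(S,I)$ is connected, the graph $K_{S,I}$ with vertex set $S$, inner edges $I$, one input leg for each edge $e\notin I$ with $\mathrm{tgt}(e)\in S$ and one output leg for each edge $e\notin I$ with $\mathrm{src}(e)\in S$ (an edge $e\notin I$ with both ends in $S$ gives two distinct legs). Each subgraph has canonical maps on edges and vertices to $K$, injective on its set of inputs and on its set of outputs. (Equivalently: $P$ is a subgraph of $K$ iff $K=H(P)$ for some graph $H$ with $P$ substituted at one vertex.) **The wheeled graphical category.** $\mathcal A$ has all graphs as objects. A morphism $f\colon G\to K$ (a wheeled properadic graphical map) is a map between the free wheeled properads generated by $G$ and $K$ whose image is a subgraph; explicitly, it consists of a function $f_0\colon\mathrm{Edge}(G)\to\mathrm{Edge}(K)$ and a function $f_1$ from $\mathrm{Vt}(G)$ to subgraphs of $K$ such that for each $v$, $f_0$ restricts to bijections $\mathrm{in}(v)\to\mathrm{in}(f_1(v))$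 and $\mathrm{out}(v)\to\mathrm{out}(f_1(v))$ (inputs and outputs of $f_1(v)$ being regarded as edges of $K$), and such that the graph $f(G)=G(\{f_1(v)\})$, with its canonical maps on edges and vertices to $K$, is (isomorphic over $K$ to) a subgraph of $K$. Composition: $(gf)_0=g_0f_0$ and $(gf)_1(v)$ is the image $g(f_1(v))$ of the composite of $g$ with $f_1(v)\to K$. $\mathcal B$ is the full subcategory of $\mathcal A$ on all graphs other than $\circlearrowright$. **Coface and codegeneracy maps.** A dioperadic graph is an ordinary graph with two vertices and exactly one inner edge, joining them; a contracted corolla is an ordinary graph with one vertex and exactly one inner edge. Coface maps are: inner cofaces $G\to G(P)$, where a dioperadic graph or contracted corolla $P$ is substituted at one vertex $v$ ($v\mapsto P$, other vertices go to their corollas); outer cofaces, the subgraph inclusions $P\to K$ where $K$ is obtained by substituting $P$ at one vertex of a dioperadic graph or at the vertex of a contracted corolla; and the exceptional inner coface $\bullet\to\circlearrowright$ sending the vertex to $\circlearrowright$ (only in $\mathcal A$). A codegeneracy map is $G\to G(\uparrow)$, where $\uparrow$ is substituted at a vertex $v$ having exactly one input and one output: it is the quotient map on edges, sends $v$ to the merged edge and every other vertex to its corolla. $\Gamma_{\circlearrowright}^+$ (resp. $\Gamma_{\circlearrowright}^-$) is the subcategory generated by all isomorphisms and coface maps (resp. all isomorphisms and codegeneracy maps). The degree is $\deg(\uparrow)=0$, $\deg(\bullet)=1$, and $\deg(G)=|\mathrm{Vt}(G)|+|\mathrm{Edge_i}(G)|+1$ otherwise. **Generalized Reedy structure.** On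 a small category $\mathcal R$: wide subcategories $\mathcal R^+,\mathcal R^-$ and $\deg\colon\mathrm{Ob}(\mathcal R)\to\mathbb N$ such that (i) non-invertible morphisms of $\mathcal R^+$ (resp. $\mathcal R^-$) raise (resp. lower) the degree, and isomorphisms preserve it; (ii) $\mathcal R^+\cap\mathcal R^-=\mathrm{Iso}(\mathcal R)$; (iii) every morphism factors as $f=gh$ with $g\in\mathcal R^+$, $h\in\mathcal R^-$, uniquely up to isomorphism; (iv) if $\theta f=f$ with $\theta\in\mathrm{Iso}(\mathcal R)$ and $f\in\mathcal R^-$, then $\theta$ is an identity. It is dualizable if moreover (iv') if $f\theta=f$ with $\theta\in\mathrm{Iso}(\mathcal R)$ and $f\in\mathcal R^+$, then $\theta$ is an identity. *)

theory Defs
  imports "HOL-Library.FuncSet"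
begin

section \<open>Generalized Reedy structures\<close>

record ('o, 'a) cat =
  Obj :: "'o set"
  Arr :: "'a set"
  source :: "'a \<Rightarrow> 'o"
  target :: "'a \<Rightarrow> 'o"
  ident :: "'o \<Rightarrow> 'a"
  cmp :: "'a \<Rightarrow> 'a \<Rightarrow> 'a"  \<comment> \<open>\<open>cmp C g f\<close> is \<open>g\<close> after \<open>f\<close>\<close>

locale category =
  fixes C :: "('o, 'a) cat"
  assumes source_obj: "f \<in> Arr C \<Longrightarrow> source C f \<in> Obj C"
    and target_obj: "f \<in> Arr C \<Longrightarrow> target C f \<in> Obj C"
    and ident_arr: "X \<in> Obj C \<Longrightarrow> ident C X \<in> Arr C"
    and source_ident: "X \<in> Obj C \<Longrightarrow> source C (ident C X) = X"
    and target_ident: "X \<in> Obj C \<Longrightarrow> target C (ident C X) = X"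
    and cmp_arr: "\<lbrakk>f \<in> Arr C; g \<in> Arr C; source C g = target C f\<rbrakk> \<Longrightarrow> cmp C g f \<in> Arr C"
    and source_cmp: "\<lbrakk>f \<in> Arr C; g \<in> Arr C; source C g = target C f\<rbrakk>
                      \<Longrightarrow> source C (cmp C g f) = source C f"
    and target_cmp: "\<lbrakk>f \<in> Arr C; g \<in> Arr C; source C g = target C f\<rbrakk>
                      \<Longrightarrow> target C (cmp C g f) = target C g"
    and cmp_ident_right: "f \<in> Arr C \<Longrightarrow> cmp C f (ident C (source C f)) = f"
    and cmp_ident_left: "f \<in> Arr C \<Longrightarrow> cmp C (ident C (target C f)) f = f"
    and cmp_assoc: "\<lbrakk>f \<in> Arr C; g \<in> Arr C; h \<in> Arr C;
                      source C g = target C f; source C h = target C g\<rbrakk>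
                      \<Longrightarrow> cmp C h (cmp C g f) = cmp C (cmp C h g) f"

definition isos :: "('o, 'a) cat \<Rightarrow> 'a set" where
  "isos C = {f \<in> Arr C. \<exists>g \<in> Arr C. source C g = target C f \<and> target C g = source C f \<and>
               cmp C g f = ident C (source C f) \<and> cmp C f g = ident C (target C f)}"

definition wide_subcategory :: "('o, 'a) cat \<Rightarrow> 'a set \<Rightarrow> bool" where
  "wide_subcategory C W \<longleftrightarrow>
     W \<subseteq> Arr C \<and> (\<forall>X \<in> Obj C. ident C X \<in> W) \<and>
     (\<forall>f \<in> W. \<forall>g \<in> W. source C g = target C f \<longrightarrow> cmp C g f \<in> W)"

inductive_set generated :: "('o, 'a) cat \<Rightarrow> 'a set \<Rightarrow> 'a set"
  for C :: "('o, 'a) cat" and S :: "'a set" where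
  ident: "X \<in> Obj C \<Longrightarrow> ident C X \<in> generated C S"
| incl: "f \<in> S \<Longrightarrow> f \<in> generated C S"
| cmp: "\<lbrakk>f \<in> generated C S; g \<in> generated C S; source C g = target C f\<rbrakk>
         \<Longrightarrow> cmp C g f \<in> generated C S"

definition full_subcategory :: "('o, 'a) cat \<Rightarrow> 'o set \<Rightarrow> ('o, 'a) cat" where
  "full_subcategory C X =
     C\<lparr>Obj := Obj C \<inter> X, Arr := {f \<in> Arr C. source C f \<in> X \<and> target C f \<in> X}\<rparr>"

locale generalized_reedy = category C
  for C :: "('o, 'a) cat" +
  fixes Rplus Rminus :: "'a set" and degree :: "'o \<Rightarrow> nat"
  assumes wide_plus: "wide_subcategory C Rplus"
    and wide_minus: "wide_subcategory C Rminus"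
    and plus_raises: "f \<in> Rplus \<Longrightarrow> f \<notin> isos C \<Longrightarrow> degree (source C f) < degree (target C f)"
    and minus_lowers: "f \<in> Rminus \<Longrightarrow> f \<notin> isos C \<Longrightarrow> degree (target C f) < degree (source C f)"
    and iso_preserves: "f \<in> isos C \<Longrightarrow> degree (target C f) = degree (source C f)"
    and plus_minus: "Rplus \<inter> Rminus = isos C"
    and factorization: "f \<in> Arr C \<Longrightarrow>
          \<exists>g \<in> Rplus. \<exists>h \<in> Rminus. source C g = target C h \<and> f = cmp C g h"
    and factorization_unique:
          "\<lbrakk>g \<in> Rplus; h \<in> Rminus; source C g = target C h;
            g' \<in> Rplus; h' \<in> Rminus; source C g' = target C h'; cmp C g h = cmp C g' h'\<rbrakk>
           \<Longrightarrow> \<exists>\<theta> \<in> isos C. source C \<theta> = target C h \<and> target C \<theta> = target C h' \<and>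
                 h' = cmp C \<theta> h \<and> g = cmp C g' \<theta>"
    and minus_rigid: "\<lbrakk>\<theta> \<in> isos C; f \<in> Rminus; source C \<theta> = target C f; cmp C \<theta> f = f\<rbrakk>
           \<Longrightarrow> \<theta> = ident C (target C f)"

locale dualizable_generalized_reedy = generalized_reedy C Rplus Rminus degree
  for C :: "('o, 'a) cat" and Rplus Rminus :: "'a set" and degree :: "'o \<Rightarrow> nat" +
  assumes plus_rigid: "\<lbrakk>\<theta> \<in> isos C; f \<in> Rplus; target C \<theta> = source C f; cmp C f \<theta> = f\<rbrakk>
           \<Longrightarrow> \<theta> = ident C (source C f)"


section \<open>Graphs\<close>

text \<open>
  The edge of an exceptional graph is part of the data, so there is one copy of the exceptional
  edge and of the exceptional loop for each element of the type of edges. \<open>Ordinary V E s t\<close> has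
  vertices \<open>V\<close>, edges \<open>E\<close> and partial functions \<open>s\<close> (source) and \<open>t\<close> (target).
\<close>

datatype ('v, 'e) graph =
    is_Exc_Edge: Exc_Edge 'e
  | is_Exc_Loop: Exc_Loop 'e
  | is_Ordinary: Ordinary "'v set" "'e set" "'e \<rightharpoonup> 'v" "'e \<rightharpoonup> 'v"

fun verts :: "('v, 'e) graph \<Rightarrow> 'v set" where
  "verts (Exc_Edge e) = {}"
| "verts (Exc_Loop e) = {}"
| "verts (Ordinary V E s t) = V"

fun edges :: "('v, 'e) graph \<Rightarrow> 'e set" where
  "edges (Exc_Edge e) = {e}"
| "edges (Exc_Loop e) = {e}"
| "edges (Ordinary V E s t) = E"

fun src :: "('v, 'e) graph \<Rightarrow> 'e \<rightharpoonup> 'v" where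
  "src (Exc_Edge e) = Map.empty"
| "src (Exc_Loop e) = Map.empty"
| "src (Ordinary V E s t) = s"

fun tgt :: "('v, 'e) graph \<Rightarrow> 'e \<rightharpoonup> 'v" where
  "tgt (Exc_Edge e) = Map.empty"
| "tgt (Exc_Loop e) = Map.empty"
| "tgt (Ordinary V E s t) = t"

fun inputs :: "('v, 'e) graph \<Rightarrow> 'e set" where
  "inputs (Exc_Edge e) = {e}"
| "inputs (Exc_Loop e) = {}"
| "inputs (Ordinary V E s t) = {e \<in> E. s e = None}"

fun outputs :: "('v, 'e) graph \<Rightarrow> 'e set" where
  "outputs (Exc_Edge e) = {e}"
| "outputs (Exc_Loop e) = {}"
| "outputs (Ordinary V E s t) = {e \<in> E. t e = None}"

fun inner_edges :: "('v, 'e) graph \<Rightarrow> 'e set" where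
  "inner_edges (Exc_Edge e) = {}"
| "inner_edges (Exc_Loop e) = {e}"
| "inner_edges (Ordinary V E s t) = {e \<in> E. s e \<noteq> None \<and> t e \<noteq> None}"

definition in_at :: "('v, 'e) graph \<Rightarrow> 'v \<Rightarrow> 'e set" where
  "in_at G v = {e \<in> edges G. tgt G e = Some v}"

definition out_at :: "('v, 'e) graph \<Rightarrow> 'v \<Rightarrow> 'e set" where
  "out_at G v = {e \<in> edges G. src G e = Some v}"

definition joined :: "('v, 'e) graph \<Rightarrow> 'e set \<Rightarrow> ('v \<times> 'v) set" where
  "joined G I = {(u, w). \<exists>e \<in> I. src G e = Some u \<and> tgt G e = Some w}"

definition connected_by :: "('v, 'e) graph \<Rightarrow> 'v set \<Rightarrow> 'e set \<Rightarrow> bool" where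
  "connected_by G S I \<longleftrightarrow>
     (\<forall>u \<in> S. \<forall>w \<in> S. (u, w) \<in> (joined G I \<union> (joined G I)\<inverse>)\<^sup>*)"

fun wf_graph :: "('v, 'e) graph \<Rightarrow> bool" where
  "wf_graph (Exc_Edge e) \<longleftrightarrow> True"
| "wf_graph (Exc_Loop e) \<longleftrightarrow> True"
| "wf_graph (Ordinary V E s t) \<longleftrightarrow>
     finite V \<and> V \<noteq> {} \<and> finite E \<and> dom s \<union> dom t = E \<and> ran s \<subseteq> V \<and> ran t \<subseteq> V \<and>
     connected_by (Ordinary V E s t) V (inner_edges (Ordinary V E s t))"

definition graph_iso ::
  "('v \<Rightarrow> 'w) \<Rightarrow> ('e \<Rightarrow> 'd) \<Rightarrow> ('v, 'e) graph \<Rightarrow> ('w, 'd) graph \<Rightarrow> bool" where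
  "graph_iso \<phi>V \<phi>E G H \<longleftrightarrow>
     (is_Exc_Edge G \<longleftrightarrow> is_Exc_Edge H) \<and> (is_Exc_Loop G \<longleftrightarrow> is_Exc_Loop H) \<and>
     bij_betw \<phi>V (verts G) (verts H) \<and> bij_betw \<phi>E (edges G) (edges H) \<and>
     (\<forall>e \<in> edges G. src H (\<phi>E e) = map_option \<phi>V (src G e) \<and>
                    tgt H (\<phi>E e) = map_option \<phi>V (tgt G e))"

definition corolla :: "('v, 'e) graph \<Rightarrow> bool" where
  "corolla G \<longleftrightarrow> wf_graph G \<and> (\<exists>v. verts G = {v}) \<and> inner_edges G = {}"

definition bullet :: "('v, 'e) graph \<Rightarrow> bool" where
  "bullet G \<longleftrightarrow> corolla G \<and> edges G = {}"

definition dioperadic :: "('v, 'e) graph \<Rightarrow> bool" where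
  "dioperadic G \<longleftrightarrow> wf_graph G \<and>
     (\<exists>u w e. u \<noteq> w \<and> verts G = {u, w} \<and> inner_edges G = {e} \<and>
              src G e = Some u \<and> tgt G e = Some w)"

definition contracted_corolla :: "('v, 'e) graph \<Rightarrow> bool" where
  "contracted_corolla G \<longleftrightarrow> wf_graph G \<and> (\<exists>v. verts G = {v}) \<and> (\<exists>e. inner_edges G = {e})"

definition deg :: "('v, 'e) graph \<Rightarrow> nat" where
  "deg G = (if is_Exc_Edge G then 0 else if bullet G then 1
            else card (verts G) + card (inner_edges G) + 1)"

text \<open>
  A set of graphs containing every isomorphism type; all graphs being finite, those with natural
  numbers as vertices and edges represent all isomorphism types.
\<close>

definition graph_universe :: "('v, 'e) graph set \<Rightarrow> bool" where
  "graph_universe U \<longleftrightarrow> (\<forall>G \<in> U. wf_graph G) \<and>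
     (\<forall>H :: (nat, nat) graph. wf_graph H \<longrightarrow> (\<exists>G \<in> U. \<exists>\<phi>V \<phi>E. graph_iso \<phi>V \<phi>E H G))"

lemma graph_universe_nat: "graph_universe {G :: (nat, nat) graph. wf_graph G}"
proof -
  have "graph_iso id id H H" for H :: "(nat, nat) graph"
    by (simp add: graph_iso_def option.map_id)
  then show ?thesis
    unfolding graph_universe_def by blast
qed


section \<open>Substitution\<close>

text \<open>
  The edges of \<open>G({P\<^sub>v})\<close> are the classes of the disjoint union of the edges of \<open>G\<close> (\<open>Inl\<close>) and
  of all \<open>P\<^sub>v\<close> (\<open>Inr (v, _)\<close>) under the equivalence relation that identifies each edge at \<open>v\<close>
  with the leg of \<open>P\<^sub>v\<close> corresponding to it under \<open>bi v\<close> (inputs) or \<open>bo v\<close> (outputs). A loop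
  at \<open>v\<close> is identified with both an input and an output of \<open>P\<^sub>v\<close>; substituting the exceptional
  edge at \<open>v\<close> merges the two edges at \<open>v\<close>.
\<close>

definition glue ::
  "('v, 'e) graph \<Rightarrow> ('v \<Rightarrow> 'e \<Rightarrow> 'd) \<Rightarrow> ('v \<Rightarrow> 'e \<Rightarrow> 'd) \<Rightarrow>
   (('e + 'v \<times> 'd) \<times> ('e + 'v \<times> 'd)) set" where
  "glue G bi bo =
     {(Inl e, Inr (v, bi v e)) | v e. v \<in> verts G \<and> e \<in> in_at G v} \<union>
     {(Inl e, Inr (v, bo v e)) | v e. v \<in> verts G \<and> e \<in> out_at G v}"

definition glue_class ::
  "('v, 'e) graph \<Rightarrow> ('v \<Rightarrow> 'e \<Rightarrow> 'd) \<Rightarrow> ('v \<Rightarrow> 'e \<Rightarrow> 'd) \<Rightarrow>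
   'e + 'v \<times> 'd \<Rightarrow> ('e + 'v \<times> 'd) set" where
  "glue_class G bi bo x = (glue G bi bo \<union> (glue G bi bo)\<inverse>)\<^sup>* `` {x}"

definition subst_verts ::
  "('v, 'e) graph \<Rightarrow> ('v \<Rightarrow> ('w, 'd) graph) \<Rightarrow> ('v \<times> 'w) set" where
  "subst_verts G P = (SIGMA v : verts G. verts (P v))"

definition subst_edges ::
  "('v, 'e) graph \<Rightarrow> ('v \<Rightarrow> ('w, 'd) graph) \<Rightarrow> ('v \<Rightarrow> 'e \<Rightarrow> 'd) \<Rightarrow> ('v \<Rightarrow> 'e \<Rightarrow> 'd) \<Rightarrow>
   ('e + 'v \<times> 'd) set set" where
  "subst_edges G P bi bo =
     glue_class G bi bo ` (edges G <+> (SIGMA v : verts G. edges (P v)))"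

text \<open>
  The end of an edge \<open>c\<close> of \<open>G({P\<^sub>v})\<close>: the end of a representative of \<open>c\<close> in some \<open>P\<^sub>v\<close>. Here
  \<open>h\<close> is \<open>src\<close> or \<open>tgt\<close>; under \<open>subst_data\<close> below the vertex is unique.
\<close>

definition subst_end ::
  "(('w, 'd) graph \<Rightarrow> 'd \<rightharpoonup> 'w) \<Rightarrow> ('v, 'e) graph \<Rightarrow> ('v \<Rightarrow> ('w, 'd) graph) \<Rightarrow>
   ('v \<Rightarrow> 'e \<Rightarrow> 'd) \<Rightarrow> ('v \<Rightarrow> 'e \<Rightarrow> 'd) \<Rightarrow> ('e + 'v \<times> 'd) set \<rightharpoonup> 'v \<times> 'w" where
  "subst_end h G P bi bo c =
     (let ends = {(v, w). v \<in> verts G \<and> (\<exists>d. Inr (v, d) \<in> c \<and> h (P v) d = Some w)}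
      in if c \<in> subst_edges G P bi bo \<and> ends \<noteq> {} then Some (the_elem ends) else None)"

text \<open>
  If there are no vertices there is exactly one edge, and the result is exceptional. The legs of
  \<open>G({P\<^sub>v})\<close> are those of \<open>G\<close>.
\<close>

definition graph_subst ::
  "('v, 'e) graph \<Rightarrow> ('v \<Rightarrow> ('w, 'd) graph) \<Rightarrow> ('v \<Rightarrow> 'e \<Rightarrow> 'd) \<Rightarrow> ('v \<Rightarrow> 'e \<Rightarrow> 'd) \<Rightarrow>
   ('v \<times> 'w, ('e + 'v \<times> 'd) set) graph" where
  "graph_subst G P bi bo =
     (if subst_verts G P \<noteq> {} then
        Ordinary (subst_verts G P) (subst_edges G P bi bo)
          (subst_end src G P bi bo) (subst_end tgt G P bi bo)
      else if inputs G \<union> outputs G \<noteq> {} then Exc_Edge (the_elem (subst_edges G P bi bo))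
      else Exc_Loop (the_elem (subst_edges G P bi bo)))"

definition subst_data ::
  "('v, 'e) graph \<Rightarrow> ('v \<Rightarrow> ('w, 'd) graph) \<Rightarrow> ('v \<Rightarrow> 'e \<Rightarrow> 'd) \<Rightarrow> ('v \<Rightarrow> 'e \<Rightarrow> 'd) \<Rightarrow> bool" where
  "subst_data G P bi bo \<longleftrightarrow>
     (\<forall>v \<in> verts G. wf_graph (P v) \<and>
        bij_betw (bi v) (in_at G v) (inputs (P v)) \<and>
        bij_betw (bo v) (out_at G v) (outputs (P v)))"


section \<open>Subgraphs\<close>

datatype ('v, 'e) subgraph =
    Sub_Edge 'e
  | Sub_Loop 'e  \<comment> \<open>the exceptional loop as a subgraph of itself\<close>
  | Sub_Ord "'v set" "'e set"

definition subgraphs :: "('v, 'e) graph \<Rightarrow> ('v, 'e) subgraph set" where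
  "subgraphs K =
     {Sub_Edge e | e. e \<in> edges K} \<union>
     {Sub_Loop e | e. K = Exc_Loop e} \<union>
     {Sub_Ord S I | S I. S \<noteq> {} \<and> S \<subseteq> verts K \<and> I \<subseteq> inner_edges K \<and>
        (\<forall>e \<in> I. the (src K e) \<in> S \<and> the (tgt K e) \<in> S) \<and> connected_by K S I}"

text \<open>
  An edge of \<open>K\<close> outside \<open>I\<close> with both ends in \<open>S\<close> gives two legs of the subgraph, which are
  told apart by the constructors \<open>In_Leg\<close> and \<open>Out_Leg\<close>.
\<close>

datatype 'e sub_edge = Whole (under: 'e) | In_Leg (under: 'e) | Out_Leg (under: 'e)

fun sub_src :: "('v, 'e) graph \<Rightarrow> 'v set \<Rightarrow> 'e set \<Rightarrow> 'e sub_edge \<rightharpoonup> 'v" where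
  "sub_src K S I (Whole e) = (if e \<in> I then src K e else None)"
| "sub_src K S I (In_Leg e) = None"
| "sub_src K S I (Out_Leg e) = (if e \<in> edges K - I \<and> src K e \<in> Some ` S then src K e else None)"

fun sub_tgt :: "('v, 'e) graph \<Rightarrow> 'v set \<Rightarrow> 'e set \<Rightarrow> 'e sub_edge \<rightharpoonup> 'v" where
  "sub_tgt K S I (Whole e) = (if e \<in> I then tgt K e else None)"
| "sub_tgt K S I (In_Leg e) = (if e \<in> edges K - I \<and> tgt K e \<in> Some ` S then tgt K e else None)"
| "sub_tgt K S I (Out_Leg e) = None"

text \<open>
  The canonical map from a subgraph to \<open>K\<close> is \<open>under\<close> on edges and the inclusion on vertices.
\<close>

fun graph_of :: "('v, 'e) graph \<Rightarrow> ('v, 'e) subgraph \<Rightarrow> ('v, 'e sub_edge) graph" where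
  "graph_of K (Sub_Edge e) = Exc_Edge (Whole e)"
| "graph_of K (Sub_Loop e) = Exc_Loop (Whole e)"
| "graph_of K (Sub_Ord S I) =
     Ordinary S
       (Whole ` I \<union> In_Leg ` {e \<in> edges K - I. tgt K e \<in> Some ` S}
                \<union> Out_Leg ` {e \<in> edges K - I. src K e \<in> Some ` S})
       (sub_src K S I) (sub_tgt K S I)"


section \<open>The wheeled graphical category\<close>

text \<open>
  For \<open>f0\<close> from the edges of \<open>H\<close> to those of \<open>K\<close> and \<open>f1\<close> from the vertices of \<open>H\<close> to subgraphs
  of \<open>K\<close>, the graph \<open>H({f1 v})\<close>; an edge \<open>e\<close> at \<open>v\<close> corresponds to the leg of \<open>f1 v\<close> over \<open>f0 e\<close>.
\<close>

definition image_graph ::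
  "('w, 'd) graph \<Rightarrow> ('v, 'e) graph \<Rightarrow> ('d \<Rightarrow> 'e) \<Rightarrow> ('w \<Rightarrow> ('v, 'e) subgraph) \<Rightarrow>
   ('w \<times> 'v, ('d + 'w \<times> 'e sub_edge) set) graph" where
  "image_graph H K f0 f1 =
     graph_subst H (\<lambda>v. graph_of K (f1 v))
       (\<lambda>v e. inv_into (inputs (graph_of K (f1 v))) under (f0 e))
       (\<lambda>v e. inv_into (outputs (graph_of K (f1 v))) under (f0 e))"

text \<open>
  \<open>is_image H K f0 f1 s\<close>: the graph \<open>H({f1 v})\<close> is isomorphic over \<open>K\<close> to the subgraph \<open>s\<close>. Its
  canonical map to \<open>K\<close> sends the class of \<open>Inl e\<close> to \<open>f0 e\<close>, that of \<open>Inr (v, d)\<close> to \<open>under d\<close>,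
  and the vertex \<open>(v, w)\<close> to \<open>w\<close>.
\<close>

definition is_image ::
  "('w, 'd) graph \<Rightarrow> ('v, 'e) graph \<Rightarrow> ('d \<Rightarrow> 'e) \<Rightarrow> ('w \<Rightarrow> ('v, 'e) subgraph) \<Rightarrow>
   ('v, 'e) subgraph \<Rightarrow> bool" where
  "is_image H K f0 f1 s \<longleftrightarrow>
     s \<in> subgraphs K \<and>
     (\<exists>\<phi>V \<phi>E. graph_iso \<phi>V \<phi>E (image_graph H K f0 f1) (graph_of K s) \<and>
        (\<forall>(v, w) \<in> verts (image_graph H K f0 f1). \<phi>V (v, w) = w) \<and>
        (\<forall>c \<in> edges (image_graph H K f0 f1).
           (\<forall>e. Inl e \<in> c \<longrightarrow> under (\<phi>E c) = f0 e) \<and>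
           (\<forall>v d. Inr (v, d) \<in> c \<longrightarrow> under (\<phi>E c) = under d)))"

definition map_image ::
  "('w, 'd) graph \<Rightarrow> ('v, 'e) graph \<Rightarrow> ('d \<Rightarrow> 'e) \<Rightarrow> ('w \<Rightarrow> ('v, 'e) subgraph) \<Rightarrow>
   ('v, 'e) subgraph" where
  "map_image H K f0 f1 = (THE s. is_image H K f0 f1 s)"

record ('v, 'e) gmap =
  gdom :: "('v, 'e) graph"
  gcod :: "('v, 'e) graph"
  emap :: "'e \<Rightarrow> 'e"
  vmap :: "'v \<Rightarrow> ('v, 'e) subgraph"

text \<open>The two functions are extensional, so that equality of maps is equality of records.\<close>

definition graphical_map :: "('v, 'e) gmap \<Rightarrow> bool" where
  "graphical_map f \<longleftrightarrow>
     emap f \<in> edges (gdom f) \<rightarrow>\<^sub>E edges (gcod f) \<and>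
     vmap f \<in> verts (gdom f) \<rightarrow>\<^sub>E subgraphs (gcod f) \<and>
     (\<forall>v \<in> verts (gdom f).
        bij_betw (emap f) (in_at (gdom f) v) (under ` inputs (graph_of (gcod f) (vmap f v))) \<and>
        bij_betw (emap f) (out_at (gdom f) v) (under ` outputs (graph_of (gcod f) (vmap f v)))) \<and>
     (\<exists>s. is_image (gdom f) (gcod f) (emap f) (vmap f) s)"

definition gid :: "('v, 'e) graph \<Rightarrow> ('v, 'e) gmap" where
  "gid G = \<lparr>gdom = G, gcod = G, emap = (\<lambda>e \<in> edges G. e), vmap = (\<lambda>v \<in> verts G. Sub_Ord {v} {})\<rparr>"

text \<open>
  The composite of \<open>g\<close> with the inclusion of a subgraph \<open>s\<close> is given by \<open>emap g \<circ> under\<close> and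
  by the restriction of \<open>vmap g\<close> to the vertices of \<open>s\<close>.
\<close>

definition gcomp :: "('v, 'e) gmap \<Rightarrow> ('v, 'e) gmap \<Rightarrow> ('v, 'e) gmap" where
  "gcomp g f = \<lparr>gdom = gdom f, gcod = gcod g,
     emap = (\<lambda>e \<in> edges (gdom f). emap g (emap f e)),
     vmap = (\<lambda>v \<in> verts (gdom f).
               map_image (graph_of (gcod f) (vmap f v)) (gcod g) (emap g \<circ> under) (vmap g))\<rparr>"

definition wheeled_A :: "('v, 'e) graph set \<Rightarrow> (('v, 'e) graph, ('v, 'e) gmap) cat" where
  "wheeled_A U = \<lparr>Obj = U, Arr = {f. gdom f \<in> U \<and> gcod f \<in> U \<and> graphical_map f},
     source = gdom, target = gcod, ident = gid, cmp = gcomp\<rparr>"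

definition wheeled_B :: "('v, 'e) graph set \<Rightarrow> (('v, 'e) graph, ('v, 'e) gmap) cat" where
  "wheeled_B U = full_subcategory (wheeled_A U) {G. \<not> is_Exc_Loop G}"


section \<open>Coface and codegeneracy maps\<close>

text \<open>
  Substitution determines a graph up to isomorphism only, so a map into \<open>G({P\<^sub>v})\<close> means a map
  into a graph \<open>K\<close> equipped with an isomorphism \<open>(\<phi>V, \<phi>E)\<close> from \<open>graph_subst G P bi bo\<close> to \<open>K\<close>.
  \<open>placed\<close> is the subgraph of \<open>K\<close> given by the graph \<open>P\<^sub>v\<close> substituted at \<open>v\<close>. If \<open>P\<^sub>v\<close> is a
  corolla, then this is the corolla of the corresponding vertex of \<open>K\<close>.
\<close>

definition placed ::
  "('v, 'e) graph \<Rightarrow> ('v \<Rightarrow> ('w, 'd) graph) \<Rightarrow> ('v \<Rightarrow> 'e \<Rightarrow> 'd) \<Rightarrow> ('v \<Rightarrow> 'e \<Rightarrow> 'd) \<Rightarrow>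
   ('v \<times> 'w \<Rightarrow> 'x) \<Rightarrow> (('e + 'v \<times> 'd) set \<Rightarrow> 'y) \<Rightarrow> 'v \<Rightarrow> ('x, 'y) subgraph" where
  "placed G P bi bo \<phi>V \<phi>E v =
     (let edge = (\<lambda>d. \<phi>E (glue_class G bi bo (Inr (v, d)))) in
      case P v of
        Exc_Edge d \<Rightarrow> Sub_Edge (edge d)
      | Exc_Loop d \<Rightarrow> Sub_Loop (edge d)
      | Ordinary _ _ _ _ \<Rightarrow> Sub_Ord ((\<lambda>w. \<phi>V (v, w)) ` verts (P v)) (edge ` inner_edges (P v)))"

text \<open>The maps \<open>G \<rightarrow> G(Q)\<close>, where a graph \<open>Q\<close> of the given kind is substituted at one vertex.\<close>

definition substitution_map :: "(('v, 'e) graph \<Rightarrow> bool) \<Rightarrow> ('v, 'e) gmap \<Rightarrow> bool" where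
  "substitution_map kind f \<longleftrightarrow>
     (\<exists>v (P :: 'v \<Rightarrow> ('v, 'e) graph) bi bo \<phi>V \<phi>E.
        v \<in> verts (gdom f) \<and> subst_data (gdom f) P bi bo \<and>
        kind (P v) \<and> (\<forall>w \<in> verts (gdom f) - {v}. corolla (P w)) \<and>
        graph_iso \<phi>V \<phi>E (graph_subst (gdom f) P bi bo) (gcod f) \<and>
        emap f = (\<lambda>e \<in> edges (gdom f). \<phi>E (glue_class (gdom f) bi bo (Inl e))) \<and>
        vmap f = (\<lambda>w \<in> verts (gdom f). placed (gdom f) P bi bo \<phi>V \<phi>E w))"

definition inner_coface :: "('v, 'e) gmap \<Rightarrow> bool" where
  "inner_coface f \<longleftrightarrow> substitution_map (\<lambda>Q. dioperadic Q \<or> contracted_corolla Q) f"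

text \<open>
  The maps \<open>P \<rightarrow> D(P)\<close>, where \<open>P\<close> is substituted at one vertex of a dioperadic graph or contracted
  corolla \<open>D\<close>. In the family of substituted graphs, \<open>P\<close> is the member at the vertex \<open>v\<close>.
\<close>

definition outer_coface :: "('v, 'e) gmap \<Rightarrow> bool" where
  "outer_coface f \<longleftrightarrow>
     (\<exists>(D :: ('v, 'e) graph) v (P :: 'v \<Rightarrow> ('v, 'e) graph) bi bo \<phi>V \<phi>E.
        (dioperadic D \<or> contracted_corolla D) \<and>
        v \<in> verts D \<and> subst_data D P bi bo \<and>
        P v = gdom f \<and> (\<forall>w \<in> verts D - {v}. corolla (P w)) \<and>
        graph_iso \<phi>V \<phi>E (graph_subst D P bi bo) (gcod f) \<and>
        emap f = (\<lambda>e \<in> edges (gdom f). \<phi>E (glue_class D bi bo (Inr (v, e)))) \<and>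
        vmap f = (\<lambda>w \<in> verts (gdom f). Sub_Ord {\<phi>V (v, w)} {}))"

definition exceptional_coface :: "('v, 'e) gmap \<Rightarrow> bool" where
  "exceptional_coface f \<longleftrightarrow>
     bullet (gdom f) \<and>
     (\<exists>e. gcod f = Exc_Loop e \<and> emap f = (\<lambda>_. undefined) \<and>
          vmap f = (\<lambda>v \<in> verts (gdom f). Sub_Loop e))"

text \<open>
  A vertex at which the exceptional edge can be substituted has exactly one input and exactly one
  output, by the bijections in \<open>subst_data\<close>.
\<close>

definition codegeneracy :: "('v, 'e) gmap \<Rightarrow> bool" where
  "codegeneracy f \<longleftrightarrow> substitution_map is_Exc_Edge f"

type_synonym ('v, 'e) graph_cat = "(('v, 'e) graph, ('v, 'e) gmap) cat"

definition Gamma_plus :: "('v, 'e) graph_cat \<Rightarrow> ('v, 'e) gmap set" where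
  "Gamma_plus C = generated C (isos C \<union>
     {f \<in> Arr C. inner_coface f \<or> outer_coface f \<or> exceptional_coface f})"

definition Gamma_minus :: "('v, 'e) graph_cat \<Rightarrow> ('v, 'e) gmap set" where
  "Gamma_minus C = generated C (isos C \<union> {f \<in> Arr C. codegeneracy f})"

end

theory Submission
  imports Defs
begin

text \<open>
  A graphical map \<open>f : G \<rightarrow> K\<close> carries less data than its definition suggests. A subgraph of \<open>K\<close> is
  determined by its vertices and its inputs, because an edge with both ends among the vertices is
  an inner edge unless it is an input; and the inputs of \<open>f\<^sub>1 v\<close> are the edges \<open>f\<^sub>0 e\<close> for \<open>e\<close> an
  input of \<open>v\<close>. So \<open>f\<close> is determined by \<open>f\<^sub>0\<close> and the vertex sets of the \<open>f\<^sub>1 v\<close> (\<open>hom_eqI\<close>).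
  Furthermore, the requirement that \<open>G({f\<^sub>1 v})\<close> is a subgraph of \<open>K\<close> just says that these vertex
  sets are disjoint, except that a graph without legs can be collapsed to a graph without vertices
  only if \<open>K\<close> is the exceptional loop (locale \<open>gmorphism\<close>, \<open>hom_iff\<close>). The proof of this analyses
  the classes of edges of a substituted graph: they are chains, each with one upstream end and
  one downstream end. In the new description composition composes the edge maps and takes unions of
  vertex sets, so the laws of a category are immediate.

  Call \<open>f\<close> positive if it sends no vertex to an edge, and negative if it sends each vertex to an edge
  or to a corolla and its image is all of \<open>K\<close>. Positive maps do not lower the degree, since they are
  injective on inner edges and send the vertices to disjoint nonempty sets, apart from the map from
  the vertex without edges to the exceptional loop; negative maps that are not positive lower it; and a positive map that preserves the degree is negative, hence an
  isomorphism (\<open>positive_deg\<close>, \<open>negative_deg\<close>, \<open>positive_negative_graph_iso\<close>). Negative maps are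
  epimorphisms, and a map factors through a negative map \<open>h\<close> with the same domain as soon as it
  sends to edges all vertices that \<open>h\<close> sends to edges (\<open>factor_through_negative\<close>). In a factorization
  of \<open>f\<close> into a negative map \<open>h\<close> and a positive map, \<open>h\<close> sends to edges the same vertices as \<open>f\<close>; so
  any two factorizations differ by an isomorphism. An automorphism \<open>\<theta>\<close> with \<open>f \<theta> = f\<close> for a positive
  \<open>f\<close> fixes all vertices because of disjointness, and then all edges because \<open>f\<^sub>0\<close> is injective on the
  inputs and on the outputs of each vertex.

  It remains to identify the generated subcategories. That generators are positive or negative can
  be read off from their vertex maps. For the converse a generator is split off. If \<open>f\<close> sends \<open>v\<close> to
  an edge, then \<open>v\<close> has one input and one output, and \<open>f\<close> factors through the codegeneracy that
  removes \<open>v\<close> (\<open>degenerate_step\<close>). If \<open>f\<close> is positive and its image is not all of \<open>K\<close>, then the image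
  lies in a maximal proper subgraph; such a subgraph lacks a single inner edge of \<open>K\<close>, its inclusion
  is an outer coface map, and \<open>f\<close> lifts to it (\<open>outer_step\<close>). If \<open>f\<close> is positive with image \<open>K\<close> but not
  invertible, then some \<open>f\<^sub>1 v\<close> has an inner edge, and \<open>f\<close> factors through the inner coface map that
  restores this edge in the graph where it is contracted (\<open>inner_step\<close>). Each step lowers a degree.
  That the maps split off really are generators follows from \<open>onto_substitution\<close>: a map whose image
  is its target exhibits the target as a substitution into its domain.
\<close>

section \<open>Connectedness and reversal of graphs\<close>

lemma wf_finite:
  assumes "wf_graph G"
  shows finite_verts: "finite (verts G)" and finite_edges: "finite (edges G)"
  using assms by (cases G; auto)+

lemma src_Some:
  assumes "wf_graph G" "src G e = Some v"
  shows src_Some_edge: "e \<in> edges G" and src_Some_vert: "v \<in> verts G"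
  using assms by (cases G; auto simp: ran_def)+

lemma tgt_Some:
  assumes "wf_graph G" "tgt G e = Some v"
  shows tgt_Some_edge: "e \<in> edges G" and tgt_Some_vert: "v \<in> verts G"
  using assms by (cases G; auto simp: ran_def)+

lemma in_at_iff: "wf_graph G \<Longrightarrow> e \<in> in_at G v \<longleftrightarrow> tgt G e = Some v"
  by (auto simp: in_at_def dest: tgt_Some)

lemma out_at_iff: "wf_graph G \<Longrightarrow> e \<in> out_at G v \<longleftrightarrow> src G e = Some v"
  by (auto simp: out_at_def dest: src_Some)

lemma inputs_subset: "inputs G \<subseteq> edges G"
  by (cases G) auto

lemma outputs_subset: "outputs G \<subseteq> edges G"
  by (cases G) auto

lemma inputs_iff: "verts G \<noteq> {} \<Longrightarrow> e \<in> inputs G \<longleftrightarrow> e \<in> edges G \<and> src G e = None"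
  by (cases G) auto

lemma outputs_iff: "verts G \<noteq> {} \<Longrightarrow> e \<in> outputs G \<longleftrightarrow> e \<in> edges G \<and> tgt G e = None"
  by (cases G) auto

lemma inner_edges_iff:
  "verts G \<noteq> {} \<Longrightarrow> e \<in> inner_edges G \<longleftrightarrow> e \<in> edges G \<and> src G e \<noteq> None \<and> tgt G e \<noteq> None"
  by (cases G) auto

lemma inner_edges_subset: "inner_edges G \<subseteq> edges G"
  by (cases G) auto

lemma wf_ends:
  "wf_graph G \<Longrightarrow> verts G \<noteq> {} \<Longrightarrow> e \<in> edges G \<Longrightarrow> src G e \<noteq> None \<or> tgt G e \<noteq> None"
  by (cases G) auto

lemma is_Ordinary_iff: "wf_graph G \<Longrightarrow> is_Ordinary G \<longleftrightarrow> verts G \<noteq> {}"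
  by (cases G) auto

lemma inputs_outputs_Exc_Edge:
  "wf_graph G \<Longrightarrow> d \<in> inputs G \<Longrightarrow> d \<in> outputs G \<Longrightarrow> G = Exc_Edge d"
  by (cases G) auto

text \<open>
  Connectedness in terms of sets of vertices that are closed under adjacency. This form passes to
  quotients and to substituted graphs without any handling of paths.
\<close>

lemma connected_by_iff_closed:
  "connected_by G S I \<longleftrightarrow>
     (\<forall>T. T \<inter> S \<noteq> {} \<longrightarrow>
        (\<forall>e \<in> I. \<forall>u w. src G e = Some u \<longrightarrow> tgt G e = Some w \<longrightarrow> (u \<in> T \<longleftrightarrow> w \<in> T)) \<longrightarrow> S \<subseteq> T)"
    (is "_ \<longleftrightarrow> ?R")
proof
  let ?J = "joined G I \<union> (joined G I)\<inverse>"
  assume c: "connected_by G S I"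
  show ?R
  proof (intro allI impI)
    fix T
    assume T: "T \<inter> S \<noteq> {}"
      and cl: "\<forall>e \<in> I. \<forall>u w. src G e = Some u \<longrightarrow> tgt G e = Some w \<longrightarrow> (u \<in> T \<longleftrightarrow> w \<in> T)"
    obtain u where u: "u \<in> T" "u \<in> S" using T by auto
    have "w \<in> T" if "(u, w) \<in> ?J\<^sup>*" for w
      using that by (induction rule: rtrancl_induct) (use u cl in \<open>auto simp: joined_def\<close>)
    then show "S \<subseteq> T" using c u unfolding connected_by_def by blast
  qed
next
  let ?J = "joined G I \<union> (joined G I)\<inverse>"
  assume R: ?R
  show "connected_by G S I" unfolding connected_by_def
  proof (intro ballI)
    fix u w assume u: "u \<in> S" and w: "w \<in> S"
    have "(u, a) \<in> ?J\<^sup>* \<longleftrightarrow> (u, b) \<in> ?J\<^sup>*" if "e \<in> I" "src G e = Some a" "tgt G e = Some b" for e a b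
    proof -
      have "(a, b) \<in> ?J" "(b, a) \<in> ?J" using that by (auto simp: joined_def)
      then show ?thesis by (meson rtrancl.rtrancl_into_rtrancl)
    qed
    then have "S \<subseteq> {x. (u, x) \<in> ?J\<^sup>*}"
      by (intro R[rule_format]) (use u in auto)
    then show "(u, w) \<in> ?J\<^sup>*" using w by auto
  qed
qed

lemma wf_graph_closed:
  assumes "wf_graph G" "v \<in> verts G" "v \<in> T"
    and "\<And>e u w. src G e = Some u \<Longrightarrow> tgt G e = Some w \<Longrightarrow> u \<in> T \<longleftrightarrow> w \<in> T"
  shows "verts G \<subseteq> T"
proof (cases G)
  case (Ordinary V E s t)
  then have "connected_by G (verts G) (inner_edges G)" using assms(1) by simp
  then show ?thesis unfolding connected_by_iff_closed using assms by blast
qed auto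

text \<open>
  Reversing all edges exchanges inputs and outputs, so that statements about targets follow from
  those about sources.
\<close>

fun rev_graph :: "('v, 'e) graph \<Rightarrow> ('v, 'e) graph" where
  "rev_graph (Exc_Edge e) = Exc_Edge e"
| "rev_graph (Exc_Loop e) = Exc_Loop e"
| "rev_graph (Ordinary V E s t) = Ordinary V E t s"

lemma rev_graph_simps [simp]:
  "verts (rev_graph G) = verts G" "edges (rev_graph G) = edges G"
  "src (rev_graph G) = tgt G" "tgt (rev_graph G) = src G"
  "inputs (rev_graph G) = outputs G" "outputs (rev_graph G) = inputs G"
  "in_at (rev_graph G) = out_at G" "out_at (rev_graph G) = in_at G"
  "is_Exc_Edge (rev_graph G) = is_Exc_Edge G" "is_Exc_Loop (rev_graph G) = is_Exc_Loop G"
  "inner_edges (rev_graph G) = inner_edges G"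
  "rev_graph (rev_graph G) = G"
  by (cases G; auto simp: in_at_def out_at_def fun_eq_iff)+

lemma connected_by_rev: "connected_by (rev_graph G) S I \<longleftrightarrow> connected_by G S I"
  unfolding connected_by_def joined_def rev_graph_simps by (simp add: converse_unfold Un_commute conj_ac)

lemma wf_rev_graph [simp]: "wf_graph (rev_graph G) \<longleftrightarrow> wf_graph G"
proof (cases G)
  case (Ordinary V E s t)
  have i: "inner_edges (Ordinary V E t s) = inner_edges (Ordinary V E s t)" by auto
  show ?thesis
    using connected_by_rev[of "Ordinary V E s t" V "inner_edges (Ordinary V E s t)"]
    unfolding Ordinary rev_graph.simps wf_graph.simps i by (simp add: Un_commute conj_ac)
qed auto

section \<open>Chains\<close>

text \<open>
  Two elements joined by steps of a deterministic relation and their inverses have a common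
  successor, since forks can be closed.
\<close>

lemma chain_terminal_unique:
  assumes sv: "single_valued r"
    and xy: "(x, y) \<in> (r \<union> r\<inverse>)\<^sup>*" and x: "x \<notin> Domain r" and y: "y \<notin> Domain r"
  shows "x = y"
proof -
  have "(y, x) \<in> r\<^sup>*"
    using xy
  proof (induction rule: rtrancl_induct)
    case (step y z)
    then consider "(y, z) \<in> r" | "(z, y) \<in> r" by auto
    then show ?case
    proof cases
      case 1
      then have "y \<noteq> x" using x by auto
      then obtain y' where "(y, y') \<in> r" "(y', x) \<in> r\<^sup>*"
        using step.IH by (meson converse_rtranclE)
      then show ?thesis using 1 sv by (metis single_valuedD)
    qed (use step.IH in auto)
  qed auto
  then show ?thesis using y by (cases rule: converse_rtranclE) auto
qed

text \<open>
  An injective map of a finite set to itself is surjective.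
\<close>

lemma chain_endless:
  assumes sv: "single_valued (r\<inverse>)" and fin: "finite c" and cl: "\<And>x y. x \<in> c \<Longrightarrow> (x, y) \<in> r \<Longrightarrow> y \<in> c"
    and sub: "c \<subseteq> Domain r"
  shows "c \<subseteq> Range r"
proof -
  have "\<forall>x\<in>c. \<exists>y. (x, y) \<in> r" using sub by auto
  then obtain f where f: "\<And>x. x \<in> c \<Longrightarrow> (x, f x) \<in> r" by metis
  have "inj_on f c" using f sv by (metis converseI inj_onI single_valuedD)
  moreover have "f ` c \<subseteq> c" using f cl by auto
  ultimately have "f ` c = c" using fin by (simp add: endo_inj_surj)
  then show ?thesis using f by force
qed

section \<open>The edges of a substituted graph\<close>

text \<open>
  The edges of \<open>G({P\<^sub>v})\<close> are the classes \<open>cls x\<close> of \<open>cells\<close> under gluing. Gluing is given a direction: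
  \<open>upstream\<close> relates each cell to the one that precedes it along the direction of the edges. As a cell
  has at most one successor and at most one predecessor under \<open>upstream\<close>, the classes are chains or
  cycles.
\<close>

locale substitution =
  fixes G :: "('v, 'e) graph" and P :: "'v \<Rightarrow> ('w, 'd) graph" and bi bo :: "'v \<Rightarrow> 'e \<Rightarrow> 'd"
  assumes wfG: "wf_graph G" and data: "subst_data G P bi bo"
begin

definition cells :: "('e + 'v \<times> 'd) set" where
  "cells = edges G <+> (SIGMA v : verts G. edges (P v))"

abbreviation cls :: "'e + 'v \<times> 'd \<Rightarrow> ('e + 'v \<times> 'd) set" where
  "cls \<equiv> glue_class G bi bo"

definition upstream :: "(('e + 'v \<times> 'd) \<times> ('e + 'v \<times> 'd)) set" where
  "upstream = {(Inr (v, bi v e), Inl e) | v e. v \<in> verts G \<and> e \<in> in_at G v} \<union>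
          {(Inl e, Inr (v, bo v e)) | v e. v \<in> verts G \<and> e \<in> out_at G v}"

lemma wfP: "v \<in> verts G \<Longrightarrow> wf_graph (P v)"
  and bi: "v \<in> verts G \<Longrightarrow> bij_betw (bi v) (in_at G v) (inputs (P v))"
  and bo: "v \<in> verts G \<Longrightarrow> bij_betw (bo v) (out_at G v) (outputs (P v))"
  using data unfolding subst_data_def by auto

lemma rev: "substitution (rev_graph G) (\<lambda>v. rev_graph (P v)) bo bi"
  by unfold_locales (use wfG data in \<open>auto simp: subst_data_def\<close>)

lemma glue_upstream: "glue G bi bo \<union> (glue G bi bo)\<inverse> = upstream \<union> upstream\<inverse>"
  unfolding glue_def upstream_def by blast

lemma cls_iff: "y \<in> cls x \<longleftrightarrow> (x, y) \<in> (upstream \<union> upstream\<inverse>)\<^sup>*"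
  unfolding glue_class_def glue_upstream by auto

lemma cls_refl [simp]: "x \<in> cls x"
  by (simp add: cls_iff)

lemma sym_glued: "sym ((upstream \<union> upstream\<inverse>)\<^sup>*)"
  by (intro sym_rtrancl symI) auto

lemma cls_eq_iff: "cls x = cls y \<longleftrightarrow> y \<in> cls x"
proof
  assume "y \<in> cls x"
  then have xy: "(x, y) \<in> (upstream \<union> upstream\<inverse>)\<^sup>*" and yx: "(y, x) \<in> (upstream \<union> upstream\<inverse>)\<^sup>*"
    using sym_glued by (auto simp: cls_iff dest: symD)
  show "cls x = cls y"
  proof (rule set_eqI)
    fix z
    show "z \<in> cls x \<longleftrightarrow> z \<in> cls y"
      unfolding cls_iff using rtrancl_trans[OF xy, of z] rtrancl_trans[OF yx, of z] by blast
  qed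
next
  assume "cls x = cls y"
  then show "y \<in> cls x" by simp
qed

lemma cls_in: "v \<in> verts G \<Longrightarrow> e \<in> in_at G v \<Longrightarrow> cls (Inr (v, bi v e)) = cls (Inl e)"
  unfolding cls_eq_iff cls_iff by (intro r_into_rtrancl) (auto simp: upstream_def)

lemma cls_out: "v \<in> verts G \<Longrightarrow> e \<in> out_at G v \<Longrightarrow> cls (Inr (v, bo v e)) = cls (Inl e)"
  unfolding cls_eq_iff cls_iff by (intro r_into_rtrancl) (auto simp: upstream_def)

lemma upstream_deterministic: "single_valued upstream"
  unfolding single_valued_def upstream_def using bi wfG
  by (auto simp: in_at_iff out_at_iff) (metis bij_betw_inv_into_left in_at_iff)

lemma downstream_deterministic: "single_valued (upstream\<inverse>)"
  unfolding single_valued_def upstream_def using bo wfG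
  by (auto simp: in_at_iff out_at_iff) (metis bij_betw_inv_into_left out_at_iff)

lemma upstream_cells: "(x, y) \<in> upstream \<Longrightarrow> x \<in> cells \<and> y \<in> cells"
proof -
  have "bi v e \<in> edges (P v)" if "v \<in> verts G" "e \<in> in_at G v" for v e
    using bij_betwE[OF bi[OF that(1)]] that(2) inputs_subset[of "P v"] by blast
  moreover have "bo v e \<in> edges (P v)" if "v \<in> verts G" "e \<in> out_at G v" for v e
    using bij_betwE[OF bo[OF that(1)]] that(2) outputs_subset[of "P v"] by blast
  ultimately show "(x, y) \<in> upstream \<Longrightarrow> x \<in> cells \<and> y \<in> cells"
    unfolding upstream_def cells_def by (auto simp: in_at_def out_at_def)
qed

lemma cls_cells: "x \<in> cells \<Longrightarrow> cls x \<subseteq> cells"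
proof
  fix y assume "x \<in> cells" "y \<in> cls x"
  then have "(x, y) \<in> (upstream \<union> upstream\<inverse>)\<^sup>*" by (simp add: cls_iff)
  then show "y \<in> cells" by (induction rule: rtrancl_induct) (use \<open>x \<in> cells\<close> upstream_cells in auto)
qed

lemma finite_cells: "finite cells"
  unfolding cells_def using wfG wfP by (auto intro!: finite_Plus finite_SigmaI wf_finite)

lemma subst_edges_eq: "subst_edges G P bi bo = cls ` cells"
  unfolding subst_edges_def cells_def ..

text \<open>
  If a class meets only vertices at which the exceptional edge is substituted, then the set of these
  vertices is closed under adjacency, as the class passes through such a vertex from its input edge
  to its output edge. So by connectedness the class is everything.
\<close>

lemma cls_closed:
  assumes x: "x \<in> cells" and V: "verts G \<noteq> {}"
    and edge: "\<And>v d. Inr (v, d) \<in> cls x \<Longrightarrow> is_Exc_Edge (P v)"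
  shows "\<forall>v \<in> verts G. is_Exc_Edge (P v)" and "cells \<subseteq> cls x"
proof -
  define W where "W = {v. \<exists>d. Inr (v, d) \<in> cls x}"
  have WV: "v \<in> verts G" if "v \<in> W" for v
    using that cls_cells[OF x] by (auto simp: W_def cells_def)
  have sub: "Inr (v, d) \<in> cls x" if vd: "v \<in> W" "d \<in> edges (P v)" for v d
  proof -
    obtain d' where d': "Inr (v, d') \<in> cls x" using vd by (auto simp: W_def)
    then have "d' \<in> edges (P v)" using cls_cells[OF x] by (auto simp: cells_def)
    then have "d' = d" using edge[OF d'] vd(2) by (cases "P v") auto
    then show ?thesis using d' by simp
  qed
  have ein: "Inl e \<in> cls x \<longleftrightarrow> v \<in> W" if "e \<in> in_at G v" "v \<in> verts G" for v e
  proof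
    assume "Inl e \<in> cls x"
    then have "Inr (v, bi v e) \<in> cls x" using cls_in[OF that(2,1)] by (metis cls_eq_iff)
    then show "v \<in> W" by (auto simp: W_def)
  next
    assume "v \<in> W"
    moreover have "bi v e \<in> edges (P v)"
      using bi[OF that(2)] that(1) inputs_subset by (fastforce simp: bij_betw_def)
    ultimately have "Inr (v, bi v e) \<in> cls x" by (rule sub)
    then show "Inl e \<in> cls x" using cls_in[OF that(2,1)] by (metis cls_eq_iff)
  qed
  have eout: "Inl e \<in> cls x \<longleftrightarrow> v \<in> W" if "e \<in> out_at G v" "v \<in> verts G" for v e
  proof
    assume "Inl e \<in> cls x"
    then have "Inr (v, bo v e) \<in> cls x" using cls_out[OF that(2,1)] by (metis cls_eq_iff)
    then show "v \<in> W" by (auto simp: W_def)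
  next
    assume "v \<in> W"
    moreover have "bo v e \<in> edges (P v)"
      using bo[OF that(2)] that(1) outputs_subset by (fastforce simp: bij_betw_def)
    ultimately have "Inr (v, bo v e) \<in> cls x" by (rule sub)
    then show "Inl e \<in> cls x" using cls_out[OF that(2,1)] by (metis cls_eq_iff)
  qed
  have ends: "\<exists>v \<in> verts G. e \<in> in_at G v \<or> e \<in> out_at G v" if "e \<in> edges G" for e
    using wf_ends[OF wfG V that] wfG
    by (auto simp: in_at_iff out_at_iff dest: src_Some_vert tgt_Some_vert)
  have "\<exists>v. v \<in> W"
  proof (cases x)
    case (Inl e)
    then have "e \<in> edges G" using x by (auto simp: cells_def)
    then show ?thesis using ends ein eout cls_refl[of x] Inl by blast
  next
    case (Inr p)
    then have "Inr (fst p, snd p) \<in> cls x" by simp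
    then show ?thesis unfolding W_def by blast
  qed
  then obtain v where v: "v \<in> W" by auto
  have VW: "verts G \<subseteq> W"
  proof (rule wf_graph_closed[OF wfG WV[OF v] v])
    fix e a b assume "src G e = Some a" "tgt G e = Some b"
    then show "a \<in> W \<longleftrightarrow> b \<in> W"
      using ein[of e b] eout[of e a] wfG by (auto simp: in_at_iff out_at_iff dest: src_Some_vert tgt_Some_vert)
  qed
  then show "\<forall>v \<in> verts G. is_Exc_Edge (P v)" using edge by (force simp: W_def)
  show "cells \<subseteq> cls x"
  proof
    fix y assume "y \<in> cells"
    then show "y \<in> cls x"
    proof (cases y)
      case (Inl e)
      then have "e \<in> edges G" using \<open>y \<in> cells\<close> by (auto simp: cells_def)
      then obtain v where "v \<in> verts G" "e \<in> in_at G v \<or> e \<in> out_at G v" using ends by blast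
      then show ?thesis using VW ein eout Inl by blast
    next
      case (Inr p)
      then show ?thesis using VW sub \<open>y \<in> cells\<close> by (auto simp: cells_def)
    qed
  qed
qed

text \<open>
  The exceptional loop has no legs, so a vertex at which it is substituted has no edges.
\<close>

lemma Exc_Loop_alone:
  assumes v: "v \<in> verts G" and "is_Exc_Loop (P v)"
  shows "verts G = {v}" "edges G = {}"
proof -
  have io: "in_at G v = {}" "out_at G v = {}"
    using bi[OF v] bo[OF v] assms(2) by (auto simp: bij_betw_def is_Exc_Loop_def)
  have "verts G \<subseteq> {v}"
    by (rule wf_graph_closed[OF wfG v]) (use io wfG in \<open>auto simp: in_at_iff[symmetric] out_at_iff[symmetric]\<close>)
  then show V: "verts G = {v}" using v by auto
  show "edges G = {}"
  proof (rule ccontr)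
    assume "edges G \<noteq> {}"
    then obtain e where "e \<in> edges G" by auto
    then have "src G e \<noteq> None \<or> tgt G e \<noteq> None" using wf_ends[OF wfG] V by auto
    then have "src G e = Some v \<or> tgt G e = Some v"
      using V src_Some_vert[OF wfG] tgt_Some_vert[OF wfG] by fastforce
    then show False using io wfG by (auto simp: in_at_iff[symmetric] out_at_iff[symmetric])
  qed
qed

lemma not_Exc_Loop: "subst_verts G P \<noteq> {} \<Longrightarrow> v \<in> verts G \<Longrightarrow> \<not> is_Exc_Loop (P v)"
  using Exc_Loop_alone(1)[of v] by (auto simp: subst_verts_def is_Exc_Loop_def)

lemma subst_verts_iff:
  "subst_verts G P = {} \<longleftrightarrow> (\<forall>v \<in> verts G. \<not> is_Ordinary (P v))"
proof -
  have "subst_verts G P = {} \<longleftrightarrow> (\<forall>v \<in> verts G. verts (P v) = {})"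
    unfolding subst_verts_def by auto
  then show ?thesis using wfP is_Ordinary_iff by auto
qed

text \<open>
  Following a class upstream ends at an input of \<open>G\<close> or at an edge with a source, unless the class is
  a cycle. A cycle passes only through copies of the exceptional edge, so by \<open>cls_closed\<close> it is all of
  \<open>G\<close> and the substituted graph is the exceptional loop.
\<close>

lemma source_exists:
  assumes x: "x \<in> cells" and S: "subst_verts G P \<noteq> {} \<or> inputs G \<union> outputs G \<noteq> {}"
  shows "(\<exists>e \<in> inputs G. Inl e \<in> cls x) \<or>
         (\<exists>v d w. Inr (v, d) \<in> cls x \<and> v \<in> verts G \<and> src (P v) d = Some w)"
proof (cases "verts G = {}")
  case True
  then obtain e where "inputs G = {e}" "edges G = {e}"
    using S by (cases G) (use wfG in \<open>auto simp: subst_verts_def\<close>)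
  then show ?thesis using x cls_refl[of x] True by (auto simp: cells_def simp del: cls_refl)
next
  case False
  show ?thesis
  proof (rule ccontr)
    assume no: "\<not> ?thesis"
    have "False" if l: "is_Exc_Loop (P v)" "v \<in> verts G" for v
      using Exc_Loop_alone[OF l(2,1)] S not_Exc_Loop[OF _ l(2)] l(1) inputs_subset[of G] outputs_subset[of G]
        by auto
    then have nl: "\<not> is_Exc_Loop (P v)" if "v \<in> verts G" for v using that by auto
    have "cls x \<subseteq> Domain upstream"
    proof
      fix y assume y: "y \<in> cls x"
      show "y \<in> Domain upstream"
      proof (cases y)
        case (Inl e)
        then have e: "e \<in> edges G" "e \<notin> inputs G" using y no cls_cells[OF x]
          by (auto simp: cells_def)
        then obtain v where "src G e = Some v" using inputs_iff[OF False] by auto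
        moreover have "v \<in> verts G" using calculation by (rule src_Some_vert[OF wfG])
        ultimately have "(y, Inr (v, bo v e)) \<in> upstream"
          using Inl by (auto simp: upstream_def out_at_iff[OF wfG])
        then show ?thesis by auto
      next
        case (Inr p)
        obtain v d where p: "p = (v, d)" by (cases p)
        have v: "v \<in> verts G" "d \<in> edges (P v)" using y Inr p cls_cells[OF x]
          by (auto simp: cells_def)
        then have "src (P v) d = None" using no y Inr p by (metis not_None_eq)
        then have "d \<in> inputs (P v)" using v nl[OF v(1)] by (cases "P v") auto
        then obtain e where "e \<in> in_at G v" "d = bi v e" using bi[OF v(1)] by (auto simp: bij_betw_def)
        then have "(y, Inl e) \<in> upstream" using v Inr p by (auto simp: upstream_def)
        then show ?thesis by auto
      qed
    qed
    (* every cell of the class has a successor, hence by finiteness every cell has a predecessor *)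
    moreover have "y \<in> cls x \<Longrightarrow> (y, z) \<in> upstream \<Longrightarrow> z \<in> cls x" for y z
      by (simp add: cls_iff) (meson UnI1 rtrancl.rtrancl_into_rtrancl)
    moreover have "finite (cls x)" using finite_cells cls_cells[OF x] finite_subset by blast
    ultimately have ran: "cls x \<subseteq> Range upstream" using downstream_deterministic by (intro chain_endless)
    have dom: "cls x \<subseteq> Domain upstream" by fact
    have E: "is_Exc_Edge (P v)" if "Inr (v, d) \<in> cls x" for v d
    proof -
      have "Inr (v, d) \<in> Domain upstream" "Inr (v, d) \<in> Range upstream" using that dom ran by auto
      then obtain e e' where v: "v \<in> verts G" "e \<in> in_at G v" "d = bi v e" "e' \<in> out_at G v" "d = bo v e'"
        by (auto simp: upstream_def)
      then have "d \<in> inputs (P v)" "d \<in> outputs (P v)"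
        using bij_betwE[OF bi[OF v(1)]] bij_betwE[OF bo[OF v(1)]] by auto
      with v have v: "v \<in> verts G" "d \<in> inputs (P v)" "d \<in> outputs (P v)" by auto
      then show ?thesis using inputs_outputs_Exc_Edge[OF wfP] by fastforce
    qed
    have all: "\<forall>v \<in> verts G. is_Exc_Edge (P v)" "cells \<subseteq> cls x"
      using cls_closed[OF x False E] by auto
    have "subst_verts G P = {}" using all(1) by (auto simp: subst_verts_def is_Exc_Edge_def)
    then obtain e where e: "e \<in> inputs G \<union> outputs G" using S by auto
    then have "e \<in> edges G" using inputs_subset[of G] outputs_subset[of G] by blast
    then have "Inl e \<in> cls x" using all(2) by (auto simp: cells_def)
    then have "Inl e \<in> Domain upstream" "Inl e \<in> Range upstream" using dom ran by auto
    then show False using e wfG inputs_iff[OF False] outputs_iff[OF False]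
      by (auto simp: upstream_def in_at_iff out_at_iff)
  qed
qed

lemma input_terminal: "e \<in> inputs G \<Longrightarrow> Inl e \<notin> Domain upstream"
proof -
  assume "e \<in> inputs G"
  then have "src G e = None" by (cases G) auto
  then show ?thesis by (auto simp: upstream_def out_at_iff[OF wfG])
qed

lemma source_terminal: "v \<in> verts G \<Longrightarrow> src (P v) d = Some w \<Longrightarrow> Inr (v, d) \<notin> Domain upstream"
proof
  assume v: "v \<in> verts G" "src (P v) d = Some w" and "Inr (v, d) \<in> Domain upstream"
  then have "d \<in> inputs (P v)" using bi by (auto simp: upstream_def bij_betw_def)
  then show False using v by (cases "P v") auto
qed

lemma terminal_unique: "y \<in> cls x \<Longrightarrow> z \<in> cls x \<Longrightarrow> y \<notin> Domain upstream \<Longrightarrow> z \<notin> Domain upstream \<Longrightarrow> y = z"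
  using chain_terminal_unique[OF upstream_deterministic] by (metis cls_eq_iff cls_iff)

text \<open>
  The upstream end of a chain is unique, so a class has at most one source, and a class that contains
  an input of \<open>G\<close> has none.
\<close>

lemma source_unique:
  assumes "Inr (v, d) \<in> cls x" "v \<in> verts G" "src (P v) d = Some w"
    "Inr (v', d') \<in> cls x" "v' \<in> verts G" "src (P v') d' = Some w'"
  shows "v = v' \<and> d = d'"
  using terminal_unique[OF assms(1,4)] source_terminal assms by blast

lemma input_unique:
  assumes "Inl e \<in> cls x" "e \<in> inputs G" "Inl e' \<in> cls x" "e' \<in> inputs G"
  shows "e = e'"
  using terminal_unique[OF assms(1,3)] input_terminal assms by blast

lemma input_no_source:
  assumes "Inl e \<in> cls x" "e \<in> inputs G" "Inr (v, d) \<in> cls x" "v \<in> verts G"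
  shows "src (P v) d = None"
proof (rule ccontr)
  assume "src (P v) d \<noteq> None"
  then show False using terminal_unique[OF assms(1,3)] source_terminal[OF assms(4)] input_terminal[OF assms(2)] by blast
qed

lemma rev_cls: "glue_class (rev_graph G) bo bi = cls"
proof -
  have "glue (rev_graph G) bo bi = glue G bi bo" unfolding glue_def by auto
  then show ?thesis unfolding glue_class_def by auto
qed

lemma rev_cells: "substitution.cells (rev_graph G) (\<lambda>v. rev_graph (P v)) = cells"
  unfolding cells_def substitution.cells_def[OF rev] by simp

lemma rev_subst_verts: "subst_verts (rev_graph G) (\<lambda>v. rev_graph (P v)) = subst_verts G P"
  by (simp add: subst_verts_def)

text \<open>
  The dual statements concern the same classes, because gluing does not distinguish between inputs
  and outputs.
\<close>

lemma target_exists: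
  assumes "x \<in> cells" "subst_verts G P \<noteq> {} \<or> inputs G \<union> outputs G \<noteq> {}"
  shows "(\<exists>e \<in> outputs G. Inl e \<in> cls x) \<or>
         (\<exists>v d w. Inr (v, d) \<in> cls x \<and> v \<in> verts G \<and> tgt (P v) d = Some w)"
  using substitution.source_exists[OF rev, of x] assms by (simp add: rev_cls rev_cells rev_subst_verts Un_commute)

lemma target_unique:
  assumes "Inr (v, d) \<in> cls x" "v \<in> verts G" "tgt (P v) d = Some w"
    "Inr (v', d') \<in> cls x" "v' \<in> verts G" "tgt (P v') d' = Some w'"
  shows "v = v' \<and> d = d'"
  using substitution.source_unique[OF rev, of v d x w v' d' w'] assms by (simp add: rev_cls)

lemma output_unique:
  assumes "Inl e \<in> cls x" "e \<in> outputs G" "Inl e' \<in> cls x" "e' \<in> outputs G"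
  shows "e = e'"
  using substitution.input_unique[OF rev, of e x e'] assms by (simp add: rev_cls)

lemma output_no_target:
  assumes "Inl e \<in> cls x" "e \<in> outputs G" "Inr (v, d) \<in> cls x" "v \<in> verts G"
  shows "tgt (P v) d = None"
  using substitution.input_no_source[OF rev, of e x v d] assms by (simp add: rev_cls)

text \<open>
  A class without ends in any \<open>P\<^sub>v\<close> passes through copies of the exceptional edge only, so by
  \<open>cls_closed\<close> nothing else is substituted.
\<close>

lemma end_exists:
  assumes x: "x \<in> cells" and S: "subst_verts G P \<noteq> {}"
  shows "\<exists>v d. Inr (v, d) \<in> cls x \<and> v \<in> verts G \<and> (src (P v) d \<noteq> None \<or> tgt (P v) d \<noteq> None)"
proof (rule ccontr)
  assume no: "\<not> ?thesis"
  have V: "verts G \<noteq> {}" using S by (auto simp: subst_verts_def)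
  have "is_Exc_Edge (P v)" if "Inr (v, d) \<in> cls x" for v d
  proof -
    have v: "v \<in> verts G" "d \<in> edges (P v)" using that cls_cells[OF x] by (auto simp: cells_def)
    then have "src (P v) d = None" "tgt (P v) d = None" using no that by auto
    then have "verts (P v) = {}" using wf_ends[OF wfP[OF v(1)] _ v(2)] by auto
    then show ?thesis using not_Exc_Loop[OF S v(1)] wfP[OF v(1)] by (cases "P v") auto
  qed
  then have "\<forall>v \<in> verts G. is_Exc_Edge (P v)" by (rule cls_closed[OF x V])
  then show False using S by (auto simp: subst_verts_def is_Exc_Edge_def)
qed

text \<open>
  A substituted graph without vertices has a single edge: either only exceptional edges are
  substituted, and \<open>cls_closed\<close> applies, or \<open>G\<close> is a vertex without edges.
\<close>

lemma one_class:
  assumes S: "subst_verts G P = {}" and x: "x \<in> cells" and y: "y \<in> cells"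
  shows "cls x = cls y"
proof (cases "verts G = {}")
  case True
  then obtain e where "edges G = {e}" by (cases G) (use wfG in auto)
  then have "x = y" using x y True by (auto simp: cells_def)
  then show ?thesis by simp
next
  case False
  show ?thesis
  proof (cases "\<exists>v \<in> verts G. is_Exc_Loop (P v)")
    case True
    then have "x = y" using Exc_Loop_alone x y by (fastforce simp: cells_def is_Exc_Loop_def)
    then show ?thesis by simp
  next
    case F: False
    have "is_Exc_Edge (P v)" if "Inr (v, d) \<in> cls x" for v d
    proof -
      have "v \<in> verts G" using that cls_cells[OF x] by (auto simp: cells_def)
      then show ?thesis using F S unfolding subst_verts_iff by (metis graph.exhaust_disc)
    qed
    then have "cells \<subseteq> cls x" by (rule cls_closed[OF x False])
    then show ?thesis using y by (auto simp: cls_eq_iff)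
  qed
qed

lemma cells_nonempty: "subst_verts G P = {} \<Longrightarrow> \<exists>x. x \<in> cells"
proof (cases "verts G = {}")
  case True
  then obtain e where "edges G = {e}" by (cases G) (use wfG in auto)
  then show ?thesis by (auto simp: cells_def)
next
  case False
  assume S: "subst_verts G P = {}"
  then obtain v where v: "v \<in> verts G" "\<not> is_Ordinary (P v)" using False subst_verts_iff by auto
  then obtain d where "d \<in> edges (P v)" by (cases "P v") auto
  then show ?thesis using v by (auto simp: cells_def)
qed

lemma subst_edges_single: "subst_verts G P = {} \<Longrightarrow> \<exists>x \<in> cells. subst_edges G P bi bo = {cls x}"
  using cells_nonempty one_class unfolding subst_edges_eq by blast

lemma src_end:
  assumes x: "x \<in> cells" and "Inr (v, d) \<in> cls x" "v \<in> verts G" "src (P v) d = Some w"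
  shows "subst_end src G P bi bo (cls x) = Some (v, w)"
proof -
  have "{(v, w). v \<in> verts G \<and> (\<exists>d. Inr (v, d) \<in> cls x \<and> src (P v) d = Some w)} = {(v, w)}"
  proof -
    have "v' = v \<and> w' = w" if "v' \<in> verts G" "Inr (v', d') \<in> cls x" "src (P v') d' = Some w'" for v' w' d'
      using source_unique[OF assms(2-4) that(2,1,3)] assms(4) that(3) by auto
    then show ?thesis using assms by blast
  qed
  then show ?thesis using x by (simp add: subst_end_def subst_edges_eq Let_def)
qed

lemma src_end_None:
  assumes "Inl e \<in> cls x" "e \<in> inputs G"
  shows "subst_end src G P bi bo (cls x) = None"
proof -
  have "{(v, w). v \<in> verts G \<and> (\<exists>d. Inr (v, d) \<in> cls x \<and> src (P v) d = Some w)} = {}"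
    using input_no_source[OF assms] by fastforce
  then show ?thesis by (simp add: subst_end_def Let_def)
qed

lemma tgt_end:
  assumes x: "x \<in> cells" and "Inr (v, d) \<in> cls x" "v \<in> verts G" "tgt (P v) d = Some w"
  shows "subst_end tgt G P bi bo (cls x) = Some (v, w)"
proof -
  have "{(v, w). v \<in> verts G \<and> (\<exists>d. Inr (v, d) \<in> cls x \<and> tgt (P v) d = Some w)} = {(v, w)}"
  proof -
    have "v' = v \<and> w' = w" if "v' \<in> verts G" "Inr (v', d') \<in> cls x" "tgt (P v') d' = Some w'" for v' w' d'
      using target_unique[OF assms(2-4) that(2,1,3)] assms(4) that(3) by auto
    then show ?thesis using assms by blast
  qed
  then show ?thesis using x by (simp add: subst_end_def subst_edges_eq Let_def)
qed

lemma tgt_end_None: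
  assumes "Inl e \<in> cls x" "e \<in> outputs G"
  shows "subst_end tgt G P bi bo (cls x) = None"
proof -
  have "{(v, w). v \<in> verts G \<and> (\<exists>d. Inr (v, d) \<in> cls x \<and> tgt (P v) d = Some w)} = {}"
    using output_no_target[OF assms] by fastforce
  then show ?thesis by (simp add: subst_end_def Let_def)
qed

end

context substitution
begin

text \<open>
  A graph \<open>K\<close> is recognized as \<open>G({P\<^sub>v})\<close> by a bijection \<open>c\<close> on vertices and a map \<open>\<kappa>\<close> from cells to edges
  of \<open>K\<close> that is bijective on the edges at each vertex and preserves the legs of \<open>G\<close>. Injectivity on
  classes holds because every edge of \<open>K\<close> has an end, and this end determines the vertex and hence
  the cell that reaches it.
\<close>

lemma recognition:
  fixes K :: "('x, 'y) graph"
  assumes S: "subst_verts G P \<noteq> {}" and K: "wf_graph K" "verts K \<noteq> {}"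
    and const: "\<And>x y. x \<in> cells \<Longrightarrow> y \<in> cls x \<Longrightarrow> \<kappa> y = \<kappa> x"
    and \<kappa>: "\<And>x. x \<in> cells \<Longrightarrow> \<kappa> x \<in> edges K"
    and c: "bij_betw c (subst_verts G P) (verts K)"
    and s: "\<And>v d w. v \<in> verts G \<Longrightarrow> src (P v) d = Some w \<Longrightarrow> src K (\<kappa> (Inr (v, d))) = Some (c (v, w))"
    and t: "\<And>v d w. v \<in> verts G \<Longrightarrow> tgt (P v) d = Some w \<Longrightarrow> tgt K (\<kappa> (Inr (v, d))) = Some (c (v, w))"
    and i: "\<And>e. e \<in> inputs G \<Longrightarrow> src K (\<kappa> (Inl e)) = None"
    and o: "\<And>e. e \<in> outputs G \<Longrightarrow> tgt K (\<kappa> (Inl e)) = None"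
    and sinj: "\<And>v d d' w. v \<in> verts G \<Longrightarrow> src (P v) d = Some w \<Longrightarrow> src (P v) d' = Some w \<Longrightarrow>
                 \<kappa> (Inr (v, d)) = \<kappa> (Inr (v, d')) \<Longrightarrow> d = d'"
    and tinj: "\<And>v d d' w. v \<in> verts G \<Longrightarrow> tgt (P v) d = Some w \<Longrightarrow> tgt (P v) d' = Some w \<Longrightarrow>
                 \<kappa> (Inr (v, d)) = \<kappa> (Inr (v, d')) \<Longrightarrow> d = d'"
    and ssurj: "\<And>v w k. v \<in> verts G \<Longrightarrow> w \<in> verts (P v) \<Longrightarrow> src K k = Some (c (v, w)) \<Longrightarrow>
                 \<exists>d. src (P v) d = Some w \<and> \<kappa> (Inr (v, d)) = k"
    and tsurj: "\<And>v w k. v \<in> verts G \<Longrightarrow> w \<in> verts (P v) \<Longrightarrow> tgt K k = Some (c (v, w)) \<Longrightarrow>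
                 \<exists>d. tgt (P v) d = Some w \<and> \<kappa> (Inr (v, d)) = k"
  shows "\<exists>\<phi>E. graph_iso c \<phi>E (graph_subst G P bi bo) K \<and> (\<forall>x \<in> cells. \<phi>E (cls x) = \<kappa> x)"
proof (intro exI conjI)
  define \<phi>E where "\<phi>E \<gamma> = \<kappa> (SOME x. x \<in> \<gamma>)" for \<gamma>
  have \<phi>: "\<phi>E (cls x) = \<kappa> x" if "x \<in> cells" for x
    unfolding \<phi>E_def by (rule const[OF that], rule someI[of _ x]) simp
  then show "\<forall>x \<in> cells. \<phi>E (cls x) = \<kappa> x" by simp
  have SV: "(v, w) \<in> subst_verts G P" if "v \<in> verts G" "src (P v) d = Some w \<or> tgt (P v) d = Some w" for v d w
    using that wfP[OF that(1)] by (auto simp: subst_verts_def dest: src_Some_vert tgt_Some_vert)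
  have src: "src K (\<kappa> x) = map_option c (subst_end src G P bi bo (cls x))" if x: "x \<in> cells" for x
    using source_exists[OF x disjI1[OF S]]
  proof
    assume "\<exists>e \<in> inputs G. Inl e \<in> cls x"
    then obtain e where e: "e \<in> inputs G" "Inl e \<in> cls x" by auto
    then show ?thesis using const[OF x e(2)] i[OF e(1)] src_end_None[OF e(2,1)] by simp
  next
    assume "\<exists>v d w. Inr (v, d) \<in> cls x \<and> v \<in> verts G \<and> src (P v) d = Some w"
    then obtain v d w where e: "Inr (v, d) \<in> cls x" "v \<in> verts G" "src (P v) d = Some w" by auto
    then show ?thesis using const[OF x e(1)] s[OF e(2,3)] src_end[OF x e] by simp
  qed
  have tgt: "tgt K (\<kappa> x) = map_option c (subst_end tgt G P bi bo (cls x))" if x: "x \<in> cells" for x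
    using target_exists[OF x disjI1[OF S]]
  proof
    assume "\<exists>e \<in> outputs G. Inl e \<in> cls x"
    then obtain e where e: "e \<in> outputs G" "Inl e \<in> cls x" by auto
    then show ?thesis using const[OF x e(2)] o[OF e(1)] tgt_end_None[OF e(2,1)] by simp
  next
    assume "\<exists>v d w. Inr (v, d) \<in> cls x \<and> v \<in> verts G \<and> tgt (P v) d = Some w"
    then obtain v d w where e: "Inr (v, d) \<in> cls x" "v \<in> verts G" "tgt (P v) d = Some w" by auto
    then show ?thesis using const[OF x e(1)] t[OF e(2,3)] tgt_end[OF x e] by simp
  qed
  have src_rep: "\<exists>v d w. Inr (v, d) \<in> cls x \<and> v \<in> verts G \<and> src (P v) d = Some w \<and> z = c (v, w)"
    if x: "x \<in> cells" and z: "src K (\<kappa> x) = Some z" for x z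
  proof -
    have "\<not> (\<exists>e \<in> inputs G. Inl e \<in> cls x)" 
    proof
      assume "\<exists>e \<in> inputs G. Inl e \<in> cls x"
      then obtain e where "e \<in> inputs G" "Inl e \<in> cls x" by auto
      then show False using i[of e] const[OF x, of "Inl e"] z by simp
    qed
    then obtain v d w where e: "Inr (v, d) \<in> cls x" "v \<in> verts G" "src (P v) d = Some w"
      using source_exists[OF x disjI1[OF S]] by auto
    then show ?thesis using s[OF e(2,3)] const[OF x e(1)] z by auto
  qed
  have tgt_rep: "\<exists>v d w. Inr (v, d) \<in> cls x \<and> v \<in> verts G \<and> tgt (P v) d = Some w \<and> z = c (v, w)"
    if x: "x \<in> cells" and z: "tgt K (\<kappa> x) = Some z" for x z
  proof -
    have "\<not> (\<exists>e \<in> outputs G. Inl e \<in> cls x)" 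
    proof
      assume "\<exists>e \<in> outputs G. Inl e \<in> cls x"
      then obtain e where "e \<in> outputs G" "Inl e \<in> cls x" by auto
      then show False using o[of e] const[OF x, of "Inl e"] z by simp
    qed
    then obtain v d w where e: "Inr (v, d) \<in> cls x" "v \<in> verts G" "tgt (P v) d = Some w"
      using target_exists[OF x disjI1[OF S]] by auto
    then show ?thesis using t[OF e(2,3)] const[OF x e(1)] z by auto
  qed
  have c_inj: "v = v' \<and> w = w'" if "(v, w) \<in> subst_verts G P" "(v', w') \<in> subst_verts G P" "c (v, w) = c (v', w')" for v w v' w'
    using that c by (auto simp: bij_betw_def dest: inj_onD)
  have inj: "cls x = cls y" if x: "x \<in> cells" and y: "y \<in> cells" and xy: "\<kappa> x = \<kappa> y" for x y
  proof -
    consider z where "src K (\<kappa> x) = Some z" | z where "tgt K (\<kappa> x) = Some z"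
      using wf_ends[OF K \<kappa>[OF x]] by auto
    then show ?thesis
    proof cases
      case 1
      obtain v d w where a: "Inr (v, d) \<in> cls x" "v \<in> verts G" "src (P v) d = Some w" "z = c (v, w)"
        using src_rep[OF x 1] by auto
      obtain v' d' w' where b: "Inr (v', d') \<in> cls y" "v' \<in> verts G" "src (P v') d' = Some w'" "z = c (v', w')"
        using src_rep[OF y 1[unfolded xy]] by auto
      have vw: "v = v'" "w = w'" using c_inj[of v w v' w'] SV[of v d w] SV[of v' d' w'] a b by auto
      have "d = d'" by (rule sinj[OF a(2,3)]) (use a b vw const[OF x a(1)] const[OF y b(1)] xy in auto)
      then show ?thesis using a(1) b(1) vw by (metis cls_eq_iff)
    next
      case 2
      obtain v d w where a: "Inr (v, d) \<in> cls x" "v \<in> verts G" "tgt (P v) d = Some w" "z = c (v, w)"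
        using tgt_rep[OF x 2] by auto
      obtain v' d' w' where b: "Inr (v', d') \<in> cls y" "v' \<in> verts G" "tgt (P v') d' = Some w'" "z = c (v', w')"
        using tgt_rep[OF y 2[unfolded xy]] by auto
      have vw: "v = v'" "w = w'" using c_inj[of v w v' w'] SV[of v d w] SV[of v' d' w'] a b by auto
      have "d = d'" by (rule tinj[OF a(2,3)]) (use a b vw const[OF x a(1)] const[OF y b(1)] xy in auto)
      then show ?thesis using a(1) b(1) vw by (metis cls_eq_iff)
    qed
  qed
  have surj: "\<exists>x \<in> cells. \<kappa> x = k" if k: "k \<in> edges K" for k
  proof -
    have cv: "\<exists>v w. v \<in> verts G \<and> w \<in> verts (P v) \<and> z = c (v, w)" if "z \<in> verts K" for z
    proof -
      have "z \<in> c ` subst_verts G P" using that c by (simp add: bij_betw_def)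
      then obtain p where "p \<in> subst_verts G P" "z = c p" by (rule imageE)
      then show ?thesis by (cases p) (auto simp: subst_verts_def)
    qed
    have cell: "Inr (v, d) \<in> cells" if "v \<in> verts G" "src (P v) d = Some w \<or> tgt (P v) d = Some w" for v d w
      using that wfP[OF that(1)] by (auto simp: cells_def dest: src_Some_edge tgt_Some_edge)
    consider z where "src K k = Some z" | z where "tgt K k = Some z" using wf_ends[OF K k] by auto
    then show ?thesis
    proof cases
      case 1
      then obtain v w where z: "v \<in> verts G" "w \<in> verts (P v)" "z = c (v, w)"
        using cv src_Some_vert[OF K(1)] by metis
      show ?thesis using ssurj[OF z(1,2) 1[unfolded z(3)]] cell[OF z(1)] by blast
    next
      case 2
      then obtain v w where z: "v \<in> verts G" "w \<in> verts (P v)" "z = c (v, w)"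
        using cv tgt_Some_vert[OF K(1)] by metis
      show ?thesis using tsurj[OF z(1,2) 2[unfolded z(3)]] cell[OF z(1)] by blast
    qed
  qed
  have bij: "bij_betw \<phi>E (cls ` cells) (edges K)"
  proof (rule bij_betwI')
    fix \<gamma> \<gamma>' assume g: "\<gamma> \<in> cls ` cells" "\<gamma>' \<in> cls ` cells"
    show "\<phi>E \<gamma> = \<phi>E \<gamma>' \<longleftrightarrow> \<gamma> = \<gamma>'"
    proof
      assume "\<phi>E \<gamma> = \<phi>E \<gamma>'"
      with g obtain x y where xy: "x \<in> cells" "y \<in> cells" "\<gamma> = cls x" "\<gamma>' = cls y" "\<phi>E (cls x) = \<phi>E (cls y)" by blast
      show "\<gamma> = \<gamma>'" unfolding xy(3,4) by (rule inj[OF xy(1,2)]) (use xy \<phi> in simp)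
    qed simp
  next
    fix \<gamma> assume "\<gamma> \<in> cls ` cells"
    then obtain x where "x \<in> cells" "\<gamma> = cls x" by blast
    then show "\<phi>E \<gamma> \<in> edges K" using \<kappa>[of x] \<phi>[of x] by simp
  next
    fix k assume "k \<in> edges K"
    then obtain x where "x \<in> cells" "\<kappa> x = k" using surj by auto
    then show "\<exists>\<gamma> \<in> cls ` cells. k = \<phi>E \<gamma>" using \<phi>[of x] by force
  qed
  have "is_Ordinary K" using is_Ordinary_iff K by auto
  then show "graph_iso c \<phi>E (graph_subst G P bi bo) K"
    using S c bij src tgt by (auto simp: graph_iso_def graph_subst_def subst_edges_eq is_Ordinary_def \<phi>)
qed

end

section \<open>Subgraphs\<close>

fun sverts :: "('v, 'e) subgraph \<Rightarrow> 'v set" where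
  "sverts (Sub_Ord S I) = S"
| "sverts _ = {}"

fun ins :: "('v, 'e) graph \<Rightarrow> ('v, 'e) subgraph \<Rightarrow> 'e set" where
  "ins K (Sub_Edge e) = {e}"
| "ins K (Sub_Loop e) = {}"
| "ins K (Sub_Ord S I) = {e \<in> edges K - I. tgt K e \<in> Some ` S}"

fun outs :: "('v, 'e) graph \<Rightarrow> ('v, 'e) subgraph \<Rightarrow> 'e set" where
  "outs K (Sub_Edge e) = {e}"
| "outs K (Sub_Loop e) = {}"
| "outs K (Sub_Ord S I) = {e \<in> edges K - I. src K e \<in> Some ` S}"

text \<open>
  The subgraph with vertices \<open>S\<close> and inputs \<open>N\<close>; see \<open>spanned_self\<close>. The remaining two cases are those
  of a subgraph without vertices: an edge is its own input, and the exceptional loop has no inputs.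
\<close>

definition spanned :: "('v, 'e) graph \<Rightarrow> 'v set \<Rightarrow> 'e set \<Rightarrow> ('v, 'e) subgraph" where
  "spanned K S N =
     (if S \<noteq> {} then Sub_Ord S {e \<in> edges K. src K e \<in> Some ` S \<and> tgt K e \<in> Some ` S \<and> e \<notin> N}
      else if N \<noteq> {} then Sub_Edge (the_elem N) else Sub_Loop (the_elem (edges K)))"

lemma sverts_spanned [simp]: "sverts (spanned K S N) = S"
  by (simp add: spanned_def)

lemma subgraphs_Ord_iff:
  "Sub_Ord S I \<in> subgraphs K \<longleftrightarrow> S \<noteq> {} \<and> S \<subseteq> verts K \<and> I \<subseteq> inner_edges K \<and>
        (\<forall>e \<in> I. the (src K e) \<in> S \<and> the (tgt K e) \<in> S) \<and> connected_by K S I"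
  "Sub_Edge e \<in> subgraphs K \<longleftrightarrow> e \<in> edges K"
  "Sub_Loop e \<in> subgraphs K \<longleftrightarrow> K = Exc_Loop e"
  by (auto simp: subgraphs_def)

lemma subgraph_inner:
  assumes "wf_graph K" "Sub_Ord S I \<in> subgraphs K" "e \<in> I"
  shows "\<exists>u \<in> S. \<exists>w \<in> S. src K e = Some u \<and> tgt K e = Some w" and "e \<in> edges K"
proof -
  have s: "S \<noteq> {}" "S \<subseteq> verts K" "e \<in> inner_edges K" "the (src K e) \<in> S" "the (tgt K e) \<in> S"
    using assms by (auto simp: subgraphs_Ord_iff)
  then have "verts K \<noteq> {}" by auto
  then show "\<exists>u \<in> S. \<exists>w \<in> S. src K e = Some u \<and> tgt K e = Some w" and "e \<in> edges K"
    using s inner_edges_iff[of K e] by auto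
qed

lemma sverts_subset: "s \<in> subgraphs K \<Longrightarrow> sverts s \<subseteq> verts K"
  by (cases s) (auto simp: subgraphs_Ord_iff)

text \<open>
  An edge with both ends in the vertex set of a subgraph is an inner edge or an input of it.
\<close>

lemma spanned_self:
  assumes "wf_graph K" "s \<in> subgraphs K"
  shows "spanned K (sverts s) (ins K s) = s"
proof (cases s)
  case (Sub_Ord S I)
  have "{e \<in> edges K. src K e \<in> Some ` S \<and> tgt K e \<in> Some ` S \<and> e \<notin> ins K s} = I"
    using subgraph_inner[OF assms(1), of S I] assms(2) Sub_Ord by fastforce
  then show ?thesis using assms Sub_Ord by (simp add: spanned_def subgraphs_Ord_iff)
qed (use assms in \<open>auto simp: spanned_def subgraphs_Ord_iff\<close>)

lemma subgraph_eqI: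
  assumes "wf_graph K" "s \<in> subgraphs K" "s' \<in> subgraphs K" "sverts s = sverts s'" "ins K s = ins K s'"
  shows "s = s'"
  using spanned_self assms by metis

lemma verts_graph_of [simp]: "verts (graph_of K s) = sverts s"
  by (cases s) auto

lemma src_graph_of:
  assumes "src (graph_of K s) d = Some w" "wf_graph K" "s \<in> subgraphs K"
  shows "src K (under d) = Some w" "w \<in> sverts s"
  using assms subgraph_inner[OF assms(2)] by (cases s; cases d; fastforce split: if_splits)+

lemma tgt_graph_of:
  assumes "tgt (graph_of K s) d = Some w" "wf_graph K" "s \<in> subgraphs K"
  shows "tgt K (under d) = Some w" "w \<in> sverts s"
  using assms subgraph_inner[OF assms(2)] by (cases s; cases d; fastforce split: if_splits)+

text \<open>
  An edge of \<open>K\<close> can give two edges of a subgraph, but only one of them has a source.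
\<close>

lemma src_graph_of_inj:
  assumes "src (graph_of K s) d = Some w" "src (graph_of K s) d' = Some w'" "under d = under d'"
  shows "d = d'"
  using assms by (cases s; cases d; cases d') (auto split: if_splits)

lemma tgt_graph_of_inj:
  assumes "tgt (graph_of K s) d = Some w" "tgt (graph_of K s) d' = Some w'" "under d = under d'"
  shows "d = d'"
  using assms by (cases s; cases d; cases d') (auto split: if_splits)

lemma src_graph_of_surj:
  assumes "wf_graph K" "w \<in> sverts s" "src K k = Some w"
  shows "\<exists>d. src (graph_of K s) d = Some w \<and> under d = k"
proof (cases s)
  case (Sub_Ord S I)
  then show ?thesis using assms src_Some_edge[OF assms(1,3)]
    by (intro exI[of _ "if k \<in> I then Whole k else Out_Leg k"]) auto
qed (use assms in auto)

lemma tgt_graph_of_surj: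
  assumes "wf_graph K" "w \<in> sverts s" "tgt K k = Some w"
  shows "\<exists>d. tgt (graph_of K s) d = Some w \<and> under d = k"
proof (cases s)
  case (Sub_Ord S I)
  then show ?thesis using assms tgt_Some_edge[OF assms(1,3)]
    by (intro exI[of _ "if k \<in> I then Whole k else In_Leg k"]) auto
qed (use assms in auto)

lemma inputs_graph_of:
  assumes "wf_graph K" "s \<in> subgraphs K"
  shows "inputs (graph_of K s) =
    (case s of Sub_Edge e \<Rightarrow> {Whole e} | Sub_Loop e \<Rightarrow> {} | Sub_Ord S I \<Rightarrow> In_Leg ` ins K s)"
  using assms subgraph_inner[OF assms(1)] by (cases s) (fastforce split: if_splits)+

lemma outputs_graph_of:
  assumes "wf_graph K" "s \<in> subgraphs K"
  shows "outputs (graph_of K s) =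
    (case s of Sub_Edge e \<Rightarrow> {Whole e} | Sub_Loop e \<Rightarrow> {} | Sub_Ord S I \<Rightarrow> Out_Leg ` outs K s)"
  using assms subgraph_inner[OF assms(1)] by (cases s) (fastforce split: if_splits)+

lemma inner_edges_graph_of:
  assumes "wf_graph K" "s \<in> subgraphs K"
  shows "inner_edges (graph_of K s) =
    (case s of Sub_Edge e \<Rightarrow> {} | Sub_Loop e \<Rightarrow> {Whole e} | Sub_Ord S I \<Rightarrow> Whole ` I)"
  using assms subgraph_inner[OF assms(1)] by (cases s) (fastforce split: if_splits)+

lemma bij_inputs_graph_of:
  assumes "wf_graph K" "s \<in> subgraphs K"
  shows "bij_betw under (inputs (graph_of K s)) (ins K s)"
  unfolding inputs_graph_of[OF assms]
  by (cases s) (auto simp: bij_betw_def inj_on_def image_image)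

lemma bij_outputs_graph_of:
  assumes "wf_graph K" "s \<in> subgraphs K"
  shows "bij_betw under (outputs (graph_of K s)) (outs K s)"
  unfolding outputs_graph_of[OF assms]
  by (cases s) (auto simp: bij_betw_def inj_on_def image_image)

lemma edges_graph_of:
  assumes "wf_graph K" "s \<in> subgraphs K" "d \<in> edges (graph_of K s)"
  shows "under d \<in> edges K"
  using assms inner_edges_subset[of K] by (cases s) (auto simp: subgraphs_Ord_iff)

lemma ins_subset: "wf_graph K \<Longrightarrow> s \<in> subgraphs K \<Longrightarrow> ins K s \<subseteq> edges K"
  and outs_subset: "wf_graph K \<Longrightarrow> s \<in> subgraphs K \<Longrightarrow> outs K s \<subseteq> edges K"
  by (cases s; auto simp: subgraphs_Ord_iff)+

lemma wf_graph_of: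
  assumes "wf_graph K" "s \<in> subgraphs K"
  shows "wf_graph (graph_of K s)"
proof (cases s)
  case (Sub_Ord S I)
  note sub = subgraph_inner[OF assms[unfolded Sub_Ord]]
  have "S \<subseteq> verts K" "I \<subseteq> edges K" "S \<noteq> {}"
    using assms Sub_Ord inner_edges_subset[of K] by (auto simp: subgraphs_Ord_iff)
  then have fin: "finite S" "finite I" "S \<noteq> {}"
    using finite_verts[OF assms(1)] finite_edges[OF assms(1)] finite_subset by blast+
  let ?G = "graph_of K s"
  have J: "joined K I \<subseteq> joined ?G (inner_edges ?G)"
    unfolding inner_edges_graph_of[OF assms] using Sub_Ord sub by (fastforce simp: joined_def)
  have conn: "connected_by K S I" using assms(2) Sub_Ord by (simp add: subgraphs_Ord_iff)
  have "(joined K I \<union> (joined K I)\<inverse>)\<^sup>* \<subseteq> (joined ?G (inner_edges ?G) \<union> (joined ?G (inner_edges ?G))\<inverse>)\<^sup>*"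
    by (rule rtrancl_mono) (use J in auto)
  then have c: "connected_by ?G S (inner_edges ?G)" using conn unfolding connected_by_def by blast
  define E where "E = edges ?G"
  have G: "?G = Ordinary S E (sub_src K S I) (sub_tgt K S I)" using Sub_Ord by (simp add: E_def)
  have "finite E" using fin finite_edges[OF assms(1)] Sub_Ord by (simp add: E_def)
  moreover have "dom (sub_src K S I) \<union> dom (sub_tgt K S I) = E"
  proof (rule set_eqI)
    fix d show "d \<in> dom (sub_src K S I) \<union> dom (sub_tgt K S I) \<longleftrightarrow> d \<in> E"
      using sub Sub_Ord by (cases d) (fastforce simp: E_def split: if_splits)+
  qed
  moreover have "ran (sub_src K S I) \<subseteq> S" "ran (sub_tgt K S I) \<subseteq> S"
    using src_graph_of(2)[OF _ assms] tgt_graph_of(2)[OF _ assms] Sub_Ord by (auto simp: ran_def)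
  ultimately show ?thesis using fin c unfolding G by simp
qed auto

lemma sverts_empty_iff:
  "s \<in> subgraphs K \<Longrightarrow> sverts s = {} \<longleftrightarrow> (\<exists>e. s = Sub_Edge e) \<or> (\<exists>e. s = Sub_Loop e)"
  by (cases s) (auto simp: subgraphs_Ord_iff)

lemma is_Exc_Edge_graph_of: "is_Exc_Edge (graph_of K s) \<longleftrightarrow> (\<exists>e. s = Sub_Edge e)"
  and is_Exc_Loop_graph_of: "is_Exc_Loop (graph_of K s) \<longleftrightarrow> (\<exists>e. s = Sub_Loop e)"
  by (cases s; simp)+

section \<open>The image of a map\<close>

definition canonical :: "('d \<Rightarrow> 'e) \<Rightarrow> 'd + 'w \<times> 'e sub_edge \<Rightarrow> 'e" where
  "canonical f0 x = (case x of Inl e \<Rightarrow> f0 e | Inr p \<Rightarrow> under (snd p))"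

lemma canonical_simps [simp]:
  "canonical f0 (Inl e) = f0 e" "canonical f0 (Inr (v, d)) = under d"
  by (simp_all add: canonical_def)

text \<open>
  The local part of the definition of a graphical map, without any condition on the image. The
  functions \<open>in_leg\<close> and \<open>out_leg\<close> are the bijections along which \<open>image_graph\<close> substitutes.
\<close>

locale premap =
  fixes G :: "('w, 'd) graph" and K :: "('v, 'e) graph"
    and f0 :: "'d \<Rightarrow> 'e" and f1 :: "'w \<Rightarrow> ('v, 'e) subgraph"
  assumes wf_dom: "wf_graph G" and wf_cod: "wf_graph K"
    and f0: "e \<in> edges G \<Longrightarrow> f0 e \<in> edges K"
    and f1: "v \<in> verts G \<Longrightarrow> f1 v \<in> subgraphs K"
    and f_in: "v \<in> verts G \<Longrightarrow> bij_betw f0 (in_at G v) (ins K (f1 v))"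
    and f_out: "v \<in> verts G \<Longrightarrow> bij_betw f0 (out_at G v) (outs K (f1 v))"
begin

definition in_leg :: "'w \<Rightarrow> 'd \<Rightarrow> 'e sub_edge" where
  "in_leg v e = inv_into (inputs (graph_of K (f1 v))) under (f0 e)"

definition out_leg :: "'w \<Rightarrow> 'd \<Rightarrow> 'e sub_edge" where
  "out_leg v e = inv_into (outputs (graph_of K (f1 v))) under (f0 e)"

abbreviation P :: "'w \<Rightarrow> ('v, 'e sub_edge) graph" where
  "P v \<equiv> graph_of K (f1 v)"

lemma image_graph_eq: "image_graph G K f0 f1 = graph_subst G P in_leg out_leg"
  unfolding image_graph_def in_leg_def[abs_def] out_leg_def[abs_def] ..

lemma bij_in_leg: "v \<in> verts G \<Longrightarrow> bij_betw (in_leg v) (in_at G v) (inputs (P v))"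
  using bij_betw_trans[OF f_in bij_betw_inv_into[OF bij_inputs_graph_of[OF wf_cod f1]]]
  by (simp add: in_leg_def[abs_def] comp_def)

lemma bij_out_leg: "v \<in> verts G \<Longrightarrow> bij_betw (out_leg v) (out_at G v) (outputs (P v))"
  using bij_betw_trans[OF f_out bij_betw_inv_into[OF bij_outputs_graph_of[OF wf_cod f1]]]
  by (simp add: out_leg_def[abs_def] comp_def)

lemma under_in_leg: "v \<in> verts G \<Longrightarrow> e \<in> in_at G v \<Longrightarrow> under (in_leg v e) = f0 e"
  unfolding in_leg_def using bij_betwE[OF f_in] bij_inputs_graph_of[OF wf_cod f1]
  by (metis bij_betw_inv_into_right)

lemma under_out_leg: "v \<in> verts G \<Longrightarrow> e \<in> out_at G v \<Longrightarrow> under (out_leg v e) = f0 e"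
  unfolding out_leg_def using bij_betwE[OF f_out] bij_outputs_graph_of[OF wf_cod f1]
  by (metis bij_betw_inv_into_right)

sublocale substitution G P in_leg out_leg
  by unfold_locales
    (auto simp: subst_data_def wf_dom wf_graph_of[OF wf_cod f1] bij_in_leg bij_out_leg)

lemma canonical_cls: "y \<in> cls x \<Longrightarrow> canonical f0 y = canonical f0 x"
  unfolding cls_iff
  by (induction rule: rtrancl_induct) (auto simp: upstream_def under_in_leg under_out_leg)

lemma canonical_edge: "x \<in> cells \<Longrightarrow> canonical f0 x \<in> edges K"
  unfolding cells_def using f0 edges_graph_of[OF wf_cod f1] by auto

lemma subst_verts_empty_iff: "subst_verts G P = {} \<longleftrightarrow> (\<forall>v \<in> verts G. sverts (f1 v) = {})"
  by (auto simp: subst_verts_def)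

text \<open>
  If the substituted graph is the exceptional edge, then its only class has one upstream end, which
  is an input of \<open>G\<close>, and one downstream end, which is an output.
\<close>

lemma leg_exists:
  assumes "subst_verts G P = {}" "inputs G \<union> outputs G \<noteq> {}"
  shows "\<exists>e. inputs G = {e}" "\<exists>e. outputs G = {e}"
proof -
  have no: "src (P v) d = None" "tgt (P v) d = None" if "v \<in> verts G" for v d
    using that assms(1) src_graph_of(2)[OF _ wf_cod f1[OF that]] tgt_graph_of(2)[OF _ wf_cod f1[OF that]]
    unfolding subst_verts_empty_iff by (metis empty_iff not_Some_eq)+
  obtain x where x: "x \<in> cells" using cells_nonempty[OF assms(1)] by auto
  obtain e where e: "e \<in> inputs G" "Inl e \<in> cls x"
    using source_exists[OF x disjI2[OF assms(2)]] no by auto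
  obtain e' where e': "e' \<in> outputs G" "Inl e' \<in> cls x"
    using target_exists[OF x disjI2[OF assms(2)]] no by auto
  have "Inl a \<in> cls x" if "a \<in> edges G" for a
    using one_class[OF assms(1) x, of "Inl a"] that by (auto simp: cells_def cls_eq_iff)
  then show "\<exists>e. inputs G = {e}" "\<exists>e. outputs G = {e}"
    using e e' input_unique output_unique inputs_subset[of G] outputs_subset[of G] by blast+
qed

lemma canonical_single:
  assumes "subst_verts G P = {}" "x \<in> cells" "y \<in> cells"
  shows "canonical f0 x = canonical f0 y"
  using one_class[OF assms] canonical_cls by (metis cls_eq_iff)

text \<open>
  What an isomorphism over \<open>K\<close> between \<open>G({f\<^sub>1 v})\<close> and a subgraph \<open>s\<close> implies. As it sends the vertex
  \<open>(v, w)\<close> to \<open>w\<close>, the vertex sets are disjoint; and it identifies the legs of \<open>s\<close> with those of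
  \<open>G({f\<^sub>1 v})\<close>, which are the legs of \<open>G\<close>.
\<close>

lemma image_facts:
  assumes im: "is_image G K f0 f1 s"
  shows image_disjoint: "\<And>v v'. v \<in> verts G \<Longrightarrow> v' \<in> verts G \<Longrightarrow> v \<noteq> v' \<Longrightarrow> sverts (f1 v) \<inter> sverts (f1 v') = {}"
    and image_loop: "(\<forall>v \<in> verts G. sverts (f1 v) = {}) \<Longrightarrow> inputs G \<union> outputs G = {} \<Longrightarrow> is_Exc_Loop K"
    and sverts_image: "sverts s = (\<Union>v \<in> verts G. sverts (f1 v))"
    and bij_inputs_image: "bij_betw f0 (inputs G) (ins K s)"
    and bij_outputs_image: "bij_betw f0 (outputs G) (outs K s)"
proof -
  obtain \<phi>V \<phi>E where iso: "graph_iso \<phi>V \<phi>E (image_graph G K f0 f1) (graph_of K s)"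
    and V: "\<forall>(v, w) \<in> verts (image_graph G K f0 f1). \<phi>V (v, w) = w"
    and E: "\<forall>c \<in> edges (image_graph G K f0 f1). (\<forall>e. Inl e \<in> c \<longrightarrow> under (\<phi>E c) = f0 e) \<and>
           (\<forall>v d. Inr (v, d) \<in> c \<longrightarrow> under (\<phi>E c) = under d)"
    and s: "s \<in> subgraphs K"
    using im unfolding is_image_def by blast
  let ?S = "\<Union>v \<in> verts G. sverts (f1 v)"
  have all: "(\<forall>v v'. v \<in> verts G \<longrightarrow> v' \<in> verts G \<longrightarrow> v \<noteq> v' \<longrightarrow> sverts (f1 v) \<inter> sverts (f1 v') = {}) \<and>
      ((\<forall>v \<in> verts G. sverts (f1 v) = {}) \<longrightarrow> inputs G \<union> outputs G = {} \<longrightarrow> is_Exc_Loop K) \<and>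
      sverts s = ?S \<and> bij_betw f0 (inputs G) (ins K s) \<and> bij_betw f0 (outputs G) (outs K s)"
  proof (cases "subst_verts G P = {}")
    case False
    have IG: "image_graph G K f0 f1 = Ordinary (subst_verts G P) (cls ` cells)
        (subst_end src G P in_leg out_leg) (subst_end tgt G P in_leg out_leg)" (is "_ = Ordinary _ _ ?es ?et")
      using False by (simp add: image_graph_eq graph_subst_def subst_edges_eq)
    have under: "under (\<phi>E (cls x)) = canonical f0 x" if "x \<in> cells" for x
    proof (cases x)
      case (Inr p)
      have "Inr (fst p, snd p) \<in> cls x" using Inr by simp
      then show ?thesis using E that unfolding IG Inr canonical_def by (simp; blast)
    qed (use E that in \<open>auto simp: IG\<close>)
    have bV: "bij_betw \<phi>V (subst_verts G P) (sverts s)" and bE: "bij_betw \<phi>E (cls ` cells) (edges (graph_of K s))"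
      and src: "\<And>x. x \<in> cells \<Longrightarrow> src (graph_of K s) (\<phi>E (cls x)) = map_option \<phi>V (?es (cls x))"
      and tgt: "\<And>x. x \<in> cells \<Longrightarrow> tgt (graph_of K s) (\<phi>E (cls x)) = map_option \<phi>V (?et (cls x))"
      using iso unfolding graph_iso_def IG by auto
    have V: "\<phi>V (v, w) = w" if "v \<in> verts G" "w \<in> sverts (f1 v)" for v w
      using V that unfolding IG by (auto simp: subst_verts_def)
    have disj: "v = v'" if "v \<in> verts G" "v' \<in> verts G" "w \<in> sverts (f1 v)" "w \<in> sverts (f1 v')" for v v' w
    proof -
      have "(v, w) = (v', w)"
        by (rule inj_onD[OF bij_betw_imp_inj_on[OF bV]]) (use that V in \<open>auto simp: subst_verts_def\<close>)
      then show ?thesis by simp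
    qed
    have Vs: "sverts s = ?S"
    proof -
      have "sverts s = \<phi>V ` subst_verts G P" using bV by (auto simp: bij_betw_def)
      also have "\<dots> = snd ` subst_verts G P"
        by (rule image_cong[OF refl]) (use V in \<open>auto simp: subst_verts_def\<close>)
      also have "\<dots> = ?S" by (force simp: subst_verts_def image_iff)
      finally show ?thesis .
    qed
    then have ne: "sverts s \<noteq> {}" using False by (auto simp: subst_verts_def)
    have cell: "Inl e \<in> cells" if "e \<in> edges G" for e using that by (auto simp: cells_def)
    have inE: "\<phi>E (cls x) \<in> edges (graph_of K s)" if "x \<in> cells" for x
      using bE that by (auto simp: bij_betw_def)
    have iE: "cls x = cls y" if "\<phi>E (cls x) = \<phi>E (cls y)" "x \<in> cells" "y \<in> cells" for x y
      using that bE by (auto simp: bij_betw_def dest: inj_onD)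
    have surjE: "\<exists>x \<in> cells. d = \<phi>E (cls x)" if "d \<in> edges (graph_of K s)" for d
      using that bE by (auto simp: bij_betw_def)
    have bij: "bij_betw (\<lambda>e. \<phi>E (cls (Inl e))) (inputs G) (inputs (graph_of K s))"
      unfolding bij_betw_def
    proof (intro conjI inj_onI set_eqI iffI)
      fix e e' assume a: "e \<in> inputs G" "e' \<in> inputs G" "\<phi>E (cls (Inl e)) = \<phi>E (cls (Inl e'))"
      then have "cls (Inl e) = cls (Inl e')" using cell inputs_subset[of G] by (intro iE) auto
      then show "e = e'" using input_unique a by (metis cls_refl)
    next
      fix d assume "d \<in> (\<lambda>e. \<phi>E (cls (Inl e))) ` inputs G"
      then obtain e where e: "e \<in> inputs G" "d = \<phi>E (cls (Inl e))" by auto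
      then have c: "Inl e \<in> cells" using cell inputs_subset[of G] by auto
      show "d \<in> inputs (graph_of K s)"
        using src[OF c] src_end_None[OF cls_refl e(1)] inE[OF c] e ne by (simp add: inputs_iff)
    next
      fix d assume "d \<in> inputs (graph_of K s)"
      then have d: "d \<in> edges (graph_of K s)" "src (graph_of K s) d = None"
        using ne by (auto simp: inputs_iff)
      obtain x where x: "x \<in> cells" "d = \<phi>E (cls x)" using surjE[OF d(1)] by auto
      have "\<not> (\<exists>v d w. Inr (v, d) \<in> cls x \<and> v \<in> verts G \<and> src (P v) d = Some w)"
      proof
        assume "\<exists>v d w. Inr (v, d) \<in> cls x \<and> v \<in> verts G \<and> src (P v) d = Some w"
        then obtain v d' w where "Inr (v, d') \<in> cls x" "v \<in> verts G" "src (P v) d' = Some w" by blast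
        then show False using src[OF x(1)] d(2) x(2) src_end[OF x(1), of v d' w] by simp
      qed
      then obtain e where "e \<in> inputs G" "Inl e \<in> cls x" using source_exists[OF x(1) disjI1[OF False]]
        by auto
      then show "d \<in> (\<lambda>e. \<phi>E (cls (Inl e))) ` inputs G"
        using x(2) by (auto simp: cls_eq_iff[symmetric])
    qed
    have "bij_betw (under \<circ> (\<lambda>e. \<phi>E (cls (Inl e)))) (inputs G) (ins K s)"
      by (rule bij_betw_trans[OF bij bij_inputs_graph_of[OF wf_cod s]])
    moreover have "(under \<circ> (\<lambda>e. \<phi>E (cls (Inl e)))) e = f0 e" if "e \<in> inputs G" for e
      using under[of "Inl e"] cell inputs_subset[of G] that by auto
    ultimately have I: "bij_betw f0 (inputs G) (ins K s)" using bij_betw_cong[of "inputs G"] by metis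
    have bij: "bij_betw (\<lambda>e. \<phi>E (cls (Inl e))) (outputs G) (outputs (graph_of K s))"
      unfolding bij_betw_def
    proof (intro conjI inj_onI set_eqI iffI)
      fix e e' assume a: "e \<in> outputs G" "e' \<in> outputs G" "\<phi>E (cls (Inl e)) = \<phi>E (cls (Inl e'))"
      then have "cls (Inl e) = cls (Inl e')" using cell outputs_subset[of G] by (intro iE) auto
      then show "e = e'" using output_unique a by (metis cls_refl)
    next
      fix d assume "d \<in> (\<lambda>e. \<phi>E (cls (Inl e))) ` outputs G"
      then obtain e where e: "e \<in> outputs G" "d = \<phi>E (cls (Inl e))" by auto
      then have c: "Inl e \<in> cells" using cell outputs_subset[of G] by auto
      show "d \<in> outputs (graph_of K s)"
        using tgt[OF c] tgt_end_None[OF cls_refl e(1)] inE[OF c] e ne by (simp add: outputs_iff)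
    next
      fix d assume "d \<in> outputs (graph_of K s)"
      then have d: "d \<in> edges (graph_of K s)" "tgt (graph_of K s) d = None"
        using ne by (auto simp: outputs_iff)
      obtain x where x: "x \<in> cells" "d = \<phi>E (cls x)" using surjE[OF d(1)] by auto
      have "\<not> (\<exists>v d w. Inr (v, d) \<in> cls x \<and> v \<in> verts G \<and> tgt (P v) d = Some w)"
      proof
        assume "\<exists>v d w. Inr (v, d) \<in> cls x \<and> v \<in> verts G \<and> tgt (P v) d = Some w"
        then obtain v d' w where "Inr (v, d') \<in> cls x" "v \<in> verts G" "tgt (P v) d' = Some w" by blast
        then show False using tgt[OF x(1)] d(2) x(2) tgt_end[OF x(1), of v d' w] by simp
      qed
      then obtain e where "e \<in> outputs G" "Inl e \<in> cls x" using target_exists[OF x(1) disjI1[OF False]]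
        by auto
      then show "d \<in> (\<lambda>e. \<phi>E (cls (Inl e))) ` outputs G"
        using x(2) by (auto simp: cls_eq_iff[symmetric])
    qed
    have "bij_betw (under \<circ> (\<lambda>e. \<phi>E (cls (Inl e)))) (outputs G) (outs K s)"
      by (rule bij_betw_trans[OF bij bij_outputs_graph_of[OF wf_cod s]])
    moreover have "(under \<circ> (\<lambda>e. \<phi>E (cls (Inl e)))) e = f0 e" if "e \<in> outputs G" for e
      using under[of "Inl e"] cell outputs_subset[of G] that by auto
    ultimately have O: "bij_betw f0 (outputs G) (outs K s)" using bij_betw_cong[of "outputs G"] by metis
    have "\<not> (\<forall>v \<in> verts G. sverts (f1 v) = {})" using False unfolding subst_verts_empty_iff .
    then show ?thesis using disj Vs I O by blast
  next
    case True
    obtain x where x: "x \<in> cells" "subst_edges G P in_leg out_leg = {cls x}"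
      using subst_edges_single[OF True] by auto
    have emp: "\<forall>v \<in> verts G. sverts (f1 v) = {}" using True subst_verts_empty_iff by auto
    show ?thesis
    proof (cases "inputs G \<union> outputs G = {}")
      case legs: True
      have "image_graph G K f0 f1 = Exc_Loop (cls x)"
        using True legs x(2) by (simp add: image_graph_eq graph_subst_def)
      then have "is_Exc_Loop (graph_of K s)" using iso by (simp add: graph_iso_def)
      then obtain k where k: "s = Sub_Loop k" unfolding is_Exc_Loop_graph_of by auto
      then have "K = Exc_Loop k" using s by (simp add: subgraphs_Ord_iff)
      then show ?thesis using emp k legs by (auto simp: bij_betw_def)
    next
      case legs: False
      have IG: "image_graph G K f0 f1 = Exc_Edge (cls x)"
        using True legs x(2) by (simp add: image_graph_eq graph_subst_def)
      then have "is_Exc_Edge (graph_of K s)" using iso by (simp add: graph_iso_def)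
      then obtain k where k: "s = Sub_Edge k" unfolding is_Exc_Edge_graph_of by auto
      have "\<phi>E (cls x) = Whole k" using iso k unfolding IG by (auto simp: graph_iso_def bij_betw_def)
      then have "f0 e = k" if "e \<in> edges G" for e
      proof -
        have "Inl e \<in> cells" using that by (auto simp: cells_def)
        then have "Inl e \<in> cls x" using one_class[OF True x(1)] by (metis cls_refl)
        then show ?thesis using E \<open>\<phi>E (cls x) = Whole k\<close> by (simp add: IG)
      qed
      then show ?thesis
        using emp k legs leg_exists[OF True legs] inputs_subset[of G] outputs_subset[of G]
        by (auto simp: bij_betw_def)
    qed
  qed
  show "\<And>v v'. v \<in> verts G \<Longrightarrow> v' \<in> verts G \<Longrightarrow> v \<noteq> v' \<Longrightarrow> sverts (f1 v) \<inter> sverts (f1 v') = {}"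
    "(\<forall>v \<in> verts G. sverts (f1 v) = {}) \<Longrightarrow> inputs G \<union> outputs G = {} \<Longrightarrow> is_Exc_Loop K"
    "sverts s = ?S" "bij_betw f0 (inputs G) (ins K s)" "bij_betw f0 (outputs G) (outs K s)"
    using all by blast+
qed

lemma is_image_subgraph: "is_image G K f0 f1 s \<Longrightarrow> s \<in> subgraphs K"
  by (simp add: is_image_def)

lemma image_spanned:
  assumes "is_image G K f0 f1 s"
  shows "s = spanned K (\<Union>v \<in> verts G. sverts (f1 v)) (f0 ` inputs G)"
  using spanned_self[OF wf_cod is_image_subgraph[OF assms]] sverts_image[OF assms] bij_inputs_image[OF assms]
  by (simp add: bij_betw_def)

end

text \<open>
  The necessary conditions of \<open>image_facts\<close> are also sufficient: under them \<open>is_image_spanned\<close> shows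
  that \<open>G({f\<^sub>1 v})\<close> is the subgraph with vertices \<open>S\<close> and inner edges \<open>I\<close>.
\<close>

locale gmorphism = premap G K f0 f1
  for G :: "('w, 'd) graph" and K :: "('v, 'e) graph"
    and f0 :: "'d \<Rightarrow> 'e" and f1 :: "'w \<Rightarrow> ('v, 'e) subgraph" +
  assumes disjoint: "v \<in> verts G \<Longrightarrow> v' \<in> verts G \<Longrightarrow> v \<noteq> v' \<Longrightarrow> sverts (f1 v) \<inter> sverts (f1 v') = {}"
    and loop: "(\<forall>v \<in> verts G. sverts (f1 v) = {}) \<Longrightarrow> inputs G \<union> outputs G = {} \<Longrightarrow> is_Exc_Loop K"
begin

abbreviation S where "S \<equiv> \<Union>v \<in> verts G. sverts (f1 v)"

definition I where "I = {e \<in> edges K. src K e \<in> Some ` S \<and> tgt K e \<in> Some ` S \<and> e \<notin> f0 ` inputs G}"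

lemma same_vert: "v \<in> verts G \<Longrightarrow> v' \<in> verts G \<Longrightarrow> w \<in> sverts (f1 v) \<Longrightarrow> w \<in> sverts (f1 v') \<Longrightarrow> v = v'"
  using disjoint by fastforce

lemma src_P: "v \<in> verts G \<Longrightarrow> src (P v) d = Some w \<Longrightarrow> src K (under d) = Some w \<and> w \<in> sverts (f1 v)"
  using src_graph_of[OF _ wf_cod f1] by blast

lemma tgt_P: "v \<in> verts G \<Longrightarrow> tgt (P v) d = Some w \<Longrightarrow> tgt K (under d) = Some w \<and> w \<in> sverts (f1 v)"
  using tgt_graph_of[OF _ wf_cod f1] by blast

text \<open>
  \<open>source_in x v d w\<close>: the class of the cell \<open>x\<close> has its source at the vertex \<open>(v, w)\<close> of \<open>G({f\<^sub>1 v})\<close>,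
  and \<open>d\<close> is the representative that starts there.
\<close>

definition source_in where
  "source_in x v d w \<longleftrightarrow> Inr (v, d) \<in> cls x \<and> v \<in> verts G \<and> src (P v) d = Some w"
definition target_in where
  "target_in x v d w \<longleftrightarrow> Inr (v, d) \<in> cls x \<and> v \<in> verts G \<and> tgt (P v) d = Some w"

lemma source_in: "source_in x v d w \<Longrightarrow> src K (canonical f0 x) = Some w \<and> w \<in> sverts (f1 v)"
  unfolding source_in_def using src_P canonical_cls by fastforce

lemma target_in: "target_in x v d w \<Longrightarrow> tgt K (canonical f0 x) = Some w \<and> w \<in> sverts (f1 v)"
  unfolding target_in_def using tgt_P canonical_cls by fastforce

text \<open>
  A class with a source is determined by its canonical image \<open>k\<close>: the source of \<open>k\<close> lies in the vertex
  set of a single \<open>f\<^sub>1 v\<close>, and in \<open>f\<^sub>1 v\<close> a single edge over \<open>k\<close> has a source.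
\<close>

lemma source_in_cong: "source_in x v d w \<Longrightarrow> source_in y v' d' w' \<Longrightarrow> canonical f0 x = canonical f0 y \<Longrightarrow> cls x = cls y"
proof -
  assume a: "source_in x v d w" "source_in y v' d' w'" "canonical f0 x = canonical f0 y"
  then have "w = w'" using source_in[OF a(1)] source_in[OF a(2)] by simp
  then have v: "v = v'" using a source_in[OF a(1)] source_in[OF a(2)] same_vert unfolding source_in_def by blast
  have "under d = under d'" using a canonical_cls unfolding source_in_def by (metis canonical_simps(2))
  moreover have "src (P v') d = Some w" "src (P v') d' = Some w'" using a v unfolding source_in_def by auto
  ultimately have "d = d'" using src_graph_of_inj[of K "f1 v'" d w d' w'] by blast
  then show ?thesis using a v unfolding source_in_def by (metis cls_eq_iff)
qed

lemma target_in_cong: "target_in x v d w \<Longrightarrow> target_in y v' d' w' \<Longrightarrow> canonical f0 x = canonical f0 y \<Longrightarrow> cls x = cls y"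
proof -
  assume a: "target_in x v d w" "target_in y v' d' w'" "canonical f0 x = canonical f0 y"
  then have "w = w'" using target_in[OF a(1)] target_in[OF a(2)] by simp
  then have v: "v = v'" using a target_in[OF a(1)] target_in[OF a(2)] same_vert unfolding target_in_def by blast
  have "under d = under d'" using a canonical_cls unfolding target_in_def by (metis canonical_simps(2))
  moreover have "tgt (P v') d = Some w" "tgt (P v') d' = Some w'" using a v unfolding target_in_def by auto
  ultimately have "d = d'" using tgt_graph_of_inj[of K "f1 v'" d w d' w'] by blast
  then show ?thesis using a v unfolding target_in_def by (metis cls_eq_iff)
qed

lemma source_cases:
  assumes "x \<in> cells" "S \<noteq> {}"
  obtains e where "e \<in> inputs G" "Inl e \<in> cls x" | v d w where "source_in x v d w"
  using source_exists[OF assms(1)] assms(2) subst_verts_empty_iff unfolding source_in_def by blast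

lemma target_cases:
  assumes "x \<in> cells" "S \<noteq> {}"
  obtains e where "e \<in> outputs G" "Inl e \<in> cls x" | v d w where "target_in x v d w"
  using target_exists[OF assms(1)] assms(2) subst_verts_empty_iff unfolding target_in_def by blast

lemma input_not_source: "e \<in> inputs G \<Longrightarrow> Inl e \<in> cls x \<Longrightarrow> \<not> source_in x v d w"
  unfolding source_in_def using input_no_source by fastforce

lemma output_not_target: "e \<in> outputs G \<Longrightarrow> Inl e \<in> cls x \<Longrightarrow> \<not> target_in x v d w"
  unfolding target_in_def using output_no_target by fastforce

lemma some_end:
  assumes "x \<in> cells" "S \<noteq> {}"
  obtains v d w where "source_in x v d w" | v d w where "target_in x v d w"
  using end_exists[OF assms(1)] assms(2) subst_verts_empty_iff unfolding source_in_def target_in_def by blast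

text \<open>
  If the class of an input \<open>e\<close> had the same canonical image as a class with a source and a target,
  then it would have a target by \<open>end_exists\<close>, so by \<open>target_in_cong\<close> it would be the same class; but
  the class of an input has no source.
\<close>

lemma inner_class:
  assumes s: "source_in x v d w" and t: "target_in x v' d' w'"
  shows "canonical f0 x \<in> I"
proof -
  have S: "w \<in> S" "w' \<in> S" "src K (canonical f0 x) = Some w" "tgt K (canonical f0 x) = Some w'"
    using source_in[OF s] target_in[OF t] s t unfolding source_in_def target_in_def by auto
  have "canonical f0 x \<notin> f0 ` inputs G"
  proof
    assume "canonical f0 x \<in> f0 ` inputs G"
    then obtain e where e: "e \<in> inputs G" "canonical f0 x = f0 e" by auto
    have c: "Inl e \<in> cells" using e inputs_subset[of G] by (auto simp: cells_def)
    have ne: "S \<noteq> {}" using S by auto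
    obtain v2 d2 w2 where "target_in (Inl e) v2 d2 w2"
      by (rule some_end[OF c ne]) (use input_not_source[OF e(1) cls_refl] in auto)
    then have "cls x = cls (Inl e)" using target_in_cong[OF t] e by auto
    then have "Inl e \<in> cls x" by simp
    then show False using input_not_source[OF e(1)] s by auto
  qed
  then show ?thesis using S src_Some_edge[OF wf_cod S(3)] by (auto simp: I_def)
qed

text \<open>
  Conversely, a class whose canonical image \<open>k\<close> is in \<open>I\<close> has a source, as it contains no input. If
  \<open>d'\<close> is the edge over \<open>k\<close> that ends at the target of \<open>k\<close>, then its class has a source for the same
  reason, so it is the given class, which therefore has a target.
\<close>

lemma inner_class_ends:
  assumes x: "x \<in> cells" and i: "canonical f0 x \<in> I"
  shows "\<exists>v d w. source_in x v d w" "\<exists>v d w. target_in x v d w"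
proof -
  have ne: "S \<noteq> {}" using i by (auto simp: I_def)
  show s: "\<exists>v d w. source_in x v d w"
  proof (rule source_cases[OF x ne])
    fix e assume "e \<in> inputs G" "Inl e \<in> cls x"
    then have "canonical f0 x = f0 e" using canonical_cls[of "Inl e" x] by simp
    moreover have "f0 e \<in> f0 ` inputs G" using \<open>e \<in> inputs G\<close> by (rule imageI)
    ultimately show ?thesis using i by (simp add: I_def)
  qed auto
  then obtain v d w where s: "source_in x v d w" by auto
  obtain w' v' where w': "tgt K (canonical f0 x) = Some w'" "w' \<in> sverts (f1 v')" "v' \<in> verts G"
    using i by (auto simp: I_def)
  obtain d' where d': "tgt (P v') d' = Some w'" "under d' = canonical f0 x"
    using tgt_graph_of_surj[OF wf_cod w'(2,1)] by auto
  let ?y = "Inr (v', d')"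
  have y: "?y \<in> cells" using d' w' wfP[OF w'(3)] by (auto simp: cells_def dest: tgt_Some_edge)
  have t: "target_in ?y v' d' w'" using d' w' by (simp add: target_in_def)
  show "\<exists>v d w. target_in x v d w"
  proof (rule source_cases[OF y ne])
    fix e assume "e \<in> inputs G" "Inl e \<in> cls ?y"
    then have "canonical f0 x = f0 e" using canonical_cls[of "Inl e" ?y] d' by simp
    moreover have "f0 e \<in> f0 ` inputs G" using \<open>e \<in> inputs G\<close> by (rule imageI)
    ultimately show ?thesis using i by (simp add: I_def)
  next
    fix v2 d2 w2 assume "source_in ?y v2 d2 w2"
    then have "cls x = cls ?y" using source_in_cong[OF s] d' by auto
    then have "target_in x v' d' w'" using t unfolding target_in_def by simp
    then show ?thesis by blast
  qed
qed

text \<open>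
  A set \<open>T\<close> of vertices of \<open>K\<close> that is closed under adjacency along \<open>I\<close> and meets \<open>S\<close> contains \<open>S\<close>: the
  set \<open>W\<close> of vertices \<open>v\<close> of \<open>G\<close> such that \<open>f\<^sub>1 v\<close> lies in \<open>T\<close> is closed under adjacency. For vertices
  that are sent to edges, "lies in \<open>T\<close>" means that the class of the edge has an end in \<open>T\<close>.
\<close>

lemma connected_image:
  assumes ne: "S \<noteq> {}"
  shows "connected_by K S I"
  unfolding connected_by_iff_closed
proof (intro allI impI)
  fix T
  assume T: "T \<inter> S \<noteq> {}"
    and cl: "\<forall>e \<in> I. \<forall>u w. src K e = Some u \<longrightarrow> tgt K e = Some w \<longrightarrow> (u \<in> T \<longleftrightarrow> w \<in> T)"
  define ends where "ends x w \<longleftrightarrow> (\<exists>v d. source_in x v d w \<or> target_in x v d w)" for x w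
  have ends: "w' \<in> T" if "ends x w" "ends x w'" "w \<in> T" for x w w'
  proof -
    have "w = w' \<or> (canonical f0 x \<in> I \<and>
        (src K (canonical f0 x) = Some w \<and> tgt K (canonical f0 x) = Some w' \<or>
         src K (canonical f0 x) = Some w' \<and> tgt K (canonical f0 x) = Some w))"
      using that(1,2) unfolding ends_def using source_in target_in inner_class by (metis option.inject)
    then show ?thesis using cl that(3) by blast
  qed
  define touch where "touch x \<longleftrightarrow> (\<exists>w \<in> T. ends x w)" for x
  have touch_cong: "touch y" if "touch x" "cls x = cls y" for x y
    using that unfolding touch_def ends_def source_in_def target_in_def by simp
  define W where "W = {v \<in> verts G. sverts (f1 v) \<subseteq> T \<and> (\<forall>d \<in> edges (P v). touch (Inr (v, d)))}"
  have end_at: "\<exists>w \<in> sverts (f1 v). ends (Inr (v, d)) w"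
    if v: "v \<in> verts G" "d \<in> edges (P v)" "sverts (f1 v) \<noteq> {}" for v d
  proof -
    have "src (P v) d \<noteq> None \<or> tgt (P v) d \<noteq> None"
      using wf_ends[OF wfP[OF v(1)] _ v(2)] v(3) by simp
    then obtain w where "src (P v) d = Some w \<or> tgt (P v) d = Some w" by auto
    then show ?thesis using src_P[OF v(1)] tgt_P[OF v(1)] v unfolding ends_def source_in_def target_in_def
      by (intro bexI[of _ w]) auto
  qed
  have W1: "v \<in> W" if v: "v \<in> verts G" and meet: "sverts (f1 v) \<inter> T \<noteq> {}" for v
  proof -
    obtain S' I' where s: "f1 v = Sub_Ord S' I'" using meet by (cases "f1 v") auto
    have sub: "Sub_Ord S' I' \<in> subgraphs K" using f1[OF v] s by simp
    have "I' \<subseteq> I"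
    proof
      fix e assume e: "e \<in> I'"
      obtain u w where uw: "src K e = Some u" "tgt K e = Some w" "u \<in> S'" "w \<in> S'"
        using subgraph_inner[OF wf_cod sub e] by auto
      have "source_in (Inr (v, Whole e)) v (Whole e) u" "target_in (Inr (v, Whole e)) v (Whole e) w"
        using v e uw s by (auto simp: source_in_def target_in_def)
      then show "e \<in> I" using inner_class by fastforce
    qed
    moreover have "connected_by K S' I'" using sub by (simp add: subgraphs_Ord_iff)
    ultimately have "S' \<subseteq> T" using meet s cl unfolding connected_by_iff_closed
      by (elim allE[of _ T]) (auto simp: Int_commute)
    then have "sverts (f1 v) \<subseteq> T" using s by simp
    then show ?thesis using v end_at[OF v] meet unfolding W_def touch_def by blast
  qed
  have W2: "v \<in> W" if v: "v \<in> verts G" "d \<in> edges (P v)" and t: "touch (Inr (v, d))" for v d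
  proof (cases "sverts (f1 v) = {}")
    case True
    then have "edges (P v) = {d}"
      using v by (cases "f1 v") (use f1[OF v(1)] in \<open>auto simp: subgraphs_Ord_iff\<close>)
    then show ?thesis using v t True by (simp add: W_def)
  next
    case False
    then show ?thesis using W1[OF v(1)] end_at[OF v False] ends t unfolding touch_def by blast
  qed
  obtain w v where "w \<in> T" "v \<in> verts G" "w \<in> sverts (f1 v)" using T by auto
  then have "v \<in> W" using W1 by blast
  moreover have "a \<in> W \<longleftrightarrow> b \<in> W" if "src G e = Some a" "tgt G e = Some b" for e a b
  proof -
    have a: "a \<in> verts G" "e \<in> out_at G a" using that src_Some_vert[OF wf_dom] out_at_iff[OF wf_dom]
      by auto
    have b: "b \<in> verts G" "e \<in> in_at G b" using that tgt_Some_vert[OF wf_dom] in_at_iff[OF wf_dom]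
      by auto
    have la: "out_leg a e \<in> edges (P a)"
      using bij_betwE[OF bij_out_leg[OF a(1)]] a(2) outputs_subset[of "P a"] by blast
    have lb: "in_leg b e \<in> edges (P b)"
      using bij_betwE[OF bij_in_leg[OF b(1)]] b(2) inputs_subset[of "P b"] by blast
    have c: "cls (Inr (a, out_leg a e)) = cls (Inr (b, in_leg b e))"
      using cls_out[OF a] cls_in[OF b] by simp
    have "a \<in> W \<longleftrightarrow> touch (Inr (a, out_leg a e))"
      using W2[OF a(1) la] la unfolding W_def by auto
    moreover have "b \<in> W \<longleftrightarrow> touch (Inr (b, in_leg b e))"
      using W2[OF b(1) lb] lb unfolding W_def by auto
    ultimately show ?thesis using touch_cong c by metis
  qed
  ultimately have "verts G \<subseteq> W"
    using wf_graph_closed[OF wf_dom, of v W] \<open>v \<in> verts G\<close> by blast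
  then show "S \<subseteq> T" unfolding W_def by auto
qed

lemma image_subgraph: "S \<noteq> {} \<Longrightarrow> Sub_Ord S I \<in> subgraphs K"
proof -
  assume ne: "S \<noteq> {}"
  have sub: "S \<subseteq> verts K" using sverts_subset[OF f1] by blast
  then have "verts K \<noteq> {}" using ne by auto
  then have "I \<subseteq> inner_edges K" using inner_edges_iff by (fastforce simp: I_def)
  then show ?thesis using sub ne connected_image[OF ne] by (auto simp: subgraphs_Ord_iff I_def)
qed

lemma is_image_spanned: "is_image G K f0 f1 (spanned K S (f0 ` inputs G))"
proof (cases "S = {}")
  case True
  then have emp: "subst_verts G P = {}" using subst_verts_empty_iff by blast
  obtain x where x: "x \<in> cells" "subst_edges G P in_leg out_leg = {cls x}"
    using subst_edges_single[OF emp] by auto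
  have can: "under d = canonical f0 x" if "Inr (v, d) \<in> cls x" for v d
    using canonical_cls[OF that] by simp
  have can': "f0 e = canonical f0 x" if "Inl e \<in> cls x" for e
    using canonical_cls[OF that] by simp
  show ?thesis
  proof (cases "inputs G \<union> outputs G = {}")
    case legs: True
    have "is_Exc_Loop K" using loop emp legs unfolding subst_verts_empty_iff by blast
    then obtain k where k: "K = Exc_Loop k" by (auto simp: is_Exc_Loop_def)
    have sp: "spanned K S (f0 ` inputs G) = Sub_Loop k" using True legs k by (simp add: spanned_def)
    have ck: "canonical f0 x = k" using canonical_edge[OF x(1)] k by simp
    have IG: "image_graph G K f0 f1 = Exc_Loop (cls x)"
      using emp legs x(2) by (simp add: image_graph_eq graph_subst_def)
    show ?thesis unfolding sp is_image_def IG
      by (intro conjI exI[of _ snd] exI[of _ "\<lambda>_. Whole k"])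
        (use can can' ck k in \<open>auto simp: graph_iso_def bij_betw_def subgraphs_Ord_iff\<close>)
  next
    case legs: False
    obtain e where e: "inputs G = {e}" using leg_exists(1)[OF emp legs] by auto
    have eG: "e \<in> edges G" using e inputs_subset[of G] by auto
    have sp: "spanned K S (f0 ` inputs G) = Sub_Edge (f0 e)" using True e by (simp add: spanned_def)
    have "Inl e \<in> cells" using eG by (auto simp: cells_def)
    then have ck: "canonical f0 x = f0 e" using canonical_single[OF emp x(1)] by fastforce
    have IG: "image_graph G K f0 f1 = Exc_Edge (cls x)"
      using emp legs x(2) by (simp add: image_graph_eq graph_subst_def)
    show ?thesis unfolding sp is_image_def IG
      by (intro conjI exI[of _ snd] exI[of _ "\<lambda>_. Whole (f0 e)"])
        (use can can' ck f0[OF eG] in \<open>auto simp: graph_iso_def bij_betw_def subgraphs_Ord_iff\<close>)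
  qed
next
  case ne: False
  then have SV: "subst_verts G P \<noteq> {}" using subst_verts_empty_iff by blast
  let ?s = "Sub_Ord S I"
  let ?K = "graph_of K ?s"
  have sub: "?s \<in> subgraphs K" by (rule image_subgraph[OF ne])
  have sp: "spanned K S (f0 ` inputs G) = ?s" using ne by (simp add: spanned_def I_def)
  (* a class is a leg of the image exactly if its canonical image is not in I, and then its only
     end tells which of the two possible legs it is *)
  define \<kappa> where "\<kappa> x = (let k = canonical f0 x in if k \<in> I then Whole k
      else if \<exists>v d w. target_in x v d w then In_Leg k else Out_Leg k)" for x
  have under: "under (\<kappa> x) = canonical f0 x" for x by (simp add: \<kappa>_def Let_def)
  have ti: "target_in x = target_in y" if "cls x = cls y" for x y
    using that by (simp add: target_in_def[abs_def])
  have src: "src ?K (\<kappa> x) = Some w" if s: "source_in x v d w" for x v d w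
  proof (cases "canonical f0 x \<in> I")
    case True
    then show ?thesis using source_in[OF s] by (simp add: \<kappa>_def)
  next
    case False
    then have "\<not> (\<exists>v d w. target_in x v d w)" using inner_class[OF s] by blast
    moreover have "src K (canonical f0 x) = Some w" "w \<in> S"
      using source_in[OF s] s by (auto simp: source_in_def)
    moreover have "\<kappa> x = Out_Leg (canonical f0 x)"
      using False calculation(1) by (simp add: \<kappa>_def Let_def)
    ultimately show ?thesis using False src_Some_edge[OF wf_cod] by auto
  qed
  have tgt: "tgt ?K (\<kappa> x) = Some w" if t: "target_in x v d w" for x v d w
  proof (cases "canonical f0 x \<in> I")
    case True
    then show ?thesis using target_in[OF t] by (simp add: \<kappa>_def)
  next
    case False
    moreover have "tgt K (canonical f0 x) = Some w" "w \<in> S"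
      using target_in[OF t] t by (auto simp: target_in_def)
    moreover have "\<kappa> x = In_Leg (canonical f0 x)" using False t by (auto simp: \<kappa>_def Let_def)
    ultimately show ?thesis using False tgt_Some_edge[OF wf_cod] by auto
  qed
  have wfK: "wf_graph ?K" by (rule wf_graph_of[OF wf_cod sub])
  have "\<exists>\<phi>E. graph_iso snd \<phi>E (graph_subst G P in_leg out_leg) ?K \<and> (\<forall>x \<in> cells. \<phi>E (cls x) = \<kappa> x)"
  proof (rule recognition[OF SV wfK])
    show "verts ?K \<noteq> {}" using ne by simp
    show "\<kappa> y = \<kappa> x" if "y \<in> cls x" for x y
      using that canonical_cls[OF that] ti[of x y] unfolding \<kappa>_def cls_eq_iff[symmetric]
        by (simp add: Let_def)
    show "\<kappa> x \<in> edges ?K" if x: "x \<in> cells" for x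
      by (rule some_end[OF x ne]) (use src tgt src_Some_edge[OF wfK] tgt_Some_edge[OF wfK] in blast)+
    show "bij_betw snd (subst_verts G P) (verts ?K)"
    proof (rule bij_betw_imageI)
      show "inj_on snd (subst_verts G P)"
      proof (rule inj_onI)
        fix p q assume "p \<in> subst_verts G P" "q \<in> subst_verts G P" "snd p = snd q"
        then show "p = q" using same_vert[of "fst p" "fst q" "snd p"]
          by (auto simp: subst_verts_def)
      qed
      show "snd ` subst_verts G P = verts ?K" by (force simp: subst_verts_def image_iff)
    qed
    show "src ?K (\<kappa> (Inr (v, d))) = Some (snd (v, w))" if "v \<in> verts G" "src (P v) d = Some w" for v d w
      using src[of "Inr (v, d)" v d w] that by (simp add: source_in_def)
    show "tgt ?K (\<kappa> (Inr (v, d))) = Some (snd (v, w))" if "v \<in> verts G" "tgt (P v) d = Some w" for v d w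
      using tgt[of "Inr (v, d)" v d w] that by (simp add: target_in_def)
    show "src ?K (\<kappa> (Inl e)) = None" if e: "e \<in> inputs G" for e
    proof -
      have c: "Inl e \<in> cells" using e inputs_subset[of G] by (auto simp: cells_def)
      obtain v d w where "target_in (Inl e) v d w"
        by (rule some_end[OF c ne]) (use input_not_source[OF e cls_refl] in auto)
      moreover have "f0 e \<notin> I" using e by (simp add: I_def)
      ultimately show ?thesis by (auto simp: \<kappa>_def Let_def)
    qed
    show "tgt ?K (\<kappa> (Inl e)) = None" if e: "e \<in> outputs G" for e
    proof -
      have c: "Inl e \<in> cells" using e outputs_subset[of G] by (auto simp: cells_def)
      have "\<not> (\<exists>v d w. target_in (Inl e) v d w)" using output_not_target[OF e cls_refl] by auto
      moreover have "f0 e \<notin> I" using inner_class_ends(2)[OF c] calculation by auto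
      ultimately show ?thesis by (auto simp: \<kappa>_def Let_def)
    qed
    show "d = d'" if "src (P v) d = Some w" "src (P v) d' = Some w" "\<kappa> (Inr (v, d)) = \<kappa> (Inr (v, d'))" for v d d' w
      using src_graph_of_inj[OF that(1,2)] arg_cong[OF that(3), of under] under by simp
    show "d = d'" if "tgt (P v) d = Some w" "tgt (P v) d' = Some w" "\<kappa> (Inr (v, d)) = \<kappa> (Inr (v, d'))" for v d d' w
      using tgt_graph_of_inj[OF that(1,2)] arg_cong[OF that(3), of under] under by simp
    show "\<exists>d. src (P v) d = Some w \<and> \<kappa> (Inr (v, d)) = k"
      if v: "v \<in> verts G" "w \<in> verts (P v)" "src ?K k = Some (snd (v, w))" for v w k
    proof -
      have k: "src K (under k) = Some w" using src_graph_of(1)[OF _ wf_cod sub, of k] v(3) by simp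
      obtain d where d: "src (P v) d = Some w" "under d = under k"
        using src_graph_of_surj[OF wf_cod _ k, of "f1 v"] v(2) by auto
      have "src ?K (\<kappa> (Inr (v, d))) = Some w"
        using src[of "Inr (v, d)" v d w] d v(1) by (simp add: source_in_def)
      then have "\<kappa> (Inr (v, d)) = k" using src_graph_of_inj[of K ?s _ w k w] v(3) under d(2) by simp
      then show ?thesis using d by auto
    qed
    show "\<exists>d. tgt (P v) d = Some w \<and> \<kappa> (Inr (v, d)) = k"
      if v: "v \<in> verts G" "w \<in> verts (P v)" "tgt ?K k = Some (snd (v, w))" for v w k
    proof -
      have k: "tgt K (under k) = Some w" using tgt_graph_of(1)[OF _ wf_cod sub, of k] v(3) by simp
      obtain d where d: "tgt (P v) d = Some w" "under d = under k"
        using tgt_graph_of_surj[OF wf_cod _ k, of "f1 v"] v(2) by auto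
      have "tgt ?K (\<kappa> (Inr (v, d))) = Some w"
        using tgt[of "Inr (v, d)" v d w] d v(1) by (simp add: target_in_def)
      then have "\<kappa> (Inr (v, d)) = k" using tgt_graph_of_inj[of K ?s _ w k w] v(3) under d(2) by simp
      then show ?thesis using d by auto
    qed
  qed
  then obtain \<phi>E where iso: "graph_iso snd \<phi>E (graph_subst G P in_leg out_leg) ?K"
    and \<phi>: "\<And>x. x \<in> cells \<Longrightarrow> \<phi>E (cls x) = \<kappa> x" by auto
  have E: "edges (image_graph G K f0 f1) = cls ` cells"
    using SV by (simp add: image_graph_eq graph_subst_def subst_edges_eq)
  have over: "under (\<phi>E c) = canonical f0 y" if "c \<in> edges (image_graph G K f0 f1)" "y \<in> c" for c y
    using that \<phi> under canonical_cls unfolding E by auto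
  show ?thesis unfolding sp is_image_def
    using sub iso over[of _ "Inl _"] over[of _ "Inr (_, _)"]
    by (intro conjI exI[of _ snd] exI[of _ \<phi>E]) (auto simp: image_graph_eq)
qed

end

context gmorphism
begin

definition img :: "('v, 'e) subgraph" where
  "img = spanned K S (f0 ` inputs G)"

lemma is_image_iff: "is_image G K f0 f1 s \<longleftrightarrow> s = img"
  using is_image_spanned image_spanned unfolding img_def by blast

lemma map_image_eq: "map_image G K f0 f1 = img"
  unfolding map_image_def is_image_iff by simp

lemma image_in_subgraphs: "img \<in> subgraphs K"
  using is_image_iff is_image_subgraph by blast

lemma sverts_image_eq [simp]: "sverts img = S"
  by (simp add: img_def)

lemma bij_ins_image: "bij_betw f0 (inputs G) (ins K img)"
  using is_image_iff bij_inputs_image by blast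

lemma bij_outs_image: "bij_betw f0 (outputs G) (outs K img)"
  using is_image_iff bij_outputs_image by blast

end

lemma premap_gmorphism_iff:
  assumes "premap G K f0 f1"
  shows "gmorphism G K f0 f1 \<longleftrightarrow> (\<exists>s. is_image G K f0 f1 s)"
proof
  assume "gmorphism G K f0 f1"
  then show "\<exists>s. is_image G K f0 f1 s" using gmorphism.is_image_iff by blast
next
  assume "\<exists>s. is_image G K f0 f1 s"
  then obtain s where s: "is_image G K f0 f1 s" by auto
  interpret premap G K f0 f1 by fact
  show "gmorphism G K f0 f1"
    by unfold_locales (use image_disjoint[OF s] image_loop[OF s] in blast)+
qed

lemma gmorphism_cong:
  assumes "gmorphism G K f0 f1" and e: "\<And>e. e \<in> edges G \<Longrightarrow> f0 e = f0' e" and v: "\<And>v. v \<in> verts G \<Longrightarrow> f1 v = f1' v"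
  shows "gmorphism G K f0' f1'"
proof -
  interpret gmorphism G K f0 f1 by fact
  have "bij_betw f0' (in_at G v) (ins K (f1' v))" "bij_betw f0' (out_at G v) (outs K (f1' v))" if "v \<in> verts G" for v
    using f_in[OF that] f_out[OF that] v[OF that]
      bij_betw_cong[of "in_at G v" f0 f0'] bij_betw_cong[of "out_at G v" f0 f0'] e
    by (auto simp: in_at_def out_at_def)
  then show ?thesis
    by unfold_locales (use wf_dom wf_cod f0 f1 disjoint loop e v in auto)
qed

section \<open>The category of graphs\<close>

text \<open>
  Graphical maps between well-formed graphs, without reference to a set of objects.
\<close>

definition hom :: "('v, 'e) gmap \<Rightarrow> bool" where
  "hom f \<longleftrightarrow> wf_graph (gdom f) \<and> wf_graph (gcod f) \<and> graphical_map f"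

lemma hom_iff:
  "hom f \<longleftrightarrow> gmorphism (gdom f) (gcod f) (emap f) (vmap f) \<and>
     emap f \<in> extensional (edges (gdom f)) \<and> vmap f \<in> extensional (verts (gdom f))"
proof -
  let ?G = "gdom f" and ?K = "gcod f"
  have ins: "under ` inputs (graph_of ?K s) = ins ?K s" "under ` outputs (graph_of ?K s) = outs ?K s"
    if "wf_graph ?K" "s \<in> subgraphs ?K" for s
    using bij_inputs_graph_of[OF that] bij_outputs_graph_of[OF that] by (auto simp: bij_betw_def)
  show ?thesis
  proof (cases "premap ?G ?K (emap f) (vmap f)")
    case True
    then interpret premap ?G ?K "emap f" "vmap f" .
    show ?thesis unfolding hom_def graphical_map_def premap_gmorphism_iff[OF True]
      using wf_dom wf_cod f0 f1 f_in f_out ins[OF wf_cod f1] by (auto simp: PiE_def)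
  next
    case False
    have "\<not> hom f"
    proof
      assume h: "hom f"
      have f1: "vmap f v \<in> subgraphs ?K" if "v \<in> verts ?G" for v
        using h that by (auto simp: hom_def graphical_map_def)
      have "premap ?G ?K (emap f) (vmap f)"
        by unfold_locales (use h ins[OF _ f1] in \<open>auto simp: hom_def graphical_map_def\<close>)
      then show False using False by simp
    qed
    moreover have "\<not> gmorphism ?G ?K (emap f) (vmap f)" using False gmorphism.axioms(1) by blast
    ultimately show ?thesis by simp
  qed
qed

lemma hom_gmorphism: "hom f \<Longrightarrow> gmorphism (gdom f) (gcod f) (emap f) (vmap f)"
  by (simp add: hom_iff)

definition gmap_of :: "('v, 'e) graph \<Rightarrow> ('v, 'e) graph \<Rightarrow> ('e \<Rightarrow> 'e) \<Rightarrow> ('v \<Rightarrow> ('v, 'e) subgraph) \<Rightarrow> ('v, 'e) gmap" where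
  "gmap_of G K f0 f1 = \<lparr>gdom = G, gcod = K, emap = restrict f0 (edges G), vmap = restrict f1 (verts G)\<rparr>"

lemma gmap_of_simps [simp]:
  "gdom (gmap_of G K f0 f1) = G" "gcod (gmap_of G K f0 f1) = K"
  "emap (gmap_of G K f0 f1) = restrict f0 (edges G)" "vmap (gmap_of G K f0 f1) = restrict f1 (verts G)"
  by (simp_all add: gmap_of_def)

lemma hom_gmap_of: "gmorphism G K f0 f1 \<Longrightarrow> hom (gmap_of G K f0 f1)"
  unfolding hom_iff gmap_of_simps by (auto intro: gmorphism_cong)

text \<open>
  The inputs of \<open>f\<^sub>1 v\<close> are given by \<open>f\<^sub>0\<close>, and vertices and inputs determine a subgraph.
\<close>

lemma hom_eqI:
  assumes f: "hom f" and g: "hom g" and "gdom f = gdom g" "gcod f = gcod g"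
    and e: "\<And>e. e \<in> edges (gdom f) \<Longrightarrow> emap f e = emap g e"
    and v: "\<And>v. v \<in> verts (gdom f) \<Longrightarrow> sverts (vmap f v) = sverts (vmap g v)"
  shows "f = g"
proof -
  interpret f: gmorphism "gdom f" "gcod f" "emap f" "vmap f" using hom_gmorphism[OF f] .
  interpret g: gmorphism "gdom g" "gcod g" "emap g" "vmap g" using hom_gmorphism[OF g] .
  have "emap f = emap g" using f g assms(3) e unfolding hom_iff by (auto intro: extensionalityI)
  moreover have "vmap f = vmap g"
  proof (rule extensionalityI[of _ "verts (gdom f)"])
    fix x assume x: "x \<in> verts (gdom f)"
    show "vmap f x = vmap g x"
      by (rule subgraph_eqI[OF f.wf_cod f.f1[OF x]])
        (use x v g.f1 assms(3,4) f.f_in[OF x] g.f_in[of x] \<open>emap f = emap g\<close> in \<open>auto simp: bij_betw_def\<close>)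
  qed (use f g assms(3) in \<open>auto simp: hom_iff\<close>)
  ultimately show ?thesis using assms(3,4) by simp
qed

lemma bij_in_at_graph_of:
  assumes "wf_graph K" "s \<in> subgraphs K" "w \<in> sverts s"
  shows "bij_betw under (in_at (graph_of K s) w) (in_at K w)"
proof (rule bij_betw_imageI)
  have at: "d \<in> in_at (graph_of K s) w \<longleftrightarrow> tgt (graph_of K s) d = Some w" for d
    by (rule in_at_iff[OF wf_graph_of[OF assms(1,2)]])
  show "inj_on under (in_at (graph_of K s) w)"
    by (rule inj_onI) (use tgt_graph_of_inj in \<open>auto simp: at\<close>)
  show "under ` in_at (graph_of K s) w = in_at K w"
  proof (intro set_eqI iffI)
    fix k assume "k \<in> under ` in_at (graph_of K s) w"
    then show "k \<in> in_at K w"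
      using tgt_graph_of(1)[OF _ assms(1,2)] by (auto simp: at in_at_iff[OF assms(1)])
  next
    fix k assume "k \<in> in_at K w"
    then obtain d where "tgt (graph_of K s) d = Some w" "under d = k"
      using tgt_graph_of_surj[OF assms(1,3), of k] by (auto simp: in_at_iff[OF assms(1)])
    then show "k \<in> under ` in_at (graph_of K s) w" by (auto simp: at)
  qed
qed

lemma bij_out_at_graph_of:
  assumes "wf_graph K" "s \<in> subgraphs K" "w \<in> sverts s"
  shows "bij_betw under (out_at (graph_of K s) w) (out_at K w)"
proof (rule bij_betw_imageI)
  have at: "d \<in> out_at (graph_of K s) w \<longleftrightarrow> src (graph_of K s) d = Some w" for d
    by (rule out_at_iff[OF wf_graph_of[OF assms(1,2)]])
  show "inj_on under (out_at (graph_of K s) w)"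
    by (rule inj_onI) (use src_graph_of_inj in \<open>auto simp: at\<close>)
  show "under ` out_at (graph_of K s) w = out_at K w"
  proof (intro set_eqI iffI)
    fix k assume "k \<in> under ` out_at (graph_of K s) w"
    then show "k \<in> out_at K w"
      using src_graph_of(1)[OF _ assms(1,2)] by (auto simp: at out_at_iff[OF assms(1)])
  next
    fix k assume "k \<in> out_at K w"
    then obtain d where "src (graph_of K s) d = Some w" "under d = k"
      using src_graph_of_surj[OF assms(1,3), of k] by (auto simp: out_at_iff[OF assms(1)])
    then show "k \<in> under ` out_at (graph_of K s) w" by (auto simp: at)
  qed
qed

text \<open>
  In a subgraph without legs all edges at its vertices are inner, so by connectedness it is the whole
  graph.
\<close>

lemma legless_subgraph:
  assumes wf: "wf_graph K" and s: "s \<in> subgraphs K" and no: "ins K s = {}" "outs K s = {}"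
  shows "sverts s = verts K" "inputs K = {}" "outputs K = {}"
proof -
  have "sverts s = verts K \<and> inputs K = {} \<and> outputs K = {}"
  proof (cases s)
    case (Sub_Ord S I)
    obtain v where v: "v \<in> S" "v \<in> verts K" using s Sub_Ord by (auto simp: subgraphs_Ord_iff)
    note sub = subgraph_inner[OF wf s[unfolded Sub_Ord]]
    have I1: "e \<in> I" if "tgt K e = Some w" "w \<in> S" for e w
      using no(1) that tgt_Some_edge[OF wf that(1)] Sub_Ord by auto
    have I2: "e \<in> I" if "src K e = Some w" "w \<in> S" for e w
      using no(2) that src_Some_edge[OF wf that(1)] Sub_Ord by auto
    have "verts K \<subseteq> S"
      by (rule wf_graph_closed[OF wf v(2,1)]) (use I1 I2 sub in \<open>fastforce\<close>)
    then have V: "verts K = S" using s Sub_Ord by (auto simp: subgraphs_Ord_iff)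
    have ne: "verts K \<noteq> {}" using v by auto
    have "e \<in> I" if e: "e \<in> edges K" for e
      using wf_ends[OF wf ne e] I1 I2 src_Some_vert[OF wf] tgt_Some_vert[OF wf] V by auto
    then have "inputs K = {}" "outputs K = {}"
      using sub by (fastforce simp: inputs_iff[OF ne] outputs_iff[OF ne])+
    then show ?thesis using V Sub_Ord by simp
  qed (use s no in \<open>auto simp: subgraphs_Ord_iff\<close>)
  then show "sverts s = verts K" "inputs K = {}" "outputs K = {}" by auto
qed

lemma gmorphism_restrict:
  assumes "gmorphism K L g0 g1" and s: "s \<in> subgraphs K"
  shows "gmorphism (graph_of K s) L (g0 \<circ> under) g1"
proof -
  interpret gmorphism K L g0 g1 by fact
  note V = sverts_subset[OF s]
  show ?thesis
  proof unfold_locales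
    show "wf_graph (graph_of K s)" "wf_graph L" using wf_graph_of[OF wf_dom s] wf_cod by auto
    show "(g0 \<circ> under) e \<in> edges L" if "e \<in> edges (graph_of K s)" for e
      using f0 edges_graph_of[OF wf_dom s that] by simp
    show "bij_betw (g0 \<circ> under) (in_at (graph_of K s) v) (ins L (g1 v))" if "v \<in> verts (graph_of K s)" for v
      by (rule bij_betw_trans[OF bij_in_at_graph_of[OF wf_dom s] f_in]) (use that V in auto)
    show "bij_betw (g0 \<circ> under) (out_at (graph_of K s) v) (outs L (g1 v))" if "v \<in> verts (graph_of K s)" for v
      by (rule bij_betw_trans[OF bij_out_at_graph_of[OF wf_dom s] f_out]) (use that V in auto)
    show "is_Exc_Loop L" if "\<forall>v \<in> verts (graph_of K s). sverts (g1 v) = {}" "inputs (graph_of K s) \<union> outputs (graph_of K s) = {}"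
    proof -
      have "ins K s = {}" "outs K s = {}"
        using that(2) bij_inputs_graph_of[OF wf_dom s] bij_outputs_graph_of[OF wf_dom s]
          by (auto simp: bij_betw_def)
      then show ?thesis using legless_subgraph[OF wf_dom s] that(1) loop by auto
    qed
    show "sverts (g1 v) \<inter> sverts (g1 v') = {}"
      if "v \<in> verts (graph_of K s)" "v' \<in> verts (graph_of K s)" "v \<noteq> v'" for v v'
      by (rule disjoint) (use that V in auto)
  qed (use f1 V in auto)
qed

text \<open>
  The image of the subgraph \<open>s\<close> of \<open>K\<close> under the map \<open>(g\<^sub>0, g\<^sub>1) : K \<rightarrow> L\<close>; see \<open>image_restrict\<close>.
\<close>

definition push ::
  "('v, 'e) graph \<Rightarrow> ('x, 'y) graph \<Rightarrow> ('e \<Rightarrow> 'y) \<Rightarrow> ('v \<Rightarrow> ('x, 'y) subgraph) \<Rightarrow>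
   ('v, 'e) subgraph \<Rightarrow> ('x, 'y) subgraph" where
  "push K L g0 g1 s = spanned L (\<Union>w \<in> sverts s. sverts (g1 w)) (g0 ` ins K s)"

lemma sverts_push [simp]: "sverts (push K L g0 g1 s) = (\<Union>w \<in> sverts s. sverts (g1 w))"
  by (simp add: push_def)

lemma image_restrict:
  assumes g: "gmorphism K L g0 g1" and s: "s \<in> subgraphs K"
  shows "map_image (graph_of K s) L (g0 \<circ> under) g1 = push K L g0 g1 s"
    and "push K L g0 g1 s \<in> subgraphs L"
    and "bij_betw g0 (ins K s) (ins L (push K L g0 g1 s))"
    and "bij_betw g0 (outs K s) (outs L (push K L g0 g1 s))"
proof -
  interpret g: gmorphism K L g0 g1 by fact
  interpret r: gmorphism "graph_of K s" L "g0 \<circ> under" g1 by (rule gmorphism_restrict[OF g s])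
  note bi = bij_inputs_graph_of[OF g.wf_dom s] and bo = bij_outputs_graph_of[OF g.wf_dom s]
  have "under ` inputs (graph_of K s) = ins K s" using bi by (simp add: bij_betw_def)
  then have im: "r.img = push K L g0 g1 s"
    unfolding r.img_def push_def by (simp only: image_comp[symmetric] verts_graph_of)
  show "map_image (graph_of K s) L (g0 \<circ> under) g1 = push K L g0 g1 s"
    using r.map_image_eq im by simp
  show "push K L g0 g1 s \<in> subgraphs L" using r.image_in_subgraphs im by simp
  show "bij_betw g0 (ins K s) (ins L (push K L g0 g1 s))"
    using r.bij_ins_image bij_betw_comp_iff[OF bi, of g0] unfolding im by blast
  show "bij_betw g0 (outs K s) (outs L (push K L g0 g1 s))"
    using r.bij_outs_image bij_betw_comp_iff[OF bo, of g0] unfolding im by blast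
qed

lemma gmorphism_comp:
  assumes f: "gmorphism G K f0 f1" and g: "gmorphism K L g0 g1"
  shows "gmorphism G L (g0 \<circ> f0) (\<lambda>v. push K L g0 g1 (f1 v))"
proof -
  interpret f: gmorphism G K f0 f1 by fact
  interpret g: gmorphism K L g0 g1 by fact
  note im = image_restrict[OF g f.f1]
  show ?thesis
  proof unfold_locales
    show "bij_betw (g0 \<circ> f0) (in_at G v) (ins L (push K L g0 g1 (f1 v)))" if "v \<in> verts G" for v
      by (rule bij_betw_trans[OF f.f_in im(3)]) (use that in auto)
    show "bij_betw (g0 \<circ> f0) (out_at G v) (outs L (push K L g0 g1 (f1 v)))" if "v \<in> verts G" for v
      by (rule bij_betw_trans[OF f.f_out im(4)]) (use that in auto)
    show "sverts (push K L g0 g1 (f1 v)) \<inter> sverts (push K L g0 g1 (f1 v')) = {}"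
      if v: "v \<in> verts G" "v' \<in> verts G" "v \<noteq> v'" for v v'
    proof (rule ccontr)
      assume "\<not> ?thesis"
      then obtain x w w' where x: "w \<in> sverts (f1 v)" "w' \<in> sverts (f1 v')" "x \<in> sverts (g1 w)" "x \<in> sverts (g1 w')" by auto
      then have "w \<in> verts K" "w' \<in> verts K" using sverts_subset[OF f.f1] v by blast+
      then have "w = w'" using g.same_vert x by blast
      then show False using f.same_vert v x by blast
    qed
    show "is_Exc_Loop L" if a: "\<forall>v \<in> verts G. sverts (push K L g0 g1 (f1 v)) = {}" "inputs G \<union> outputs G = {}"
    proof -
      have "ins K f.img = {}" "outs K f.img = {}"
        using a(2) f.bij_ins_image f.bij_outs_image by (auto simp: bij_betw_def)
      note l = legless_subgraph[OF f.wf_cod f.image_in_subgraphs this]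
      then show ?thesis using g.loop a(1) by fastforce
    qed
  qed (use f.wf_dom g.wf_cod f.f0 g.f0 im(2) in auto)
qed

lemma gcomp_eq:
  assumes f: "hom f" and g: "hom g" and c: "gdom g = gcod f"
  shows "gcomp g f = gmap_of (gdom f) (gcod g) (emap g \<circ> emap f)
     (\<lambda>v. push (gcod f) (gcod g) (emap g) (vmap g) (vmap f v))"
proof -
  interpret f: gmorphism "gdom f" "gcod f" "emap f" "vmap f" using hom_gmorphism[OF f] .
  show ?thesis unfolding gcomp_def gmap_of_def
    using image_restrict(1)[OF hom_gmorphism[OF g, unfolded c] f.f1] by (auto simp: restrict_def fun_eq_iff)
qed

lemma hom_gcomp: "hom f \<Longrightarrow> hom g \<Longrightarrow> gdom g = gcod f \<Longrightarrow> hom (gcomp g f)"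
  unfolding gcomp_eq by (rule hom_gmap_of, rule gmorphism_comp) (auto dest: hom_gmorphism)

lemma gcomp_simps [simp]:
  "gdom (gcomp g f) = gdom f" "gcod (gcomp g f) = gcod g"
  "e \<in> edges (gdom f) \<Longrightarrow> emap (gcomp g f) e = emap g (emap f e)"
  by (simp_all add: gcomp_def)

lemma vmap_gcomp:
  assumes "hom f" "hom g" "gdom g = gcod f" "v \<in> verts (gdom f)"
  shows "vmap (gcomp g f) v = push (gcod f) (gcod g) (emap g) (vmap g) (vmap f v)"
  using assms by (simp add: gcomp_eq)

lemma ins_corolla: "wf_graph K \<Longrightarrow> ins K (Sub_Ord {w} {}) = in_at K w"
  and outs_corolla: "wf_graph K \<Longrightarrow> outs K (Sub_Ord {w} {}) = out_at K w"
  by (auto simp: in_at_def out_at_def)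

lemma corolla_subgraph: "w \<in> verts K \<Longrightarrow> Sub_Ord {w} {} \<in> subgraphs K"
  by (auto simp: subgraphs_Ord_iff connected_by_def)

lemma gmorphism_graph_iso:
  assumes iso: "graph_iso \<phi>V \<phi>E G H" and G: "wf_graph G" and H: "wf_graph H"
  shows "gmorphism G H \<phi>E (\<lambda>v. Sub_Ord {\<phi>V v} {})"
proof -
  have V: "bij_betw \<phi>V (verts G) (verts H)" and E: "bij_betw \<phi>E (edges G) (edges H)"
    and st: "\<And>e. e \<in> edges G \<Longrightarrow> src H (\<phi>E e) = map_option \<phi>V (src G e) \<and> tgt H (\<phi>E e) = map_option \<phi>V (tgt G e)"
    using iso by (auto simp: graph_iso_def)
  have vm: "\<phi>V v \<in> verts H" if "v \<in> verts G" for v using V that by (auto simp: bij_betw_def)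
  have vi: "v = v'" if "\<phi>V v = \<phi>V v'" "v \<in> verts G" "v' \<in> verts G" for v v'
    using V that by (auto simp: bij_betw_def dest: inj_onD)
  have es: "\<exists>e \<in> edges G. k = \<phi>E e" if "k \<in> edges H" for k
    using E that by (auto simp: bij_betw_def)
  show ?thesis
  proof unfold_locales
    show "bij_betw \<phi>E (in_at G v) (ins H (Sub_Ord {\<phi>V v} {}))" if v: "v \<in> verts G" for v
      unfolding ins_corolla[OF H]
    proof (rule bij_betw_imageI)
      show "inj_on \<phi>E (in_at G v)"
        by (rule inj_on_subset[OF bij_betw_imp_inj_on[OF E]]) (auto simp: in_at_def)
      show "\<phi>E ` in_at G v = in_at H (\<phi>V v)"
      proof (intro set_eqI iffI)
        fix k assume "k \<in> in_at H (\<phi>V v)"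
        then obtain e where e: "e \<in> edges G" "k = \<phi>E e" "tgt H k = Some (\<phi>V v)"
          using es by (auto simp: in_at_def)
        then obtain v' where "tgt G e = Some v'" "\<phi>V v' = \<phi>V v" using st[OF e(1)] by auto
        then have "tgt G e = Some v" using vi v tgt_Some_vert[OF G] by auto
        then show "k \<in> \<phi>E ` in_at G v" using e by (auto simp: in_at_def)
      qed (use st E in \<open>auto simp: in_at_def bij_betw_def\<close>)
    qed
    show "bij_betw \<phi>E (out_at G v) (outs H (Sub_Ord {\<phi>V v} {}))" if v: "v \<in> verts G" for v
      unfolding outs_corolla[OF H]
    proof (rule bij_betw_imageI)
      show "inj_on \<phi>E (out_at G v)"
        by (rule inj_on_subset[OF bij_betw_imp_inj_on[OF E]]) (auto simp: out_at_def)
      show "\<phi>E ` out_at G v = out_at H (\<phi>V v)"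
      proof (intro set_eqI iffI)
        fix k assume "k \<in> out_at H (\<phi>V v)"
        then obtain e where e: "e \<in> edges G" "k = \<phi>E e" "src H k = Some (\<phi>V v)"
          using es by (auto simp: out_at_def)
        then obtain v' where "src G e = Some v'" "\<phi>V v' = \<phi>V v" using st[OF e(1)] by auto
        then have "src G e = Some v" using vi v src_Some_vert[OF G] by auto
        then show "k \<in> \<phi>E ` out_at G v" using e by (auto simp: out_at_def)
      qed (use st E in \<open>auto simp: out_at_def bij_betw_def\<close>)
    qed
    show "is_Exc_Loop H" if "\<forall>v \<in> verts G. sverts (Sub_Ord {\<phi>V v} {}) = {}" "inputs G \<union> outputs G = {}"
      using that iso G by (cases G) (auto simp: graph_iso_def)
  qed (use G H E vm vi corolla_subgraph[of _ H] in \<open>auto simp: bij_betw_def\<close>)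
qed

lemma graph_iso_id: "graph_iso id id G G"
  by (simp add: graph_iso_def option.map_id)

lemma hom_gid: "wf_graph G \<Longrightarrow> hom (gid G)"
  using hom_gmap_of[OF gmorphism_graph_iso[OF graph_iso_id], of G]
    by (simp add: gid_def gmap_of_def restrict_def cong: if_cong)

lemma gid_simps [simp]:
  "gdom (gid G) = G" "gcod (gid G) = G" "e \<in> edges G \<Longrightarrow> emap (gid G) e = e"
  "v \<in> verts G \<Longrightarrow> vmap (gid G) v = Sub_Ord {v} {}"
  by (simp_all add: gid_def)

lemma hom_edge: "hom f \<Longrightarrow> e \<in> edges (gdom f) \<Longrightarrow> emap f e \<in> edges (gcod f)"
  by (auto simp: hom_def graphical_map_def)

lemma hom_sverts: "hom f \<Longrightarrow> v \<in> verts (gdom f) \<Longrightarrow> sverts (vmap f v) \<subseteq> verts (gcod f)"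
  by (rule sverts_subset) (auto simp: hom_def graphical_map_def)

lemma gcomp_gid_right: "hom f \<Longrightarrow> gcomp f (gid (gdom f)) = f"
proof (rule hom_eqI)
  assume f: "hom f"
  then have w: "hom (gid (gdom f))" by (intro hom_gid) (simp add: hom_def)
  then show "hom (gcomp f (gid (gdom f)))" using f by (intro hom_gcomp) auto
  show "sverts (vmap (gcomp f (gid (gdom f))) v) = sverts (vmap f v)"
    if "v \<in> verts (gdom (gcomp f (gid (gdom f))))" for v
    using that by (simp add: vmap_gcomp[OF w f])
qed auto

lemma gcomp_gid_left: "hom f \<Longrightarrow> gcomp (gid (gcod f)) f = f"
proof (rule hom_eqI)
  assume f: "hom f"
  then have w: "hom (gid (gcod f))" by (intro hom_gid) (simp add: hom_def)
  then show "hom (gcomp (gid (gcod f)) f)" using f by (intro hom_gcomp) auto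
  show "emap (gcomp (gid (gcod f)) f) e = emap f e" if "e \<in> edges (gdom (gcomp (gid (gcod f)) f))" for e
    using that hom_edge[OF f] by simp
  show "sverts (vmap (gcomp (gid (gcod f)) f) v) = sverts (vmap f v)" if "v \<in> verts (gdom (gcomp (gid (gcod f)) f))" for v
  proof -
    have "v \<in> verts (gdom f)" using that by simp
    moreover have "sverts (vmap (gid (gcod f)) w) = {w}" if "w \<in> sverts (vmap f v)" for w
      using hom_sverts[OF f \<open>v \<in> verts (gdom f)\<close>] that by auto
    ultimately show ?thesis by (simp add: vmap_gcomp[OF f w])
  qed
qed auto

lemma gcomp_assoc:
  assumes f: "hom f" and g: "hom g" and h: "hom h" and c: "gdom g = gcod f" "gdom h = gcod g"
  shows "gcomp h (gcomp g f) = gcomp (gcomp h g) f"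
proof (rule hom_eqI)
  have gf: "hom (gcomp g f)" and hg: "hom (gcomp h g)" using assms by (auto intro: hom_gcomp)
  show "hom (gcomp h (gcomp g f))" "hom (gcomp (gcomp h g) f)"
    using gf hg f h c by (auto intro: hom_gcomp)
  show "emap (gcomp h (gcomp g f)) e = emap (gcomp (gcomp h g) f) e" if "e \<in> edges (gdom (gcomp h (gcomp g f)))" for e
    using that hom_edge[OF f] c by simp
  show "sverts (vmap (gcomp h (gcomp g f)) v) = sverts (vmap (gcomp (gcomp h g) f) v)"
    if v: "v \<in> verts (gdom (gcomp h (gcomp g f)))" for v
  proof -
    have v: "v \<in> verts (gdom f)" using v by simp
    have s: "sverts (vmap f v) \<subseteq> verts (gdom g)" using hom_sverts[OF f v] c by simp
    have "sverts (vmap (gcomp h (gcomp g f)) v) = (\<Union>x \<in> (\<Union>w \<in> sverts (vmap f v). sverts (vmap g w)). sverts (vmap h x))"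
      using vmap_gcomp[OF gf h, of v] vmap_gcomp[OF f g c(1) v] c v by simp
    also have "\<dots> = (\<Union>w \<in> sverts (vmap f v). sverts (vmap (gcomp h g) w))"
    proof -
      have "sverts (vmap (gcomp h g) w) = (\<Union>x \<in> sverts (vmap g w). sverts (vmap h x))" if "w \<in> sverts (vmap f v)" for w
        using vmap_gcomp[OF g h c(2), of w] subsetD[OF s that] by simp
      then show ?thesis by simp
    qed
    also have "\<dots> = sverts (vmap (gcomp (gcomp h g) f) v)"
      using vmap_gcomp[OF f hg _ v] c by simp
    finally show ?thesis .
  qed
qed auto

text \<open>
  Both versions of the wheeled graphical category have the same operations and are full on their
  objects, so they are treated together.
\<close>

locale wheeled =
  fixes U :: "('v, 'e) graph set" and \<Gamma> :: "('v, 'e) graph_cat"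
  assumes universe: "graph_universe U"
    and \<Gamma>: "\<Gamma> = wheeled_A U \<or> \<Gamma> = wheeled_B U"
begin

lemma \<Gamma>_simps [simp]: "source \<Gamma> = gdom" "target \<Gamma> = gcod" "ident \<Gamma> = gid" "cmp \<Gamma> = gcomp"
  using \<Gamma> by (auto simp: wheeled_A_def wheeled_B_def full_subcategory_def)

lemma Arr_iff: "f \<in> Arr \<Gamma> \<longleftrightarrow> hom f \<and> gdom f \<in> Obj \<Gamma> \<and> gcod f \<in> Obj \<Gamma>"
  using \<Gamma> universe
  by (auto simp: wheeled_A_def wheeled_B_def full_subcategory_def hom_def graph_universe_def)

lemma Obj_wf: "G \<in> Obj \<Gamma> \<Longrightarrow> wf_graph G"
  using \<Gamma> universe by (auto simp: wheeled_A_def wheeled_B_def full_subcategory_def graph_universe_def)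

lemma Obj_iff: "G \<in> Obj \<Gamma> \<longleftrightarrow> G \<in> U \<and> (\<Gamma> = wheeled_A U \<or> \<not> is_Exc_Loop G)"
proof (cases "\<Gamma> = wheeled_A U")
  case True
  then show ?thesis by (simp add: wheeled_A_def)
next
  case False
  then have "\<Gamma> = wheeled_B U" using \<Gamma> by simp
  then show ?thesis using False by (auto simp: wheeled_B_def wheeled_A_def full_subcategory_def)
qed

sublocale category \<Gamma>
  by unfold_locales
    (auto simp: Arr_iff hom_gid Obj_wf hom_gcomp gcomp_gid_left gcomp_gid_right gcomp_assoc)

end

section \<open>Positive and negative maps\<close>

text \<open>
  The three properties that describe the factorization system: \<open>onto\<close> says that the image of the map
  is its target, since then the vertices and the inputs of the image are those of the target. Below,
  \<open>Gamma_plus\<close> is shown to consist of the positive maps and \<open>Gamma_minus\<close> to consist of negative maps.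
\<close>

definition positive :: "('v, 'e) gmap \<Rightarrow> bool" where
  "positive f \<longleftrightarrow> (\<forall>v \<in> verts (gdom f). \<forall>k. vmap f v \<noteq> Sub_Edge k)"

definition onto :: "('v, 'e) gmap \<Rightarrow> bool" where
  "onto f \<longleftrightarrow> (\<Union>v \<in> verts (gdom f). sverts (vmap f v)) = verts (gcod f) \<and>
     emap f ` inputs (gdom f) \<subseteq> inputs (gcod f)"

definition negative :: "('v, 'e) gmap \<Rightarrow> bool" where
  "negative f \<longleftrightarrow> onto f \<and>
     (\<forall>v \<in> verts (gdom f). (\<exists>k. vmap f v = Sub_Edge k) \<or> (\<exists>w. vmap f v = Sub_Ord {w} {}))"

lemma spanned_Sub_Edge: "spanned K S N = Sub_Edge k \<Longrightarrow> S = {} \<and> N \<noteq> {}"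
  by (auto simp: spanned_def split: if_splits)

lemma push_Sub_Edge [simp]: "push K L g0 g1 (Sub_Edge k) = Sub_Edge (g0 k)"
  by (simp add: push_def spanned_def)

lemma push_corolla:
  assumes "gmorphism K L g0 g1" "w \<in> verts K"
  shows "push K L g0 g1 (Sub_Ord {w} {}) = g1 w"
proof -
  interpret gmorphism K L g0 g1 by fact
  have "spanned L (sverts (g1 w)) (ins L (g1 w)) = g1 w" by (rule spanned_self[OF wf_cod f1[OF assms(2)]])
  moreover have "g0 ` in_at K w = ins L (g1 w)" using f_in[OF assms(2)] by (simp add: bij_betw_def)
  ultimately show ?thesis unfolding push_def ins_corolla[OF wf_dom] by simp
qed

text \<open>
  A vertex is sent by \<open>g f\<close> to the image under \<open>g\<close> of a subgraph that is not an edge. If this image had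
  no vertices, then \<open>g\<close> would send a vertex to the exceptional loop; the domain of \<open>g\<close> would then be a
  vertex without edges, and the image would have no legs.
\<close>

lemma positive_gcomp:
  assumes f: "hom f" "positive f" and g: "hom g" "positive g" and c: "gdom g = gcod f"
  shows "positive (gcomp g f)"
  unfolding positive_def
proof (intro ballI allI notI)
  fix v k assume "v \<in> verts (gdom (gcomp g f))" and e: "vmap (gcomp g f) v = Sub_Edge k"
  then have v: "v \<in> verts (gdom f)" by simp
  interpret f: gmorphism "gdom f" "gcod f" "emap f" "vmap f" using hom_gmorphism[OF f(1)] .
  interpret g: gmorphism "gdom g" "gcod g" "emap g" "vmap g" using hom_gmorphism[OF g(1)] .
  have "(\<Union>w \<in> sverts (vmap f v). sverts (vmap g w)) = {} \<and> emap g ` ins (gcod f) (vmap f v) \<noteq> {}"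
    using e unfolding vmap_gcomp[OF f(1) g(1) c v] push_def by (rule spanned_Sub_Edge)
  then have emp: "\<And>w. w \<in> sverts (vmap f v) \<Longrightarrow> sverts (vmap g w) = {}" and ne: "ins (gcod f) (vmap f v) \<noteq> {}"
    by auto
  obtain S I where s: "vmap f v = Sub_Ord S I" using f(2) v ne by (cases "vmap f v") (auto simp: positive_def)
  then obtain w where w: "w \<in> S" "w \<in> verts (gdom g)"
    using f.f1[OF v] c by (auto simp: subgraphs_Ord_iff)
  have "\<exists>l. vmap g w = Sub_Loop l"
    using g(2) emp[of w] w s sverts_empty_iff[OF g.f1[OF w(2)]] by (auto simp: positive_def)
  then have "is_Exc_Loop (graph_of (gcod g) (vmap g w))" unfolding is_Exc_Loop_graph_of .
  then have "edges (gdom g) = {}" by (rule g.Exc_Loop_alone(2)[OF w(2)])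
  then show False using ne s c by auto
qed

lemma onto_gcomp:
  assumes f: "hom f" "onto f" and g: "hom g" "onto g" and c: "gdom g = gcod f"
  shows "onto (gcomp g f)"
proof -
  have "(\<Union>v \<in> verts (gdom f). sverts (vmap (gcomp g f) v)) =
      (\<Union>w \<in> (\<Union>v \<in> verts (gdom f). sverts (vmap f v)). sverts (vmap g w))"
    using vmap_gcomp[OF f(1) g(1) c] by auto
  also have "(\<Union>v \<in> verts (gdom f). sverts (vmap f v)) = verts (gdom g)"
    using f(2) c by (simp add: onto_def)
  also have "(\<Union>w \<in> verts (gdom g). sverts (vmap g w)) = verts (gcod g)"
    using g(2) by (simp add: onto_def)
  finally have U: "(\<Union>v \<in> verts (gdom f). sverts (vmap (gcomp g f) v)) = verts (gcod g)" .
  have "emap (gcomp g f) e \<in> inputs (gcod g)" if "e \<in> inputs (gdom f)" for e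
  proof -
    have "e \<in> edges (gdom f)" using that inputs_subset[of "gdom f"] by blast
    moreover have "emap f e \<in> inputs (gdom g)" using that f(2) c unfolding onto_def by auto
    moreover then have "emap g (emap f e) \<in> inputs (gcod g)" using g(2) unfolding onto_def by blast
    ultimately show ?thesis by simp
  qed
  then show ?thesis using U by (auto simp: onto_def)
qed

lemma negative_gcomp:
  assumes f: "hom f" "negative f" and g: "hom g" "negative g" and c: "gdom g = gcod f"
  shows "negative (gcomp g f)"
proof -
  have "(\<exists>k. vmap (gcomp g f) v = Sub_Edge k) \<or> (\<exists>w. vmap (gcomp g f) v = Sub_Ord {w} {})"
    if v: "v \<in> verts (gdom f)" for v
  proof -
    note vm = vmap_gcomp[OF f(1) g(1) c v]
    consider k where "vmap f v = Sub_Edge k" | w where "vmap f v = Sub_Ord {w} {}"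
      using f(2) v by (auto simp: negative_def)
    then show ?thesis
    proof cases
      case 2
      then have "w \<in> verts (gdom g)" using hom_sverts[OF f(1) v] c by auto
      then show ?thesis using vm 2 push_corolla[OF hom_gmorphism[OF g(1)], of w] g(2) c
        by (auto simp: negative_def)
    qed (simp add: vm)
  qed
  moreover have "onto (gcomp g f)"
    using f g c by (intro onto_gcomp) (auto simp: negative_def)
  ultimately show ?thesis by (auto simp: negative_def)
qed

section \<open>Positive and negative maps change the degree\<close>

lemma deg_cases:
  assumes "wf_graph G"
  shows "is_Exc_Edge G \<Longrightarrow> deg G = 0" "is_Exc_Loop G \<Longrightarrow> deg G = 2"
    "verts G \<noteq> {} \<Longrightarrow> edges G = {} \<Longrightarrow> deg G = 1 \<and> (\<exists>v. verts G = {v}) \<and> bullet G"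
    "verts G \<noteq> {} \<Longrightarrow> edges G \<noteq> {} \<Longrightarrow> deg G = card (verts G) + card (inner_edges G) + 1"
proof -
  show "is_Exc_Edge G \<Longrightarrow> deg G = 0" by (simp add: deg_def)
  show "is_Exc_Loop G \<Longrightarrow> deg G = 2" by (cases G) (auto simp: deg_def bullet_def)
  show "deg G = card (verts G) + card (inner_edges G) + 1" if "verts G \<noteq> {}" "edges G \<noteq> {}"
    using that by (cases G) (auto simp: deg_def bullet_def)
  assume V: "verts G \<noteq> {}" and E: "edges G = {}"
  obtain v where v: "v \<in> verts G" using V by auto
  have "verts G \<subseteq> {v}" by (rule wf_graph_closed[OF assms v]) (use E src_Some_edge[OF assms] in auto)
  then have "verts G = {v}" using v by auto
  moreover then have "bullet G" using assms E inner_edges_subset[of G] by (auto simp: bullet_def corolla_def)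
  moreover have "\<not> is_Exc_Edge G" using V by (cases G) auto
  ultimately show "deg G = 1 \<and> (\<exists>v. verts G = {v}) \<and> bullet G" by (simp add: deg_def)
qed

lemma deg_pos: "wf_graph G \<Longrightarrow> \<not> is_Exc_Edge G \<Longrightarrow> deg G > 0"
  by (simp add: deg_def)

lemma gmorphism_rev:
  assumes "gmorphism G K f0 f1"
  shows "gmorphism (rev_graph G) (rev_graph K) f0 f1"
proof -
  interpret gmorphism G K f0 f1 by fact
  have s: "s \<in> subgraphs (rev_graph K)" if "s \<in> subgraphs K" for s
    using that by (cases s) (auto simp: subgraphs_Ord_iff connected_by_rev)
  have i: "ins (rev_graph K) s = outs K s" "outs (rev_graph K) s = ins K s" for s by (cases s; simp)+
  show ?thesis
    by unfold_locales (use wf_dom wf_cod f0 f1 s i f_in f_out disjoint loop in \<open>auto simp: Un_commute\<close>)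
qed

context gmorphism
begin

lemma tgt_edge: "tgt G e = Some v \<Longrightarrow> sverts (f1 v) \<noteq> {} \<Longrightarrow> \<exists>w \<in> sverts (f1 v). tgt K (f0 e) = Some w"
proof -
  assume a: "tgt G e = Some v" "sverts (f1 v) \<noteq> {}"
  then have v: "v \<in> verts G" using tgt_Some_vert[OF wf_dom] by auto
  then have "f0 e \<in> ins K (f1 v)" using bij_betwE[OF f_in[OF v]] in_at_iff[OF wf_dom] a by auto
  then show ?thesis using a(2) by (cases "f1 v") auto
qed

lemma tgt_edge_inj:
  assumes "tgt G e = Some v" "tgt G e' = Some v'" "f0 e = f0 e'" "sverts (f1 v) \<noteq> {}" "sverts (f1 v') \<noteq> {}"
  shows "e = e'"
proof -
  have v: "v \<in> verts G" "v' \<in> verts G" using tgt_Some_vert[OF wf_dom] assms by auto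
  obtain w where w: "w \<in> sverts (f1 v)" "tgt K (f0 e) = Some w" using tgt_edge[OF assms(1,4)] by auto
  obtain w' where w': "w' \<in> sverts (f1 v')" "tgt K (f0 e') = Some w'" using tgt_edge[OF assms(2,5)]
    by auto
  have "v = v'" by (rule same_vert[OF v w(1)]) (use w w' assms(3) in simp)
  then have "e \<in> in_at G v" "e' \<in> in_at G v" using assms in_at_iff[OF wf_dom] by auto
  then show ?thesis using inj_onD[OF bij_betw_imp_inj_on[OF f_in[OF v(1)]]] assms(3) by auto
qed

lemma in_edge_surj:
  assumes "tgt K k = Some w" "v \<in> verts G" "f1 v = Sub_Ord S' I'" "w \<in> S'" "k \<notin> I'"
  shows "\<exists>e. tgt G e = Some v \<and> f0 e = k"
proof -
  have "k \<in> ins K (f1 v)" using assms tgt_Some_edge[OF wf_cod] by auto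
  then have "k \<in> f0 ` in_at G v" using f_in[OF assms(2)] by (simp add: bij_betw_def)
  then show ?thesis using in_at_iff[OF wf_dom] by blast
qed

lemmas src_edge = gmorphism.tgt_edge[OF gmorphism_rev[OF gmorphism_axioms], simplified]
  and src_edge_inj = gmorphism.tgt_edge_inj[OF gmorphism_rev[OF gmorphism_axioms], simplified]
  and out_edge_surj = gmorphism.in_edge_surj[OF gmorphism_rev[OF gmorphism_axioms], simplified]

lemma cod_loop_dom: "v \<in> verts G \<Longrightarrow> f1 v = Sub_Loop k \<Longrightarrow> verts G = {v} \<and> edges G = {}"
  using Exc_Loop_alone[of v] by auto

text \<open>
  An edge \<open>f\<^sub>0 e\<close> for an output \<open>e\<close> is an output of the image, thus not an inner edge of it. If it had a
  target, it would be an input of the image, that is, of \<open>K\<close>, so it would have no source.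
\<close>

lemma onto_outputs:
  assumes S: "S = verts K" and i: "f0 ` inputs G \<subseteq> inputs K"
  shows "f0 ` outputs G \<subseteq> outputs K"
proof (cases "verts K = {}")
  case True
  show ?thesis
  proof (cases K)
    case (Exc_Edge k)
    then show ?thesis using f0 outputs_subset[of G] by auto
  next
    case (Exc_Loop k)
    then have "inputs G = {}" using i by auto
    moreover have "subst_verts G P = {}" using subst_verts_empty_iff S True by auto
    ultimately have "outputs G = {}" using leg_exists(1) by fastforce
    then show ?thesis by auto
  qed (use True wf_cod in auto)
next
  case False
  show ?thesis
  proof
    fix k assume "k \<in> f0 ` outputs G"
    then have "k \<in> outs K img" using bij_outs_image by (auto simp: bij_betw_def)
    moreover have "img = Sub_Ord S I" using False S by (simp add: img_def spanned_def I_def)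
    ultimately have k: "k \<in> edges K" "k \<notin> I" "src K k \<in> Some ` S" by auto
    have "tgt K k = None"
    proof (rule ccontr)
      assume "tgt K k \<noteq> None"
      then have "tgt K k \<in> Some ` S" using S tgt_Some_vert[OF wf_cod] by auto
      then have "k \<in> f0 ` inputs G" using k by (auto simp: I_def)
      then have "k \<in> inputs K" using i by blast
      then have "src K k = None" using False by (simp add: inputs_iff)
      then show False using k(3) by auto
    qed
    then show "k \<in> outputs K" using k(1) False by (simp add: outputs_iff)
  qed
qed

end

text \<open>
  If a vertex is sent to the exceptional loop, then the degree increases. Otherwise choosing a
  vertex \<open>\<omega> v\<close> in each \<open>f\<^sub>1 v\<close> embeds the vertices of the domain into those of the target, and
  \<open>f\<^sub>0\<close> embeds the inner edges. If the degrees agree, then both embeddings are bijective. For the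
  vertices this holds for every choice, so all \<open>f\<^sub>1 v\<close> have a single vertex; and no \<open>f\<^sub>1 v\<close> has an inner
  edge, since an inner edge of \<open>f\<^sub>1 v\<close> is not in the image of \<open>f\<^sub>0\<close>.
\<close>

lemma positive_deg:
  assumes f: "hom f" and p: "positive f"
  shows "deg (gdom f) \<le> deg (gcod f) \<and> (deg (gcod f) \<le> deg (gdom f) \<longrightarrow> negative f)"
proof -
  let ?G = "gdom f" and ?K = "gcod f"
  interpret f: gmorphism ?G ?K "emap f" "vmap f" using hom_gmorphism[OF f] .
  note G = f.wf_dom and K = f.wf_cod
  show ?thesis
  proof (cases "verts ?G = {}")
    case True
    show ?thesis
    proof (cases ?G)
      case (Exc_Edge e)
      then have dG: "deg ?G = 0" using deg_cases(1)[OF G] by simp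
      then have "is_Exc_Edge ?K" if "deg ?K \<le> deg ?G" using that deg_pos[OF K] by auto
      moreover have "negative f" if "is_Exc_Edge ?K"
        using that True f.f0 Exc_Edge by (auto simp: negative_def onto_def is_Exc_Edge_def)
      ultimately show ?thesis using dG by simp
    next
      case (Exc_Loop e)
      then have "is_Exc_Loop ?K" using f.loop by auto
      then show ?thesis using Exc_Loop True deg_cases(2)[OF G] deg_cases(2)[OF K]
        by (auto simp: negative_def onto_def is_Exc_Loop_def)
    qed (use True G in auto)
  next
    case VG: False
    then have nG: "\<not> is_Exc_Edge ?G" by (cases ?G) auto
    obtain v0 where v0: "v0 \<in> verts ?G" using VG by auto
    show ?thesis
    proof (cases "verts ?K = {}")
      case True
      have "sverts (vmap f v0) = {}" using hom_sverts[OF f v0] True by auto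
      then obtain k where k: "vmap f v0 = Sub_Loop k"
        using sverts_empty_iff[OF f.f1[OF v0]] p v0 by (auto simp: positive_def)
      then have "edges ?G = {}" "is_Exc_Loop ?K" using f.cod_loop_dom[OF v0] f.f1[OF v0]
        by (auto simp: subgraphs_Ord_iff)
      then show ?thesis using deg_cases(3)[OF G VG] deg_cases(2)[OF K] by auto
    next
      case VK: False
      have ord: "\<exists>S I. vmap f v = Sub_Ord S I \<and> S \<noteq> {}" if v: "v \<in> verts ?G" for v
        using f.f1[OF v] p v VK by (cases "vmap f v") (auto simp: positive_def subgraphs_Ord_iff)
      then have ne: "sverts (vmap f v) \<noteq> {}" if "v \<in> verts ?G" for v using that by fastforce
      then have "\<forall>v \<in> verts ?G. \<exists>w. w \<in> sverts (vmap f v)" by auto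
      then obtain \<omega> where \<omega>: "\<And>v. v \<in> verts ?G \<Longrightarrow> \<omega> v \<in> sverts (vmap f v)" by metis
      have \<omega>_inj: "inj_on \<omega> (verts ?G)" using \<omega> f.same_vert by (metis inj_onI)
      have \<omega>_sub: "\<omega> ` verts ?G \<subseteq> verts ?K" using \<omega> hom_sverts[OF f] by blast
      have cV: "card (verts ?G) \<le> card (verts ?K)"
        by (rule card_inj_on_le[OF \<omega>_inj \<omega>_sub finite_verts[OF K]])
      have e_inj: "inj_on (emap f) (inner_edges ?G)"
      proof (rule inj_onI)
        fix e e' assume "e \<in> inner_edges ?G" "e' \<in> inner_edges ?G" and ee: "emap f e = emap f e'"
        then obtain v v' where "tgt ?G e = Some v" "tgt ?G e' = Some v'"
          using VG by (auto simp: inner_edges_iff)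
        then show "e = e'" using f.tgt_edge_inj[of e v e' v'] ee VK ne tgt_Some_vert[OF G] by blast
      qed
      have e_sub: "emap f ` inner_edges ?G \<subseteq> inner_edges ?K"
      proof
        fix k assume "k \<in> emap f ` inner_edges ?G"
        then obtain e where e: "e \<in> inner_edges ?G" "k = emap f e" by auto
        then obtain u v where "src ?G e = Some u" "tgt ?G e = Some v" using VG by (auto simp: inner_edges_iff)
        then show "k \<in> inner_edges ?K"
          using f.tgt_edge[of e v] f.src_edge[of e u] VK ne tgt_Some_vert[OF G] src_Some_vert[OF G] e
            f.f0[of e] inner_edges_subset[of ?G] by (auto simp: inner_edges_iff[OF VK])
      qed
      have fin: "finite (inner_edges ?K)"
        using finite_edges[OF K] inner_edges_subset[of ?K] finite_subset by blast
      have cE: "card (inner_edges ?G) \<le> card (inner_edges ?K)"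
        by (rule card_inj_on_le[OF e_inj e_sub fin])
      have E: "edges ?G = {}" if "edges ?K = {}" using that f.f0 by auto
      have cards: "deg ?G \<le> deg ?K \<and> (deg ?K \<le> deg ?G \<longrightarrow>
          card (verts ?G) = card (verts ?K) \<and> card (inner_edges ?G) = card (inner_edges ?K))"
      proof (cases "edges ?G = {}")
        case True
        then have dG: "deg ?G = 1" using deg_cases(3)[OF G VG] by simp
        show ?thesis
        proof (cases "edges ?K = {}")
          case K': True
          have "inner_edges ?G = {}" "inner_edges ?K = {}"
            using True K' inner_edges_subset[of ?G] inner_edges_subset[of ?K] by auto
          then show ?thesis using dG deg_cases(3)[OF K VK K'] deg_cases(3)[OF G VG True] by auto
        next
          case False
          have "card (verts ?K) > 0" using VK finite_verts[OF K] by (simp add: card_gt_0_iff)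
          then show ?thesis using dG deg_cases(4)[OF K VK False] by simp
        qed
      next
        case False
        then have "edges ?K \<noteq> {}" using E by auto
        then show ?thesis using cV cE deg_cases(4)[OF K VK] deg_cases(4)[OF G VG False] by auto
      qed
      have "negative f" if "deg ?K \<le> deg ?G"
      proof -
        have "card (\<omega> ` verts ?G) = card (verts ?K)" "card (emap f ` inner_edges ?G) = card (inner_edges ?K)"
          using cards that card_image[OF \<omega>_inj] card_image[OF e_inj] by auto
        then have \<omega>_surj: "\<omega> ` verts ?G = verts ?K" and e_surj: "emap f ` inner_edges ?G = inner_edges ?K"
          using card_subset_eq[OF finite_verts[OF K] \<omega>_sub] card_subset_eq[OF fin e_sub] by auto
        have sv: "sverts (vmap f v) = {\<omega> v}" if v: "v \<in> verts ?G" for v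
        proof -
          have "x = \<omega> v" if x: "x \<in> sverts (vmap f v)" for x
          proof -
            have "x \<in> verts ?K" using x hom_sverts[OF f v] by auto
            then have "x \<in> \<omega> ` verts ?G" using \<omega>_surj by simp
            then obtain v' where v': "v' \<in> verts ?G" "x = \<omega> v'" by blast
            have "v = v'" by (rule f.same_vert[OF v v'(1) x]) (use \<omega> v' in simp)
            then show ?thesis using v' by simp
          qed
          then show ?thesis using \<omega>[OF v] by blast
        qed
        have kI: "\<exists>e v. e \<in> inner_edges ?G \<and> k = emap f e \<and> tgt ?G e = Some v \<and> v \<in> verts ?G \<and> (\<exists>w \<in> sverts (vmap f v). tgt ?K k = Some w) \<and> k \<in> ins ?K (vmap f v)"
          if k: "k \<in> inner_edges ?K" for k
        proof -
          obtain e where e: "e \<in> inner_edges ?G" "k = emap f e" using k e_surj by auto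
          then obtain v where v: "tgt ?G e = Some v" using VG by (auto simp: inner_edges_iff)
          have vG: "v \<in> verts ?G" using v tgt_Some_vert[OF G] by auto
          have "k \<in> ins ?K (vmap f v)" using bij_betwE[OF f.f_in[OF vG]] v e(2) in_at_iff[OF G] by auto
          then show ?thesis using e v vG f.tgt_edge[OF v ne[OF vG]] by blast
        qed
        have "vmap f v = Sub_Ord {\<omega> v} {}" if v: "v \<in> verts ?G" for v
        proof -
          obtain S I where s: "vmap f v = Sub_Ord S I" using ord[OF v] by auto
          have "I = {}"
          proof (rule ccontr)
            assume "I \<noteq> {}"
            then obtain k where k: "k \<in> I" by auto
            have sub: "Sub_Ord S I \<in> subgraphs ?K" using f.f1[OF v] s by simp
            then have "k \<in> inner_edges ?K" using k by (auto simp: subgraphs_Ord_iff)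
            then obtain v' w where v': "v' \<in> verts ?G" "w \<in> sverts (vmap f v')" "tgt ?K k = Some w" "k \<in> ins ?K (vmap f v')"
              using kI by blast
            moreover have "w \<in> sverts (vmap f v)" using subgraph_inner(1)[OF K sub k] v'(3) s by auto
            ultimately have "v = v'" using f.same_vert v by blast
            then show False using v'(4) s k by auto
          qed
          then show ?thesis using s sv[OF v] by auto
        qed
        moreover have "emap f e \<in> inputs ?K" if e: "e \<in> inputs ?G" for e
        proof (rule ccontr)
          assume "emap f e \<notin> inputs ?K"
          have eG: "e \<in> edges ?G" "src ?G e = None" using e VG by (auto simp: inputs_iff)
          then obtain v where v: "tgt ?G e = Some v" using wf_ends[OF G VG eG(1)] by auto
          have vG: "v \<in> verts ?G" using v tgt_Some_vert[OF G] by auto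
          obtain w where w: "w \<in> sverts (vmap f v)" "tgt ?K (emap f e) = Some w"
            using f.tgt_edge[OF v ne[OF vG]] by auto
          have "emap f e \<in> inner_edges ?K"
            using \<open>emap f e \<notin> inputs ?K\<close> f.f0[OF eG(1)] w(2)
            by (auto simp: inner_edges_iff[OF VK] inputs_iff[OF VK])
          then obtain e' v' where e': "e' \<in> inner_edges ?G" "emap f e = emap f e'" "tgt ?G e' = Some v'" "v' \<in> verts ?G"
            using kI by blast
          then have "e = e'" using f.tgt_edge_inj[OF v e'(3,2) ne[OF vG] ne] by auto
          then show False using e'(1) eG by (auto simp: inner_edges_iff[OF VG])
        qed
        ultimately show ?thesis using \<omega>_surj by (auto simp: negative_def onto_def)
      qed
      then show ?thesis using cards by auto
    qed
  qed
qed

section \<open>Negative maps are epimorphisms and lower the degree\<close>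

lemma negative_surj:
  assumes f: "hom f" and n: "negative f"
  shows "emap f ` edges (gdom f) = edges (gcod f)"
proof -
  let ?G = "gdom f" and ?K = "gcod f"
  interpret f: gmorphism ?G ?K "emap f" "vmap f" using hom_gmorphism[OF f] .
  have "edges ?K \<subseteq> emap f ` edges ?G"
  proof (cases "verts ?K = {}")
    case True
    have "edges ?G \<noteq> {}"
    proof (cases "verts ?G = {}")
      case True
      then show ?thesis using f.wf_dom by (cases ?G) auto
    next
      case False
      then obtain v where v: "v \<in> verts ?G" by auto
      have "sverts (vmap f v) = {}" using hom_sverts[OF f v] True by auto
      then obtain k where "vmap f v = Sub_Edge k" using n v by (force simp: negative_def)
      then have "in_at ?G v \<noteq> {}" using f.f_in[OF v] by (auto simp: bij_betw_def)
      then show ?thesis by (auto simp: in_at_def)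
    qed
    then obtain e where "e \<in> edges ?G" by auto
    moreover have "\<exists>k. edges ?K = {k}" using True f.wf_cod by (cases ?K) auto
    ultimately show ?thesis using f.f0 by fastforce
  next
    case False
    have sv: "\<exists>v \<in> verts ?G. vmap f v = Sub_Ord {x} {}" if x: "x \<in> verts ?K" for x
    proof -
      have "f.S = verts ?K" using n by (simp add: negative_def onto_def)
      then obtain v where v: "v \<in> verts ?G" "x \<in> sverts (vmap f v)" using x by blast
      then show ?thesis using n by (fastforce simp: negative_def)
    qed
    show ?thesis
    proof
      fix k assume k: "k \<in> edges ?K"
      consider x where "tgt ?K k = Some x" | x where "src ?K k = Some x"
        using wf_ends[OF f.wf_cod False k] by auto
      then show "k \<in> emap f ` edges ?G"
      proof cases
        case 1
        then obtain v where v: "v \<in> verts ?G" "vmap f v = Sub_Ord {x} {}"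
          using sv tgt_Some_vert[OF f.wf_cod] by meson
        obtain e where "tgt ?G e = Some v" "emap f e = k" using f.in_edge_surj[OF 1 v] by auto
        then show ?thesis using tgt_Some_edge[OF f.wf_dom] by auto
      next
        case 2
        then obtain v where v: "v \<in> verts ?G" "vmap f v = Sub_Ord {x} {}"
          using sv src_Some_vert[OF f.wf_cod] by meson
        obtain e where "src ?G e = Some v" "emap f e = k" using f.out_edge_surj[OF 2 v] by auto
        then show ?thesis using src_Some_edge[OF f.wf_dom] by auto
      qed
    qed
  qed
  then show ?thesis using f.f0 by auto
qed

lemma negative_vertex:
  assumes "hom f" "negative f" "w \<in> verts (gcod f)"
  shows "\<exists>v \<in> verts (gdom f). vmap f v = Sub_Ord {w} {}"
proof -
  have "(\<Union>v \<in> verts (gdom f). sverts (vmap f v)) = verts (gcod f)"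
    using assms(2) by (simp add: negative_def onto_def)
  then obtain v where v: "v \<in> verts (gdom f)" "w \<in> sverts (vmap f v)" using assms(3) by blast
  then consider k where "vmap f v = Sub_Edge k" | w where "vmap f v = Sub_Ord {w} {}"
    using assms(2) by (auto simp: negative_def)
  then show ?thesis using v by cases auto
qed

text \<open>
  Every edge of the target is in the image of \<open>f\<^sub>0\<close>, and every vertex of the target is the image of a
  vertex.
\<close>

lemma negative_epi:
  assumes f: "hom f" "negative f" and g: "hom g" "gdom g = gcod f" and g': "hom g'" "gdom g' = gcod f"
    and eq: "gcomp g f = gcomp g' f"
  shows "g = g'"
proof (rule hom_eqI[OF g(1) g'(1)])
  show "gdom g = gdom g'" using g g' by simp
  show "gcod g = gcod g'" using arg_cong[OF eq, of gcod] by simp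
  show "emap g e = emap g' e" if e: "e \<in> edges (gdom g)" for e
  proof -
    obtain a where "a \<in> edges (gdom f)" "e = emap f a" using e g(2) negative_surj[OF f] by auto
    then show ?thesis using arg_cong[OF eq, of "\<lambda>h. emap h a"] by simp
  qed
  show "sverts (vmap g w) = sverts (vmap g' w)" if w: "w \<in> verts (gdom g)" for w
  proof -
    obtain v where v: "v \<in> verts (gdom f)" "vmap f v = Sub_Ord {w} {}"
      using negative_vertex[OF f] w g by auto
    then show ?thesis using arg_cong[OF eq, of "\<lambda>h. sverts (vmap h v)"]
      by (simp add: vmap_gcomp[OF f(1) g v(1)] vmap_gcomp[OF f(1) g' v(1)])
  qed
qed

text \<open>
  The vertices and the inner edges of the target are images of vertices and inner edges of the
  domain, and a vertex that is sent to an edge reaches no vertex of the target.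
\<close>

lemma negative_deg:
  assumes f: "hom f" and n: "negative f" and np: "\<not> positive f"
  shows "deg (gcod f) < deg (gdom f)"
proof -
  let ?G = "gdom f" and ?K = "gcod f"
  interpret f: gmorphism ?G ?K "emap f" "vmap f" using hom_gmorphism[OF f] .
  note G = f.wf_dom and K = f.wf_cod
  obtain v0 k0 where v0: "v0 \<in> verts ?G" "vmap f v0 = Sub_Edge k0" using np by (auto simp: positive_def)
  then have VG: "verts ?G \<noteq> {}" by auto
  have "in_at ?G v0 \<noteq> {}" using f.f_in[OF v0(1)] v0(2) by (auto simp: bij_betw_def)
  then obtain e0 where e0: "e0 \<in> edges ?G" "tgt ?G e0 = Some v0" by (auto simp: in_at_def)
  then have EG: "edges ?G \<noteq> {}" by auto
  have dG: "deg ?G = card (verts ?G) + card (inner_edges ?G) + 1" by (rule deg_cases(4)[OF G VG EG])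
  have cG: "card (verts ?G) > 0" using VG finite_verts[OF G] by (simp add: card_gt_0_iff)
  have finI: "finite (inner_edges ?G)"
    using finite_edges[OF G] inner_edges_subset[of ?G] finite_subset by blast
  show ?thesis
  proof (cases "verts ?K = {}")
    case True
    show ?thesis
    proof (cases ?K)
      case (Exc_Edge k)
      then show ?thesis using dG deg_cases(1)[OF K] by simp
    next
      case (Exc_Loop k)
      then have "inputs ?G = {}" using n by (auto simp: negative_def onto_def)
      then have "e0 \<in> inner_edges ?G"
        using e0 by (auto simp: inner_edges_iff[OF VG] inputs_iff[OF VG] set_eq_iff)
      then have "card (inner_edges ?G) > 0" using finI by (auto simp: card_gt_0_iff)
      then show ?thesis using dG cG deg_cases(2)[OF K] Exc_Loop by simp
    qed (use True K in auto)
  next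
    case VK: False
    have "verts ?K \<subseteq> (\<lambda>v. the_elem (sverts (vmap f v))) ` (verts ?G - {v0})"
    proof
      fix x assume "x \<in> verts ?K"
      then obtain v where "v \<in> verts ?G" "vmap f v = Sub_Ord {x} {}" using negative_vertex[OF f n] by auto
      then show "x \<in> (\<lambda>v. the_elem (sverts (vmap f v))) ` (verts ?G - {v0})" using v0(2)
        by (intro image_eqI[of _ _ v]) auto
    qed
    then have "card (verts ?K) \<le> card (verts ?G - {v0})"
      using finite_verts[OF G] surj_card_le by blast
    then have cV: "card (verts ?K) < card (verts ?G)" using v0(1) cG finite_verts[OF G] by simp
    have "inner_edges ?K \<subseteq> emap f ` inner_edges ?G"
    proof
      fix k assume k: "k \<in> inner_edges ?K"
      then obtain x where x: "tgt ?K k = Some x" by (auto simp: inner_edges_iff[OF VK])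
      obtain v where v: "v \<in> verts ?G" "vmap f v = Sub_Ord {x} {}"
        using negative_vertex[OF f n] x tgt_Some_vert[OF K] by meson
      obtain e where e: "tgt ?G e = Some v" "emap f e = k" using f.in_edge_surj[OF x v] by auto
      have eG: "e \<in> edges ?G" using e tgt_Some_edge[OF G] by auto
      have "e \<notin> inputs ?G"
        using n e(2) k by (auto simp: negative_def onto_def inner_edges_iff[OF VK] inputs_iff[OF VK])
      then have "e \<in> inner_edges ?G" using e eG by (auto simp: inner_edges_iff[OF VG] inputs_iff[OF VG])
      then show "k \<in> emap f ` inner_edges ?G" using e(2) by auto
    qed
    then have cE: "card (inner_edges ?K) \<le> card (inner_edges ?G)" by (rule surj_card_le[OF finI])
    show ?thesis
    proof (cases "edges ?K = {}")
      case True
      then show ?thesis using deg_cases(3)[OF K VK] dG cG by auto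
    next
      case False
      then show ?thesis using deg_cases(4)[OF K VK] dG cV cE by auto
    qed
  qed
qed

section \<open>Isomorphisms\<close>

lemma positive_negative_graph_iso:
  assumes f: "hom f" and p: "positive f" and n: "negative f"
  shows "\<exists>\<phi>V. graph_iso \<phi>V (emap f) (gdom f) (gcod f) \<and> (\<forall>v \<in> verts (gdom f). vmap f v = Sub_Ord {\<phi>V v} {})"
proof -
  let ?G = "gdom f" and ?K = "gcod f"
  interpret f: gmorphism ?G ?K "emap f" "vmap f" using hom_gmorphism[OF f] .
  note G = f.wf_dom and K = f.wf_cod
  have "\<forall>v \<in> verts ?G. \<exists>w. vmap f v = Sub_Ord {w} {}"
    using p n by (auto simp: positive_def negative_def)
  then obtain \<omega> where \<omega>: "\<And>v. v \<in> verts ?G \<Longrightarrow> vmap f v = Sub_Ord {\<omega> v} {}" by metis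
  have U: "\<omega> ` verts ?G = verts ?K" using n \<omega> by (auto simp: negative_def onto_def)
  have inj: "inj_on \<omega> (verts ?G)" 
  proof (rule inj_onI)
    fix v v' assume v: "v \<in> verts ?G" "v' \<in> verts ?G" "\<omega> v = \<omega> v'"
    show "v = v'" by (rule f.same_vert[OF v(1,2), of "\<omega> v"]) (simp_all add: \<omega>[OF v(1)] \<omega>[OF v(2)] v(3))
  qed
  have surj: "emap f ` edges ?G = edges ?K" by (rule negative_surj[OF f n])
  have i: "emap f ` inputs ?G \<subseteq> inputs ?K" using n by (simp add: negative_def onto_def)
  have o: "emap f ` outputs ?G \<subseteq> outputs ?K"
    by (rule f.onto_outputs) (use n in \<open>simp_all add: negative_def onto_def\<close>)
  have "graph_iso \<omega> (emap f) ?G ?K"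
  proof (cases "verts ?G = {}")
    case True
    then have VK: "verts ?K = {}" using U by auto
    show ?thesis
    proof (cases ?G)
      case (Exc_Edge e)
      then have "is_Exc_Edge ?K" using VK i K by (cases ?K) auto
      then show ?thesis using Exc_Edge surj by (auto simp: graph_iso_def bij_betw_def is_Exc_Edge_def)
    next
      case (Exc_Loop e)
      then have "is_Exc_Loop ?K" using f.loop by auto
      then show ?thesis using Exc_Loop surj by (auto simp: graph_iso_def bij_betw_def is_Exc_Loop_def)
    qed (use True G in auto)
  next
    case VG: False
    then have VK: "verts ?K \<noteq> {}" using U by auto
    have src: "src ?K (emap f e) = map_option \<omega> (src ?G e)" if e: "e \<in> edges ?G" for e
    proof (cases "src ?G e")
      case None
      then have "e \<in> inputs ?G" using e VG by (simp add: inputs_iff)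
      then have "emap f e \<in> inputs ?K" using i by blast
      then show ?thesis using None VK by (simp add: inputs_iff)
    next
      case (Some v)
      then have "v \<in> verts ?G" using src_Some_vert[OF G] by auto
      then show ?thesis using f.src_edge[OF Some] \<omega> Some by auto
    qed
    have tgt: "tgt ?K (emap f e) = map_option \<omega> (tgt ?G e)" if e: "e \<in> edges ?G" for e
    proof (cases "tgt ?G e")
      case None
      then have "e \<in> outputs ?G" using e VG by (simp add: outputs_iff)
      then have "emap f e \<in> outputs ?K" using o by blast
      then show ?thesis using None VK by (simp add: outputs_iff)
    next
      case (Some v)
      then have "v \<in> verts ?G" using tgt_Some_vert[OF G] by auto
      then show ?thesis using f.tgt_edge[OF Some] \<omega> Some by auto
    qed
    have "inj_on (emap f) (edges ?G)"
    proof (rule inj_onI)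
      fix e e' assume e: "e \<in> edges ?G" "e' \<in> edges ?G" "emap f e = emap f e'"
      have ne: "sverts (vmap f v) \<noteq> {}" if "v \<in> verts ?G" for v using \<omega>[OF that] by simp
      consider v where "tgt ?G e = Some v" | v where "src ?G e = Some v" using wf_ends[OF G VG e(1)] by auto
      then show "e = e'"
      proof cases
        case 1
        then obtain v' where v': "tgt ?G e' = Some v'" using tgt[OF e(1)] tgt[OF e(2)] e(3) by auto
        show ?thesis by (rule f.tgt_edge_inj[OF 1 v' e(3) ne ne]) (use 1 v' tgt_Some_vert[OF G] in auto)
      next
        case 2
        then obtain v' where v': "src ?G e' = Some v'" using src[OF e(1)] src[OF e(2)] e(3) by auto
        show ?thesis by (rule f.src_edge_inj[OF 2 v' e(3) ne ne]) (use 2 v' src_Some_vert[OF G] in auto)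
      qed
    qed
    moreover have "is_Exc_Edge ?G = is_Exc_Edge ?K" "is_Exc_Loop ?G = is_Exc_Loop ?K"
      using VG VK by (cases ?G; cases ?K; simp)+
    ultimately show ?thesis using src tgt inj U surj by (auto simp: graph_iso_def bij_betw_def)
  qed
  then show ?thesis using \<omega> by blast
qed

definition iso_map where
  "iso_map \<phi>V \<phi>E G H = gmap_of G H \<phi>E (\<lambda>v. Sub_Ord {\<phi>V v} {})"

lemma iso_map_simps [simp]:
  "gdom (iso_map \<phi>V \<phi>E G H) = G" "gcod (iso_map \<phi>V \<phi>E G H) = H"
  "e \<in> edges G \<Longrightarrow> emap (iso_map \<phi>V \<phi>E G H) e = \<phi>E e"
  "v \<in> verts G \<Longrightarrow> vmap (iso_map \<phi>V \<phi>E G H) v = Sub_Ord {\<phi>V v} {}"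
  by (simp_all add: iso_map_def)

lemma hom_iso_map: "graph_iso \<phi>V \<phi>E G H \<Longrightarrow> wf_graph G \<Longrightarrow> wf_graph H \<Longrightarrow> hom (iso_map \<phi>V \<phi>E G H)"
  unfolding iso_map_def by (intro hom_gmap_of gmorphism_graph_iso)

lemma graph_iso_inv:
  assumes "graph_iso \<phi>V \<phi>E G H" "wf_graph G"
  shows "graph_iso (inv_into (verts G) \<phi>V) (inv_into (edges G) \<phi>E) H G"
proof -
  have V: "bij_betw \<phi>V (verts G) (verts H)" and E: "bij_betw \<phi>E (edges G) (edges H)"
    and st: "\<And>e. e \<in> edges G \<Longrightarrow> src H (\<phi>E e) = map_option \<phi>V (src G e) \<and> tgt H (\<phi>E e) = map_option \<phi>V (tgt G e)"
    using assms by (auto simp: graph_iso_def)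
  have inv: "inv_into (verts G) \<phi>V (\<phi>V v) = v" if "v \<in> verts G" for v
    using V that by (simp add: bij_betw_def)
  have "src G (inv_into (edges G) \<phi>E k) = map_option (inv_into (verts G) \<phi>V) (src H k) \<and>
      tgt G (inv_into (edges G) \<phi>E k) = map_option (inv_into (verts G) \<phi>V) (tgt H k)" if k: "k \<in> edges H" for k
  proof -
    obtain e where e: "e \<in> edges G" "k = \<phi>E e" using k E by (auto simp: bij_betw_def)
    have "inv_into (edges G) \<phi>E k = e" using e E by (simp add: bij_betw_def)
    then show ?thesis using st[OF e(1)] e(2) inv src_Some_vert[OF assms(2)] tgt_Some_vert[OF assms(2)]
      by (cases "src G e"; cases "tgt G e") auto
  qed
  then show ?thesis using assms V E by (auto simp: graph_iso_def bij_betw_inv_into)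
qed

lemma iso_map_inverse:
  assumes iso: "graph_iso \<phi>V \<phi>E G H" and G: "wf_graph G" and H: "wf_graph H"
  defines "f \<equiv> iso_map \<phi>V \<phi>E G H" and "g \<equiv> iso_map (inv_into (verts G) \<phi>V) (inv_into (edges G) \<phi>E) H G"
  shows "gcomp g f = gid G" "gcomp f g = gid H" "hom f" "hom g"
proof -
  show f: "hom f" unfolding f_def by (rule hom_iso_map[OF iso G H])
  show g: "hom g" unfolding g_def by (rule hom_iso_map[OF graph_iso_inv[OF iso G] H G])
  have V: "bij_betw \<phi>V (verts G) (verts H)" and E: "bij_betw \<phi>E (edges G) (edges H)"
    using iso by (auto simp: graph_iso_def)
  have fg: "gdom g = gcod f" "gdom f = gcod g" by (auto simp: f_def g_def iso_map_def)
  have d: "gdom f = G" "gdom g = H" "gcod f = H" "gcod g = G" by (auto simp: f_def g_def iso_map_def)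
  show "gcomp g f = gid G"
  proof (rule hom_eqI)
    show "hom (gcomp g f)" by (rule hom_gcomp[OF f g fg(1)])
    show "hom (gid G)" by (rule hom_gid[OF G])
    show "emap (gcomp g f) e = emap (gid G) e" if "e \<in> edges (gdom (gcomp g f))" for e
      using that E d by (auto simp: f_def g_def iso_map_def bij_betw_def)
    show "sverts (vmap (gcomp g f) v) = sverts (vmap (gid G) v)" if "v \<in> verts (gdom (gcomp g f))" for v
    proof -
      have v: "v \<in> verts (gdom f)" using that by simp
      then have "\<phi>V v \<in> verts H" using V d by (auto simp: bij_betw_def)
      then show ?thesis using V v d unfolding vmap_gcomp[OF f g fg(1) v]
        by (simp add: f_def g_def iso_map_def bij_betw_def)
    qed
  qed (simp_all add: d)
  show "gcomp f g = gid H"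
  proof (rule hom_eqI)
    show "hom (gcomp f g)" by (rule hom_gcomp[OF g f fg(2)])
    show "hom (gid H)" by (rule hom_gid[OF H])
    show "emap (gcomp f g) e = emap (gid H) e" if "e \<in> edges (gdom (gcomp f g))" for e
      using that E d bij_betw_inv_into_right[OF E, of e] bij_betwE[OF bij_betw_inv_into[OF E]]
      by (auto simp: f_def g_def iso_map_def)
    show "sverts (vmap (gcomp f g) v) = sverts (vmap (gid H) v)" if "v \<in> verts (gdom (gcomp f g))" for v
    proof -
      have v: "v \<in> verts (gdom g)" using that by simp
      then have "inv_into (verts G) \<phi>V v \<in> verts G" "\<phi>V (inv_into (verts G) \<phi>V v) = v"
        using d bij_betw_inv_into_right[OF V, of v] bij_betwE[OF bij_betw_inv_into[OF V]] by auto
      then show ?thesis using v d unfolding vmap_gcomp[OF g f fg(2) v] by (simp add: f_def g_def iso_map_def)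
    qed
  qed (simp_all add: d)
qed

section \<open>Factoring through negative maps\<close>

context gmorphism
begin

text \<open>
  An edge \<open>k\<close> of \<open>K\<close> has an end, say a target. Then every class over \<open>k\<close> has a target, since outputs
  of \<open>G\<close> are sent to outputs of \<open>K\<close>; so there is only one such class by \<open>target_in_cong\<close>.
\<close>

lemma onto_kernel:
  assumes S: "S = verts K" and i: "f0 ` inputs G \<subseteq> inputs K"
    and e: "e \<in> edges G" "e' \<in> edges G" "f0 e = f0 e'"
  shows "cls (Inl e) = cls (Inl e')"
proof -
  have c: "Inl e \<in> cells" "Inl e' \<in> cells" using e by (auto simp: cells_def)
  show ?thesis
  proof (cases "verts K = {}")
    case True
    then have "subst_verts G P = {}" using S subst_verts_empty_iff by auto
    then show ?thesis using one_class c by blast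
  next
    case False
    then have ne: "S \<noteq> {}" using S by simp
    have o: "f0 ` outputs G \<subseteq> outputs K" by (rule onto_outputs[OF S i])
    consider x where "tgt K (f0 e) = Some x" | x where "src K (f0 e) = Some x"
      using wf_ends[OF wf_cod False f0[OF e(1)]] by auto
    then show ?thesis
    proof cases
      case 1
      have t: "\<exists>v d w. target_in (Inl a) v d w" if a: "Inl a \<in> cells" "f0 a = f0 e" for a
      proof (rule target_cases[OF a(1) ne])
        fix b assume "b \<in> outputs G" "Inl b \<in> cls (Inl a)"
        then have "f0 e \<in> outputs K" using canonical_cls[of "Inl b" "Inl a"] o a(2) by auto
        then show ?thesis using 1 False by (simp add: outputs_iff)
      qed auto
      then show ?thesis using target_in_cong[of "Inl e" _ _ _ "Inl e'"] c e(3) by force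
    next
      case 2
      have t: "\<exists>v d w. source_in (Inl a) v d w" if a: "Inl a \<in> cells" "f0 a = f0 e" for a
      proof (rule source_cases[OF a(1) ne])
        fix b assume "b \<in> inputs G" "Inl b \<in> cls (Inl a)"
        then have "f0 e \<in> inputs K" using canonical_cls[of "Inl b" "Inl a"] i a(2) by auto
        then show ?thesis using 2 False by (simp add: inputs_iff)
      qed auto
      then show ?thesis using source_in_cong[of "Inl e" _ _ _ "Inl e'"] c e(3) by force
    qed
  qed
qed

end

text \<open>
  By \<open>onto_kernel\<close>, \<open>h\<^sub>0\<close> identifies two edges only if they are joined by a chain of vertices that \<open>h\<close>
  sends to edges. The map \<open>f\<close> identifies the two edges at each of these vertices as well, so \<open>f\<^sub>0\<close>
  factors through \<open>h\<^sub>0\<close>. On a vertex \<open>w\<close> of the target of \<open>h\<close>, the factor has the value of \<open>f\<close> at the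
  unique vertex that \<open>h\<close> sends to the corolla of \<open>w\<close>.
\<close>

lemma factor_through_negative:
  assumes h: "hom h" "negative h" and f: "hom f" and d: "gdom f = gdom h"
    and deg: "\<And>v k. v \<in> verts (gdom h) \<Longrightarrow> vmap h v = Sub_Edge k \<Longrightarrow> \<exists>k'. vmap f v = Sub_Edge k'"
  shows "\<exists>g. hom g \<and> gdom g = gcod h \<and> gcod g = gcod f \<and> gcomp g h = f"
proof -
  let ?G = "gdom h" and ?H = "gcod h" and ?K = "gcod f"
  interpret h: gmorphism ?G ?H "emap h" "vmap h" using hom_gmorphism[OF h(1)] .
  interpret f: gmorphism ?G ?K "emap f" "vmap f" using hom_gmorphism[OF f] unfolding d .
  have onto: "h.S = verts ?H" "emap h ` inputs ?G \<subseteq> inputs ?H"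
    using h(2) by (auto simp: negative_def onto_def)
  (* the edge of G at which a cell is glued gives an extension of the edge map of f to all legs
     of the substituted graphs *)
  define \<kappa> where "\<kappa> x = (case x of Inl e \<Rightarrow> emap f e | Inr (v, d) \<Rightarrow>
      if d \<in> inputs (graph_of ?H (vmap h v)) then emap f (inv_into (in_at ?G v) (h.in_leg v) d)
      else emap f (inv_into (out_at ?G v) (h.out_leg v) d))" for x
  have up: "\<kappa> x = \<kappa> y" if "(x, y) \<in> h.upstream" for x y
  proof -
    from that consider v e where "v \<in> verts ?G" "e \<in> in_at ?G v" "x = Inr (v, h.in_leg v e)" "y = Inl e"
      | v e where "v \<in> verts ?G" "e \<in> out_at ?G v" "x = Inl e" "y = Inr (v, h.out_leg v e)"
      unfolding h.upstream_def by blast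
    then show ?thesis
    proof cases
      case 1
      then show ?thesis using bij_betwE[OF h.bij_in_leg[OF 1(1)]] bij_betw_inv_into_left[OF h.bij_in_leg[OF 1(1)] 1(2)]
        by (auto simp: \<kappa>_def)
    next
      case 2
      note l = bij_betw_inv_into_left[OF h.bij_out_leg[OF 2(1)] 2(2)]
      show ?thesis
      proof (cases "h.out_leg v e \<in> inputs (graph_of ?H (vmap h v))")
        case True
        have "h.out_leg v e \<in> outputs (graph_of ?H (vmap h v))"
          using bij_betwE[OF h.bij_out_leg[OF 2(1)]] 2(2) by auto
        then have "is_Exc_Edge (graph_of ?H (vmap h v))" using inputs_outputs_Exc_Edge[OF h.wfP[OF 2(1)] True]
          by simp
        then obtain k' where k': "vmap f v = Sub_Edge k'"
          using deg[OF 2(1)] unfolding is_Exc_Edge_graph_of by auto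
        have "inv_into (in_at ?G v) (h.in_leg v) (h.out_leg v e) \<in> in_at ?G v"
          using bij_betwE[OF bij_betw_inv_into[OF h.bij_in_leg[OF 2(1)]]] True by auto
        then have "emap f (inv_into (in_at ?G v) (h.in_leg v) (h.out_leg v e)) = k'" "emap f e = k'"
          using bij_betwE[OF f.f_in[OF 2(1)]] bij_betwE[OF f.f_out[OF 2(1)]] 2(2) k' by auto
        then show ?thesis using True 2 by (simp add: \<kappa>_def)
      qed (use 2 l in \<open>simp add: \<kappa>_def\<close>)
    qed
  qed
  have \<kappa>: "\<kappa> y = \<kappa> x" if "y \<in> h.cls x" for x y
    using that unfolding h.cls_iff by (induction rule: rtrancl_induct) (auto dest: up)
  have ker: "emap f e = emap f e'" if "e \<in> edges ?G" "e' \<in> edges ?G" "emap h e = emap h e'" for e e'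
    using \<kappa>[of "Inl e'" "Inl e"] h.onto_kernel[OF onto that]
      by (simp add: \<kappa>_def h.cls_eq_iff[symmetric])
  define g0 where "g0 k = emap f (SOME e. e \<in> edges ?G \<and> emap h e = k)" for k
  define g1 where "g1 w = vmap f (SOME v. v \<in> verts ?G \<and> vmap h v = Sub_Ord {w} {})" for w
  have g0: "g0 (emap h e) = emap f e" if e: "e \<in> edges ?G" for e
  proof -
    have "(SOME a. a \<in> edges ?G \<and> emap h a = emap h e) \<in> edges ?G \<and> emap h (SOME a. a \<in> edges ?G \<and> emap h a = emap h e) = emap h e"
      by (rule someI[of _ e]) (use e in simp)
    then show ?thesis unfolding g0_def using ker e by blast
  qed
  have g1: "g1 w = vmap f v" if v: "v \<in> verts ?G" "vmap h v = Sub_Ord {w} {}" for v w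
  proof -
    let ?v = "SOME v. v \<in> verts ?G \<and> vmap h v = Sub_Ord {w} {}"
    have "?v \<in> verts ?G \<and> vmap h ?v = Sub_Ord {w} {}" by (rule someI[of _ v]) (use v in simp)
    then have "?v = v" using h.same_vert[of ?v v w] v by simp
    then show ?thesis unfolding g1_def by simp
  qed
  have vert: "\<exists>v \<in> verts ?G. vmap h v = Sub_Ord {w} {} \<and> g1 w = vmap f v" if "w \<in> verts ?H" for w
    using negative_vertex[OF h that] g1 by auto
  have gm: "gmorphism ?H ?K g0 g1"
  proof unfold_locales
    show "wf_graph ?H" "wf_graph ?K" by (rule h.wf_cod, rule f.wf_cod)
    show "g0 k \<in> edges ?K" if "k \<in> edges ?H" for k
    proof -
      have "k \<in> emap h ` edges ?G" using that negative_surj[OF h] by simp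
      then obtain e where "e \<in> edges ?G" "k = emap h e" by blast
      then show ?thesis using g0[of e] f.f0[of e] by simp
    qed
    show "g1 w \<in> subgraphs ?K" if "w \<in> verts ?H" for w using vert[OF that] f.f1 by auto
    show "bij_betw g0 (in_at ?H w) (ins ?K (g1 w))" if w: "w \<in> verts ?H" for w
    proof -
      obtain v where v: "v \<in> verts ?G" "vmap h v = Sub_Ord {w} {}" "g1 w = vmap f v" using vert[OF w]
        by auto
      have b: "bij_betw (emap h) (in_at ?G v) (in_at ?H w)" using h.f_in[OF v(1)] v(2) ins_corolla[OF h.wf_cod]
        by simp
      have "bij_betw (g0 \<circ> emap h) (in_at ?G v) (ins ?K (g1 w))"
        using f.f_in[OF v(1)] v(3) bij_betw_cong[of "in_at ?G v" "g0 \<circ> emap h" "emap f"] g0 by (auto simp: in_at_def)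
      then show ?thesis using bij_betw_comp_iff[OF b] by blast
    qed
    show "bij_betw g0 (out_at ?H w) (outs ?K (g1 w))" if w: "w \<in> verts ?H" for w
    proof -
      obtain v where v: "v \<in> verts ?G" "vmap h v = Sub_Ord {w} {}" "g1 w = vmap f v" using vert[OF w]
        by auto
      have b: "bij_betw (emap h) (out_at ?G v) (out_at ?H w)"
        using h.f_out[OF v(1)] v(2) outs_corolla[OF h.wf_cod] by simp
      have "bij_betw (g0 \<circ> emap h) (out_at ?G v) (outs ?K (g1 w))"
        using f.f_out[OF v(1)] v(3) bij_betw_cong[of "out_at ?G v" "g0 \<circ> emap h" "emap f"] g0 by (auto simp: out_at_def)
      then show ?thesis using bij_betw_comp_iff[OF b] by blast
    qed
    show "sverts (g1 w) \<inter> sverts (g1 w') = {}" if w: "w \<in> verts ?H" "w' \<in> verts ?H" "w \<noteq> w'" for w w'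
    proof -
      obtain v v' where v: "v \<in> verts ?G" "vmap h v = Sub_Ord {w} {}" "g1 w = vmap f v"
        "v' \<in> verts ?G" "vmap h v' = Sub_Ord {w'} {}" "g1 w' = vmap f v'" using vert w by meson
      then have "v \<noteq> v'" using w(3) by auto
      then show ?thesis using f.disjoint v by simp
    qed
    show "is_Exc_Loop ?K" if a: "\<forall>w \<in> verts ?H. sverts (g1 w) = {}" "inputs ?H \<union> outputs ?H = {}"
    proof (rule f.loop)
      show "\<forall>v \<in> verts ?G. sverts (vmap f v) = {}"
      proof
        fix v assume v: "v \<in> verts ?G"
        then consider k where "vmap h v = Sub_Edge k" | w where "vmap h v = Sub_Ord {w} {}"
          using h(2) by (auto simp: negative_def)
        then show "sverts (vmap f v) = {}"
        proof cases
          case 1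
          then show ?thesis using deg[OF v] by auto
        next
          case 2
          then have "w \<in> verts ?H" using hom_sverts[OF h(1) v] by auto
          then show ?thesis using a(1) g1[OF v 2] by auto
        qed
      qed
      show "inputs ?G \<union> outputs ?G = {}" using a(2) onto h.onto_outputs[OF onto] by auto
    qed
  qed
  define g where "g = gmap_of ?H ?K g0 g1"
  have g: "hom g" unfolding g_def by (rule hom_gmap_of[OF gm])
  have dg: "gdom g = ?H" "gcod g = ?K" by (simp_all add: g_def)
  have "gcomp g h = f"
  proof (rule hom_eqI[OF hom_gcomp[OF h(1) g dg(1)] f])
    show "emap (gcomp g h) e = emap f e" if "e \<in> edges (gdom (gcomp g h))" for e
      using that g0 h.f0 by (simp add: g_def)
    show "sverts (vmap (gcomp g h) v) = sverts (vmap f v)" if "v \<in> verts (gdom (gcomp g h))" for v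
    proof -
      have v: "v \<in> verts ?G" using that by simp
      then consider k where "vmap h v = Sub_Edge k" | w where "vmap h v = Sub_Ord {w} {}"
        using h(2) by (auto simp: negative_def)
      then show ?thesis
      proof cases
        case 1
        then show ?thesis using deg[OF v 1] by (auto simp: vmap_gcomp[OF h(1) g dg(1) v])
      next
        case 2
        then have "w \<in> verts ?H" using hom_sverts[OF h(1) v] by auto
        then have "vmap g w = vmap f v" using g1[OF v 2] by (simp add: g_def)
        then show ?thesis using 2 by (simp add: vmap_gcomp[OF h(1) g dg(1) v])
      qed
    qed
  qed (use d dg in auto)
  then show ?thesis using g dg by blast
qed

section \<open>Coface and codegeneracy maps are positive and negative\<close>

text \<open>
  The legs of a substituted graph are those of \<open>G\<close> (\<open>src_end_None\<close>), which gives the condition on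
  inputs; the rest is visible in the values on vertices.
\<close>

lemma codegeneracy_negative:
  fixes f :: "('a, 'b) gmap"
  assumes f: "hom f" and c: "codegeneracy f"
  shows "negative f"
proof -
  let ?G = "gdom f" and ?K = "gcod f"
  obtain v and P :: "'a \<Rightarrow> ('a, 'b) graph" and bi bo \<phi>V \<phi>E where v: "v \<in> verts ?G" "subst_data ?G P bi bo" "is_Exc_Edge (P v)"
      "\<forall>w \<in> verts ?G - {v}. corolla (P w)" and iso: "graph_iso \<phi>V \<phi>E (graph_subst ?G P bi bo) ?K"
      and em: "emap f = (\<lambda>e \<in> edges ?G. \<phi>E (glue_class ?G bi bo (Inl e)))"
      and vm: "vmap f = (\<lambda>w \<in> verts ?G. placed ?G P bi bo \<phi>V \<phi>E w)"
    using c unfolding codegeneracy_def substitution_map_def by blast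
  interpret f: gmorphism ?G ?K "emap f" "vmap f" using hom_gmorphism[OF f] .
  interpret s: substitution ?G P bi bo by unfold_locales (use f.wf_dom v in auto)
  have vw: "((\<exists>k. vmap f w = Sub_Edge k) \<or> (\<exists>x. vmap f w = Sub_Ord {x} {})) \<and>
      sverts (vmap f w) = (\<lambda>x. \<phi>V (w, x)) ` verts (P w)" if w: "w \<in> verts ?G" for w
  proof (cases "w = v")
    case True
    then show ?thesis using v w vm by (auto simp: placed_def Let_def is_Exc_Edge_def)
  next
    case False
    then have "corolla (P w)" using v w by auto
    then obtain V E s t x where "P w = Ordinary V E s t" "V = {x}" "inner_edges (P w) = {}"
      by (cases "P w") (auto simp: corolla_def)
    then show ?thesis using w vm by (auto simp: placed_def Let_def)
  qed
  have "(\<Union>w \<in> verts ?G. sverts (vmap f w)) = \<phi>V ` subst_verts ?G P"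
    using vw by (auto simp: subst_verts_def image_iff Bex_def)
  also have "\<dots> = verts ?K"
  proof -
    have "verts (graph_subst ?G P bi bo) = subst_verts ?G P" by (auto simp: graph_subst_def)
    then show ?thesis using iso by (auto simp: graph_iso_def bij_betw_def)
  qed
  finally have U: "(\<Union>w \<in> verts ?G. sverts (vmap f w)) = verts ?K" .
  have "emap f e \<in> inputs ?K" if e: "e \<in> inputs ?G" for e
  proof -
    have eG: "e \<in> edges ?G" using e inputs_subset[of ?G] by blast
    have eK: "emap f e \<in> edges ?K" using f.f0[OF eG] .
    show ?thesis
    proof (cases "subst_verts ?G P = {}")
      case True
      have "inputs ?G \<union> outputs ?G \<noteq> {}" using e by auto
      then have "is_Exc_Edge (graph_subst ?G P bi bo)" using True by (simp add: graph_subst_def)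
      then have "is_Exc_Edge ?K" using iso by (simp add: graph_iso_def)
      then show ?thesis using eK by (auto simp: is_Exc_Edge_def)
    next
      case False
      have c: "Inl e \<in> s.cells" using eG by (auto simp: s.cells_def)
      have "src ?K (\<phi>E (s.cls (Inl e))) = map_option \<phi>V (subst_end src ?G P bi bo (s.cls (Inl e)))"
        using iso False c by (auto simp: graph_iso_def graph_subst_def s.subst_edges_eq)
      then have "src ?K (emap f e) = None" using s.src_end_None[OF s.cls_refl e] em eG by simp
      moreover have "verts ?K \<noteq> {}"
        using iso False by (auto simp: graph_iso_def graph_subst_def bij_betw_def)
      ultimately show ?thesis using eK by (simp add: inputs_iff)
    qed
  qed
  then show ?thesis using U vw by (auto simp: negative_def onto_def)
qed

lemma coface_positive:
  fixes f :: "('a, 'b) gmap"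
  assumes "hom f" "inner_coface f \<or> outer_coface f \<or> exceptional_coface f"
  shows "positive f"
  using assms(2)
proof (elim disjE)
  assume "inner_coface f"
  then obtain v and P :: "'a \<Rightarrow> ('a, 'b) graph" and bi bo \<phi>V \<phi>E where v: "v \<in> verts (gdom f)" "dioperadic (P v) \<or> contracted_corolla (P v)"
      "\<forall>w \<in> verts (gdom f) - {v}. corolla (P w)"
      and vm: "vmap f = (\<lambda>w \<in> verts (gdom f). placed (gdom f) P bi bo \<phi>V \<phi>E w)"
    unfolding inner_coface_def substitution_map_def by blast
  have "is_Ordinary (P w)" if "w \<in> verts (gdom f)" for w
    using v that is_Ordinary_iff[of "P w"]
    by (cases "w = v") (auto simp: dioperadic_def contracted_corolla_def corolla_def)
  then show ?thesis using vm by (auto simp: positive_def placed_def Let_def is_Ordinary_def split: graph.splits) (metis graph.distinct(3) graph.distinct(5))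
next
  assume "outer_coface f"
  then obtain \<phi>V :: "'a \<times> 'a \<Rightarrow> 'a" and v where "vmap f = (\<lambda>w \<in> verts (gdom f). Sub_Ord {\<phi>V (v, w)} {})"
    unfolding outer_coface_def by blast
  then show ?thesis by (simp add: positive_def)
next
  assume "exceptional_coface f"
  then show ?thesis by (auto simp: positive_def exceptional_coface_def)
qed

section \<open>Copies of graphs\<close>

lemma graph_iso_trans:
  assumes "graph_iso \<phi>V \<phi>E G H" "graph_iso \<psi>V \<psi>E H K"
  shows "graph_iso (\<psi>V \<circ> \<phi>V) (\<psi>E \<circ> \<phi>E) G K"
proof -
  have b: "bij_betw (\<psi>V \<circ> \<phi>V) (verts G) (verts K)" "bij_betw (\<psi>E \<circ> \<phi>E) (edges G) (edges K)"
    using assms by (auto simp: graph_iso_def intro: bij_betw_trans)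
  have "\<phi>E e \<in> edges H" if "e \<in> edges G" for e
    using assms(1) that by (auto simp: graph_iso_def dest: bij_betwE)
  then show ?thesis using assms b by (simp add: graph_iso_def option.map_comp)
qed

lemma graph_iso_kinds:
  assumes iso: "graph_iso \<phi>V \<phi>E G H"
  shows "bij_betw \<phi>E (inputs G) (inputs H)" "bij_betw \<phi>E (outputs G) (outputs H)"
    "bij_betw \<phi>E (inner_edges G) (inner_edges H)"
proof -
  have E: "inj_on \<phi>E (edges G)" "\<phi>E ` edges G = edges H"
    and st: "\<And>e. e \<in> edges G \<Longrightarrow> src H (\<phi>E e) = map_option \<phi>V (src G e) \<and> tgt H (\<phi>E e) = map_option \<phi>V (tgt G e)"
    and k: "is_Exc_Edge G \<longleftrightarrow> is_Exc_Edge H" "is_Exc_Loop G \<longleftrightarrow> is_Exc_Loop H"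
    using iso by (auto simp: graph_iso_def bij_betw_def)
  have inj: "inj_on \<phi>E (inputs G)" "inj_on \<phi>E (outputs G)" "inj_on \<phi>E (inner_edges G)"
    using inj_on_subset[OF E(1)] inputs_subset[of G] outputs_subset[of G] inner_edges_subset[of G] by auto
  have "\<phi>E ` inputs G = inputs H \<and> \<phi>E ` outputs G = outputs H \<and> \<phi>E ` inner_edges G = inner_edges H"
  proof (cases G)
    case (Ordinary V A s t)
    then obtain V' A' s' t' where H: "H = Ordinary V' A' s' t'" using k by (cases H) auto
    have A': "A' = \<phi>E ` A" using E(2) Ordinary H by simp
    have st: "s' (\<phi>E e) = map_option \<phi>V (s e)" "t' (\<phi>E e) = map_option \<phi>V (t e)" if "e \<in> A" for e
      using st[of e] that Ordinary H by auto
    have im: "\<phi>E ` {e \<in> A. p e} = {k \<in> \<phi>E ` A. q k}" if "\<And>e. e \<in> A \<Longrightarrow> q (\<phi>E e) = p e" for p q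
      using that by blast
    show ?thesis unfolding Ordinary H A' inputs.simps outputs.simps inner_edges.simps
      by (intro conjI im) (simp_all add: st)
  qed (use k E in \<open>auto simp: is_Exc_Edge_def is_Exc_Loop_def\<close>)
  then show "bij_betw \<phi>E (inputs G) (inputs H)" "bij_betw \<phi>E (outputs G) (outputs H)"
    "bij_betw \<phi>E (inner_edges G) (inner_edges H)"
    using inj by (auto simp: bij_betw_def)
qed

lemma relabel:
  fixes G :: "('v, 'e) graph" and g :: "'v \<Rightarrow> 'x" and h :: "'e \<Rightarrow> 'y"
  assumes wf: "wf_graph G" and g: "inj_on g (verts G)" and h: "inj_on h (edges G)"
  shows "\<exists>H. wf_graph H \<and> graph_iso g h G H"
proof (cases G)
  case (Exc_Edge e)
  then show ?thesis by (intro exI[of _ "Exc_Edge (h e)"]) (simp add: graph_iso_def bij_betw_def)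
next
  case (Exc_Loop e)
  then show ?thesis by (intro exI[of _ "Exc_Loop (h e)"]) (simp add: graph_iso_def bij_betw_def)
next
  case (Ordinary V E s t)
  let ?i = "inv_into E h"
  define s' where "s' k = (if k \<in> h ` E then map_option g (s (?i k)) else None)" for k
  define t' where "t' k = (if k \<in> h ` E then map_option g (t (?i k)) else None)" for k
  have s': "s' (h e) = map_option g (s e)" and t': "t' (h e) = map_option g (t e)" if "e \<in> E" for e
    using that h Ordinary by (auto simp: s'_def t'_def)
  have wf': "finite V" "V \<noteq> {}" "finite E" "dom s \<union> dom t = E" "ran s \<subseteq> V" "ran t \<subseteq> V"
    using wf Ordinary by auto
  let ?H = "Ordinary (g ` V) (h ` E) s' t'"
  have "graph_iso g h G ?H"
    using Ordinary s' t' g h by (auto simp: graph_iso_def bij_betw_def)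
  moreover have "wf_graph ?H"
  proof -
    have dom: "dom s' \<union> dom t' = h ` E"
    proof
      show "dom s' \<union> dom t' \<subseteq> h ` E" by (auto simp: s'_def t'_def split: if_splits)
      show "h ` E \<subseteq> dom s' \<union> dom t'"
      proof
        fix k assume "k \<in> h ` E"
        then obtain e where e: "e \<in> E" "k = h e" by auto
        then have "s e \<noteq> None \<or> t e \<noteq> None" using wf'(4) by auto
        then show "k \<in> dom s' \<union> dom t'" using s'[OF e(1)] t'[OF e(1)] e(2) by auto
      qed
    qed
    have ran: "ran s' \<subseteq> g ` V" "ran t' \<subseteq> g ` V"
      using s' t' wf'(5,6) by (auto simp: ran_def s'_def t'_def split: if_splits)
    have "connected_by ?H (g ` V) (inner_edges ?H)"
      unfolding connected_by_iff_closed
    proof (intro allI impI)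
      fix T assume T: "T \<inter> g ` V \<noteq> {}"
        and cl: "\<forall>k \<in> inner_edges ?H. \<forall>u w. src ?H k = Some u \<longrightarrow> tgt ?H k = Some w \<longrightarrow> (u \<in> T \<longleftrightarrow> w \<in> T)"
      obtain v where v: "v \<in> V" "g v \<in> T" using T by auto
      have "verts G \<subseteq> {x. g x \<in> T}"
      proof (rule wf_graph_closed[OF wf, of v])
        fix e u w assume e: "src G e = Some u" "tgt G e = Some w"
        then have eE: "e \<in> E" using src_Some_edge[OF wf] Ordinary by fastforce
        then have "h e \<in> inner_edges ?H" "src ?H (h e) = Some (g u)" "tgt ?H (h e) = Some (g w)"
          using s'[OF eE] t'[OF eE] e Ordinary by auto
        then show "u \<in> {x. g x \<in> T} \<longleftrightarrow> w \<in> {x. g x \<in> T}" using cl by blast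
      qed (use v Ordinary in auto)
      then show "g ` V \<subseteq> T" using Ordinary by auto
    qed
    then show ?thesis using wf' dom ran by simp
  qed
  ultimately show ?thesis by blast
qed

text \<open>
  A finite graph over any types of vertices and edges is isomorphic to one over the natural numbers.
\<close>

lemma universe_copy:
  fixes U :: "('v, 'e) graph set" and H :: "('x, 'y) graph"
  assumes U: "graph_universe U" and H: "wf_graph H"
  shows "\<exists>G \<in> U. wf_graph G \<and> (\<exists>\<phi>V \<phi>E. graph_iso \<phi>V \<phi>E H G)"
proof -
  obtain g :: "'x \<Rightarrow> nat" where g: "inj_on g (verts H)"
    using finite_imp_inj_to_nat_seg[OF finite_verts[OF H]] by blast
  obtain h :: "'y \<Rightarrow> nat" where h: "inj_on h (edges H)"
    using finite_imp_inj_to_nat_seg[OF finite_edges[OF H]] by blast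
  obtain N where N: "wf_graph N" "graph_iso g h H N" using relabel[OF H g h] by auto
  obtain G \<phi>V \<phi>E where "G \<in> U" "graph_iso \<phi>V \<phi>E N G"
    using U N(1) unfolding graph_universe_def by blast
  moreover then have "wf_graph G" using U unfolding graph_universe_def by blast
  ultimately show ?thesis using graph_iso_trans[OF N(2)] by blast
qed

section \<open>Maps onto their target are substitutions\<close>

text \<open>
  If the image of \<open>G \<rightarrow> K\<close> is \<open>K\<close>, then \<open>K\<close> is the result of substituting into \<open>G\<close> any graphs \<open>Q v\<close> that
  are isomorphic to the subgraphs \<open>f\<^sub>1 v\<close>. The generators of the two subcategories are defined by
  substitutions of graphs of the given types, hence the copies \<open>Q v\<close>.
\<close>

lemma onto_substitution:
  fixes G :: "('w, 'd) graph" and K :: "('v, 'e) graph" and Q :: "'w \<Rightarrow> ('x, 'y) graph"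
  assumes gm: "gmorphism G K f0 f1"
    and S: "(\<Union>v \<in> verts G. sverts (f1 v)) = verts K" and i: "f0 ` inputs G \<subseteq> inputs K"
    and Q: "\<And>v. v \<in> verts G \<Longrightarrow> wf_graph (Q v)"
    and iso: "\<And>v. v \<in> verts G \<Longrightarrow> graph_iso (\<psi>V v) (\<psi>E v) (graph_of K (f1 v)) (Q v)"
  shows "\<exists>bi bo \<phi>V \<phi>E. subst_data G Q bi bo \<and> graph_iso \<phi>V \<phi>E (graph_subst G Q bi bo) K \<and>
     (\<forall>e \<in> edges G. \<phi>E (glue_class G bi bo (Inl e)) = f0 e) \<and>
     (\<forall>v \<in> verts G. \<forall>d \<in> edges (graph_of K (f1 v)). \<phi>E (glue_class G bi bo (Inr (v, \<psi>E v d))) = under d) \<and>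
     (\<forall>v \<in> verts G. \<forall>w \<in> sverts (f1 v). \<phi>V (v, \<psi>V v w) = w) \<and>
     (\<forall>v \<in> verts G. placed G Q bi bo \<phi>V \<phi>E v = f1 v)"
proof -
  interpret gmorphism G K f0 f1 by fact
  define bi where "bi v e = \<psi>E v (in_leg v e)" for v e
  define bo where "bo v e = \<psi>E v (out_leg v e)" for v e
  have bi: "bij_betw (bi v) (in_at G v) (inputs (Q v))" and bo: "bij_betw (bo v) (out_at G v) (outputs (Q v))"
    if v: "v \<in> verts G" for v
    using bij_betw_trans[OF bij_in_leg[OF v] graph_iso_kinds(1)[OF iso[OF v]]]
      bij_betw_trans[OF bij_out_leg[OF v] graph_iso_kinds(2)[OF iso[OF v]]]
    by (simp_all add: bi_def[abs_def] bo_def[abs_def] comp_def)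
  have sd: "subst_data G Q bi bo" using Q bi bo by (simp add: subst_data_def)
  interpret s: substitution G Q bi bo by unfold_locales (use wf_dom sd in auto)
  have EB: "bij_betw (\<psi>E v) (edges (P v)) (edges (Q v))" and VB: "bij_betw (\<psi>V v) (sverts (f1 v)) (verts (Q v))"
    and st: "\<And>d. d \<in> edges (P v) \<Longrightarrow> src (Q v) (\<psi>E v d) = map_option (\<psi>V v) (src (P v) d) \<and>
        tgt (Q v) (\<psi>E v d) = map_option (\<psi>V v) (tgt (P v) d)"
    if v: "v \<in> verts G" for v
    using iso[OF v] by (auto simp: graph_iso_def)
  define iE where "iE v = inv_into (edges (P v)) (\<psi>E v)" for v
  define iV where "iV v = inv_into (sverts (f1 v)) (\<psi>V v)" for v
  have iE: "iE v (\<psi>E v d) = d" if "v \<in> verts G" "d \<in> edges (P v)" for v d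
    using bij_betw_inv_into_left[OF EB] that by (simp add: iE_def)
  have iE': "iE v d \<in> edges (P v) \<and> \<psi>E v (iE v d) = d" if "v \<in> verts G" "d \<in> edges (Q v)" for v d
    using bij_betw_inv_into_right[OF EB] bij_betwE[OF bij_betw_inv_into[OF EB]] that by (auto simp: iE_def)
  have iV: "iV v (\<psi>V v d) = d" if "v \<in> verts G" "d \<in> sverts (f1 v)" for v d
    using bij_betw_inv_into_left[OF VB] that by (simp add: iV_def)
  have iV': "iV v d \<in> sverts (f1 v) \<and> \<psi>V v (iV v d) = d" if "v \<in> verts G" "d \<in> verts (Q v)" for v d
    using bij_betw_inv_into_right[OF VB] bij_betwE[OF bij_betw_inv_into[OF VB]] that by (auto simp: iV_def)
  define \<kappa> where "\<kappa> x = (case x of Inl e \<Rightarrow> f0 e | Inr (v, d) \<Rightarrow> under (iE v d))" for x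
  define c where "c = (\<lambda>(v, w). iV v w)"
  have in_edge: "in_leg v e \<in> edges (P v)" if "v \<in> verts G" "e \<in> in_at G v" for v e
    using bij_betwE[OF bij_in_leg] that inputs_subset[of "P v"] by blast
  have out_edge: "out_leg v e \<in> edges (P v)" if "v \<in> verts G" "e \<in> out_at G v" for v e
    using bij_betwE[OF bij_out_leg] that outputs_subset[of "P v"] by blast
  have up: "\<kappa> x = \<kappa> y" if "(x, y) \<in> s.upstream" for x y
    using that in_edge out_edge iE under_in_leg under_out_leg
    by (auto simp: s.upstream_def \<kappa>_def bi_def bo_def)
  have const: "\<kappa> y = \<kappa> x" if "y \<in> s.cls x" for x y
    using that unfolding s.cls_iff by (induction rule: rtrancl_induct) (auto dest: up)
  have \<kappa>E: "\<kappa> x \<in> edges K" if "x \<in> s.cells" for x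
  proof (cases x)
    case (Inl e)
    then show ?thesis using that f0 by (auto simp: s.cells_def \<kappa>_def)
  next
    case (Inr p)
    obtain v d where p: "p = (v, d)" by (cases p)
    then have x: "x = Inr (v, d)" "v \<in> verts G" "d \<in> edges (Q v)"
      using that Inr by (auto simp: s.cells_def)
    then show ?thesis using edges_graph_of[OF wf_cod f1[OF x(2)]] iE'[OF x(2,3)] by (simp add: \<kappa>_def)
  qed
  have src: "\<exists>w. src (P v) (iE v d) = Some w \<and> \<psi>V v w = w' \<and> iV v w' = w \<and> src K (under (iE v d)) = Some w"
    if v: "v \<in> verts G" "src (Q v) d = Some w'" for v d w'
  proof -
    have d: "d \<in> edges (Q v)" using src_Some_edge[OF Q[OF v(1)] v(2)] .
    then have "map_option (\<psi>V v) (src (P v) (iE v d)) = Some w'"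
      using st[OF v(1), of "iE v d"] iE'[OF v(1) d] v(2) by simp
    then obtain w where w: "src (P v) (iE v d) = Some w" "\<psi>V v w = w'" by auto
    then show ?thesis using src_P[OF v(1) w(1)] iV[OF v(1)] by auto
  qed
  have tgt: "\<exists>w. tgt (P v) (iE v d) = Some w \<and> \<psi>V v w = w' \<and> iV v w' = w \<and> tgt K (under (iE v d)) = Some w"
    if v: "v \<in> verts G" "tgt (Q v) d = Some w'" for v d w'
  proof -
    have d: "d \<in> edges (Q v)" using tgt_Some_edge[OF Q[OF v(1)] v(2)] .
    then have "map_option (\<psi>V v) (tgt (P v) (iE v d)) = Some w'"
      using st[OF v(1), of "iE v d"] iE'[OF v(1) d] v(2) by simp
    then obtain w where w: "tgt (P v) (iE v d) = Some w" "\<psi>V v w = w'" by auto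
    then show ?thesis using tgt_P[OF v(1) w(1)] iV[OF v(1)] by auto
  qed
  have "\<exists>\<phi>E. graph_iso c \<phi>E (graph_subst G Q bi bo) K \<and> (\<forall>x \<in> s.cells. \<phi>E (s.cls x) = \<kappa> x)"
  proof (cases "verts K = {}")
    case True
    then have "\<forall>v \<in> verts G. verts (Q v) = {}" using S VB by (fastforce simp: bij_betw_def)
    then have emp: "subst_verts G Q = {}" "subst_verts G P = {}" using True S by (auto simp: subst_verts_def)
    obtain k where k: "edges K = {k}" using True wf_cod by (cases K) auto
    have "is_Exc_Loop K \<longleftrightarrow> inputs G \<union> outputs G = {}"
    proof
      assume "is_Exc_Loop K"
      then have "inputs K = {}" "outputs K = {}" by (auto simp: is_Exc_Loop_def)
      then show "inputs G \<union> outputs G = {}" using i onto_outputs[OF S i] by auto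
    qed (use loop S True in auto)
    then have "graph_iso c (\<lambda>_. k) (graph_subst G Q bi bo) K"
      using True k emp(1) wf_cod by (cases K) (auto simp: graph_iso_def graph_subst_def bij_betw_def)
    moreover have "\<kappa> x = k" if "x \<in> s.cells" for x using \<kappa>E[OF that] k by simp
    ultimately show ?thesis by auto
  next
    case False
    have SV: "subst_verts G Q \<noteq> {}"
    proof -
      obtain w where "w \<in> verts K" using False by auto
      then obtain v where "v \<in> verts G" "w \<in> sverts (f1 v)" using S by blast
      then have "v \<in> verts G" "\<psi>V v w \<in> verts (Q v)" using bij_betwE[OF VB] by auto
      then show ?thesis by (auto simp: subst_verts_def)
    qed
    have o: "f0 ` outputs G \<subseteq> outputs K" by (rule onto_outputs[OF S i])
    show ?thesis
    proof (rule s.recognition[OF SV wf_cod False])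
      show "bij_betw c (subst_verts G Q) (verts K)"
      proof (rule bij_betw_imageI)
        show "inj_on c (subst_verts G Q)"
        proof (rule inj_onI)
          fix p q assume p: "p \<in> subst_verts G Q" "q \<in> subst_verts G Q" "c p = c q"
          obtain v w v' w' where vw: "p = (v, w)" "q = (v', w')" by (cases p; cases q)
          have a: "v \<in> verts G" "w \<in> verts (Q v)" "v' \<in> verts G" "w' \<in> verts (Q v')" "iV v w = iV v' w'"
            using p vw by (auto simp: subst_verts_def c_def)
          have "iV v w \<in> sverts (f1 v)" "iV v' w' \<in> sverts (f1 v')"
            using iV'[OF a(1,2)] iV'[OF a(3,4)] by blast+
          then have "v = v'" using same_vert[OF a(1,3)] a(5) by simp
          then show "p = q" using a iV' vw by metis
        qed
        show "c ` subst_verts G Q = verts K"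
        proof (intro set_eqI iffI)
          fix x assume "x \<in> c ` subst_verts G Q"
          then show "x \<in> verts K" using iV' S by (auto simp: subst_verts_def c_def)
        next
          fix x assume "x \<in> verts K"
          then obtain v where v: "v \<in> verts G" "x \<in> sverts (f1 v)" using S by blast
          then have "(v, \<psi>V v x) \<in> subst_verts G Q" "c (v, \<psi>V v x) = x"
            using bij_betwE[OF VB[OF v(1)]] iV[OF v] by (auto simp: subst_verts_def c_def)
          then show "x \<in> c ` subst_verts G Q" by force
        qed
      qed
      show "\<kappa> y = \<kappa> x" if "y \<in> s.cls x" for x y by (rule const[OF that])
      show "\<kappa> x \<in> edges K" if "x \<in> s.cells" for x by (rule \<kappa>E[OF that])
      show "src K (\<kappa> (Inr (v, d))) = Some (c (v, w))" if "v \<in> verts G" "src (Q v) d = Some w" for v d w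
        using src[OF that] by (auto simp: \<kappa>_def c_def)
      show "tgt K (\<kappa> (Inr (v, d))) = Some (c (v, w))" if "v \<in> verts G" "tgt (Q v) d = Some w" for v d w
        using tgt[OF that] by (auto simp: \<kappa>_def c_def)
      show "src K (\<kappa> (Inl e)) = None" if "e \<in> inputs G" for e
      proof -
        have "f0 e \<in> inputs K" using that i by blast
        then show ?thesis using False by (simp add: inputs_iff \<kappa>_def)
      qed
      show "tgt K (\<kappa> (Inl e)) = None" if "e \<in> outputs G" for e
      proof -
        have "f0 e \<in> outputs K" using that o by blast
        then show ?thesis using False by (simp add: outputs_iff \<kappa>_def)
      qed
      show "d = d'" if v: "v \<in> verts G" "src (Q v) d = Some w" "src (Q v) d' = Some w"
        and e: "\<kappa> (Inr (v, d)) = \<kappa> (Inr (v, d'))" for v d d' w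
      proof -
        obtain a b where "src (P v) (iE v d) = Some a" "src (P v) (iE v d') = Some b"
          using src[OF v(1,2)] src[OF v(1,3)] by auto
        then have "iE v d = iE v d'" using src_graph_of_inj e by (fastforce simp: \<kappa>_def)
        then show ?thesis using iE'[OF v(1)] src_Some_edge[OF Q[OF v(1)]] v(2,3) by metis
      qed
      show "d = d'" if v: "v \<in> verts G" "tgt (Q v) d = Some w" "tgt (Q v) d' = Some w"
        and e: "\<kappa> (Inr (v, d)) = \<kappa> (Inr (v, d'))" for v d d' w
      proof -
        obtain a b where "tgt (P v) (iE v d) = Some a" "tgt (P v) (iE v d') = Some b"
          using tgt[OF v(1,2)] tgt[OF v(1,3)] by auto
        then have "iE v d = iE v d'" using tgt_graph_of_inj e by (fastforce simp: \<kappa>_def)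
        then show ?thesis using iE'[OF v(1)] tgt_Some_edge[OF Q[OF v(1)]] v(2,3) by metis
      qed
      show "\<exists>d. src (Q v) d = Some w \<and> \<kappa> (Inr (v, d)) = k"
        if v: "v \<in> verts G" "w \<in> verts (Q v)" "src K k = Some (c (v, w))" for v w k
      proof -
        note w = iV'[OF v(1,2)]
        obtain d where d: "src (P v) d = Some (iV v w)" "under d = k"
          using src_graph_of_surj[OF wf_cod, of "iV v w" "f1 v" k] w v(3) by (auto simp: c_def)
        have "d \<in> edges (P v)" using d src_Some_edge[OF wfP[OF v(1)]] by auto
        then show ?thesis using st[OF v(1), of d] iE[OF v(1), of d] d w by (intro exI[of _ "\<psi>E v d"]) (auto simp: \<kappa>_def)
      qed
      show "\<exists>d. tgt (Q v) d = Some w \<and> \<kappa> (Inr (v, d)) = k"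
        if v: "v \<in> verts G" "w \<in> verts (Q v)" "tgt K k = Some (c (v, w))" for v w k
      proof -
        note w = iV'[OF v(1,2)]
        obtain d where d: "tgt (P v) d = Some (iV v w)" "under d = k"
          using tgt_graph_of_surj[OF wf_cod, of "iV v w" "f1 v" k] w v(3) by (auto simp: c_def)
        have "d \<in> edges (P v)" using d tgt_Some_edge[OF wfP[OF v(1)]] by auto
        then show ?thesis using st[OF v(1), of d] iE[OF v(1), of d] d w by (intro exI[of _ "\<psi>E v d"]) (auto simp: \<kappa>_def)
      qed
    qed
  qed
  then obtain \<phi>E where \<phi>: "graph_iso c \<phi>E (graph_subst G Q bi bo) K" "\<And>x. x \<in> s.cells \<Longrightarrow> \<phi>E (s.cls x) = \<kappa> x" by auto
  have e1: "\<phi>E (s.cls (Inl e)) = f0 e" if "e \<in> edges G" for e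
  proof -
    have "Inl e \<in> s.cells" using that by (auto simp: s.cells_def)
    then show ?thesis using \<phi>(2) by (simp add: \<kappa>_def)
  qed
  have e2: "\<phi>E (s.cls (Inr (v, \<psi>E v d))) = under d" if "v \<in> verts G" "d \<in> edges (P v)" for v d
  proof -
    have "Inr (v, \<psi>E v d) \<in> s.cells" using that bij_betwE[OF EB] by (auto simp: s.cells_def)
    then show ?thesis using \<phi>(2) iE[OF that] by (simp add: \<kappa>_def)
  qed
  have e3: "c (v, \<psi>V v w) = w" if "v \<in> verts G" "w \<in> sverts (f1 v)" for v w
    using iV that by (simp add: c_def)
  have "placed G Q bi bo c \<phi>E v = f1 v" if v: "v \<in> verts G" for v
  proof (cases "f1 v")
    case (Sub_Edge k)
    then have "is_Exc_Edge (Q v)" using iso[OF v] by (simp add: graph_iso_def)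
    then obtain d where d: "Q v = Exc_Edge d" by (auto simp: is_Exc_Edge_def)
    have "d = \<psi>E v (Whole k)" using EB[OF v] d Sub_Edge by (auto simp: bij_betw_def)
    then show ?thesis using e2[OF v, of "Whole k"] Sub_Edge d by (simp add: placed_def)
  next
    case (Sub_Loop k)
    then have "is_Exc_Loop (Q v)" using iso[OF v] by (simp add: graph_iso_def)
    then obtain d where d: "Q v = Exc_Loop d" by (auto simp: is_Exc_Loop_def)
    have "d = \<psi>E v (Whole k)" using EB[OF v] d Sub_Loop by (auto simp: bij_betw_def)
    then show ?thesis using e2[OF v, of "Whole k"] Sub_Loop d by (simp add: placed_def)
  next
    case (Sub_Ord T J)
    then have "\<not> is_Exc_Edge (Q v)" "\<not> is_Exc_Loop (Q v)" using iso[OF v]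
      by (auto simp: graph_iso_def)
    then obtain A B s t where Qv: "Q v = Ordinary A B s t" by (cases "Q v") auto
    have "verts (Q v) = \<psi>V v ` T" using VB[OF v] Sub_Ord by (simp add: bij_betw_def)
    then have V: "(\<lambda>w. c (v, w)) ` verts (Q v) = T"
      using e3[OF v] Sub_Ord by (force simp: image_image)
    have "inner_edges (Q v) = \<psi>E v ` Whole ` J"
      using graph_iso_kinds(3)[OF iso[OF v]] inner_edges_graph_of[OF wf_cod f1[OF v]] Sub_Ord by (simp add: bij_betw_def)
    moreover have "\<phi>E (s.cls (Inr (v, \<psi>E v (Whole k)))) = k" if "k \<in> J" for k
      using e2[OF v, of "Whole k"] Sub_Ord that by simp
    ultimately have "(\<lambda>d. \<phi>E (s.cls (Inr (v, d)))) ` inner_edges (Q v) = J"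
      by (force simp: image_image)
    then show ?thesis using V Qv Sub_Ord by (simp add: placed_def Let_def)
  qed
  then show ?thesis using sd \<phi>(1) e1 e2 e3 by blast
qed

lemma corolla_iso:
  assumes "graph_iso \<phi>V \<phi>E (graph_of K (Sub_Ord {x} {})) Q" "wf_graph Q" "wf_graph K" "x \<in> verts K"
  shows "corolla Q"
proof -
  have "verts Q = {\<phi>V x}" using assms(1) by (auto simp: graph_iso_def bij_betw_def)
  moreover have "inner_edges Q = {}"
    using graph_iso_kinds(3)[OF assms(1)]
    unfolding inner_edges_graph_of[OF assms(3) corolla_subgraph[OF assms(4)]] by (simp add: bij_betw_def)
  ultimately show ?thesis using assms(2) by (simp add: corolla_def)
qed

lemma copies:
  fixes U :: "('v, 'e) graph set" and K :: "('a, 'b) graph"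
  assumes U: "graph_universe U" and K: "wf_graph K" and s: "\<And>w. w \<in> W \<Longrightarrow> s w \<in> subgraphs K"
  shows "\<exists>(Q :: 'w \<Rightarrow> ('v, 'e) graph) \<psi>V \<psi>E. \<forall>w \<in> W. wf_graph (Q w) \<and> graph_iso (\<psi>V w) (\<psi>E w) (graph_of K (s w)) (Q w)"
proof -
  have "\<forall>w \<in> W. \<exists>G :: ('v, 'e) graph. \<exists>\<phi>V \<phi>E. wf_graph G \<and> graph_iso \<phi>V \<phi>E (graph_of K (s w)) G"
    using universe_copy[OF U wf_graph_of[OF K s]] by blast
  then show ?thesis unfolding bchoice_iff by blast
qed

lemma substitution_mapI:
  fixes f :: "('v, 'e) gmap" and U :: "('v, 'e) graph set"
  assumes U: "graph_universe U" and f: "hom f" "onto f" and v: "v \<in> verts (gdom f)"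
    and cor: "\<And>w. w \<in> verts (gdom f) \<Longrightarrow> w \<noteq> v \<Longrightarrow> \<exists>x. vmap f w = Sub_Ord {x} {}"
    and kind: "\<And>Q \<psi>V \<psi>E. wf_graph Q \<Longrightarrow> graph_iso \<psi>V \<psi>E (graph_of (gcod f) (vmap f v)) Q \<Longrightarrow> kind Q"
  shows "substitution_map kind f"
proof -
  let ?G = "gdom f" and ?K = "gcod f"
  interpret f: gmorphism ?G ?K "emap f" "vmap f" using hom_gmorphism[OF f(1)] .
  obtain Q :: "'v \<Rightarrow> ('v, 'e) graph" and \<psi>V \<psi>E where Q: "\<And>w. w \<in> verts ?G \<Longrightarrow> wf_graph (Q w)"
    "\<And>w. w \<in> verts ?G \<Longrightarrow> graph_iso (\<psi>V w) (\<psi>E w) (graph_of ?K (vmap f w)) (Q w)"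
    using copies[OF U f.wf_cod, of "verts ?G" "vmap f"] f.f1 by blast
  have on: "f.S = verts ?K" "emap f ` inputs ?G \<subseteq> inputs ?K" using f(2) by (auto simp: onto_def)
  obtain bi bo \<phi>V \<phi>E where z: "subst_data ?G Q bi bo" "graph_iso \<phi>V \<phi>E (graph_subst ?G Q bi bo) ?K"
     "\<forall>e \<in> edges ?G. \<phi>E (glue_class ?G bi bo (Inl e)) = emap f e"
     "\<forall>v \<in> verts ?G. placed ?G Q bi bo \<phi>V \<phi>E v = vmap f v"
    using onto_substitution[OF f.gmorphism_axioms on Q] by blast
  have c: "\<forall>w \<in> verts ?G - {v}. corolla (Q w)"
  proof
    fix w assume "w \<in> verts ?G - {v}"
    then have w: "w \<in> verts ?G" "w \<noteq> v" by auto
    then obtain x where x: "vmap f w = Sub_Ord {x} {}" using cor by blast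
    then have "x \<in> verts ?K" using hom_sverts[OF f(1) w(1)] by auto
    then show "corolla (Q w)" by (rule corolla_iso[OF Q(2)[OF w(1), unfolded x] Q(1)[OF w(1)] f.wf_cod])
  qed
  have "emap f = (\<lambda>e \<in> edges ?G. \<phi>E (glue_class ?G bi bo (Inl e)))"
    by (rule extensionalityI[of _ "edges ?G"]) (use f(1) z(3) in \<open>auto simp: hom_iff\<close>)
  moreover have "vmap f = (\<lambda>w \<in> verts ?G. placed ?G Q bi bo \<phi>V \<phi>E w)"
    by (rule extensionalityI[of _ "verts ?G"]) (use f(1) z(4) in \<open>auto simp: hom_iff\<close>)
  ultimately show ?thesis unfolding substitution_map_def
    using v z(1,2) kind[OF Q[OF v]] c by blast
qed

text \<open>
  A graph \<open>K\<close> is obtained by substituting the domain of \<open>c\<close> into \<open>D\<close> if there is a map \<open>D \<rightarrow> K\<close> onto \<open>K\<close>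
  that sends one vertex to the subgraph given by \<open>c\<close> and the others to corollas.
\<close>

lemma outer_cofaceI:
  fixes c :: "('v, 'e) gmap" and U :: "('v, 'e) graph set" and D :: "('v, 'e) graph"
  assumes U: "graph_universe U" and c: "hom c" and D: "dioperadic D \<or> contracted_corolla D"
    and gm: "gmorphism D (gcod c) d0 d1" and S: "(\<Union>v \<in> verts D. sverts (d1 v)) = verts (gcod c)"
    and i: "d0 ` inputs D \<subseteq> inputs (gcod c)" and p: "p \<in> verts D"
    and cor: "\<And>w. w \<in> verts D \<Longrightarrow> w \<noteq> p \<Longrightarrow> \<exists>x. d1 w = Sub_Ord {x} {}"
    and iso: "graph_iso \<alpha>V \<alpha>E (graph_of (gcod c) (d1 p)) (gdom c)"
    and ce: "\<And>d. d \<in> edges (graph_of (gcod c) (d1 p)) \<Longrightarrow> emap c (\<alpha>E d) = under d"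
    and cv: "\<And>w. w \<in> sverts (d1 p) \<Longrightarrow> vmap c (\<alpha>V w) = Sub_Ord {w} {}"
  shows "outer_coface c"
proof -
  let ?H = "gdom c" and ?K = "gcod c"
  interpret d: gmorphism D ?K d0 d1 by fact
  obtain Q' :: "'v \<Rightarrow> ('v, 'e) graph" and \<psi>V' \<psi>E' where Q': "\<And>w. w \<in> verts D \<Longrightarrow> wf_graph (Q' w)"
    "\<And>w. w \<in> verts D \<Longrightarrow> graph_iso (\<psi>V' w) (\<psi>E' w) (graph_of ?K (d1 w)) (Q' w)"
    using copies[OF U d.wf_cod, of "verts D" d1] d.f1 by blast
  define Q where "Q = Q'(p := ?H)"
  define \<psi>V where "\<psi>V = \<psi>V'(p := \<alpha>V)"
  define \<psi>E where "\<psi>E = \<psi>E'(p := \<alpha>E)"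
  have Q: "\<And>w. w \<in> verts D \<Longrightarrow> wf_graph (Q w)"
    "\<And>w. w \<in> verts D \<Longrightarrow> graph_iso (\<psi>V w) (\<psi>E w) (graph_of ?K (d1 w)) (Q w)"
    using Q' iso c by (auto simp: Q_def \<psi>V_def \<psi>E_def hom_def)
  obtain bi bo \<phi>V \<phi>E where z: "subst_data D Q bi bo" "graph_iso \<phi>V \<phi>E (graph_subst D Q bi bo) ?K"
     "\<forall>v \<in> verts D. \<forall>d \<in> edges (graph_of ?K (d1 v)). \<phi>E (glue_class D bi bo (Inr (v, \<psi>E v d))) = under d"
     "\<forall>v \<in> verts D. \<forall>w \<in> sverts (d1 v). \<phi>V (v, \<psi>V v w) = w"
    using onto_substitution[OF gm S i Q] by blast
  have cc: "\<forall>w \<in> verts D - {p}. corolla (Q w)"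
  proof
    fix w assume "w \<in> verts D - {p}"
    then have w: "w \<in> verts D" "w \<noteq> p" by auto
    then obtain x where x: "d1 w = Sub_Ord {x} {}" using cor by blast
    then have "x \<in> verts ?K" using sverts_subset[OF d.f1[OF w(1)]] by auto
    then show "corolla (Q w)" by (rule corolla_iso[OF Q(2)[OF w(1), unfolded x] Q(1)[OF w(1)] d.wf_cod])
  qed
  have EB: "\<alpha>E ` edges (graph_of ?K (d1 p)) = edges ?H" and VB: "\<alpha>V ` sverts (d1 p) = verts ?H"
    using iso by (auto simp: graph_iso_def bij_betw_def)
  have "emap c = (\<lambda>e \<in> edges ?H. \<phi>E (glue_class D bi bo (Inr (p, e))))"
  proof (rule extensionalityI[of _ "edges ?H"])
    fix e assume e: "e \<in> edges ?H"
    then obtain d where "d \<in> edges (graph_of ?K (d1 p))" "e = \<alpha>E d" using EB by blast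
    then show "emap c e = (\<lambda>e \<in> edges ?H. \<phi>E (glue_class D bi bo (Inr (p, e)))) e"
      using ce[of d] z(3) p e by (auto simp: \<psi>E_def)
  qed (use c in \<open>auto simp: hom_iff\<close>)
  moreover have "vmap c = (\<lambda>w \<in> verts ?H. Sub_Ord {\<phi>V (p, w)} {})"
  proof (rule extensionalityI[of _ "verts ?H"])
    fix w assume w: "w \<in> verts ?H"
    then obtain x where "x \<in> sverts (d1 p)" "w = \<alpha>V x" using VB by blast
    then show "vmap c w = (\<lambda>w \<in> verts ?H. Sub_Ord {\<phi>V (p, w)} {}) w"
      using cv[of x] z(4) p w by (auto simp: \<psi>V_def)
  qed (use c in \<open>auto simp: hom_iff\<close>)
  moreover have "Q p = ?H" by (simp add: Q_def)
  ultimately show ?thesis unfolding outer_coface_def using D p z(1,2) cc by blast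
qed

section \<open>Contraction of a subgraph\<close>

definition collapse :: "'v set \<Rightarrow> 'v \<Rightarrow> 'v \<Rightarrow> 'v" where
  "collapse S p x = (if x \<in> S then p else x)"

text \<open>
  The graph \<open>K\<close> with the subgraph on vertices \<open>S\<close> and inner edges \<open>I\<close> contracted to the vertex \<open>p\<close> of \<open>S\<close>.
  Edges with both ends in \<open>S\<close> that are not in \<open>I\<close> become loops.
\<close>

definition contract :: "('v, 'e) graph \<Rightarrow> 'v set \<Rightarrow> 'e set \<Rightarrow> 'v \<Rightarrow> ('v, 'e) graph" where
  "contract K S I p = Ordinary (insert p (verts K - S)) (edges K - I)
     (\<lambda>e. if e \<in> I then None else map_option (collapse S p) (src K e))
     (\<lambda>e. if e \<in> I then None else map_option (collapse S p) (tgt K e))"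

lemma contract_simps [simp]:
  "verts (contract K S I p) = insert p (verts K - S)" "edges (contract K S I p) = edges K - I"
  "src (contract K S I p) e = (if e \<in> I then None else map_option (collapse S p) (src K e))"
  "tgt (contract K S I p) e = (if e \<in> I then None else map_option (collapse S p) (tgt K e))"
  by (simp_all add: contract_def)

lemma wf_contract:
  assumes K: "wf_graph K" and s: "Sub_Ord S I \<in> subgraphs K" and p: "p \<in> S"
  shows "wf_graph (contract K S I p)"
proof -
  note sub = subgraph_inner[OF K s]
  have SV: "S \<subseteq> verts K" using s by (simp add: subgraphs_Ord_iff)
  have ne: "verts K \<noteq> {}" using SV p by auto
  let ?D = "contract K S I p"
  let ?s = "\<lambda>e. if e \<in> I then None else map_option (collapse S p) (src K e)"
  let ?t = "\<lambda>e. if e \<in> I then None else map_option (collapse S p) (tgt K e)"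
  have "dom ?s \<union> dom ?t = edges K - I"
    using wf_ends[OF K ne] src_Some_edge[OF K] tgt_Some_edge[OF K] by (fastforce split: if_splits)
  moreover have "ran ?s \<subseteq> insert p (verts K - S)" "ran ?t \<subseteq> insert p (verts K - S)"
    using src_Some_vert[OF K] tgt_Some_vert[OF K] by (auto simp: ran_def collapse_def split: if_splits)
  moreover have "connected_by ?D (insert p (verts K - S)) (inner_edges ?D)"
    unfolding connected_by_iff_closed
  proof (intro allI impI)
    fix T assume T: "T \<inter> insert p (verts K - S) \<noteq> {}"
      and cl: "\<forall>e \<in> inner_edges ?D. \<forall>u w. src ?D e = Some u \<longrightarrow> tgt ?D e = Some w \<longrightarrow> (u \<in> T \<longleftrightarrow> w \<in> T)"
    obtain y where y: "y \<in> T" "y \<in> insert p (verts K - S)" using T by auto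
    have "verts K \<subseteq> {x. collapse S p x \<in> T}"
    proof (rule wf_graph_closed[OF K, of y])
      show "y \<in> verts K" using y p SV by auto
      show "y \<in> {x. collapse S p x \<in> T}" using y p by (auto simp: collapse_def)
      fix e u w assume e: "src K e = Some u" "tgt K e = Some w"
      show "u \<in> {x. collapse S p x \<in> T} \<longleftrightarrow> w \<in> {x. collapse S p x \<in> T}"
      proof (cases "e \<in> I")
        case True
        then show ?thesis using sub(1)[OF True] e by (auto simp: collapse_def)
      next
        case False
        then have "e \<in> inner_edges ?D" using e src_Some_edge[OF K e(1)] by (simp add: contract_def)
        then show ?thesis using cl e False by auto
      qed
    qed
    then show "insert p (verts K - S) \<subseteq> T" using p SV by (auto simp: collapse_def)
  qed
  ultimately show ?thesis using finite_verts[OF K] finite_edges[OF K] by (simp add: contract_def)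
qed

text \<open>
  Substituting the contracted subgraph at \<open>p\<close> gives \<open>K\<close> again.
\<close>

lemma contract_gmorphism:
  assumes K: "wf_graph K" and s: "Sub_Ord S I \<in> subgraphs K" and p: "p \<in> S"
  defines "d1 \<equiv> \<lambda>x. if x = p then Sub_Ord S I else Sub_Ord {x} {}"
  shows "gmorphism (contract K S I p) K id d1"
    and "(\<Union>v \<in> verts (contract K S I p). sverts (d1 v)) = verts K"
    and "id ` inputs (contract K S I p) \<subseteq> inputs K"
proof -
  note sub = subgraph_inner[OF K s]
  have SV: "S \<subseteq> verts K" using s by (simp add: subgraphs_Ord_iff)
  have ne: "verts K \<noteq> {}" using SV p by auto
  let ?D = "contract K S I p"
  have D: "wf_graph ?D" by (rule wf_contract[OF K s p])
  have in_D: "in_at ?D v = ins K (d1 v)" and out_D: "out_at ?D v = outs K (d1 v)" if "v \<in> verts ?D" for v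
    using that p sub by (auto simp: in_at_def out_at_def d1_def collapse_def split: if_splits) fastforce+
  show "gmorphism ?D K id d1"
  proof unfold_locales
    show "d1 v \<in> subgraphs K" if "v \<in> verts ?D" for v
      using that s corolla_subgraph[of v K] by (auto simp: d1_def)
    show "bij_betw id (in_at ?D v) (ins K (d1 v))" "bij_betw id (out_at ?D v) (outs K (d1 v))" if "v \<in> verts ?D" for v
      using in_D[OF that] out_D[OF that] by auto
    show "sverts (d1 v) \<inter> sverts (d1 v') = {}" if "v \<in> verts ?D" "v' \<in> verts ?D" "v \<noteq> v'" for v v'
      using that by (auto simp: d1_def)
    show "is_Exc_Loop K" if "\<forall>v \<in> verts ?D. sverts (d1 v) = {}"
      using that p by (auto simp: d1_def)
  qed (use D K in auto)
  show "(\<Union>v \<in> verts ?D. sverts (d1 v)) = verts K"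
    using SV p by (auto simp: d1_def split: if_splits)
  show "id ` inputs ?D \<subseteq> inputs K"
    by (auto simp: inputs_iff[of ?D] inputs_iff[OF ne] split: if_splits)
qed

lemma inner_edges_contract: "verts K \<noteq> {} \<Longrightarrow> inner_edges (contract K S I p) = inner_edges K - I"
proof -
  assume ne: "verts K \<noteq> {}"
  show ?thesis by (auto simp: inner_edges_iff[of "contract K S I p"] inner_edges_iff[OF ne] split: if_splits)
qed

lemma gmorphism_precomp_iso:
  assumes gm: "gmorphism D K d0 d1" and iso: "graph_iso \<phi>V \<phi>E D2 D" and D2: "wf_graph D2"
    and S: "(\<Union>v \<in> verts D. sverts (d1 v)) = verts K" and i: "d0 ` inputs D \<subseteq> inputs K"
  shows "gmorphism D2 K (d0 \<circ> \<phi>E) (d1 \<circ> \<phi>V)"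
    and "(\<Union>v \<in> verts D2. sverts ((d1 \<circ> \<phi>V) v)) = verts K" and "(d0 \<circ> \<phi>E) ` inputs D2 \<subseteq> inputs K"
proof -
  interpret d: gmorphism D K d0 d1 by fact
  have V: "\<phi>V ` verts D2 = verts D" using iso by (auto simp: graph_iso_def bij_betw_def)
  have g: "gmorphism D2 D \<phi>E (\<lambda>v. Sub_Ord {\<phi>V v} {})"
    by (rule gmorphism_graph_iso[OF iso D2 d.wf_dom])
  show "gmorphism D2 K (d0 \<circ> \<phi>E) (d1 \<circ> \<phi>V)"
    by (rule gmorphism_cong[OF gmorphism_comp[OF g gm]]) (use push_corolla[OF gm] V in auto)
  have "(\<Union>v \<in> verts D2. sverts ((d1 \<circ> \<phi>V) v)) = (\<Union>x \<in> \<phi>V ` verts D2. sverts (d1 x))" by simp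
  then show "(\<Union>v \<in> verts D2. sverts ((d1 \<circ> \<phi>V) v)) = verts K" unfolding V S .
  have "\<phi>E ` inputs D2 = inputs D" using graph_iso_kinds(1)[OF iso] by (simp add: bij_betw_def)
  then show "(d0 \<circ> \<phi>E) ` inputs D2 \<subseteq> inputs K"
    using i by (simp only: image_comp[symmetric])
qed

section \<open>Inclusions of subgraphs\<close>

lemma subgraph_inclusion:
  fixes K H :: "('v, 'e) graph"
  assumes K: "wf_graph K" and s: "s \<in> subgraphs K" and iso: "graph_iso \<psi>V \<psi>E (graph_of K s) H" and H: "wf_graph H"
  shows "\<exists>c. hom c \<and> gdom c = H \<and> gcod c = K \<and> positive c \<and>
     (\<forall>d \<in> edges (graph_of K s). emap c (\<psi>E d) = under d) \<and>
     (\<forall>w \<in> sverts s. vmap c (\<psi>V w) = Sub_Ord {w} {})"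
proof -
  let ?P = "graph_of K s"
  have P: "wf_graph ?P" by (rule wf_graph_of[OF K s])
  define iV where "iV = inv_into (verts ?P) \<psi>V"
  define iE where "iE = inv_into (edges ?P) \<psi>E"
  have inv: "graph_iso iV iE H ?P" unfolding iV_def iE_def by (rule graph_iso_inv[OF iso P])
  have iV: "iV (\<psi>V w) = w" if "w \<in> sverts s" for w
    using iso that by (simp add: iV_def graph_iso_def bij_betw_def)
  have iE: "iE (\<psi>E d) = d" if "d \<in> edges ?P" for d
    using iso that by (simp add: iE_def graph_iso_def bij_betw_def)
  have j: "gmorphism ?P K (id \<circ> under) (\<lambda>v. Sub_Ord {id v} {})"
    by (rule gmorphism_restrict[OF gmorphism_graph_iso[OF graph_iso_id K K] s])
  have g: "gmorphism H ?P iE (\<lambda>v. Sub_Ord {iV v} {})" by (rule gmorphism_graph_iso[OF inv H P])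
  have vm: "iV v \<in> verts ?P" if "v \<in> verts H" for v using inv that by (auto simp: graph_iso_def dest: bij_betwE)
  have gm: "gmorphism H K (under \<circ> iE) (\<lambda>v. Sub_Ord {iV v} {})"
    by (rule gmorphism_cong[OF gmorphism_comp[OF g j]]) (use push_corolla[OF j] vm in auto)
  have "\<psi>V w \<in> verts H" if "w \<in> sverts s" for w using iso that by (auto simp: graph_iso_def dest: bij_betwE)
  moreover have "\<psi>E d \<in> edges H" if "d \<in> edges ?P" for d using iso that by (auto simp: graph_iso_def dest: bij_betwE)
  ultimately show ?thesis using hom_gmap_of[OF gm] iV iE
    by (intro exI[of _ "gmap_of H K (under \<circ> iE) (\<lambda>v. Sub_Ord {iV v} {})"]) (auto simp: positive_def)
qed

fun sinner :: "('v, 'e) subgraph \<Rightarrow> 'e set" where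
  "sinner (Sub_Ord S I) = I"
| "sinner _ = {}"

lemma Sub_Ord_eq: "sverts s \<noteq> {} \<Longrightarrow> s = Sub_Ord (sverts s) (sinner s)"
  by (cases s) auto

text \<open>
  An edge of \<open>G\<close> whose image is cut in the subgraph is a leg of \<open>G\<close>, by the assumption on inner edges.
  It is lifted to an input leg if it has a target in \<open>G\<close>, and to an output leg otherwise.
\<close>

lemma lift_to_subgraph:
  fixes K :: "('v, 'e) graph" and G :: "('w, 'd) graph"
  assumes gm: "gmorphism G K f0 f1" and VG: "verts G \<noteq> {}"
    and ne: "\<And>v. v \<in> verts G \<Longrightarrow> sverts (f1 v) \<noteq> {}"
    and s: "Sub_Ord S' I' \<in> subgraphs K"
    and sub: "\<And>v. v \<in> verts G \<Longrightarrow> sverts (f1 v) \<subseteq> S'" "\<And>v. v \<in> verts G \<Longrightarrow> sinner (f1 v) \<subseteq> I'"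
    and inner: "\<And>e. e \<in> inner_edges G \<Longrightarrow> f0 e \<in> I'"
  shows "\<exists>l0 l1. gmorphism G (graph_of K (Sub_Ord S' I')) l0 l1 \<and>
     (\<forall>e \<in> edges G. under (l0 e) = f0 e) \<and> (\<forall>v \<in> verts G. sverts (l1 v) = sverts (f1 v))"
proof -
  interpret gmorphism G K f0 f1 by fact
  let ?s = "Sub_Ord S' I'"
  let ?P = "graph_of K ?s"
  have wfP': "wf_graph ?P" by (rule wf_graph_of[OF wf_cod s])
  have S': "verts ?P = S'" by simp
  define il where "il k = (if k \<in> I' then Whole k else In_Leg k)" for k
  define ol where "ol k = (if k \<in> I' then Whole k else Out_Leg k)" for k
  define l0 where "l0 e = (if tgt G e \<noteq> None then il (f0 e) else ol (f0 e))" for e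
  define l1 where "l1 v = Sub_Ord (sverts (f1 v)) (Whole ` sinner (f1 v))" for v
  have f1: "f1 v = Sub_Ord (sverts (f1 v)) (sinner (f1 v))" if "v \<in> verts G" for v
    by (rule Sub_Ord_eq[OF ne[OF that]])
  have tP: "tgt ?P (il k) = Some w" if "tgt K k = Some w" "w \<in> S'" for k w
    using that tgt_Some_edge[OF wf_cod] by (auto simp: il_def)
  have sP: "src ?P (ol k) = Some w" if "src K k = Some w" "w \<in> S'" for k w
    using that src_Some_edge[OF wf_cod] by (auto simp: ol_def)
  have under: "under (il k) = k" "under (ol k) = k" for k by (simp_all add: il_def ol_def)
  have l1: "l1 v \<in> subgraphs ?P" if v: "v \<in> verts G" for v
  proof -
    have sv: "Sub_Ord (sverts (f1 v)) (sinner (f1 v)) \<in> subgraphs K"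
      using premap.f1[OF premap_axioms v] f1[OF v] by simp
    have "joined ?P (Whole ` sinner (f1 v)) = joined K (sinner (f1 v))"
      using sub(2)[OF v] by (auto simp: joined_def)
    then have "connected_by ?P (sverts (f1 v)) (Whole ` sinner (f1 v))"
      using sv by (simp add: subgraphs_Ord_iff connected_by_def)
    moreover have "Whole ` sinner (f1 v) \<subseteq> inner_edges ?P"
      unfolding inner_edges_graph_of[OF wf_cod s] using sub(2)[OF v] by auto
    moreover have "the (src ?P d) \<in> sverts (f1 v) \<and> the (tgt ?P d) \<in> sverts (f1 v)"
      if "d \<in> Whole ` sinner (f1 v)" for d
      using that sub(2)[OF v] sv by (auto simp: subgraphs_Ord_iff)
    ultimately show ?thesis using ne[OF v] sub(1)[OF v] by (simp add: l1_def subgraphs_Ord_iff)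
  qed
  have bil: "bij_betw il (ins K (f1 v)) (ins ?P (l1 v))" if v: "v \<in> verts G" for v
  proof (rule bij_betw_imageI)
    show "inj_on il (ins K (f1 v))" using under by (metis inj_onI)
    show "il ` ins K (f1 v) = ins ?P (l1 v)"
    proof (intro set_eqI iffI)
      fix d assume "d \<in> il ` ins K (f1 v)"
      then obtain k where k: "k \<in> ins K (f1 v)" "d = il k" by auto
      then obtain w where w: "k \<notin> sinner (f1 v)" "tgt K k = Some w" "w \<in> sverts (f1 v)"
        using f1[OF v]
        by (cases "f1 v") auto
      have t: "tgt ?P d = Some w" using tP[OF w(2)] w(3) sub(1)[OF v] k(2) by auto
      have "d \<notin> Whole ` sinner (f1 v)" using w(1) k(2) by (auto simp: il_def split: if_splits)
      then show "d \<in> ins ?P (l1 v)" using t w(3) tgt_Some_edge[OF wfP' t] by (simp add: l1_def)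
    next
      fix d assume "d \<in> ins ?P (l1 v)"
      then obtain w where w: "d \<notin> Whole ` sinner (f1 v)" "tgt ?P d = Some w" "w \<in> sverts (f1 v)"
        by (auto simp: l1_def)
      have k: "tgt K (under d) = Some w" by (rule tgt_graph_of(1)[OF w(2) wf_cod s])
      have "tgt ?P (il (under d)) = Some w" by (rule tP[OF k]) (use w sub(1)[OF v] in auto)
      then have d: "d = il (under d)" using tgt_graph_of_inj[OF w(2)] under by metis
      have "under d \<notin> sinner (f1 v)"
      proof
        assume a: "under d \<in> sinner (f1 v)"
        then have "d = Whole (under d)" using d sub(2)[OF v] by (auto simp: il_def split: if_splits)
        then show False using w(1) a by (metis imageI)
      qed
      then have "under d \<in> ins K (f1 v)" using k w(3) tgt_Some_edge[OF wf_cod k] f1[OF v]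
        by (cases "f1 v") auto
      then show "d \<in> il ` ins K (f1 v)" using d by (metis imageI)
    qed
  qed
  have bol: "bij_betw ol (outs K (f1 v)) (outs ?P (l1 v))" if v: "v \<in> verts G" for v
  proof (rule bij_betw_imageI)
    show "inj_on ol (outs K (f1 v))" using under by (metis inj_onI)
    show "ol ` outs K (f1 v) = outs ?P (l1 v)"
    proof (intro set_eqI iffI)
      fix d assume "d \<in> ol ` outs K (f1 v)"
      then obtain k where k: "k \<in> outs K (f1 v)" "d = ol k" by auto
      then obtain w where w: "k \<notin> sinner (f1 v)" "src K k = Some w" "w \<in> sverts (f1 v)"
        using f1[OF v]
        by (cases "f1 v") auto
      have t: "src ?P d = Some w" using sP[OF w(2)] w(3) sub(1)[OF v] k(2) by auto
      have "d \<notin> Whole ` sinner (f1 v)" using w(1) k(2) by (auto simp: ol_def split: if_splits)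
      then show "d \<in> outs ?P (l1 v)" using t w(3) src_Some_edge[OF wfP' t] by (simp add: l1_def)
    next
      fix d assume "d \<in> outs ?P (l1 v)"
      then obtain w where w: "d \<notin> Whole ` sinner (f1 v)" "src ?P d = Some w" "w \<in> sverts (f1 v)"
        by (auto simp: l1_def)
      have k: "src K (under d) = Some w" by (rule src_graph_of(1)[OF w(2) wf_cod s])
      have "src ?P (ol (under d)) = Some w" by (rule sP[OF k]) (use w sub(1)[OF v] in auto)
      then have d: "d = ol (under d)" using src_graph_of_inj[OF w(2)] under by metis
      have "under d \<notin> sinner (f1 v)"
      proof
        assume a: "under d \<in> sinner (f1 v)"
        then have "d = Whole (under d)" using d sub(2)[OF v] by (auto simp: ol_def split: if_splits)
        then show False using w(1) a by (metis imageI)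
      qed
      then have "under d \<in> outs K (f1 v)" using k w(3) src_Some_edge[OF wf_cod k] f1[OF v]
        by (cases "f1 v") auto
      then show "d \<in> ol ` outs K (f1 v)" using d by (metis imageI)
    qed
  qed
  have l0_in: "l0 e = (il \<circ> f0) e" if "e \<in> in_at G v" for e v
    using that by (simp add: l0_def in_at_def)
  have l0_out: "l0 e = (ol \<circ> f0) e" if "e \<in> out_at G v" for e v
    using that inner[of e] by (auto simp: l0_def out_at_def inner_edges_iff[OF VG] il_def ol_def)
  have bin: "bij_betw l0 (in_at G v) (ins ?P (l1 v))" if "v \<in> verts G" for v
    using bij_betw_trans[OF f_in[OF that] bil[OF that]] bij_betw_cong[of "in_at G v" l0 "il \<circ> f0"] l0_in by blast
  have bout: "bij_betw l0 (out_at G v) (outs ?P (l1 v))" if "v \<in> verts G" for v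
    using bij_betw_trans[OF f_out[OF that] bol[OF that]] bij_betw_cong[of "out_at G v" l0 "ol \<circ> f0"] l0_out by blast
  have "gmorphism G ?P l0 l1"
  proof unfold_locales
    show "l0 e \<in> edges ?P" if e: "e \<in> edges G" for e
    proof -
      consider v where "tgt G e = Some v" | v where "src G e = Some v" using wf_ends[OF wf_dom VG e] by auto
      then show ?thesis
      proof cases
        case 1
        then have v: "v \<in> verts G" "e \<in> in_at G v" using tgt_Some_vert[OF wf_dom] in_at_iff[OF wf_dom]
          by auto
        then show ?thesis using bij_betwE[OF bin[OF v(1)]] ins_subset[OF wfP' l1[OF v(1)]] by blast
      next
        case 2
        then have v: "v \<in> verts G" "e \<in> out_at G v" using src_Some_vert[OF wf_dom] out_at_iff[OF wf_dom]
          by auto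
        then show ?thesis using bij_betwE[OF bout[OF v(1)]] outs_subset[OF wfP' l1[OF v(1)]] by blast
      qed
    qed
    show "sverts (l1 v) \<inter> sverts (l1 v') = {}" if "v \<in> verts G" "v' \<in> verts G" "v \<noteq> v'" for v v'
      using disjoint[OF that] by (simp add: l1_def)
    show "is_Exc_Loop ?P" if "\<forall>v \<in> verts G. sverts (l1 v) = {}"
      using that ne VG by (auto simp: l1_def)
  qed (use wf_dom wfP' l1 bin bout in auto)
  moreover have "under (l0 e) = f0 e" for e by (simp add: l0_def under)
  ultimately show ?thesis by (intro exI[of _ l0] exI[of _ l1]) (simp add: l1_def)
qed

section \<open>Splitting off an outer coface map\<close>

text \<open>
  Subgraphs grow by one edge at a time, which either closes up within the subgraph or brings in one
  new vertex.
\<close>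

lemma extend_subgraph:
  assumes K: "wf_graph K" and s: "Sub_Ord S I \<in> subgraphs K"
    and e: "src K e = Some u" "tgt K e = Some w" and uw: "u \<in> S \<or> w \<in> S"
  shows "Sub_Ord (S \<union> {u, w}) (insert e I) \<in> subgraphs K"
proof -
  have V: "u \<in> verts K" "w \<in> verts K" "e \<in> edges K"
    using e src_Some_vert[OF K] tgt_Some_vert[OF K] src_Some_edge[OF K] by auto
  have "connected_by K (S \<union> {u, w}) (insert e I)"
    unfolding connected_by_iff_closed
  proof (intro allI impI)
    fix T assume T: "T \<inter> (S \<union> {u, w}) \<noteq> {}"
      and cl: "\<forall>e \<in> insert e I. \<forall>u w. src K e = Some u \<longrightarrow> tgt K e = Some w \<longrightarrow> (u \<in> T \<longleftrightarrow> w \<in> T)"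
    have uwT: "u \<in> T \<longleftrightarrow> w \<in> T" using cl e by blast
    then have "T \<inter> S \<noteq> {}" using T uw by blast
    moreover have "connected_by K S I" using s by (simp add: subgraphs_Ord_iff)
    ultimately have "S \<subseteq> T" unfolding connected_by_iff_closed using cl by blast
    then show "S \<union> {u, w} \<subseteq> T" using uwT uw by blast
  qed
  moreover have "e \<in> inner_edges K" using V e inner_edges_iff[of K e] by auto
  ultimately show ?thesis using s V e by (auto simp: subgraphs_Ord_iff)
qed

text \<open>
  By connectedness, a proper subgraph can be extended by an edge that has an end in it. The last
  proper subgraph in a sequence of such extensions has the stated form.
\<close>

lemma maximal_proper_subgraph:
  assumes K: "wf_graph K" and s: "Sub_Ord S I \<in> subgraphs K" and ne: "S \<noteq> verts K \<or> I \<noteq> inner_edges K"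
  shows "\<exists>S' I' e u w. Sub_Ord S' I' \<in> subgraphs K \<and> S \<subseteq> S' \<and> I \<subseteq> I' \<and> src K e = Some u \<and> tgt K e = Some w \<and>
     (u \<in> S' \<or> w \<in> S') \<and> verts K = S' \<union> {u, w} \<and> e \<in> inner_edges K \<and> I' = inner_edges K - {e}"
  using s ne
proof (induction "card (verts K) + card (inner_edges K) - (card S + card I)" arbitrary: S I rule: less_induct)
  case less
  have VK: "verts K \<noteq> {}" and SV: "S \<subseteq> verts K" "I \<subseteq> inner_edges K" "S \<noteq> {}"
    using less.prems(1) by (auto simp: subgraphs_Ord_iff)
  note sub = subgraph_inner[OF K less.prems(1)]
  have "\<exists>e u w. src K e = Some u \<and> tgt K e = Some w \<and> e \<notin> I \<and> (u \<in> S \<or> w \<in> S)"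
  proof (cases "S = verts K")
    case True
    then obtain e where "e \<in> inner_edges K" "e \<notin> I" using less.prems(2) SV by auto
    then show ?thesis using True src_Some_vert[OF K] by (fastforce simp: inner_edges_iff[OF VK])
  next
    case False
    obtain x where x: "x \<in> S" "x \<in> verts K" using SV by auto
    have "\<not> verts K \<subseteq> S" using False SV by auto
    then obtain e u w where e: "src K e = Some u" "tgt K e = Some w" "(u \<in> S) \<noteq> (w \<in> S)"
      using wf_graph_closed[OF K x(2,1)] by blast
    moreover have "e \<notin> I"
    proof
      assume "e \<in> I"
      from sub(1)[OF this] show False using e by auto
    qed
    ultimately show ?thesis by blast
  qed
  then obtain e u w where e: "src K e = Some u" "tgt K e = Some w" "e \<notin> I" "u \<in> S \<or> w \<in> S" by blast
  have eI: "e \<in> inner_edges K" using e src_Some_edge[OF K e(1)] by (simp add: inner_edges_iff[OF VK])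
  have ext: "Sub_Ord (S \<union> {u, w}) (insert e I) \<in> subgraphs K"
    by (rule extend_subgraph[OF K less.prems(1) e(1,2,4)])
  show ?case
  proof (cases "S \<union> {u, w} = verts K \<and> insert e I = inner_edges K")
    case True
    then have "I = inner_edges K - {e}" using e(3) by auto
    show ?thesis
      by (rule exI[of _ S], rule exI[of _ I], rule exI[of _ e], rule exI[of _ u], rule exI[of _ w])
        (use True \<open>I = inner_edges K - {e}\<close> less.prems(1) e eI in simp)
  next
    case False
    have fin: "finite (verts K)" "finite (inner_edges K)"
      using finite_verts[OF K] finite_edges[OF K] inner_edges_subset[of K] finite_subset by auto
    have le: "card (S \<union> {u, w}) \<le> card (verts K)" "card (insert e I) \<le> card (inner_edges K)"
      using ext fin by (auto simp: subgraphs_Ord_iff intro!: card_mono)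
    have "card S \<le> card (S \<union> {u, w})"
      using ext fin by (intro card_mono) (auto simp: subgraphs_Ord_iff intro: finite_subset)
    moreover have "card (insert e I) = Suc (card I)" using e(3) SV fin by (simp add: finite_subset)
    ultimately have lt: "card (verts K) + card (inner_edges K) - (card (S \<union> {u, w}) + card (insert e I)) <
        card (verts K) + card (inner_edges K) - (card S + card I)" using le by linarith
    have "S \<union> {u, w} \<noteq> verts K \<or> insert e I \<noteq> inner_edges K" using False by blast
    from less.hyps[OF lt ext this] obtain S' I' e' u' w' where
      IH: "Sub_Ord S' I' \<in> subgraphs K" "S \<union> {u, w} \<subseteq> S'" "insert e I \<subseteq> I'" "src K e' = Some u'" "tgt K e' = Some w'"
        "u' \<in> S' \<or> w' \<in> S'" "verts K = S' \<union> {u', w'}" "e' \<in> inner_edges K" "I' = inner_edges K - {e'}"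
      by (elim exE conjE)
    have "S \<subseteq> S'" "I \<subseteq> I'" using IH(2,3) by auto
    then show ?thesis
      by (intro exI[of _ S'] exI[of _ I'] exI[of _ e'] exI[of _ u'] exI[of _ w'] conjI IH(1) IH(4-9))
  qed
qed

lemma positive_inner:
  assumes f: "hom f" "positive f" and VG: "verts (gdom f) \<noteq> {}" and VK: "verts (gcod f) \<noteq> {}"
  shows "v \<in> verts (gdom f) \<Longrightarrow> sverts (vmap f v) \<noteq> {}"
proof -
  interpret f: gmorphism "gdom f" "gcod f" "emap f" "vmap f" using hom_gmorphism[OF f(1)] .
  show "v \<in> verts (gdom f) \<Longrightarrow> sverts (vmap f v) \<noteq> {}"
    using f.f1[of v] f(2) VK by (cases "vmap f v") (auto simp: positive_def subgraphs_Ord_iff)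
qed

text \<open>
  The graph \<open>D\<close> in which \<open>c\<close> is substituted is the contraction of the maximal proper subgraph. It has
  one inner edge, namely the missing one; this edge is a loop or leads to a second vertex.
\<close>

lemma outer_step:
  fixes f :: "('v, 'e) gmap"
  assumes U: "graph_universe U" and f: "hom f" "positive f" and VG: "verts (gdom f) \<noteq> {}" and VK: "verts (gcod f) \<noteq> {}"
    and no: "\<not> onto f"
  shows "\<exists>c f'. hom c \<and> outer_coface c \<and> hom f' \<and> positive f' \<and> gdom f' = gdom f \<and> gcod f' = gdom c \<and>
     gcod c = gcod f \<and> gdom c \<in> U \<and> verts (gdom c) \<noteq> {} \<and> gcomp c f' = f \<and> deg (gdom c) < deg (gcod c)"
proof -
  let ?G = "gdom f" and ?K = "gcod f"
  interpret f: gmorphism ?G ?K "emap f" "vmap f" using hom_gmorphism[OF f(1)] .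
  note K = f.wf_cod and G = f.wf_dom
  note ne = positive_inner[OF f VG VK]
  have Sne: "f.S \<noteq> {}" using VG ne by blast
  have sub: "Sub_Ord f.S f.I \<in> subgraphs ?K" by (rule f.image_subgraph[OF Sne])
  have vI: "sinner (vmap f v) \<subseteq> f.I" if v: "v \<in> verts ?G" for v
  proof
    fix k assume k: "k \<in> sinner (vmap f v)"
    have eq: "vmap f v = Sub_Ord (sverts (vmap f v)) (sinner (vmap f v))" by (rule Sub_Ord_eq[OF ne[OF v]])
    obtain a b where ab: "a \<in> sverts (vmap f v)" "b \<in> sverts (vmap f v)" "src ?K k = Some a" "tgt ?K k = Some b"
      using subgraph_inner(1)[OF K _ k] f.f1[OF v] eq by metis
    have "k \<notin> emap f ` inputs ?G"
    proof
      assume "k \<in> emap f ` inputs ?G"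
      then obtain e where e: "e \<in> inputs ?G" "k = emap f e" by auto
      then have eG: "e \<in> edges ?G" "src ?G e = None" by (auto simp: inputs_iff[OF VG])
      then obtain v' where v': "tgt ?G e = Some v'" using wf_ends[OF G VG] by blast
      have v'G: "v' \<in> verts ?G" using tgt_Some_vert[OF G v'] .
      obtain b' where "b' \<in> sverts (vmap f v')" "tgt ?K k = Some b'"
        using f.tgt_edge[OF v' ne[OF v'G]] e by auto
      then have "v = v'" using f.same_vert[OF v v'G ab(2)] ab(4) by simp
      then have "k \<in> ins ?K (vmap f v)" using bij_betwE[OF f.f_in[OF v]] v' e in_at_iff[OF G] by auto
      then show False using k eq by (metis (no_types, lifting) DiffE ins.simps(3) mem_Collect_eq)
    qed
    then show "k \<in> f.I" using ab v src_Some_edge[OF K ab(3)] unfolding f.I_def by blast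
  qed
  have eI: "emap f e \<in> f.I" if e: "e \<in> inner_edges ?G" for e
  proof -
    obtain a b where ab: "src ?G e = Some a" "tgt ?G e = Some b" "e \<in> edges ?G"
      using e by (auto simp: inner_edges_iff[OF VG])
    have V: "a \<in> verts ?G" "b \<in> verts ?G" using ab src_Some_vert[OF G] tgt_Some_vert[OF G] by auto
    have "emap f e \<notin> emap f ` inputs ?G"
    proof
      assume "emap f e \<in> emap f ` inputs ?G"
      then obtain e' where e': "e' \<in> inputs ?G" "emap f e = emap f e'" by auto
      then have eG: "e' \<in> edges ?G" "src ?G e' = None" by (auto simp: inputs_iff[OF VG])
      then obtain v' where v': "tgt ?G e' = Some v'" using wf_ends[OF G VG] by blast
      have "e = e'" by (rule f.tgt_edge_inj[OF ab(2) v' e'(2) ne[OF V(2)] ne[OF tgt_Some_vert[OF G v']]])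
      then show False using eG ab by simp
    qed
    then show ?thesis using f.src_edge[OF ab(1) ne[OF V(1)]] f.tgt_edge[OF ab(2) ne[OF V(2)]] V f.f0[OF ab(3)]
      unfolding f.I_def by blast
  qed
  have "f.S \<noteq> verts ?K \<or> f.I \<noteq> inner_edges ?K"
  proof (rule ccontr)
    assume "\<not> ?thesis"
    then have a: "f.S = verts ?K" "f.I = inner_edges ?K" by auto
    have "emap f e \<in> inputs ?K" if e: "e \<in> inputs ?G" for e
    proof -
      have eG: "e \<in> edges ?G" "src ?G e = None" using e by (auto simp: inputs_iff[OF VG])
      then obtain v where v: "tgt ?G e = Some v" using wf_ends[OF G VG] by blast
      have "tgt ?K (emap f e) \<noteq> None" using f.tgt_edge[OF v ne[OF tgt_Some_vert[OF G v]]] by auto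
      moreover have "emap f e \<notin> inner_edges ?K" using e unfolding a(2)[symmetric] f.I_def by auto
      ultimately show ?thesis using f.f0[OF eG(1)] by (auto simp: inputs_iff[OF VK] inner_edges_iff[OF VK])
    qed
    then show False using no a by (auto simp: onto_def)
  qed
  then obtain S' I' e u w where m: "Sub_Ord S' I' \<in> subgraphs ?K" "f.S \<subseteq> S'" "f.I \<subseteq> I'" "src ?K e = Some u" "tgt ?K e = Some w"
     "u \<in> S' \<or> w \<in> S'" "verts ?K = S' \<union> {u, w}" "e \<in> inner_edges ?K" "I' = inner_edges ?K - {e}"
    using maximal_proper_subgraph[OF K sub] by metis
  let ?s = "Sub_Ord S' I'"
  have P: "wf_graph (graph_of ?K ?s)" by (rule wf_graph_of[OF K m(1)])
  obtain H \<psi>V \<psi>E where H: "H \<in> U" "wf_graph H" "graph_iso \<psi>V \<psi>E (graph_of ?K ?s) H"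
    using universe_copy[OF U P] by blast
  obtain c where c: "hom c" "gdom c = H" "gcod c = ?K" "positive c"
      "\<And>d. d \<in> edges (graph_of ?K ?s) \<Longrightarrow> emap c (\<psi>E d) = under d" "\<And>w. w \<in> S' \<Longrightarrow> vmap c (\<psi>V w) = Sub_Ord {w} {}"
    using subgraph_inclusion[OF K m(1) H(3,2)] by auto
  have S'ne: "S' \<noteq> {}" using m(1) by (simp add: subgraphs_Ord_iff)
  then obtain p where p: "p \<in> S'" by auto
  have VH: "verts H \<noteq> {}" using H(3) S'ne by (auto simp: graph_iso_def bij_betw_def)
  let ?D = "contract ?K S' I' p"
  let ?d1 = "\<lambda>x. if x = p then Sub_Ord S' I' else Sub_Ord {x} {}"
  have D: "wf_graph ?D" by (rule wf_contract[OF K m(1) p])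
  have "S' \<subseteq> verts ?K" using m(1) by (simp add: subgraphs_Ord_iff)
  have eI': "e \<notin> I'" using m(9) by auto
  have Din: "inner_edges ?D = {e}" unfolding inner_edges_contract[OF VK] m(9) using m(8) by auto
  have "dioperadic ?D \<or> contracted_corolla ?D"
  proof (cases "verts ?K = S'")
    case True
    then show ?thesis using D Din p by (auto simp: contracted_corolla_def)
  next
    case False
    then consider "u \<in> S'" "w \<notin> S'" | "u \<notin> S'" "w \<in> S'" using m(6,7) by auto
    then show ?thesis
    proof cases
      case 1
      then have "verts ?D = {p, w}" "p \<noteq> w" using m(7) p by auto
      moreover have "src ?D e = Some p" "tgt ?D e = Some w" using 1 m(4,5) eI' by (auto simp: collapse_def)
      ultimately show ?thesis using D Din unfolding dioperadic_def by blast
    next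
      case 2
      then have "verts ?D = {u, p}" "u \<noteq> p" using m(7) p by auto
      moreover have "src ?D e = Some u" "tgt ?D e = Some p" using 2 m(4,5) eI' by (auto simp: collapse_def)
      ultimately show ?thesis using D Din unfolding dioperadic_def by blast
    qed
  qed
  note dg = contract_gmorphism[OF K m(1) p]
  have oc: "outer_coface c"
    by (rule outer_cofaceI[OF U c(1) \<open>dioperadic ?D \<or> contracted_corolla ?D\<close>, where p = p and ?d0.0 = id and ?d1.0 = ?d1
        and \<alpha>V = \<psi>V and \<alpha>E = \<psi>E])
      (use dg c H in auto)
  have "\<exists>l0 l1. gmorphism ?G (graph_of ?K ?s) l0 l1 \<and> (\<forall>e \<in> edges ?G. under (l0 e) = emap f e) \<and>
      (\<forall>v \<in> verts ?G. sverts (l1 v) = sverts (vmap f v))"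
    by (rule lift_to_subgraph[OF f.gmorphism_axioms VG ne m(1)]) (use m(2,3) vI eI in blast)+
  then obtain l0 l1 where l: "gmorphism ?G (graph_of ?K ?s) l0 l1" "\<And>e. e \<in> edges ?G \<Longrightarrow> under (l0 e) = emap f e"
    "\<And>v. v \<in> verts ?G \<Longrightarrow> sverts (l1 v) = sverts (vmap f v)" by blast
  interpret l: gmorphism ?G "graph_of ?K ?s" l0 l1 by (rule l(1))
  have i: "gmorphism (graph_of ?K ?s) H \<psi>E (\<lambda>v. Sub_Ord {\<psi>V v} {})"
    by (rule gmorphism_graph_iso[OF H(3) P H(2)])
  let ?g1 = "\<lambda>v. push (graph_of ?K ?s) H \<psi>E (\<lambda>v. Sub_Ord {\<psi>V v} {}) (l1 v)"
  have gm: "gmorphism ?G H (\<psi>E \<circ> l0) ?g1" by (rule gmorphism_comp[OF l(1) i])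
  define f' where "f' = gmap_of ?G H (\<psi>E \<circ> l0) ?g1"
  have f': "hom f'" "gdom f' = ?G" "gcod f' = H" unfolding f'_def using hom_gmap_of[OF gm] by auto
  have svf': "sverts (vmap f' v) = \<psi>V ` sverts (vmap f v)" if "v \<in> verts ?G" for v
    using that l(3) by (auto simp: f'_def)
  have pf': "positive f'"
    unfolding positive_def f'(2) using svf' ne by (metis image_is_empty sverts.simps(2))
  have lift: "gcomp c f' = f"
  proof (rule hom_eqI)
    show "hom (gcomp c f')" by (rule hom_gcomp[OF f'(1) c(1)]) (use c f' in auto)
    show "emap (gcomp c f') a = emap f a" if "a \<in> edges (gdom (gcomp c f'))" for a
      using that f'(2) l(2)[of a] l.f0[of a] c(5)[of "l0 a"] by (simp add: f'_def)
    show "sverts (vmap (gcomp c f') v) = sverts (vmap f v)" if "v \<in> verts (gdom (gcomp c f'))" for v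
    proof -
      have v: "v \<in> verts (gdom f')" using that by simp
      have "gdom c = gcod f'" using c f' by simp
      then have "sverts (vmap (gcomp c f') v) = (\<Union>x \<in> \<psi>V ` sverts (vmap f v). sverts (vmap c x))"
        using vmap_gcomp[OF f'(1) c(1) _ v] svf' v f'(2) by simp
      also have "\<dots> = sverts (vmap f v)"
      proof -
        have "sverts (vmap c (\<psi>V x)) = {x}" if "x \<in> sverts (vmap f v)" for x
          using c(6)[of x] m(2) v f'(2) that by auto
        then show ?thesis by simp
      qed
      finally show ?thesis .
    qed
  qed (use f f' c in auto)
  have "deg (gdom c) < deg (gcod c)"
  proof (rule ccontr)
    assume "\<not> ?thesis"
    then have "onto c" using positive_deg[OF c(1,4)] by (simp add: negative_def)
    (* the missing edge e is cut in the subgraph, so a leg of the subgraph is sent to the inner edge e *)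
    interpret c: gmorphism "gdom c" "gcod c" "emap c" "vmap c" using hom_gmorphism[OF c(1)] .
    have on: "c.S = verts (gcod c)" "emap c ` inputs (gdom c) \<subseteq> inputs (gcod c)"
      using \<open>onto c\<close> by (auto simp: onto_def)
    note on' = c.onto_outputs[OF on]
    have eK: "e \<in> edges ?K" using src_Some_edge[OF K m(4)] .
    show False using m(6)
    proof
      assume "w \<in> S'"
      then have d: "In_Leg e \<in> inputs (graph_of ?K ?s)"
        using inputs_graph_of[OF K m(1)] eK eI' m(5) by auto
      then have "\<psi>E (In_Leg e) \<in> inputs H" using graph_iso_kinds(1)[OF H(3)]
        by (auto dest: bij_betwE)
      then have "emap c (\<psi>E (In_Leg e)) \<in> inputs ?K" using on(2) c(2,3) by auto
      moreover have "In_Leg e \<in> edges (graph_of ?K ?s)"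
        using d inputs_subset[of "graph_of ?K ?s"] by blast
      ultimately have "e \<in> inputs ?K" using c(5) by fastforce
      then show False using m(4) by (simp add: inputs_iff[OF VK])
    next
      assume "u \<in> S'"
      then have d: "Out_Leg e \<in> outputs (graph_of ?K ?s)"
        using outputs_graph_of[OF K m(1)] eK eI' m(4) by auto
      then have "\<psi>E (Out_Leg e) \<in> outputs H" using graph_iso_kinds(2)[OF H(3)]
        by (auto dest: bij_betwE)
      then have "emap c (\<psi>E (Out_Leg e)) \<in> outputs ?K" using on' c(2,3) by auto
      moreover have "Out_Leg e \<in> edges (graph_of ?K ?s)"
        using d outputs_subset[of "graph_of ?K ?s"] by blast
      ultimately have "e \<in> outputs ?K" using c(5) by fastforce
      then show False using m(5) by (simp add: outputs_iff[OF VK])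
    qed
  qed
  then show ?thesis
    by (intro exI[of _ c] exI[of _ f'] conjI c(1,3) oc f'(1,2) pf' lift) (simp_all add: c(2) f'(3) H(1) VH)
qed

section \<open>Splitting off an inner coface map\<close>

lemma dioperadic_iso:
  assumes iso: "graph_iso \<phi>V \<phi>E G H" and H: "wf_graph H" and d: "dioperadic G"
  shows "dioperadic H"
proof -
  obtain u w e where e: "u \<noteq> w" "verts G = {u, w}" "inner_edges G = {e}" "src G e = Some u" "tgt G e = Some w"
    using d unfolding dioperadic_def by blast
  have eG: "e \<in> edges G" using e(3) inner_edges_subset[of G] by auto
  have "\<phi>V u \<noteq> \<phi>V w" "verts H = {\<phi>V u, \<phi>V w}"
    using iso e(1,2) by (auto simp: graph_iso_def bij_betw_def)
  moreover have "inner_edges H = {\<phi>E e}"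
    using graph_iso_kinds(3)[OF iso] e(3) by (simp add: bij_betw_def)
  moreover have "src H (\<phi>E e) = Some (\<phi>V u)" "tgt H (\<phi>E e) = Some (\<phi>V w)"
    using iso eG e(4,5) by (auto simp: graph_iso_def)
  ultimately show ?thesis using H unfolding dioperadic_def by blast
qed

lemma contracted_corolla_iso:
  assumes iso: "graph_iso \<phi>V \<phi>E G H" and H: "wf_graph H" and d: "contracted_corolla G"
  shows "contracted_corolla H"
proof -
  obtain v e where e: "verts G = {v}" "inner_edges G = {e}" using d unfolding contracted_corolla_def by blast
  have "verts H = {\<phi>V v}" using iso e by (auto simp: graph_iso_def bij_betw_def)
  moreover have "inner_edges H = {\<phi>E e}" using graph_iso_kinds(3)[OF iso] e by (simp add: bij_betw_def)
  ultimately show ?thesis using H unfolding contracted_corolla_def by blast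
qed

lemma edge_subgraph:
  assumes K: "wf_graph K" and e: "src K e = Some u" "tgt K e = Some w"
  shows "Sub_Ord {u, w} {e} \<in> subgraphs K"
    and "dioperadic (graph_of K (Sub_Ord {u, w} {e})) \<or> contracted_corolla (graph_of K (Sub_Ord {u, w} {e}))"
proof -
  have "u \<in> verts K" using e src_Some_vert[OF K] by auto
  then have "Sub_Ord ({u} \<union> {u, w}) (insert e {}) \<in> subgraphs K"
    by (intro extend_subgraph[OF K corolla_subgraph e]) auto
  moreover have "{u} \<union> {u, w} = {u, w}" by auto
  ultimately show s: "Sub_Ord {u, w} {e} \<in> subgraphs K" by simp
  let ?P = "graph_of K (Sub_Ord {u, w} {e})"
  have wf: "wf_graph ?P" by (rule wf_graph_of[OF K s])
  have i: "inner_edges ?P = {Whole e}" using inner_edges_graph_of[OF K s] by simp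
  have V: "verts ?P = {u, w}" by simp
  have st: "src ?P (Whole e) = Some u" "tgt ?P (Whole e) = Some w" using e by simp_all
  show "dioperadic ?P \<or> contracted_corolla ?P"
  proof (cases "u = w")
    case True
    then have "contracted_corolla ?P" unfolding contracted_corolla_def using wf i V by blast
    then show ?thesis ..
  next
    case False
    then have "dioperadic ?P" unfolding dioperadic_def using wf i V st by blast
    then show ?thesis ..
  qed
qed

lemma connected_no_edges: "connected_by K S {} \<Longrightarrow> x \<in> S \<Longrightarrow> S = {x}"
  unfolding connected_by_iff_closed by (drule spec[of _ "{x}"]) auto

text \<open>
  An inner edge \<open>e\<close> of \<open>f\<^sub>1 v\<^sub>0\<close> is not in the image of \<open>f\<^sub>0\<close>, and by disjointness its ends are not
  vertices of any other \<open>f\<^sub>1 v\<close>. So contracting \<open>e\<close> only changes \<open>f\<^sub>1 v\<^sub>0\<close>.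
\<close>

lemma factor_through_contraction:
  fixes K :: "('v, 'e) graph" and G :: "('w, 'd) graph"
  assumes gm: "gmorphism G K f0 f1" and VG: "verts G \<noteq> {}"
    and ne: "\<And>v. v \<in> verts G \<Longrightarrow> sverts (f1 v) \<noteq> {}"
    and v0: "v0 \<in> verts G" and e: "e \<in> sinner (f1 v0)" and uw: "src K e = Some u" "tgt K e = Some w"
  shows "gmorphism G (contract K {u, w} {e} u) f0 (\<lambda>v. Sub_Ord (collapse {u, w} u ` sverts (f1 v)) (sinner (f1 v) - {e}))"
    and "\<And>v. v \<in> verts G \<Longrightarrow> {u, w} \<subseteq> sverts (f1 v) \<or> {u, w} \<inter> sverts (f1 v) = {}"
proof -
  interpret gmorphism G K f0 f1 by fact
  note K = wf_cod
  let ?q = "collapse {u, w} u" and ?K = "contract K {u, w} {e} u"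
  have f1: "f1 v = Sub_Ord (sverts (f1 v)) (sinner (f1 v))" if "v \<in> verts G" for v
    by (rule Sub_Ord_eq[OF ne[OF that]])
  have sub: "Sub_Ord (sverts (f1 v)) (sinner (f1 v)) \<in> subgraphs K" if "v \<in> verts G" for v
    using premap.f1[OF premap_axioms that] f1[OF that] by simp
  have uw0: "u \<in> sverts (f1 v0)" "w \<in> sverts (f1 v0)"
    using subgraph_inner(1)[OF K sub[OF v0] e] uw by auto
  have VK: "u \<in> verts K" "w \<in> verts K" "verts K \<noteq> {}"
    using uw src_Some_vert[OF K] tgt_Some_vert[OF K] by auto
  show dich: "{u, w} \<subseteq> sverts (f1 v) \<or> {u, w} \<inter> sverts (f1 v) = {}" if "v \<in> verts G" for v
    using uw0 same_vert[OF v0 that] by (cases "v = v0") auto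
  have q: "?q x \<in> ?q ` sverts (f1 v) \<longleftrightarrow> x \<in> sverts (f1 v)" if "v \<in> verts G" for v x
    using dich[OF that] by (auto simp: collapse_def split: if_splits)
  have wfK: "wf_graph ?K" by (rule wf_contract[OF K edge_subgraph(1)[OF K uw]]) simp
  have e_notin: "e \<notin> ins K (f1 v)" "e \<notin> outs K (f1 v)" if v: "v \<in> verts G" for v
  proof -
    have "v = v0" if "w \<in> sverts (f1 v) \<or> u \<in> sverts (f1 v)"
      using that same_vert[OF v v0, of w] same_vert[OF v v0, of u] uw0 by blast
    moreover have "e \<notin> ins K (f1 v0)" "e \<notin> outs K (f1 v0)" using e by (cases "f1 v0"; simp)+
    moreover have "w \<in> sverts (f1 v)" if "e \<in> ins K (f1 v)"
      using that ne[OF v] uw by (cases "f1 v") auto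
    moreover have "u \<in> sverts (f1 v)" if "e \<in> outs K (f1 v)"
      using that ne[OF v] uw by (cases "f1 v") auto
    ultimately show "e \<notin> ins K (f1 v)" "e \<notin> outs K (f1 v)" by blast+
  qed
  have ins: "ins ?K (Sub_Ord (?q ` sverts (f1 v)) (sinner (f1 v) - {e})) = ins K (f1 v)" if v: "v \<in> verts G" for v
  proof -
    have A: "k \<in> ins ?K (Sub_Ord (?q ` sverts (f1 v)) (sinner (f1 v) - {e})) \<longleftrightarrow>
       k \<in> edges K \<and> k \<noteq> e \<and> k \<notin> sinner (f1 v) \<and> (\<exists>x \<in> sverts (f1 v). tgt K k = Some x)" for k
      using q[OF v] by (auto simp: image_iff)
    have B: "k \<in> ins K (f1 v) \<longleftrightarrow> k \<in> edges K \<and> k \<notin> sinner (f1 v) \<and> (\<exists>x \<in> sverts (f1 v). tgt K k = Some x)" for k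
      by (subst f1[OF v]) auto
    show ?thesis
    proof (rule set_eqI)
      fix k
      have "k \<in> ins K (f1 v) \<Longrightarrow> k \<noteq> e" using e_notin(1)[OF v] by blast
      then show "k \<in> ins ?K (Sub_Ord (?q ` sverts (f1 v)) (sinner (f1 v) - {e})) \<longleftrightarrow> k \<in> ins K (f1 v)"
        unfolding A B by blast
    qed
  qed
  have outs: "outs ?K (Sub_Ord (?q ` sverts (f1 v)) (sinner (f1 v) - {e})) = outs K (f1 v)" if v: "v \<in> verts G" for v
  proof -
    have A: "k \<in> outs ?K (Sub_Ord (?q ` sverts (f1 v)) (sinner (f1 v) - {e})) \<longleftrightarrow>
       k \<in> edges K \<and> k \<noteq> e \<and> k \<notin> sinner (f1 v) \<and> (\<exists>x \<in> sverts (f1 v). src K k = Some x)" for k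
      using q[OF v] by (auto simp: image_iff)
    have B: "k \<in> outs K (f1 v) \<longleftrightarrow> k \<in> edges K \<and> k \<notin> sinner (f1 v) \<and> (\<exists>x \<in> sverts (f1 v). src K k = Some x)" for k
      by (subst f1[OF v]) auto
    show ?thesis
    proof (rule set_eqI)
      fix k
      have "k \<in> outs K (f1 v) \<Longrightarrow> k \<noteq> e" using e_notin(2)[OF v] by blast
      then show "k \<in> outs ?K (Sub_Ord (?q ` sverts (f1 v)) (sinner (f1 v) - {e})) \<longleftrightarrow> k \<in> outs K (f1 v)"
        unfolding A B by blast
    qed
  qed
  show "gmorphism G ?K f0 (\<lambda>v. Sub_Ord (?q ` sverts (f1 v)) (sinner (f1 v) - {e}))"
  proof unfold_locales
    show "f0 a \<in> edges ?K" if a: "a \<in> edges G" for a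
    proof -
      consider v where "tgt G a = Some v" | v where "src G a = Some v" using wf_ends[OF wf_dom VG a] by auto
      then have "f0 a \<noteq> e"
      proof cases
        case 1
        then have v: "v \<in> verts G" "a \<in> in_at G v" using tgt_Some_vert[OF wf_dom] in_at_iff[OF wf_dom]
          by auto
        then show ?thesis using bij_betwE[OF f_in[OF v(1)]] e_notin(1)[OF v(1)] by auto
      next
        case 2
        then have v: "v \<in> verts G" "a \<in> out_at G v" using src_Some_vert[OF wf_dom] out_at_iff[OF wf_dom]
          by auto
        then show ?thesis using bij_betwE[OF f_out[OF v(1)]] e_notin(2)[OF v(1)] by auto
      qed
      then show ?thesis using f0[OF a] by simp
    qed
    show "Sub_Ord (?q ` sverts (f1 v)) (sinner (f1 v) - {e}) \<in> subgraphs ?K" if v: "v \<in> verts G" for v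
    proof -
      have "connected_by ?K (?q ` sverts (f1 v)) (sinner (f1 v) - {e})"
        unfolding connected_by_iff_closed
      proof (intro allI impI)
        fix T assume T: "T \<inter> ?q ` sverts (f1 v) \<noteq> {}"
          and cl: "\<forall>k \<in> sinner (f1 v) - {e}. \<forall>a b. src ?K k = Some a \<longrightarrow> tgt ?K k = Some b \<longrightarrow> (a \<in> T \<longleftrightarrow> b \<in> T)"
        have "{x. ?q x \<in> T} \<inter> sverts (f1 v) \<noteq> {}" using T by auto
        moreover have "\<forall>k \<in> sinner (f1 v). \<forall>a b. src K k = Some a \<longrightarrow> tgt K k = Some b \<longrightarrow>
            (a \<in> {x. ?q x \<in> T} \<longleftrightarrow> b \<in> {x. ?q x \<in> T})"
        proof (intro ballI allI impI)
          fix k a b assume k: "k \<in> sinner (f1 v)" "src K k = Some a" "tgt K k = Some b"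
          show "a \<in> {x. ?q x \<in> T} \<longleftrightarrow> b \<in> {x. ?q x \<in> T}"
          proof (cases "k = e")
            case True
            then show ?thesis using k uw by (simp add: collapse_def)
          next
            case False
            then show ?thesis using cl k by auto
          qed
        qed
        ultimately have "sverts (f1 v) \<subseteq> {x. ?q x \<in> T}"
          using sub[OF v] unfolding subgraphs_Ord_iff connected_by_iff_closed
          by (elim conjE allE[of _ "{x. ?q x \<in> T}"]) simp
        then show "?q ` sverts (f1 v) \<subseteq> T" by auto
      qed
      moreover have "sinner (f1 v) - {e} \<subseteq> inner_edges ?K"
        unfolding inner_edges_contract[OF VK(3)] using sub[OF v] by (auto simp: subgraphs_Ord_iff)
      moreover have "?q ` sverts (f1 v) \<subseteq> verts ?K"
        using sub[OF v] by (auto simp: subgraphs_Ord_iff collapse_def)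
      moreover have "the (src ?K k) \<in> ?q ` sverts (f1 v) \<and> the (tgt ?K k) \<in> ?q ` sverts (f1 v)"
        if k: "k \<in> sinner (f1 v) - {e}" for k
      proof -
        have "k \<in> sinner (f1 v)" using k by auto
        from subgraph_inner(1)[OF K sub[OF v] this] show ?thesis using k by auto
      qed
      ultimately show ?thesis using ne[OF v] by (simp add: subgraphs_Ord_iff)
    qed
    show "bij_betw f0 (in_at G v) (ins ?K (Sub_Ord (?q ` sverts (f1 v)) (sinner (f1 v) - {e})))" if "v \<in> verts G" for v
      unfolding ins[OF that] by (rule f_in[OF that])
    show "bij_betw f0 (out_at G v) (outs ?K (Sub_Ord (?q ` sverts (f1 v)) (sinner (f1 v) - {e})))" if "v \<in> verts G" for v
      unfolding outs[OF that] by (rule f_out[OF that])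
    show "sverts (Sub_Ord (?q ` sverts (f1 v)) (sinner (f1 v) - {e})) \<inter>
        sverts (Sub_Ord (?q ` sverts (f1 v')) (sinner (f1 v') - {e})) = {}"
      if v: "v \<in> verts G" "v' \<in> verts G" "v \<noteq> v'" for v v'
    proof (rule ccontr)
      assume "\<not> ?thesis"
      then obtain x where x: "x \<in> sverts (f1 v)" "?q x \<in> ?q ` sverts (f1 v')" by auto
      then have "x \<in> sverts (f1 v')" using q[OF v(2)] by simp
      then show False using x(1) disjoint[OF v] by auto
    qed
    show "is_Exc_Loop ?K"
      if "\<forall>v \<in> verts G. sverts (Sub_Ord (?q ` sverts (f1 v)) (sinner (f1 v) - {e})) = {}"
      using that ne v0 by auto
  qed (use wf_dom wfK in auto)
qed

text \<open>
  A positive map onto its target that is not negative sends some vertex to a connected subgraph that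
  is not a corolla, which has an inner edge \<open>e\<close>. The coface map is the one that restores \<open>e\<close> after its
  contraction.
\<close>

lemma inner_step:
  fixes f :: "('v, 'e) gmap"
  assumes U: "graph_universe U" and f: "hom f" "positive f" and VG: "verts (gdom f) \<noteq> {}" and VK: "verts (gcod f) \<noteq> {}"
    and on: "onto f" and nn: "\<not> negative f"
  shows "\<exists>c f'. hom c \<and> inner_coface c \<and> hom f' \<and> positive f' \<and> gdom f' = gdom f \<and> gcod f' = gdom c \<and>
     gcod c = gcod f \<and> gdom c \<in> U \<and> verts (gdom c) \<noteq> {} \<and> gcomp c f' = f \<and> deg (gdom c) < deg (gcod c)"
proof -
  let ?G = "gdom f" and ?K = "gcod f"
  interpret f: gmorphism ?G ?K "emap f" "vmap f" using hom_gmorphism[OF f(1)] .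
  note K = f.wf_cod
  note ne = positive_inner[OF f VG VK]
  obtain v0 where v0: "v0 \<in> verts ?G" "\<nexists>w. vmap f v0 = Sub_Ord {w} {}"
    using on nn by (auto simp: negative_def)
  have eq: "vmap f v = Sub_Ord (sverts (vmap f v)) (sinner (vmap f v))" if "v \<in> verts ?G" for v
    by (rule Sub_Ord_eq[OF ne[OF that]])
  have sub: "Sub_Ord (sverts (vmap f v0)) (sinner (vmap f v0)) \<in> subgraphs ?K"
    using f.f1[OF v0(1)] eq[OF v0(1)] by simp
  have "sinner (vmap f v0) \<noteq> {}"
  proof
    assume "sinner (vmap f v0) = {}"
    moreover obtain x where "x \<in> sverts (vmap f v0)" using ne[OF v0(1)] by auto
    ultimately have "sverts (vmap f v0) = {x}" "sinner (vmap f v0) = {}"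
      using sub connected_no_edges[of ?K "sverts (vmap f v0)" x] by (auto simp: subgraphs_Ord_iff)
    then show False using v0 eq[OF v0(1)] by metis
  qed
  then obtain e where e: "e \<in> sinner (vmap f v0)" by auto
  obtain u w where uw: "src ?K e = Some u" "tgt ?K e = Some w" using subgraph_inner(1)[OF K sub e] by blast
  let ?s = "Sub_Ord {u, w} {e}" and ?K1 = "contract ?K {u, w} {e} u"
  let ?q = "collapse {u, w} u"
  have s: "?s \<in> subgraphs ?K" by (rule edge_subgraph(1)[OF K uw])
  let ?d1 = "\<lambda>x. if x = u then Sub_Ord {u, w} {e} else Sub_Ord {x} {}"
  have wf1: "wf_graph ?K1" by (rule wf_contract[OF K s]) simp
  have dg: "gmorphism ?K1 ?K id ?d1" "(\<Union>v \<in> verts ?K1. sverts (?d1 v)) = verts ?K" "id ` inputs ?K1 \<subseteq> inputs ?K"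
    using contract_gmorphism[OF K s, of u] by auto
  obtain H \<phi>V \<phi>E where H: "H \<in> U" "wf_graph H" "graph_iso \<phi>V \<phi>E ?K1 H"
    using universe_copy[OF U wf1] by blast
  define iV where "iV = inv_into (verts ?K1) \<phi>V"
  define iE where "iE = inv_into (edges ?K1) \<phi>E"
  have inv: "graph_iso iV iE H ?K1" unfolding iV_def iE_def by (rule graph_iso_inv[OF H(3) wf1])
  have VB: "bij_betw \<phi>V (verts ?K1) (verts H)" using H(3) by (simp add: graph_iso_def)
  have iV: "iV (\<phi>V x) = x" if "x \<in> verts ?K1" for x using bij_betw_inv_into_left[OF VB that]
    by (simp add: iV_def)
  have iV': "\<phi>V (iV y) = y" if "y \<in> verts H" for y using bij_betw_inv_into_right[OF VB that]
    by (simp add: iV_def)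
  have iE: "iE (\<phi>E x) = x" if "x \<in> edges ?K1" for x
    using H(3) that bij_betw_inv_into_left[of \<phi>E "edges ?K1" "edges H" x]
      by (simp add: iE_def graph_iso_def)
  note c = gmorphism_precomp_iso[OF dg(1) inv H(2) dg(2,3)]
  define c where "c = gmap_of H ?K (id \<circ> iE) (?d1 \<circ> iV)"
  have hc: "hom c" unfolding c_def by (rule hom_gmap_of[OF c(1)])
  have cd: "gdom c = H" "gcod c = ?K" by (simp_all add: c_def)
  have oc: "onto c" using c(2,3) inputs_subset[of H] unfolding onto_def cd c_def by (auto simp: subset_iff)
  have u1: "u \<in> verts ?K1" by simp
  then have uH: "\<phi>V u \<in> verts H" using bij_betwE[OF VB] by blast
  have vu: "vmap c (\<phi>V u) = ?s" using uH iV[OF u1] by (simp add: c_def)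
  have pc: "positive c" unfolding positive_def cd by (simp add: c_def)
  have "substitution_map (\<lambda>Q. dioperadic Q \<or> contracted_corolla Q) c"
  proof (rule substitution_mapI[OF U hc oc])
    show "\<phi>V u \<in> verts (gdom c)" using uH cd by simp
    show "\<exists>x. vmap c y = Sub_Ord {x} {}" if "y \<in> verts (gdom c)" "y \<noteq> \<phi>V u" for y
    proof -
      have "iV y \<noteq> u" using iV'[of y] that cd by auto
      then show ?thesis using that cd by (simp add: c_def)
    qed
    show "dioperadic Q \<or> contracted_corolla Q" if "wf_graph Q" "graph_iso \<psi>V \<psi>E (graph_of (gcod c) (vmap c (\<phi>V u))) Q" for Q :: "('v, 'e) graph" and \<psi>V \<psi>E
      using edge_subgraph(2)[OF K uw] dioperadic_iso[OF that(2,1)] contracted_corolla_iso[OF that(2,1)]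
      unfolding vu cd by blast
  qed
  then have ic: "inner_coface c" by (simp add: inner_coface_def)
  let ?g1 = "\<lambda>v. Sub_Ord (?q ` sverts (vmap f v)) (sinner (vmap f v) - {e})"
  have fc1: "gmorphism ?G ?K1 (emap f) ?g1"
    by (rule factor_through_contraction(1)[OF f.gmorphism_axioms VG ne v0(1) e uw])
  have fc2: "{u, w} \<subseteq> sverts (vmap f v) \<or> {u, w} \<inter> sverts (vmap f v) = {}" if "v \<in> verts ?G" for v
    by (rule factor_through_contraction(2)[OF f.gmorphism_axioms VG ne v0(1) e uw that])
  have "gmorphism ?K1 H \<phi>E (\<lambda>v. Sub_Ord {\<phi>V v} {})"
    by (rule gmorphism_graph_iso[OF H(3) wf1 H(2)])
  note gm = gmorphism_comp[OF fc1 this]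
  interpret g1: gmorphism ?G ?K1 "emap f" ?g1 by (rule fc1)
  define f' where "f' = gmap_of ?G H (\<phi>E \<circ> emap f) (\<lambda>v. push ?K1 H \<phi>E (\<lambda>v. Sub_Ord {\<phi>V v} {}) (?g1 v))"
  have f': "hom f'" "gdom f' = ?G" "gcod f' = H" unfolding f'_def using hom_gmap_of[OF gm] by auto
  have svf': "sverts (vmap f' v) = \<phi>V ` ?q ` sverts (vmap f v)" if "v \<in> verts ?G" for v
    using that by (auto simp: f'_def)
  have pf': "positive f'"
    unfolding positive_def f'(2) using svf' ne by (metis image_is_empty sverts.simps(2))
  have lift: "gcomp c f' = f"
  proof (rule hom_eqI)
    show "hom (gcomp c f')" by (rule hom_gcomp[OF f'(1) hc]) (use cd f' in auto)
    show "emap (gcomp c f') a = emap f a" if a: "a \<in> edges (gdom (gcomp c f'))" for a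
    proof -
      have a: "a \<in> edges ?G" using a f' by simp
      have "\<phi>E (emap f a) \<in> edges H" using H(3) g1.f0[OF a]
        by (auto simp: graph_iso_def dest: bij_betwE)
      then show ?thesis using a f'(2) iE[OF g1.f0[OF a]] by (simp add: f'_def c_def)
    qed
    show "sverts (vmap (gcomp c f') v) = sverts (vmap f v)" if "v \<in> verts (gdom (gcomp c f'))" for v
    proof -
      have v: "v \<in> verts (gdom f')" "v \<in> verts ?G" using that f' by simp_all
      have "gdom c = gcod f'" using cd f' by simp
      then have "sverts (vmap (gcomp c f') v) = (\<Union>x \<in> \<phi>V ` ?q ` sverts (vmap f v). sverts (vmap c x))"
        using vmap_gcomp[OF f'(1) hc _ v(1)] svf' v by simp
      also have "\<dots> = (\<Union>x \<in> ?q ` sverts (vmap f v). sverts (?d1 x))"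
      proof -
        have "sverts (vmap c (\<phi>V x)) = sverts (?d1 x)" if x: "x \<in> ?q ` sverts (vmap f v)" for x
        proof -
          have "x \<in> verts ?K1" using x hom_sverts[OF f(1) v(2)] by (auto simp: collapse_def)
          then have "\<phi>V x \<in> verts H" "iV (\<phi>V x) = x" using bij_betwE[OF VB] iV by auto
          then show ?thesis by (simp add: c_def)
        qed
        then show ?thesis by simp
      qed
      also have "\<dots> = sverts (vmap f v)"
        using fc2[OF v(2)] by (auto simp: collapse_def split: if_splits)
      finally show ?thesis .
    qed
  qed (use f f' cd in auto)
  have "deg (gdom c) < deg (gcod c)"
  proof (rule ccontr)
    assume "\<not> ?thesis"
    then have "negative c" using positive_deg[OF hc pc] by simp
    then show False using vu uH cd unfolding negative_def by auto
  qed
  moreover have "verts H \<noteq> {}" using uH by auto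
  ultimately show ?thesis
    by (intro exI[of _ c] exI[of _ f'] conjI hc cd(2) ic f'(1,2) pf' lift) (simp_all add: cd(1) f'(3) H(1))
qed

section \<open>Maps out of the exceptional edge\<close>

text \<open>
  A corolla \<open>H\<close> with an input \<open>l\<close> arises from a graph with two vertices by substituting the exceptional
  edge: a new vertex \<open>None\<close> with one input and one output is placed on \<open>l\<close>, whose outer half is the new
  edge \<open>None\<close>. So the inclusion of \<open>l\<close> into \<open>H\<close> is an outer coface map.
\<close>

lemma edge_expansion:
  fixes H :: "('v, 'e) graph"
  assumes H: "wf_graph H" and V: "verts H = {x}" and inn: "inner_edges H = {}" and l: "tgt H l = Some x"
  shows "\<exists>(D :: ('v option, 'e option) graph) d0 d1 p. dioperadic D \<and> gmorphism D H d0 d1 \<and>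
     (\<Union>v \<in> verts D. sverts (d1 v)) = verts H \<and> d0 ` inputs D \<subseteq> inputs H \<and> d0 ` outputs D \<subseteq> outputs H \<and>
     p \<in> verts D \<and> d1 p = Sub_Edge l \<and> (\<forall>w \<in> verts D - {p}. \<exists>y. d1 w = Sub_Ord {y} {})"
proof -
  have lE: "l \<in> edges H" using tgt_Some_edge[OF H l] .
  have VH: "verts H \<noteq> {}" using V by simp
  have ls: "src H l = None" using inn l lE by (auto simp: inner_edges_iff[OF VH] set_eq_iff)
  define s where "s a = (case a of None \<Rightarrow> None | Some e \<Rightarrow> if e = l then Some None else map_option Some (src H e))" for a
  define t where "t a = (case a of None \<Rightarrow> Some None | Some e \<Rightarrow> map_option Some (tgt H e))" for a
  let ?D = "Ordinary {None, Some x} (insert None (Some ` edges H)) s t"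
  define d0 where "d0 a = (case a of None \<Rightarrow> l | Some e \<Rightarrow> e)" for a
  define d1 :: "'v option \<Rightarrow> ('v, 'e) subgraph" where "d1 v = (case v of None \<Rightarrow> Sub_Edge l | Some y \<Rightarrow> Sub_Ord {y} {})" for v
  have ends: "src H e \<noteq> None \<or> tgt H e \<noteq> None" if "e \<in> edges H" for e by (rule wf_ends[OF H VH that])
  have sv: "src H e = Some y \<Longrightarrow> y = x \<and> e \<in> edges H" for e y using src_Some_vert[OF H] src_Some_edge[OF H] V by auto
  have tv: "tgt H e = Some y \<Longrightarrow> y = x \<and> e \<in> edges H" for e y using tgt_Some_vert[OF H] tgt_Some_edge[OF H] V by auto
  have noi: "\<not> (src H e = Some y \<and> tgt H e = Some z)" for e y z
    using inn sv[of e y] by (auto simp: inner_edges_iff[OF VH] set_eq_iff)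
  have inD: "inner_edges ?D = {Some l}"
    using noi lE l by (auto simp: s_def t_def split: option.splits if_splits)
  have "dom s \<union> dom t = insert None (Some ` edges H)"
  proof (rule set_eqI)
    fix a show "a \<in> dom s \<union> dom t \<longleftrightarrow> a \<in> insert None (Some ` edges H)"
      using ends sv tv lE by (cases a) (auto simp: s_def t_def dom_def split: if_splits)
  qed
  moreover have "ran s \<subseteq> {None, Some x}" "ran t \<subseteq> {None, Some x}"
    using sv tv by (auto simp: ran_def s_def t_def split: option.splits if_splits)
  moreover have "connected_by ?D {None, Some x} (inner_edges ?D)"
    unfolding inD connected_by_iff_closed by (auto simp: s_def t_def l)
  ultimately have D: "wf_graph ?D" using finite_edges[OF H] by simp
  have dio: "dioperadic ?D" unfolding dioperadic_def
    by (intro conjI D exI[of _ None] exI[of _ "Some x"] exI[of _ "Some l"]) (use inD in \<open>simp_all add: s_def t_def l\<close>)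
  have d0S: "bij_betw d0 (Some ` A) A" for A
    by (rule bij_betw_imageI) (auto simp: d0_def inj_on_def image_image)
  have d0B: "bij_betw d0 (in_at ?D v) (ins H (d1 v))" if "v \<in> verts ?D" for v
  proof (cases v)
    case None
    have "in_at ?D None = {None}" by (auto simp: in_at_def t_def split: option.splits)
    then show ?thesis using None by (simp add: d1_def d0_def bij_betw_def)
  next
    case (Some y)
    then have y: "y = x" using that by simp
    have "in_at ?D (Some x) = Some ` in_at H x"
    proof (rule set_eqI)
      fix a show "a \<in> in_at ?D (Some x) \<longleftrightarrow> a \<in> Some ` in_at H x"
        by (cases a) (auto simp: in_at_def t_def)
    qed
    then have "in_at ?D v = Some ` in_at H x" using Some y by simp
    moreover have "ins H (d1 v) = in_at H x" using ins_corolla[OF H] Some y by (simp add: d1_def)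
    ultimately show ?thesis using d0S by simp
  qed
  have d0B': "bij_betw d0 (out_at ?D v) (outs H (d1 v))" if "v \<in> verts ?D" for v
  proof (cases v)
    case None
    have "out_at ?D None = {Some l}" using lE by (auto simp: out_at_def s_def split: option.splits if_splits)
    then show ?thesis using None by (simp add: d1_def d0_def bij_betw_def)
  next
    case (Some y)
    then have y: "y = x" using that by simp
    have "out_at ?D (Some x) = Some ` out_at H x"
    proof (rule set_eqI)
      fix a show "a \<in> out_at ?D (Some x) \<longleftrightarrow> a \<in> Some ` out_at H x"
        by (cases a) (auto simp: out_at_def s_def ls)
    qed
    then have "out_at ?D v = Some ` out_at H x" using Some y by simp
    moreover have "outs H (d1 v) = out_at H x" using outs_corolla[OF H] Some y by (simp add: d1_def)
    ultimately show ?thesis using d0S by simp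
  qed
  have gm: "gmorphism ?D H d0 d1"
  proof unfold_locales
    show "d0 a \<in> edges H" if "a \<in> edges ?D" for a using that lE by (auto simp: d0_def)
    show "d1 v \<in> subgraphs H" if "v \<in> verts ?D" for v
      using that lE corolla_subgraph[of x H] V by (auto simp: d1_def subgraphs_Ord_iff)
    show "is_Exc_Loop H" if "\<forall>v \<in> verts ?D. sverts (d1 v) = {}" using that by (simp add: d1_def)
  qed (use D H d0B d0B' in \<open>auto simp: d1_def\<close>)
  have un: "(\<Union>v \<in> verts ?D. sverts (d1 v)) = verts H" using V by (simp add: d1_def)
  have i: "d0 ` inputs ?D \<subseteq> inputs H"
    using lE ls by (auto simp: inputs_iff[OF VH] s_def d0_def split: option.splits if_splits)
  have o: "d0 ` outputs ?D \<subseteq> outputs H"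
    by (auto simp: outputs_iff[OF VH] t_def d0_def split: option.splits if_splits)
  show ?thesis
    by (rule exI[of _ ?D], rule exI[of _ d0], rule exI[of _ d1], rule exI[of _ None])
      (intro conjI dio gm un i o; simp add: d1_def)
qed

lemma edge_expansion_both:
  fixes H :: "('v, 'e) graph"
  assumes H: "wf_graph H" and V: "verts H = {x}" and inn: "inner_edges H = {}" and l: "l \<in> edges H"
  shows "\<exists>(D :: ('v option, 'e option) graph) d0 d1 p. dioperadic D \<and> gmorphism D H d0 d1 \<and>
     (\<Union>v \<in> verts D. sverts (d1 v)) = verts H \<and> d0 ` inputs D \<subseteq> inputs H \<and>
     p \<in> verts D \<and> d1 p = Sub_Edge l \<and> (\<forall>w \<in> verts D - {p}. \<exists>y. d1 w = Sub_Ord {y} {})"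
proof (cases "tgt H l")
  case (Some y)
  then have "tgt H l = Some x" using tgt_Some_vert[OF H] V by auto
  from edge_expansion[OF H V inn this] show ?thesis
    by (elim exE conjE) (intro exI conjI; assumption)
next
  case None
  then have "src H l \<noteq> None" using wf_ends[OF H _ l] V by simp
  then have "src H l = Some x" using src_Some_vert[OF H] V by auto
  then have t: "tgt (rev_graph H) l = Some x" by simp
  obtain D :: "('v option, 'e option) graph" and d0 d1 p where d: "dioperadic D" "gmorphism D (rev_graph H) d0 d1"
     "(\<Union>v \<in> verts D. sverts (d1 v)) = verts (rev_graph H)" "d0 ` outputs D \<subseteq> outputs (rev_graph H)"
     "p \<in> verts D" "d1 p = Sub_Edge l" "\<forall>w \<in> verts D - {p}. \<exists>y. d1 w = Sub_Ord {y} {}"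
    using edge_expansion[of "rev_graph H" x l] H V inn t by auto
  obtain u w e where e: "u \<noteq> w" "verts D = {u, w}" "inner_edges D = {e}" "src D e = Some u" "tgt D e = Some w"
    using d(1) unfolding dioperadic_def by blast
  have "dioperadic (rev_graph D)" unfolding dioperadic_def
    by (intro conjI exI[of _ w] exI[of _ u] exI[of _ e]) (use d(1) e in \<open>auto simp: dioperadic_def\<close>)
  moreover have "gmorphism (rev_graph D) H d0 d1" using gmorphism_rev[OF d(2)] by simp
  ultimately show ?thesis using d by (intro exI[of _ "rev_graph D"] exI[of _ d0] exI[of _ d1] exI[of _ p]) auto
qed

lemma edge_to_corolla:
  fixes f :: "('v, 'e) gmap" and U :: "('v, 'e) graph set"
  assumes U: "graph_universe U" and f: "hom f" and G: "gdom f = Exc_Edge a"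
    and V: "verts (gcod f) = {x}" and inn: "inner_edges (gcod f) = {}"
  shows "outer_coface f"
proof -
  let ?H = "gcod f" and ?l = "emap f a"
  have H: "wf_graph ?H" using f by (simp add: hom_def)
  have l: "?l \<in> edges ?H" using hom_edge[OF f, of a] G by simp
  obtain D :: "('v option, 'e option) graph" and d0 d1 p where d: "dioperadic D" "gmorphism D ?H d0 d1"
     "(\<Union>v \<in> verts D. sverts (d1 v)) = verts ?H" "d0 ` inputs D \<subseteq> inputs ?H"
     "p \<in> verts D" "d1 p = Sub_Edge ?l" "\<forall>w \<in> verts D - {p}. \<exists>y. d1 w = Sub_Ord {y} {}"
    using edge_expansion_both[OF H V inn l] by (elim exE conjE)
  have wfD: "wf_graph D" using d(1) by (simp add: dioperadic_def)
  obtain E \<phi>V \<phi>E where E: "E \<in> U" "wf_graph E" "graph_iso \<phi>V \<phi>E D E"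
    using universe_copy[OF U wfD] by blast
  define iV where "iV = inv_into (verts D) \<phi>V"
  define iE where "iE = inv_into (edges D) \<phi>E"
  have inv: "graph_iso iV iE E D" unfolding iV_def iE_def by (rule graph_iso_inv[OF E(3) wfD])
  have VB: "bij_betw \<phi>V (verts D) (verts E)" using E(3) by (simp add: graph_iso_def)
  note g = gmorphism_precomp_iso[OF d(2) inv E(2) d(3,4)]
  have p: "iV (\<phi>V p) = p" using bij_betw_inv_into_left[OF VB d(5)] by (simp add: iV_def)
  show ?thesis
  proof (rule outer_cofaceI[OF U f _ g, where p = "\<phi>V p" and \<alpha>V = undefined and \<alpha>E = "\<lambda>_. a"])
    show "dioperadic E \<or> contracted_corolla E" using dioperadic_iso[OF E(3,2) d(1)] by simp
    show "\<phi>V p \<in> verts E" using bij_betwE[OF VB] d(5) by blast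
    show "\<exists>x. (d1 \<circ> iV) w = Sub_Ord {x} {}" if w: "w \<in> verts E" "w \<noteq> \<phi>V p" for w
    proof -
      have "\<phi>V (iV w) = w" using bij_betw_inv_into_right[OF VB w(1)] by (simp add: iV_def)
      moreover have "iV w \<in> verts D" using inv w(1) by (auto simp: graph_iso_def dest: bij_betwE)
      ultimately have "iV w \<in> verts D - {p}" using w(2) by auto
      then show ?thesis using d(7) by simp
    qed
    show "graph_iso undefined (\<lambda>_. a) (graph_of ?H ((d1 \<circ> iV) (\<phi>V p))) (gdom f)"
      using p d(6) G by (simp add: graph_iso_def bij_betw_def)
    show "emap f a = under d" if "d \<in> edges (graph_of ?H ((d1 \<circ> iV) (\<phi>V p)))" for d
      using that p d(6) by simp
    show "vmap f (undefined w) = Sub_Ord {w} {}" if "w \<in> sverts ((d1 \<circ> iV) (\<phi>V p))" for w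
      using that p d(6) by simp
  qed
qed

text \<open>
  The exceptional loop is the result of substituting the exceptional edge into a vertex with a loop.
\<close>

lemma edge_to_loop:
  fixes f :: "('v, 'e) gmap" and U :: "('v, 'e) graph set"
  assumes U: "graph_universe U" and f: "hom f" and G: "gdom f = Exc_Edge a" and K: "gcod f = Exc_Loop k"
  shows "outer_coface f"
proof -
  have k: "emap f a = k" using hom_edge[OF f, of a] G K by simp
  fix v0 :: 'v
  let ?D = "Ordinary {v0} {k} [k \<mapsto> v0] [k \<mapsto> v0]"
  have D: "wf_graph ?D" by (simp add: connected_by_def)
  have gm: "gmorphism ?D (gcod f) id (\<lambda>_. Sub_Edge k)"
    unfolding K by unfold_locales (use D in \<open>auto simp: subgraphs_Ord_iff in_at_def out_at_def bij_betw_def split: if_splits\<close>)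
  have inn: "inner_edges ?D = {k}" by auto
  show ?thesis
  proof (rule outer_cofaceI[OF U f _ gm, where p = v0 and \<alpha>V = undefined and \<alpha>E = "\<lambda>_. a"])
    show "dioperadic ?D \<or> contracted_corolla ?D" unfolding contracted_corolla_def using D inn by auto
    show "graph_iso undefined (\<lambda>_. a) (graph_of (gcod f) (Sub_Edge k)) (gdom f)"
      using G by (simp add: graph_iso_def bij_betw_def)
  qed (use K k in auto)
qed

section \<open>Splitting off a codegeneracy map\<close>

text \<open>
  Deleting \<open>v\<close> merges its input \<open>a\<close> and its output \<open>b\<close> to an edge that is again called \<open>a\<close>. If \<open>v\<close> is the
  only vertex, then the result is the exceptional loop or the exceptional edge, depending on whether
  \<open>a = b\<close>.
\<close>

lemma remove_bivalent:
  fixes G :: "('v, 'e) graph"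
  assumes G: "wf_graph G" and v: "v \<in> verts G" and a: "in_at G v = {a}" and b: "out_at G v = {b}"
  shows "\<exists>(G' :: ('v, 'e) graph) h0 h1. gmorphism G G' h0 h1 \<and> (\<Union>x \<in> verts G. sverts (h1 x)) = verts G' \<and>
     h0 ` inputs G \<subseteq> inputs G' \<and> (\<exists>k. h1 v = Sub_Edge k) \<and> (\<forall>x \<in> verts G - {v}. \<exists>y. h1 x = Sub_Ord {y} {})"
proof -
  have VG: "verts G \<noteq> {}" using v by auto
  have ta: "tgt G e = Some v \<longleftrightarrow> e = a" for e using a in_at_iff[OF G, of e v] by auto
  have sb: "src G e = Some v \<longleftrightarrow> e = b" for e using b out_at_iff[OF G, of e v] by auto
  have aE: "a \<in> edges G" "b \<in> edges G"
    using ta[of a] sb[of b] src_Some_edge[OF G, of b v] tgt_Some_edge[OF G, of a v] by auto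
  show ?thesis
  proof (cases "verts G = {v}")
    case True
    have E: "edges G = {a, b}"
    proof
      show "edges G \<subseteq> {a, b}"
      proof
        fix e assume "e \<in> edges G"
        then have "src G e = Some v \<or> tgt G e = Some v"
          using wf_ends[OF G VG] src_Some_vert[OF G] tgt_Some_vert[OF G] True by fastforce
        then show "e \<in> {a, b}" using ta sb by auto
      qed
    qed (use aE in auto)
    have legs: "inputs G \<union> outputs G = {} \<longleftrightarrow> a = b"
    proof
      assume no: "inputs G \<union> outputs G = {}"
      then have "src G a \<noteq> None" using aE(1) by (auto simp: inputs_iff[OF VG])
      then have "src G a = Some v" using src_Some_vert[OF G] True by fastforce
      then show "a = b" using sb by simp
    next
      assume "a = b"
      then have "src G a = Some v" "tgt G a = Some v" "edges G = {a}" using ta[of a] sb[of b] E by auto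
      then show "inputs G \<union> outputs G = {}" by (auto simp: inputs_iff[OF VG] outputs_iff[OF VG])
    qed
    let ?G = "if a = b then Exc_Loop a else Exc_Edge a"
    have gm: "gmorphism G ?G (\<lambda>_. a) (\<lambda>_. Sub_Edge a)"
    proof unfold_locales
      show "is_Exc_Loop ?G" if "inputs G \<union> outputs G = {}" using that legs by simp
    qed (use G True a b in \<open>auto simp: subgraphs_Ord_iff bij_betw_def\<close>)
    have "inputs G = {}" if "a = b" using legs that by auto
    then show ?thesis using True gm
      by (intro exI[of _ ?G] exI[of _ "\<lambda>_. a"] exI[of _ "\<lambda>_. Sub_Edge a"]) auto
  next
    case False
    have V': "verts G - {v} \<noteq> {}" using False v by auto
    have other: "\<not> verts G \<subseteq> {v}" using V' by auto
    have ab: "a \<noteq> b"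
    proof
      assume eq: "a = b"
      have "verts G \<subseteq> {v}"
      proof (rule wf_graph_closed[OF G v])
        fix e u w assume "src G e = Some u" "tgt G e = Some w"
        then show "u \<in> {v} \<longleftrightarrow> w \<in> {v}" using ta[of e] sb[of e] eq by auto
      qed simp
      then show False using other by simp
    qed
    define s where "s e = (if e = b then None else src G e)" for e
    define t where "t e = (if e = b then None else if e = a then tgt G b else tgt G e)" for e
    let ?V = "verts G - {v}" and ?E = "edges G - {b}"
    let ?G = "Ordinary ?V ?E s t"
    define h0 where "h0 e = (if e = b then a else e)" for e
    define h1 where "h1 x = (if x = v then Sub_Edge a else Sub_Ord {x} {})" for x
    have sv: "src G e = Some x \<Longrightarrow> x \<in> verts G" "tgt G e = Some x \<Longrightarrow> x \<in> verts G" for e x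
      using src_Some_vert[OF G] tgt_Some_vert[OF G] by auto
    have sE: "src G e = Some x \<Longrightarrow> e \<in> edges G" "tgt G e = Some x \<Longrightarrow> e \<in> edges G" for e x
      using src_Some_edge[OF G] tgt_Some_edge[OF G] by auto
    have ends_ab: "src G a \<noteq> None \<or> tgt G b \<noteq> None"
    proof (rule ccontr)
      assume n: "\<not> ?thesis"
      have "verts G \<subseteq> {v}"
      proof (rule wf_graph_closed[OF G v])
        fix e u w assume e: "src G e = Some u" "tgt G e = Some w"
        then have "e \<noteq> a" "e \<noteq> b" using n by auto
        then show "u \<in> {v} \<longleftrightarrow> w \<in> {v}" using e ta[of e] sb[of e] by auto
      qed simp
      then show False using other by simp
    qed
    have dom: "dom s \<union> dom t = ?E"
    proof (rule set_eqI)
      fix e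
      show "e \<in> dom s \<union> dom t \<longleftrightarrow> e \<in> ?E"
        using ends_ab wf_ends[OF G VG, of e] aE ab sE[of e]
          by (cases "e = a") (auto simp: s_def t_def dom_def)
    qed
    have ran: "ran s \<subseteq> ?V" "ran t \<subseteq> ?V"
      using sv ta sb ab by (auto simp: ran_def s_def t_def split: if_splits)
    have conn: "connected_by ?G ?V (inner_edges ?G)"
      unfolding connected_by_iff_closed
    proof (intro allI impI)
      fix T assume T: "T \<inter> ?V \<noteq> {}"
        and cl: "\<forall>e \<in> inner_edges ?G. \<forall>x y. src ?G e = Some x \<longrightarrow> tgt ?G e = Some y \<longrightarrow> (x \<in> T \<longleftrightarrow> y \<in> T)"
      have cl: "x \<in> T \<longleftrightarrow> y \<in> T" if "s e = Some x" "t e = Some y" for e x y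
        using cl that dom by auto
      have clab: "x \<in> T \<longleftrightarrow> y \<in> T" if "src G a = Some x" "tgt G b = Some y" for x y
        using cl[of a x y] that ab by (simp add: s_def t_def)
      (* the removed vertex v is put into the closed set if one of its neighbours is in it *)
      define touch where "touch \<longleftrightarrow> (\<exists>x \<in> T. src G a = Some x \<or> tgt G b = Some x)"
      define T' where "T' = (T - {v}) \<union> (if touch then {v} else {})"
      obtain x0 where x0: "x0 \<in> T" "x0 \<in> verts G" "x0 \<noteq> v" using T by auto
      have "verts G \<subseteq> T'"
      proof (rule wf_graph_closed[OF G x0(2)])
        show "x0 \<in> T'" using x0 by (simp add: T'_def)
        fix e x y assume e: "src G e = Some x" "tgt G e = Some y"
        consider "e = a" | "e = b" | "e \<noteq> a" "e \<noteq> b" by blast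
        then show "x \<in> T' \<longleftrightarrow> y \<in> T'"
        proof cases
          case 1
          then have "y = v" "x \<noteq> v" using e ta[of e] sb[of e] ab by auto
          moreover have "touch \<longleftrightarrow> x \<in> T"
          proof
            assume touch
            then obtain z where "z \<in> T" "src G a = Some z \<or> tgt G b = Some z"
              unfolding touch_def by blast
            then show "x \<in> T" using clab[of x z] e 1 by auto
          next
            assume "x \<in> T"
            then show touch using e 1 unfolding touch_def by blast
          qed
          ultimately show ?thesis unfolding T'_def by simp
        next
          case 2
          then have "x = v" "y \<noteq> v" using e ta[of e] sb[of e] ab by auto
          moreover have "touch \<longleftrightarrow> y \<in> T"
          proof
            assume touch
            then obtain z where "z \<in> T" "src G a = Some z \<or> tgt G b = Some z"
              unfolding touch_def by blast
            then show "y \<in> T" using clab[of z y] e 2 by auto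
          next
            assume "y \<in> T"
            then show touch using e 2 unfolding touch_def by blast
          qed
          ultimately show ?thesis unfolding T'_def by simp
        next
          case 3
          then have "x \<noteq> v" "y \<noteq> v" using e ta[of e] sb[of e] by auto
          then show ?thesis using cl[of e x y] 3 e by (simp add: T'_def s_def t_def)
        qed
      qed
      then show "?V \<subseteq> T" by (auto simp: T'_def split: if_splits)
    qed
    have wf': "wf_graph ?G" using finite_verts[OF G] finite_edges[OF G] V' dom ran conn by simp
    have in': "in_at ?G x = h0 ` in_at G x" and out': "out_at ?G x = h0 ` out_at G x" if x: "x \<in> ?V" for x
    proof -
      have xv: "x \<noteq> v" using x by simp
      show "in_at ?G x = h0 ` in_at G x"
      proof (intro set_eqI iffI)
        fix e assume "e \<in> in_at ?G x"
        then have e: "t e = Some x" "e \<noteq> b" by (auto simp: in_at_def)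
        show "e \<in> h0 ` in_at G x"
        proof (cases "e = a")
          case True
          then have "tgt G b = Some x" using e ab by (simp add: t_def)
          then show ?thesis using True by (intro image_eqI[of _ _ b]) (simp_all add: h0_def in_at_iff[OF G])
        next
          case False
          then have "tgt G e = Some x" using e by (simp add: t_def)
          then show ?thesis using e by (intro image_eqI[of _ _ e]) (simp_all add: h0_def in_at_iff[OF G])
        qed
      next
        fix e assume "e \<in> h0 ` in_at G x"
        then obtain e' where e': "e = h0 e'" "tgt G e' = Some x" by (auto simp: in_at_iff[OF G])
        then have "e' \<noteq> a" using ta[of e'] xv by auto
        then have "t e = Some x" using e' ab by (auto simp: h0_def t_def)
        moreover have "e \<in> ?E" using e'(1) sE(2)[OF e'(2)] aE ab by (simp add: h0_def)
        ultimately show "e \<in> in_at ?G x" by (simp add: in_at_def)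
      qed
      show "out_at ?G x = h0 ` out_at G x"
      proof (intro set_eqI iffI)
        fix e assume "e \<in> out_at ?G x"
        then have e: "src G e = Some x" "e \<noteq> b" by (auto simp: out_at_def s_def)
        then show "e \<in> h0 ` out_at G x"
          by (intro image_eqI[of _ _ e]) (simp_all add: h0_def out_at_iff[OF G])
      next
        fix e assume "e \<in> h0 ` out_at G x"
        then obtain e' where e': "e = h0 e'" "src G e' = Some x" by (auto simp: out_at_iff[OF G])
        then have "e' \<noteq> b" using sb[of e'] xv by auto
        then have "s e = Some x" "e \<in> ?E" using e' sE(1)[OF e'(2)] by (simp_all add: h0_def s_def)
        then show "e \<in> out_at ?G x" by (simp add: out_at_def)
      qed
    qed
    have inj: "inj_on h0 (in_at G x)" "inj_on h0 (out_at G x)" if x: "x \<in> ?V" for x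
    proof -
      have "a \<notin> in_at G x" "b \<notin> out_at G x"
        using ta[of a] sb[of b] x by (auto simp add: in_at_iff[OF G] out_at_iff[OF G])
      then show "inj_on h0 (in_at G x)" "inj_on h0 (out_at G x)"
        by (auto simp: inj_on_def h0_def split: if_splits)
    qed
    have gm: "gmorphism G ?G h0 h1"
    proof unfold_locales
      show "h0 e \<in> edges ?G" if "e \<in> edges G" for e using that aE ab by (simp add: h0_def)
      show "h1 x \<in> subgraphs ?G" if "x \<in> verts G" for x
        using that aE ab corolla_subgraph[of x ?G] by (auto simp: h1_def subgraphs_Ord_iff)
      show "bij_betw h0 (in_at G x) (ins ?G (h1 x))" if "x \<in> verts G" for x
      proof (cases "x = v")
        case True
        then show ?thesis using a ab by (simp add: h1_def h0_def bij_betw_def)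
      next
        case False
        then have "ins ?G (h1 x) = in_at ?G x" using ins_corolla[OF wf'] by (simp add: h1_def)
        then show ?thesis using in'[of x] inj(1)[of x] that False by (simp add: bij_betw_def)
      qed
      show "bij_betw h0 (out_at G x) (outs ?G (h1 x))" if "x \<in> verts G" for x
      proof (cases "x = v")
        case True
        then show ?thesis using b ab by (simp add: h1_def h0_def bij_betw_def)
      next
        case False
        then have "outs ?G (h1 x) = out_at ?G x" using outs_corolla[OF wf'] by (simp add: h1_def)
        then show ?thesis using out'[of x] inj(2)[of x] that False by (simp add: bij_betw_def)
      qed
      show "is_Exc_Loop ?G" if "\<forall>x \<in> verts G. sverts (h1 x) = {}"
        using that V' by (auto simp: h1_def split: if_splits)
    qed (use G wf' in \<open>auto simp: h1_def\<close>)
    have "h0 ` inputs G \<subseteq> inputs ?G"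
    proof
      fix e assume "e \<in> h0 ` inputs G"
      then obtain e' where e': "e = h0 e'" "e' \<in> edges G" "src G e' = None"
        by (auto simp: inputs_iff[OF VG])
      then have "e' \<noteq> b" using sb[of b] by auto
      then show "e \<in> inputs ?G" using e' by (simp add: h0_def s_def)
    qed
    moreover have "(\<Union>x \<in> verts G. sverts (h1 x)) = verts ?G"
      by (auto simp: h1_def split: if_splits)
    moreover have "h1 v = Sub_Edge a" by (simp add: h1_def)
    moreover have "\<forall>x \<in> verts G - {v}. \<exists>y. h1 x = Sub_Ord {y} {}" by (simp add: h1_def)
    ultimately show ?thesis using gm
      by (intro exI[of _ ?G] exI[of _ h0] exI[of _ h1]) blast
  qed
qed

lemma bij_betw_singleton: "bij_betw f A {k} \<Longrightarrow> \<exists>a. A = {a}"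
  using bij_betw_same_card[of f A "{k}"] card_1_singletonE[of A] by auto

text \<open>
  The codegeneracy that removes \<open>v\<close> sends no other vertex to an edge, so \<open>factor_through_negative\<close>
  applies.
\<close>

lemma degenerate_step:
  fixes f :: "('v, 'e) gmap" and U :: "('v, 'e) graph set"
  assumes U: "graph_universe U" and f: "hom f" and v: "v \<in> verts (gdom f)" "vmap f v = Sub_Edge k"
  shows "\<exists>h g. hom h \<and> codegeneracy h \<and> gdom h = gdom f \<and> gcod h \<in> U \<and> hom g \<and> gdom g = gcod h \<and>
     gcod g = gcod f \<and> gcomp g h = f \<and> deg (gcod h) < deg (gdom h)"
proof -
  let ?G = "gdom f"
  interpret f: gmorphism ?G "gcod f" "emap f" "vmap f" using hom_gmorphism[OF f] .
  obtain a where a: "in_at ?G v = {a}"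
    using bij_betw_singleton[of "emap f" "in_at ?G v" k] f.f_in[OF v(1)] v(2) by auto
  obtain b where b: "out_at ?G v = {b}"
    using bij_betw_singleton[of "emap f" "out_at ?G v" k] f.f_out[OF v(1)] v(2) by auto
  obtain G' :: "('v, 'e) graph" and h0 h1 k' where r: "gmorphism ?G G' h0 h1" "(\<Union>x \<in> verts ?G. sverts (h1 x)) = verts G'"
     "h0 ` inputs ?G \<subseteq> inputs G'" "h1 v = Sub_Edge k'" "\<forall>x \<in> verts ?G - {v}. \<exists>y. h1 x = Sub_Ord {y} {}"
    using remove_bivalent[OF f.wf_dom v(1) a b] by (elim exE conjE)
  interpret r: gmorphism ?G G' h0 h1 by (rule r(1))
  obtain H \<phi>V \<phi>E where H: "H \<in> U" "wf_graph H" "graph_iso \<phi>V \<phi>E G' H"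
    using universe_copy[OF U r.wf_cod] by blast
  have i: "gmorphism G' H \<phi>E (\<lambda>v. Sub_Ord {\<phi>V v} {})"
    by (rule gmorphism_graph_iso[OF H(3) r.wf_cod H(2)])
  let ?h1 = "\<lambda>x. push G' H \<phi>E (\<lambda>v. Sub_Ord {\<phi>V v} {}) (h1 x)"
  define h where "h = gmap_of ?G H (\<phi>E \<circ> h0) ?h1"
  have h: "hom h" "gdom h = ?G" "gcod h = H" unfolding h_def using hom_gmap_of[OF gmorphism_comp[OF r(1) i]]
    by auto
  have hv: "vmap h v = Sub_Edge (\<phi>E k')" using v(1) r(4) by (simp add: h_def)
  have hx: "\<exists>y. vmap h x = Sub_Ord {y} {}" if x: "x \<in> verts ?G" "x \<noteq> v" for x
  proof -
    obtain y where y: "h1 x = Sub_Ord {y} {}" using r(5) x by blast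
    then have "y \<in> verts G'" using sverts_subset[OF r.f1[OF x(1)]] by simp
    then show ?thesis using x y push_corolla[OF i] by (simp add: h_def)
  qed
  have on: "onto h"
    unfolding onto_def h(2,3)
  proof
    have "(\<Union>x \<in> verts ?G. sverts (vmap h x)) = \<phi>V ` (\<Union>x \<in> verts ?G. sverts (h1 x))"
      by (auto simp: h_def)
    also have "\<dots> = verts H" using r(2) H(3) by (simp add: graph_iso_def bij_betw_def)
    finally show "(\<Union>x \<in> verts ?G. sverts (vmap h x)) = verts H" .
    show "emap h ` inputs ?G \<subseteq> inputs H"
    proof
      fix e assume "e \<in> emap h ` inputs ?G"
      then obtain e' where e': "e' \<in> inputs ?G" "e = emap h e'" by auto
      then have "e = \<phi>E (h0 e')" "h0 e' \<in> inputs G'"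
        using inputs_subset[of ?G] r(3) by (auto simp: h_def)
      then show "e \<in> inputs H" using bij_betwE[OF graph_iso_kinds(1)[OF H(3)]] by simp
    qed
  qed
  have neg: "negative h" unfolding negative_def h(2) using on hv hx by blast
  have cod: "codegeneracy h" unfolding codegeneracy_def
  proof (rule substitution_mapI[OF U h(1) on, of v])
    show "v \<in> verts (gdom h)" using v h by simp
    show "\<exists>x. vmap h w = Sub_Ord {x} {}" if "w \<in> verts (gdom h)" "w \<noteq> v" for w using hx that h by simp
    show "is_Exc_Edge Q" if "graph_iso \<psi>V \<psi>E (graph_of (gcod h) (vmap h v)) Q" for Q :: "('v, 'e) graph" and \<psi>V \<psi>E
      using that hv by (simp add: graph_iso_def)
  qed
  have "\<exists>g. hom g \<and> gdom g = gcod h \<and> gcod g = gcod f \<and> gcomp g h = f"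
  proof (rule factor_through_negative[OF h(1) neg f])
    show "\<exists>k'. vmap f x = Sub_Edge k'" if "x \<in> verts (gdom h)" "vmap h x = Sub_Edge l" for x l
      using hx[of x] that v h by (cases "x = v") auto
  qed (use h in simp)
  then obtain g where g: "hom g" "gdom g = gcod h" "gcod g = gcod f" "gcomp g h = f" by blast
  have "deg (gcod h) < deg (gdom h)"
    by (rule negative_deg[OF h(1) neg]) (use v h hv in \<open>auto simp: positive_def\<close>)
  then show ?thesis using h cod g H(1) by blast
qed

section \<open>The generalized Reedy structure\<close>

context wheeled
begin

text \<open>
  The inverse of \<open>f\<close> sends edges to edges, whereas \<open>f\<close> followed by it sends each vertex to its corolla.
\<close>

lemma iso_positive:
  assumes f: "f \<in> isos \<Gamma>"
  shows "positive f"
proof -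
  obtain g where g: "f \<in> Arr \<Gamma>" "g \<in> Arr \<Gamma>" "gdom g = gcod f" "gcomp g f = gid (gdom f)"
    using f by (auto simp: isos_def)
  then have h: "hom f" "hom g" by (simp_all add: Arr_iff)
  show ?thesis unfolding positive_def
  proof (intro ballI allI notI)
    fix v k assume v: "v \<in> verts (gdom f)" "vmap f v = Sub_Edge k"
    then show False using vmap_gcomp[OF h g(3) v(1)] g(4) by simp
  qed
qed

lemma isos_inverse:
  assumes "f \<in> isos \<Gamma>"
  obtains g where "g \<in> isos \<Gamma>" "gdom g = gcod f" "gcod g = gdom f" "gcomp g f = gid (gdom f)" "gcomp f g = gid (gcod f)"
  using assms that by (fastforce simp: isos_def)

lemma isos_Arr: "f \<in> isos \<Gamma> \<Longrightarrow> f \<in> Arr \<Gamma>"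
  by (simp add: isos_def)

text \<open>
  Both \<open>f\<close> and its inverse are positive, so \<open>positive_deg\<close> gives inequalities between the degrees in both
  directions.
\<close>

lemma iso_negative:
  assumes f: "f \<in> isos \<Gamma>"
  shows "negative f" and "deg (gcod f) = deg (gdom f)"
proof -
  obtain g where g: "g \<in> isos \<Gamma>" "gdom g = gcod f" "gcod g = gdom f" by (rule isos_inverse[OF f])
  have h: "hom f" "hom g" using isos_Arr f g(1) by (simp_all add: Arr_iff)
  note pf = positive_deg[OF h(1) iso_positive[OF f]] and pg = positive_deg[OF h(2) iso_positive[OF g(1)]]
  show "deg (gcod f) = deg (gdom f)" using pf pg g by simp
  show "negative f" using pf pg g by simp
qed

lemma positive_negative_iso:
  assumes f: "f \<in> Arr \<Gamma>" and p: "positive f" and n: "negative f"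
  shows "f \<in> isos \<Gamma>"
proof -
  have h: "hom f" and wf: "wf_graph (gdom f)" "wf_graph (gcod f)" using f by (auto simp: Arr_iff Obj_wf)
  obtain \<phi>V where iso: "graph_iso \<phi>V (emap f) (gdom f) (gcod f)"
    and vm: "\<forall>v \<in> verts (gdom f). vmap f v = Sub_Ord {\<phi>V v} {}"
    using positive_negative_graph_iso[OF h p n] by blast
  have eq: "f = iso_map \<phi>V (emap f) (gdom f) (gcod f)"
    by (rule hom_eqI[OF h hom_iso_map[OF iso wf]]) (use vm in auto)
  let ?g = "iso_map (inv_into (verts (gdom f)) \<phi>V) (inv_into (edges (gdom f)) (emap f)) (gcod f) (gdom f)"
  have "gcomp ?g f = gid (gdom f)" "gcomp f ?g = gid (gcod f)" "hom ?g"
    using iso_map_inverse[OF iso wf] eq by auto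
  then show ?thesis using f by (auto simp: isos_def Arr_iff intro!: bexI[of _ ?g])
qed

lemma isos_iff: "f \<in> isos \<Gamma> \<longleftrightarrow> f \<in> Arr \<Gamma> \<and> positive f \<and> negative f"
  using isos_Arr iso_positive iso_negative(1) positive_negative_iso by blast

lemma gid_isos: "X \<in> Obj \<Gamma> \<Longrightarrow> gid X \<in> isos \<Gamma>"
  using ident_arr[of X] cmp_ident_left[of "gid X"] by (auto simp: isos_def intro!: bexI[of _ "gid X"])

lemma generated_induct:
  assumes f: "f \<in> generated \<Gamma> S" and S: "S \<subseteq> Arr \<Gamma>"
    and id: "\<And>X. X \<in> Obj \<Gamma> \<Longrightarrow> Q (gid X)" and incl: "\<And>f. f \<in> S \<Longrightarrow> Q f"
    and comp: "\<And>f g. f \<in> Arr \<Gamma> \<Longrightarrow> g \<in> Arr \<Gamma> \<Longrightarrow> gdom g = gcod f \<Longrightarrow> Q f \<Longrightarrow> Q g \<Longrightarrow> Q (gcomp g f)"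
  shows "f \<in> Arr \<Gamma> \<and> Q f"
  using f
proof (induction rule: generated.induct)
  case (cmp f g)
  then show ?case using comp cmp_arr[of f g] by auto
qed (use S id incl ident_arr in auto)

lemma Gamma_plus_positive:
  assumes "f \<in> Gamma_plus \<Gamma>"
  shows "f \<in> Arr \<Gamma> \<and> positive f"
proof (rule generated_induct[OF assms[unfolded Gamma_plus_def]])
  show "positive (gcomp g f)" if "f \<in> Arr \<Gamma>" "g \<in> Arr \<Gamma>" "gdom g = gcod f" "positive f" "positive g" for f g
    by (rule positive_gcomp) (use that in \<open>simp_all add: Arr_iff\<close>)
  show "positive f" if "f \<in> isos \<Gamma> \<union> {f \<in> Arr \<Gamma>. inner_coface f \<or> outer_coface f \<or> exceptional_coface f}" for f
    using that iso_positive coface_positive by (auto simp: Arr_iff)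
qed (use gid_isos iso_positive isos_Arr in auto)

lemma Gamma_minus_negative:
  assumes "f \<in> Gamma_minus \<Gamma>"
  shows "f \<in> Arr \<Gamma> \<and> negative f"
proof (rule generated_induct[OF assms[unfolded Gamma_minus_def]])
  show "negative (gcomp g f)" if "f \<in> Arr \<Gamma>" "g \<in> Arr \<Gamma>" "gdom g = gcod f" "negative f" "negative g" for f g
    by (rule negative_gcomp) (use that in \<open>simp_all add: Arr_iff\<close>)
  show "negative f" if "f \<in> isos \<Gamma> \<union> {f \<in> Arr \<Gamma>. codegeneracy f}" for f
    using that iso_negative(1) codegeneracy_negative by (auto simp: Arr_iff)
qed (use gid_isos iso_negative(1) isos_Arr in auto)

lemma isos_Gamma_plus: "isos \<Gamma> \<subseteq> Gamma_plus \<Gamma>" and isos_Gamma_minus: "isos \<Gamma> \<subseteq> Gamma_minus \<Gamma>"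
  by (auto simp: Gamma_plus_def Gamma_minus_def intro: generated.incl)

lemma wide_generated: "S \<subseteq> Arr \<Gamma> \<Longrightarrow> wide_subcategory \<Gamma> (generated \<Gamma> S)"
  unfolding wide_subcategory_def
  using generated_induct[of _ S "\<lambda>_. True"] generated.ident[of _ \<Gamma> S] generated.cmp[of _ \<Gamma> S] by auto

lemma wide_Gamma_plus: "wide_subcategory \<Gamma> (Gamma_plus \<Gamma>)"
  and wide_Gamma_minus: "wide_subcategory \<Gamma> (Gamma_minus \<Gamma>)"
  unfolding Gamma_plus_def Gamma_minus_def by (rule wide_generated, use isos_Arr in auto)+

lemma Gamma_plus_gcomp: "f \<in> Gamma_plus \<Gamma> \<Longrightarrow> g \<in> Gamma_plus \<Gamma> \<Longrightarrow> gdom g = gcod f \<Longrightarrow> gcomp g f \<in> Gamma_plus \<Gamma>"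
  using wide_Gamma_plus by (simp add: wide_subcategory_def)

lemma Gamma_minus_gcomp: "f \<in> Gamma_minus \<Gamma> \<Longrightarrow> g \<in> Gamma_minus \<Gamma> \<Longrightarrow> gdom g = gcod f \<Longrightarrow> gcomp g f \<in> Gamma_minus \<Gamma>"
  using wide_Gamma_minus by (simp add: wide_subcategory_def)

lemma coface_Gamma_plus:
  "f \<in> Arr \<Gamma> \<Longrightarrow> inner_coface f \<or> outer_coface f \<or> exceptional_coface f \<Longrightarrow> f \<in> Gamma_plus \<Gamma>"
  unfolding Gamma_plus_def by (rule generated.incl) auto

lemma codegeneracy_Gamma_minus: "f \<in> Arr \<Gamma> \<Longrightarrow> codegeneracy f \<Longrightarrow> f \<in> Gamma_minus \<Gamma>"
  unfolding Gamma_minus_def by (rule generated.incl) auto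

text \<open>
  Induction on the degree of the target, with a coface map split off as the last factor. The domain
  stays the same, so the first factor still has a domain with vertices.
\<close>

lemma positive_generated_ordinary:
  assumes "f \<in> Arr \<Gamma>" "positive f" "verts (gdom f) \<noteq> {}"
  shows "f \<in> Gamma_plus \<Gamma>"
  using assms
proof (induction "deg (gcod f)" arbitrary: f rule: less_induct)
  case less
  note VG = less.prems(3)
  have h: "hom f" using less.prems by (simp add: Arr_iff)
  interpret f: gmorphism "gdom f" "gcod f" "emap f" "vmap f" using hom_gmorphism[OF h] .
  show ?case
  proof (cases "negative f")
    case True
    then show ?thesis using positive_negative_iso less.prems isos_Gamma_plus by blast
  next
    case nn: False
    show ?thesis
    proof (cases "verts (gcod f) = {}")
      case True
      obtain v where v: "v \<in> verts (gdom f)" using VG by auto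
      have "sverts (vmap f v) = {}" using hom_sverts[OF h v] True by auto
      then obtain k where k: "vmap f v = Sub_Loop k"
        using sverts_empty_iff[OF f.f1[OF v]] less.prems(2) v by (auto simp: positive_def)
      have VE: "verts (gdom f) = {v}" "edges (gdom f) = {}" using f.cod_loop_dom[OF v k] by auto
      have K: "gcod f = Exc_Loop k" using f.f1[OF v] k by (simp add: subgraphs_Ord_iff)
      have "bullet (gdom f)" using deg_cases(3)[OF f.wf_dom VG VE(2)] by blast
      moreover have "emap f = (\<lambda>_. undefined)" using h VE(2) by (auto simp: hom_iff extensional_def)
      moreover have "vmap f = (\<lambda>v \<in> verts (gdom f). Sub_Loop k)"
        by (rule extensionalityI[of _ "verts (gdom f)"]) (use h VE(1) k in \<open>auto simp: hom_iff\<close>)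
      ultimately have "exceptional_coface f" using K unfolding exceptional_coface_def by blast
      then show ?thesis using coface_Gamma_plus less.prems(1) by blast
    next
      case VK: False
      have "\<exists>c f'. hom c \<and> (inner_coface c \<or> outer_coface c) \<and> hom f' \<and> positive f' \<and> gdom f' = gdom f \<and> gcod f' = gdom c \<and>
          gcod c = gcod f \<and> gdom c \<in> U \<and> verts (gdom c) \<noteq> {} \<and> gcomp c f' = f \<and> deg (gdom c) < deg (gcod c)"
      proof (cases "onto f")
        case True
        show ?thesis using inner_step[OF universe h less.prems(2) VG VK True nn]
          by (elim exE conjE) (intro exI conjI disjI1; assumption)
      next
        case False
        show ?thesis using outer_step[OF universe h less.prems(2) VG VK False]
          by (elim exE conjE) (intro exI conjI disjI2; assumption)
      qed
      then obtain c f' where c: "hom c" "inner_coface c \<or> outer_coface c" "hom f'" "positive f'" "gdom f' = gdom f" "gcod f' = gdom c"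
          "gcod c = gcod f" "gdom c \<in> U" "verts (gdom c) \<noteq> {}" "gcomp c f' = f" "deg (gdom c) < deg (gcod c)"
        by (elim exE conjE)
      have "\<not> is_Exc_Loop (gdom c)" using c(9) by (cases "gdom c") auto
      then have O: "gdom c \<in> Obj \<Gamma>" using c(8) by (simp add: Obj_iff)
      then have A: "c \<in> Arr \<Gamma>" "f' \<in> Arr \<Gamma>"
        using c less.prems(1) by (auto simp: Arr_iff)
      have "f' \<in> Gamma_plus \<Gamma>" by (rule less.hyps) (use A c less.prems in auto)
      then have "gcomp c f' \<in> Gamma_plus \<Gamma>"
        using coface_Gamma_plus[OF A(1)] c by (intro Gamma_plus_gcomp) auto
      then show ?thesis using c(10) by simp
    qed
  qed
qed

text \<open>
  An edge of \<open>K\<close> with an end at \<open>x\<close> is included into the corolla of \<open>x\<close>, and the corolla into \<open>K\<close>.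
\<close>

lemma edge_generated:
  assumes A: "f \<in> Arr \<Gamma>" and G: "gdom f = Exc_Edge a"
  shows "f \<in> Gamma_plus \<Gamma>"
proof -
  have h: "hom f" using A by (simp add: Arr_iff)
  interpret f: gmorphism "gdom f" "gcod f" "emap f" "vmap f" using hom_gmorphism[OF h] .
  let ?K = "gcod f" and ?l = "emap f a"
  note K = f.wf_cod
  have p: "positive f" using G by (simp add: positive_def)
  have l: "?l \<in> edges ?K" using hom_edge[OF h, of a] G by simp
  show ?thesis
  proof (cases ?K)
    case (Exc_Edge k)
    then have "negative f" using G l by (auto simp: negative_def onto_def)
    then show ?thesis using positive_negative_iso[OF A p] isos_Gamma_plus by blast
  next
    case (Exc_Loop k)
    then have "outer_coface f" using edge_to_loop[OF universe h G] by simp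
    then show ?thesis using coface_Gamma_plus[OF A] by blast
  next
    case (Ordinary V E s t)
    then have VK: "verts ?K \<noteq> {}" using K by auto
    have "\<exists>x d. x \<in> verts ?K \<and> d \<in> edges (graph_of ?K (Sub_Ord {x} {})) \<and> under d = ?l"
    proof -
      consider x where "tgt ?K ?l = Some x" | x where "src ?K ?l = Some x" using wf_ends[OF K VK l] by auto
      then show ?thesis
      proof cases
        case 1
        then show ?thesis using l tgt_Some_vert[OF K 1]
          by (intro exI[of _ x] exI[of _ "In_Leg ?l"]) auto
      next
        case 2
        then show ?thesis using l src_Some_vert[OF K 2]
          by (intro exI[of _ x] exI[of _ "Out_Leg ?l"]) auto
      qed
    qed
    then obtain x d where x: "x \<in> verts ?K" "d \<in> edges (graph_of ?K (Sub_Ord {x} {}))" "under d = ?l" by blast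
    let ?s = "Sub_Ord {x} {}"
    have s: "?s \<in> subgraphs ?K" by (rule corolla_subgraph[OF x(1)])
    have P: "wf_graph (graph_of ?K ?s)" by (rule wf_graph_of[OF K s])
    obtain H \<psi>V \<psi>E where H: "H \<in> U" "wf_graph H" "graph_iso \<psi>V \<psi>E (graph_of ?K ?s) H"
      using universe_copy[OF universe P] by blast
    have VH: "verts H = {\<psi>V x}" using H(3) by (auto simp: graph_iso_def bij_betw_def)
    have IH: "inner_edges H = {}"
      using graph_iso_kinds(3)[OF H(3)] unfolding inner_edges_graph_of[OF K s] by (simp add: bij_betw_def)
    obtain c where c: "hom c" "gdom c = H" "gcod c = ?K" "positive c"
      "\<And>d. d \<in> edges (graph_of ?K ?s) \<Longrightarrow> emap c (\<psi>E d) = under d"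
      using subgraph_inclusion[OF K s H(3,2)] by blast
    have dH: "\<psi>E d \<in> edges H" using H(3) x(2) by (auto simp: graph_iso_def dest: bij_betwE)
    have gm: "gmorphism (Exc_Edge a) H (\<lambda>_. \<psi>E d) (\<lambda>_. undefined)"
      by unfold_locales (use H(2) dH in auto)
    define f' where "f' = gmap_of (Exc_Edge a) H (\<lambda>_. \<psi>E d) (\<lambda>_. undefined)"
    have f': "hom f'" "gdom f' = Exc_Edge a" "gcod f' = H" unfolding f'_def using hom_gmap_of[OF gm] by auto
    have "outer_coface f'" by (rule edge_to_corolla[OF universe f'(1,2)]) (use f' VH IH in auto)
    moreover have "\<not> is_Exc_Loop H" using VH by (cases H) auto
    then have "H \<in> Obj \<Gamma>" using H(1) by (simp add: Obj_iff)
    then have A': "f' \<in> Arr \<Gamma>" "c \<in> Arr \<Gamma>" using A f' c G by (auto simp: Arr_iff)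
    ultimately have "f' \<in> Gamma_plus \<Gamma>" using coface_Gamma_plus by blast
    moreover have "c \<in> Gamma_plus \<Gamma>"
      by (rule positive_generated_ordinary[OF A'(2) c(4)]) (use VH c in simp)
    ultimately have "gcomp c f' \<in> Gamma_plus \<Gamma>" by (rule Gamma_plus_gcomp) (use c f' in simp)
    moreover have "gcomp c f' = f"
    proof (rule hom_eqI)
      show "hom (gcomp c f')" by (rule hom_gcomp[OF f'(1) c(1)]) (use c f' in simp)
      show "emap (gcomp c f') e = emap f e" if "e \<in> edges (gdom (gcomp c f'))" for e
        using that f'(2) c(5)[OF x(2)] x(3) by (simp add: f'_def)
    qed (use h f' c G in auto)
    ultimately show ?thesis by simp
  qed
qed

lemma Gamma_plus_iff: "f \<in> Gamma_plus \<Gamma> \<longleftrightarrow> f \<in> Arr \<Gamma> \<and> positive f"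
proof
  assume "f \<in> Gamma_plus \<Gamma>"
  then show "f \<in> Arr \<Gamma> \<and> positive f" by (rule Gamma_plus_positive)
next
  assume f: "f \<in> Arr \<Gamma> \<and> positive f"
  then have h: "hom f" by (simp add: Arr_iff)
  interpret f: gmorphism "gdom f" "gcod f" "emap f" "vmap f" using hom_gmorphism[OF h] .
  show "f \<in> Gamma_plus \<Gamma>"
  proof (cases "gdom f")
    case (Exc_Edge a)
    then show ?thesis using edge_generated f by blast
  next
    case (Exc_Loop a)
    then have "is_Exc_Loop (gcod f)" using f.loop by auto
    then have "negative f" using Exc_Loop by (auto simp: negative_def onto_def is_Exc_Loop_def)
    then show ?thesis using positive_negative_iso f isos_Gamma_plus by blast
  next
    case (Ordinary V E s t)
    then have "verts (gdom f) \<noteq> {}" using f.wf_dom by auto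
    then show ?thesis using positive_generated_ordinary f by blast
  qed
qed

text \<open>
  Codegeneracy maps are split off as first factors until no vertex is sent to an edge. If the target
  of a codegeneracy map is the exceptional loop, then so is the target of \<open>f\<close>; hence the intermediate
  graphs are objects of the category.
\<close>

lemma factorization_exists:
  assumes "f \<in> Arr \<Gamma>"
  shows "\<exists>g \<in> Gamma_plus \<Gamma>. \<exists>h \<in> Gamma_minus \<Gamma>. gdom g = gcod h \<and> f = gcomp g h"
  using assms
proof (induction "deg (gdom f)" arbitrary: f rule: less_induct)
  case less
  have h: "hom f" using less.prems by (simp add: Arr_iff)
  show ?case
  proof (cases "positive f")
    case True
    then have "f \<in> Gamma_plus \<Gamma>" using less.prems Gamma_plus_iff by blast
    moreover have "gid (gdom f) \<in> Gamma_minus \<Gamma>"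
      using gid_isos isos_Gamma_minus less.prems by (auto simp: Arr_iff)
    ultimately show ?thesis using gcomp_gid_right[OF h] by (intro bexI[of _ f] bexI[of _ "gid (gdom f)"]) auto
  next
    case False
    then obtain v k where v: "v \<in> verts (gdom f)" "vmap f v = Sub_Edge k" by (auto simp: positive_def)
    obtain d g where d: "hom d" "codegeneracy d" "gdom d = gdom f" "gcod d \<in> U" "hom g" "gdom g = gcod d"
      "gcod g = gcod f" "gcomp g d = f" "deg (gcod d) < deg (gdom d)"
      using degenerate_step[OF universe h v] by blast
    have "gcod d \<in> Obj \<Gamma>"
    proof (cases "is_Exc_Loop (gcod d)")
      case True
      interpret g: gmorphism "gdom g" "gcod g" "emap g" "vmap g" using hom_gmorphism[OF d(5)] .
      have "is_Exc_Loop (gcod g)" using g.loop True d(6) by (auto simp: is_Exc_Loop_def)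
      moreover have "gcod f \<in> Obj \<Gamma>" using less.prems by (simp add: Arr_iff)
      ultimately have "\<Gamma> = wheeled_A U" using Obj_iff[of "gcod f"] d(7) by auto
      then show ?thesis using Obj_iff[of "gcod d"] d(4) by blast
    next
      case False
      then show ?thesis using d(4) by (simp add: Obj_iff)
    qed
    then have A: "d \<in> Arr \<Gamma>" "g \<in> Arr \<Gamma>" using d less.prems by (auto simp: Arr_iff)
    obtain p m where pm: "p \<in> Gamma_plus \<Gamma>" "m \<in> Gamma_minus \<Gamma>" "gdom p = gcod m" "g = gcomp p m"
      using less.hyps[OF _ A(2)] d by auto
    have dm: "d \<in> Gamma_minus \<Gamma>" by (rule codegeneracy_Gamma_minus[OF A(1) d(2)])
    have c: "gdom m = gcod d" using d(6) pm(4) by simp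
    have "hom m" "hom p" using Gamma_plus_positive[OF pm(1)] Gamma_minus_negative[OF pm(2)]
      by (auto simp: Arr_iff)
    then have "gcomp p (gcomp m d) = f" using gcomp_assoc[OF d(1), of m p] c pm d(8) by simp
    moreover have "gcomp m d \<in> Gamma_minus \<Gamma>" by (rule Gamma_minus_gcomp[OF dm pm(2) c])
    ultimately show ?thesis using pm by (intro bexI[of _ p] bexI[of _ "gcomp m d"]) auto
  qed
qed

text \<open>
  If \<open>h'\<close> did not send \<open>v\<close> to an edge, it would send \<open>v\<close> to a corolla, and the positive map \<open>g'\<close> would
  not send this corolla to an edge.
\<close>

lemma degenerate_transfer:
  assumes gh: "hom g" "hom h" "gdom g = gcod h" and gh': "hom g'" "hom h'" "gdom g' = gcod h'"
    and p: "positive g'" and n: "negative h'" and eq: "gcomp g h = gcomp g' h'"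
    and v: "v \<in> verts (gdom h)" "vmap h v = Sub_Edge k"
  shows "\<exists>k'. vmap h' v = Sub_Edge k'"
proof (rule ccontr)
  assume no: "\<not> ?thesis"
  have v': "v \<in> verts (gdom h')" using v(1) arg_cong[OF eq, of gdom] by simp
  then obtain w where w: "vmap h' v = Sub_Ord {w} {}" using n no by (auto simp: negative_def)
  have wv: "w \<in> verts (gdom g')" using hom_sverts[OF gh'(2) v'] w gh'(3) by simp
  have "vmap (gcomp g h) v = Sub_Edge (emap g k)" using vmap_gcomp[OF gh(2,1,3) v(1)] v(2) by simp
  moreover have "vmap (gcomp g' h') v = vmap g' w"
    using vmap_gcomp[OF gh'(2,1,3) v'] w push_corolla[OF hom_gmorphism[OF gh'(1)] wv] gh'(3) by simp
  ultimately show False using p wv eq by (simp add: positive_def)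
qed

lemma factorization_unique_up_to_iso:
  assumes g: "g \<in> Gamma_plus \<Gamma>" "h \<in> Gamma_minus \<Gamma>" "gdom g = gcod h"
    and g': "g' \<in> Gamma_plus \<Gamma>" "h' \<in> Gamma_minus \<Gamma>" "gdom g' = gcod h'"
    and eq: "gcomp g h = gcomp g' h'"
  shows "\<exists>\<theta> \<in> isos \<Gamma>. gdom \<theta> = gcod h \<and> gcod \<theta> = gcod h' \<and> h' = gcomp \<theta> h \<and> g = gcomp g' \<theta>"
proof -
  have hom: "hom g" "hom h" "hom g'" "hom h'" "positive g" "positive g'" "negative h" "negative h'"
    and A: "g \<in> Arr \<Gamma>" "h \<in> Arr \<Gamma>" "g' \<in> Arr \<Gamma>" "h' \<in> Arr \<Gamma>"
    using Gamma_plus_positive[OF g(1)] Gamma_plus_positive[OF g'(1)]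
      Gamma_minus_negative[OF g(2)] Gamma_minus_negative[OF g'(2)] by (auto simp: Arr_iff)
  have d: "gdom h = gdom h'" using arg_cong[OF eq, of gdom] by simp
  have cd: "gcod g = gcod g'" using arg_cong[OF eq, of gcod] by simp
  obtain \<theta> where \<theta>: "hom \<theta>" "gdom \<theta> = gcod h" "gcod \<theta> = gcod h'" "gcomp \<theta> h = h'"
    using factor_through_negative[OF hom(2,7,4) d[symmetric]]
      degenerate_transfer[OF hom(1,2) g(3) hom(3,4) g'(3) hom(6,8) eq] by blast
  obtain \<theta>' where \<theta>': "hom \<theta>'" "gdom \<theta>' = gcod h'" "gcod \<theta>' = gcod h" "gcomp \<theta>' h' = h"
    using factor_through_negative[OF hom(4,8,2) d]
      degenerate_transfer[OF hom(3,4) g'(3) hom(1,2) g(3) hom(5,7) eq[symmetric]] by blast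
  have wf: "wf_graph (gcod h)" "wf_graph (gcod h')" using hom by (auto simp: hom_def)
  have inv: "gcomp \<theta>' \<theta> = gid (gcod h)"
  proof (rule negative_epi[OF hom(2,7)])
    show "gcomp (gcomp \<theta>' \<theta>) h = gcomp (gid (gcod h)) h"
      using gcomp_assoc[OF hom(2) \<theta>(1) \<theta>'(1)] \<theta> \<theta>' gcomp_gid_left[OF hom(2)]
        by simp
  qed (use hom_gcomp[OF \<theta>(1) \<theta>'(1)] hom_gid[OF wf(1)] \<theta> \<theta>' in auto)
  have inv': "gcomp \<theta> \<theta>' = gid (gcod h')"
  proof (rule negative_epi[OF hom(4,8)])
    show "gcomp (gcomp \<theta> \<theta>') h' = gcomp (gid (gcod h')) h'"
      using gcomp_assoc[OF hom(4) \<theta>'(1) \<theta>(1)] \<theta> \<theta>' gcomp_gid_left[OF hom(4)]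
        by simp
  qed (use hom_gcomp[OF \<theta>'(1) \<theta>(1)] hom_gid[OF wf(2)] \<theta> \<theta>' in auto)
  have "\<theta> \<in> Arr \<Gamma>" "\<theta>' \<in> Arr \<Gamma>"
    using \<theta> \<theta>' A by (simp_all add: Arr_iff)
  then have "\<theta> \<in> isos \<Gamma>"
    unfolding isos_def using \<theta>(2,3) \<theta>'(2,3) inv inv' by (intro CollectI conjI bexI[of _ \<theta>']) simp_all
  moreover have "g = gcomp g' \<theta>"
  proof (rule negative_epi[OF hom(2,7) hom(1) g(3)])
    show "hom (gcomp g' \<theta>)" using hom_gcomp[OF \<theta>(1) hom(3)] \<theta>(3) g'(3) by simp
    show "gcomp g h = gcomp (gcomp g' \<theta>) h"
      using gcomp_assoc[OF hom(2) \<theta>(1) hom(3)] \<theta> g'(3) eq by simp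
  qed (use \<theta> in simp)
  ultimately show ?thesis using \<theta> by auto
qed

lemma Gamma_minus_rigid:
  assumes \<theta>: "\<theta> \<in> isos \<Gamma>" and f: "f \<in> Gamma_minus \<Gamma>" and c: "gdom \<theta> = gcod f" and eq: "gcomp \<theta> f = f"
  shows "\<theta> = gid (gcod f)"
proof -
  have h: "hom \<theta>" "hom f" "negative f"
    using isos_Arr[OF \<theta>] Gamma_minus_negative[OF f] by (auto simp: Arr_iff)
  then have "hom (gid (gcod f))" by (intro hom_gid) (simp add: hom_def)
  then show ?thesis
    using negative_epi[OF h(2,3) h(1) c, of "gid (gcod f)"] eq gcomp_gid_left[OF h(2)] by simp
qed

text \<open>
  Since \<open>f\<^sub>1 (\<theta> v) = f\<^sub>1 v\<close>, disjointness gives \<open>\<theta> v = v\<close>, which is clear if there is only one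
  vertex. Then \<open>\<theta>\<close> preserves the inputs and the outputs of each vertex, and \<open>f\<^sub>0\<close> is injective on them.
\<close>

lemma Gamma_plus_rigid:
  assumes \<theta>: "\<theta> \<in> isos \<Gamma>" and f: "f \<in> Gamma_plus \<Gamma>" and c: "gcod \<theta> = gdom f" and eq: "gcomp f \<theta> = f"
  shows "\<theta> = gid (gdom f)"
proof -
  let ?G = "gdom f"
  have h: "hom \<theta>" "hom f" "positive f" "negative \<theta>" "positive \<theta>"
    using isos_Arr[OF \<theta>] Gamma_plus_positive[OF f] iso_negative[OF \<theta>] iso_positive[OF \<theta>]
      by (auto simp: Arr_iff)
  interpret f: gmorphism ?G "gcod f" "emap f" "vmap f" using hom_gmorphism[OF h(2)] .
  have d: "gdom \<theta> = ?G" using arg_cong[OF eq, of gdom] by simp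
  interpret \<theta>: gmorphism ?G ?G "emap \<theta>" "vmap \<theta>"
    using hom_gmorphism[OF h(1)] unfolding c d .
  have vm: "vmap \<theta> v = Sub_Ord {v} {}" if v: "v \<in> verts ?G" for v
  proof -
    have "\<nexists>k. vmap \<theta> v = Sub_Edge k" using h(5) v d by (simp add: positive_def)
    then obtain w where w: "vmap \<theta> v = Sub_Ord {w} {}" using h(4) v d unfolding negative_def by metis
    then have wG: "w \<in> verts ?G" using hom_sverts[OF h(1), of v] v c d by simp
    have fw: "vmap f w = vmap f v"
      using vmap_gcomp[OF h(1,2) c[symmetric], of v] v d w eq push_corolla[OF f.gmorphism_axioms wG] c by simp
    have "w = v"
    proof (cases "sverts (vmap f v) = {}")
      case True
      then obtain k where "vmap f v = Sub_Loop k"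
        using sverts_empty_iff[OF f.f1[OF v]] h(3) v by (auto simp: positive_def)
      then show ?thesis using f.cod_loop_dom[OF v] wG by auto
    next
      case False
      then show ?thesis using f.same_vert[OF wG v] fw by auto
    qed
    then show ?thesis using w by simp
  qed
  have em: "emap f (emap \<theta> e) = emap f e" if "e \<in> edges ?G" for e
    using arg_cong[OF eq, of "\<lambda>g. emap g e"] that d by simp
  have "emap \<theta> e = e" if e: "e \<in> edges ?G" for e
  proof (cases "verts ?G = {}")
    case True
    then have "\<exists>a. edges ?G = {a}" using f.wf_dom by (cases ?G) auto
    then show ?thesis using e \<theta>.f0[OF e] by auto
  next
    case False
    consider v where "tgt ?G e = Some v" | v where "src ?G e = Some v" using wf_ends[OF f.wf_dom False e]
      by auto
    then show ?thesis
    proof cases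
      case 1
      then have v: "v \<in> verts ?G" "e \<in> in_at ?G v"
        using tgt_Some_vert[OF f.wf_dom] in_at_iff[OF f.wf_dom] by auto
      have "emap \<theta> e \<in> in_at ?G v"
        using bij_betwE[OF \<theta>.f_in[OF v(1)]] v(2) unfolding vm[OF v(1)] ins_corolla[OF f.wf_dom] by blast
      then show ?thesis using inj_onD[OF bij_betw_imp_inj_on[OF f.f_in[OF v(1)]] em[OF e]] v(2) by simp
    next
      case 2
      then have v: "v \<in> verts ?G" "e \<in> out_at ?G v"
        using src_Some_vert[OF f.wf_dom] out_at_iff[OF f.wf_dom] by auto
      have "emap \<theta> e \<in> out_at ?G v"
        using bij_betwE[OF \<theta>.f_out[OF v(1)]] v(2) unfolding vm[OF v(1)] outs_corolla[OF f.wf_dom] by blast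
      then show ?thesis using inj_onD[OF bij_betw_imp_inj_on[OF f.f_out[OF v(1)]] em[OF e]] v(2) by simp
    qed
  qed
  then show ?thesis
    by (intro hom_eqI[OF h(1) hom_gid[OF f.wf_dom]]) (use vm c d in auto)
qed

theorem dualizable_reedy: "dualizable_generalized_reedy \<Gamma> (Gamma_plus \<Gamma>) (Gamma_minus \<Gamma>) deg"
proof unfold_locales
  show "deg (source \<Gamma> f) < deg (target \<Gamma> f)" if f: "f \<in> Gamma_plus \<Gamma>" "f \<notin> isos \<Gamma>" for f
  proof -
    have "hom f" "positive f" "\<not> negative f"
      using Gamma_plus_positive[OF f(1)] f(2) isos_iff by (auto simp: Arr_iff)
    then show ?thesis using positive_deg by fastforce
  qed
  show "deg (target \<Gamma> f) < deg (source \<Gamma> f)" if f: "f \<in> Gamma_minus \<Gamma>" "f \<notin> isos \<Gamma>" for f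
  proof -
    have "hom f" "negative f" "\<not> positive f"
      using Gamma_minus_negative[OF f(1)] f(2) isos_iff by (auto simp: Arr_iff)
    then show ?thesis using negative_deg by simp
  qed
  show "Gamma_plus \<Gamma> \<inter> Gamma_minus \<Gamma> = isos \<Gamma>"
    using Gamma_plus_positive Gamma_minus_negative isos_iff isos_Gamma_plus isos_Gamma_minus by blast
qed (use wide_Gamma_plus wide_Gamma_minus iso_negative(2) factorization_exists factorization_unique_up_to_iso
    Gamma_minus_rigid Gamma_plus_rigid in simp_all)

end

theorem theorem1p2:
  fixes U :: "('v, 'e) graph set" and \<Gamma> :: "('v, 'e) graph_cat"
  assumes "graph_universe U"
    and "\<Gamma> = wheeled_A U \<or> \<Gamma> = wheeled_B U"
  shows "dualizable_generalized_reedy \<Gamma> (Gamma_plus \<Gamma>) (Gamma_minus \<Gamma>) deg"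
proof -
  interpret wheeled U \<Gamma> using assms by unfold_locales
  show ?thesis by (rule dualizable_reedy)
qed

end
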